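(* Let $\mathcal T\in\mathrm{Tree}(N)$ and suppose that $n=|[N]\cap\mathcal T|\ge2$. Let $\mu_1,\dots,\mu_{N^k}$ and $\nu_1,\dots,\nu_{N^k}$ be $\mathcal B$-valued laws of mean zero, variance $\eta$, and radius $\le R$. Let \[ R'=2\sqrt{\frac{N-1}{n-1}}\,\|\eta(1)\|^{1/2}. \] Then for $f\in\mathcal B\langle X\rangle$, \[ \Bigl\|[\mathrm{dil}_{n^{-k/2}}\boxplus_{\mathcal T^{n^k}}(\mu_1,\dots,\mu_{N^k})](f)-[\mathrm{dil}_{n^{-k/2}}\boxplus_{\mathcal T^{n^k}}(\nu_1,\dots,\nu_{N^k})](f)\Bigr\|\le2\,\mathrm{Mod}_{f,\,R'+n^{-k/2}R}(n^{-k/2}R). \]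
   Context: $\mathcal B$ is a unital $C^*$-algebra. For a right Hilbert $\mathcal B$-module $\mathcal H$, $\mathcal L(\mathcal H)$ is the $C^*$-algebra of bounded adjointable right-$\mathcal B$-modular operators. A $\mathcal B$-$\mathcal B$-correspondence is a right Hilbert $\mathcal B$-module with a left action given by a unital $*$-homomorphism $\mathcal B\to\mathcal L(\mathcal H)$. A $\mathcal B$-central unit vector is $\xi\in\mathcal H$ with $\langle\xi,\xi\rangle=1$, $b\xi=\xi b$ for all $b$; then $\mathcal H=\mathcal B\xi\oplus\mathcal H^\circ$, $\mathcal H^\circ=\{h:\langle h,\xi\rangle=0\}$. A $\mathcal B$-valued probability space $(\mathcal A,E)$ is a unital $C^*$-algebra $\mathcal A\supseteq\mathcal B$ (unital inclusion) with a unital completely positive $\mathcal B$-$\mathcal B$-bimodule map $E:\mathcal A\to\mathcal B$ such that $E[a_1aa_2]=0$ for all $a_1,a_2$ implies $a=0$. Laws: $\mathcal B\langle X\rangle$ is the universal unital $*$-algebra generated by $\mathcal B$ and a self-adjoint indeterminate $X$. A $\mathcal B$-valued law is a unital $\mathcal B$-$\mathcal B$-bimodule map $\mu:\mathcal B\langle X\rangle\to\mathcal B$ that is completely positive and exponentially bounded ($\|\mu(b_0Xb_1\cdots Xb_\ell)\|\le MR^\ell\|b_0\|\cdots\|b_\ell\|$ for some $M,R>0$); its radius $\mathrm{rad}(\mu)$ is the infimum of admissible $R$. Mean zero means $\mu(X)=0$; variance $\eta$ then means $\mu(XbX)=\eta(b)$ for all $b\in\mathcal B$. $\mathrm{dil}_c(\mu)(f(X))=\mu(f(cX))$.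 For $f\in\mathcal B\langle X\rangle$, $R>0$, $\epsilon>0$, $\mathrm{Mod}_{f,R}(\epsilon)$ is the supremum of $\|E[f(X)-f(Y)]\|$ over all self-adjoint $X,Y$ in $\mathcal B$-valued probability spaces $(\mathcal A,E)$ with $\|X\|\le R$, $\|Y\|\le R$, $\|X-Y\|\le\epsilon$. Trees: $[N]=\{1,\dots,N\}$. A string on $[N]$ is alternating if consecutive letters differ. $\mathcal T_{N,\mathrm{free}}$ is the graph whose vertices are the alternating strings on $[N]$ (including the empty string $\emptyset$), with an edge between $s$ and $js$ whenever $js$ is alternating, rooted at $\emptyset$. $\mathrm{Tree}(N)$ is the set of connected subgraphs containing $\emptyset$, each identified with its vertex set; $[N]\cap\mathcal T$ is the set of one-letter strings in $\mathcal T$. For $\mathcal T\in\mathrm{Tree}(k)$, $\mathcal T_j\in\mathrm{Tree}(n_j)$, with $M=n_1+\dots+n_k$ and $\iota_j:[n_j]\to[M]$, $\iota_j(i)=n_1+\dots+n_{j-1}+i$, the composition $\mathcal T(\mathcal T_1,\dots,\mathcal T_k)\in\mathrm{Tree}(M)$ consists of all strings $(\iota_{i_1})_*(s_1)\cdots(\iota_{i_\ell})_*(s_\ell)$ with $\ell\ge0$, $i_1\cdots i_\ell\in\mathcal T$, $s_m\in\mathcal T_{i_m}\setminus\{\emptyset\}$, where $(\iota_j)_*$ applies $\iota_j$ letterwise. For $\mathcal T\in\mathrm{Tree}(N)$, $\mathcal T^{n^k}\in\mathrm{Tree}(N^k)$ ($k\ge0$) is defined by $\mathcal T^{n^0}=\{\emptyset,1\}\in\mathrm{Tree}(1)$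 and $\mathcal T^{n^{k+1}}=\mathcal T(\mathcal T^{n^k},\dots,\mathcal T^{n^k})$ ($N$ copies). $\mathcal T$-free convolution: given $(\mathcal H_j,\xi_j)$, $j\in[N]$, put $\mathcal H=\bigoplus_{s\in\mathcal T}\mathcal H_s^\circ$, $\mathcal H_\emptyset^\circ=\mathcal B$, $\mathcal H^\circ_{j_1\cdots j_m}=\mathcal H_{j_1}^\circ\otimes_{\mathcal B}\cdots\otimes_{\mathcal B}\mathcal H_{j_m}^\circ$, $\xi=1\in\mathcal H_\emptyset^\circ$. $\lambda_{\mathcal T,j}:\mathcal L(\mathcal H_j)\to\mathcal L(\mathcal H)$ is the $*$-homomorphism for which $\lambda_{\mathcal T,j}(x)$ acts on $\mathcal H_s^\circ\oplus\mathcal H_{js}^\circ\cong\mathcal H_j\otimes_{\mathcal B}\mathcal H_s^\circ$ as $x\otimes\mathrm{id}$ when $s\in\mathcal T$ does not begin with $j$ and $js\in\mathcal T$, and as zero on $\mathcal H_s^\circ$ when $s\in\mathcal T$ does not begin with $j$ and $js\notin\mathcal T$. For laws $\mu_1,\dots,\mu_N$, with $\mathcal H_j=L^2(\mathcal B\langle X\rangle,\mu_j)$ (separation-completion for $\langle p,q\rangle=\mu_j(p^*q)$), $\xi_j$ the class of $1$, $X_j$ multiplication by $X$, $\boxplus_{\mathcal T}(\mu_1,\dots,\mu_N)$ is the law of $\sum_j\lambda_{\mathcal T,j}(X_j)$ with respect to $a\mapsto\langle\xi,a\xi\rangle$. *)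

theory Defs
  imports "HOL-Analysis.Analysis" "HOL-Algebra.Ring"
begin

section \<open>Unital \<open>C\<^sup>*\<close>-algebras\<close>

class cstar_algebra = real_normed_algebra_1 + banach +
  fixes scaleC :: "complex \<Rightarrow> 'a \<Rightarrow> 'a"
    and star :: "'a \<Rightarrow> 'a"
  assumes scaleC_of_real: "scaleC (of_real r) x = r *\<^sub>R x"
    and scaleC_add_left: "scaleC (c + d) x = scaleC c x + scaleC d x"
    and scaleC_add_right: "scaleC c (x + y) = scaleC c x + scaleC c y"
    and scaleC_scaleC: "scaleC c (scaleC d x) = scaleC (c * d) x"
    and mult_scaleC_left: "scaleC c x * y = scaleC c (x * y)"
    and mult_scaleC_right: "x * scaleC c y = scaleC c (x * y)"
    and norm_scaleC: "norm (scaleC c x) = cmod c * norm x"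
    and star_star: "star (star x) = x"
    and star_add: "star (x + y) = star x + star y"
    and star_mult: "star (x * y) = star y * star x"
    and star_scaleC: "star (scaleC c x) = scaleC (cnj c) (star x)"
    and norm_star_mult_self: "norm (star x * x) = (norm x)\<^sup>2"

text \<open>Positivity in \<open>M\<^sub>n(\<B>)\<close>, for matrices with index set \<open>{..<n}\<close>: the matrix is of
  the form \<open>C\<^sup>*C\<close>.\<close>

definition pos_matrix :: "nat \<Rightarrow> (nat \<Rightarrow> nat \<Rightarrow> 'b::cstar_algebra) \<Rightarrow> bool" where
  "pos_matrix n M \<longleftrightarrow> (\<exists>C. \<forall>i<n. \<forall>j<n. M i j = (\<Sum>k<n. star (C k i) * C k j))"

text \<open>The coefficient algebra \<open>\<B>\<close> is a type of class \<open>cstar_algebra\<close>. The algebras \<open>\<A>\<close>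
  containing it are quantified over inside a formula and are therefore given by an explicit
  carrier.\<close>

record 'a cstar = "'a ring" +
  cscale :: "complex \<Rightarrow> 'a \<Rightarrow> 'a"
  cstar :: "'a \<Rightarrow> 'a"
  cnorm :: "'a \<Rightarrow> real"

locale cstar_algebra_on = ring A for A :: "'a cstar" (structure) +
  assumes scale_closed: "x \<in> carrier A \<Longrightarrow> cscale A c x \<in> carrier A"
    and scale_one: "x \<in> carrier A \<Longrightarrow> cscale A 1 x = x"
    and scale_add_left: "x \<in> carrier A \<Longrightarrow> cscale A (c + d) x = cscale A c x \<oplus> cscale A d x"
    and scale_add_right: "\<lbrakk>x \<in> carrier A; y \<in> carrier A\<rbrakk> \<Longrightarrow>
          cscale A c (x \<oplus> y) = cscale A c x \<oplus> cscale A c y"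
    and scale_scale: "x \<in> carrier A \<Longrightarrow> cscale A c (cscale A d x) = cscale A (c * d) x"
    and scale_mult_left: "\<lbrakk>x \<in> carrier A; y \<in> carrier A\<rbrakk> \<Longrightarrow>
          cscale A c x \<otimes> y = cscale A c (x \<otimes> y)"
    and scale_mult_right: "\<lbrakk>x \<in> carrier A; y \<in> carrier A\<rbrakk> \<Longrightarrow>
          x \<otimes> cscale A c y = cscale A c (x \<otimes> y)"
    and star_closed: "x \<in> carrier A \<Longrightarrow> cstar A x \<in> carrier A"
    and star_invol: "x \<in> carrier A \<Longrightarrow> cstar A (cstar A x) = x"
    and star_plus: "\<lbrakk>x \<in> carrier A; y \<in> carrier A\<rbrakk> \<Longrightarrow> cstar A (x \<oplus> y) = cstar A x \<oplus> cstar A y"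
    and star_times: "\<lbrakk>x \<in> carrier A; y \<in> carrier A\<rbrakk> \<Longrightarrow> cstar A (x \<otimes> y) = cstar A y \<otimes> cstar A x"
    and star_scale: "x \<in> carrier A \<Longrightarrow> cstar A (cscale A c x) = cscale A (cnj c) (cstar A x)"
    and norm_nonneg: "x \<in> carrier A \<Longrightarrow> 0 \<le> cnorm A x"
    and norm_eq_zero: "x \<in> carrier A \<Longrightarrow> cnorm A x = 0 \<longleftrightarrow> x = \<zero>"
    and norm_triangle: "\<lbrakk>x \<in> carrier A; y \<in> carrier A\<rbrakk> \<Longrightarrow> cnorm A (x \<oplus> y) \<le> cnorm A x + cnorm A y"
    and norm_scale: "x \<in> carrier A \<Longrightarrow> cnorm A (cscale A c x) = cmod c * cnorm A x"
    and norm_times: "\<lbrakk>x \<in> carrier A; y \<in> carrier A\<rbrakk> \<Longrightarrow> cnorm A (x \<otimes> y) \<le> cnorm A x * cnorm A y"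
    and norm_cstar: "x \<in> carrier A \<Longrightarrow> cnorm A (cstar A x \<otimes> x) = (cnorm A x)\<^sup>2"
    and complete: "\<lbrakk>\<And>i::nat. u i \<in> carrier A;
          \<forall>e>0. \<exists>K. \<forall>i\<ge>K. \<forall>j\<ge>K. cnorm A (u i \<ominus> u j) < e\<rbrakk> \<Longrightarrow>
          \<exists>x\<in>carrier A. (\<lambda>i. cnorm A (u i \<ominus> x)) \<longlonglongrightarrow> 0"

locale bvalued_prob_space = cstar_algebra_on A for A :: "'a cstar" (structure) +
  fixes incl :: "'b::cstar_algebra \<Rightarrow> 'a"
    and E :: "'a \<Rightarrow> 'b"
  assumes incl_closed: "incl b \<in> carrier A"
    and incl_inj: "inj incl"
    and incl_one: "incl 1 = \<one>"
    and incl_add: "incl (b + c) = incl b \<oplus> incl c"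
    and incl_mult: "incl (b * c) = incl b \<otimes> incl c"
    and incl_scale: "incl (scaleC z b) = cscale A z (incl b)"
    and incl_star: "incl (star b) = cstar A (incl b)"
    and E_add: "\<lbrakk>x \<in> carrier A; y \<in> carrier A\<rbrakk> \<Longrightarrow> E (x \<oplus> y) = E x + E y"
    and E_scale: "x \<in> carrier A \<Longrightarrow> E (cscale A z x) = scaleC z (E x)"
    and E_one: "E \<one> = 1"
    and E_bimod: "x \<in> carrier A \<Longrightarrow> E (incl b \<otimes> x \<otimes> incl c) = b * E x * c"
    and E_cp: "(\<And>i j. Q i j \<in> carrier A) \<Longrightarrow>
          pos_matrix m (\<lambda>i j. E (\<Oplus>k\<in>{..<m}. cstar A (Q k i) \<otimes> Q k j))"
    and E_faithful: "\<lbrakk>x \<in> carrier A;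
          \<forall>y\<in>carrier A. \<forall>z\<in>carrier A. E (y \<otimes> x \<otimes> z) = 0\<rbrakk> \<Longrightarrow> x = \<zero>"

section \<open>The algebra \<open>\<B>\<langle>X\<rangle>\<close>\<close>

datatype 'b ncexpr = Const 'b | Var | Plus "'b ncexpr" "'b ncexpr" | Times "'b ncexpr" "'b ncexpr"

text \<open>\<open>\<B>\<langle>X\<rangle>\<close> is generated by \<open>\<B>\<close> and \<open>X\<close> subject to the relations of a unital complex
  algebra containing \<open>\<B>\<close> as a unital subalgebra. Multiplication by a scalar \<open>c\<close> is
  multiplication by \<open>c1\<^sub>\<B>\<close>, so that the complex algebra axioms amount to \<open>c1\<^sub>\<B>\<close> commuting
  with \<open>X\<close>.\<close>

inductive nceq :: "'b::cstar_algebra ncexpr \<Rightarrow> 'b ncexpr \<Rightarrow> bool" where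
  nc_refl: "nceq p p"
| nc_sym: "nceq p q \<Longrightarrow> nceq q p"
| nc_trans [trans]: "nceq p q \<Longrightarrow> nceq q r \<Longrightarrow> nceq p r"
| nc_Plus: "nceq p p' \<Longrightarrow> nceq q q' \<Longrightarrow> nceq (Plus p q) (Plus p' q')"
| nc_Times: "nceq p p' \<Longrightarrow> nceq q q' \<Longrightarrow> nceq (Times p q) (Times p' q')"
| nc_add_assoc: "nceq (Plus (Plus p q) r) (Plus p (Plus q r))"
| nc_add_comm: "nceq (Plus p q) (Plus q p)"
| nc_add_zero: "nceq (Plus (Const 0) p) p"
| nc_mult_assoc: "nceq (Times (Times p q) r) (Times p (Times q r))"
| nc_one_left: "nceq (Times (Const 1) p) p"
| nc_one_right: "nceq (Times p (Const 1)) p"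
| nc_zero_left: "nceq (Times (Const 0) p) (Const 0)"
| nc_zero_right: "nceq (Times p (Const 0)) (Const 0)"
| nc_distrib_right: "nceq (Times (Plus p q) r) (Plus (Times p r) (Times q r))"
| nc_distrib_left: "nceq (Times p (Plus q r)) (Plus (Times p q) (Times p r))"
| nc_Const_add: "nceq (Const (a + b)) (Plus (Const a) (Const b))"
| nc_Const_mult: "nceq (Const (a * b)) (Times (Const a) (Const b))"
| nc_scalar: "nceq (Times (Const (scaleC c 1)) Var) (Times Var (Const (scaleC c 1)))"

quotient_type (overloaded) 'b ncpoly = "'b::cstar_algebra ncexpr" / nceq
  by (intro equivpI reflpI sympI transpI) (erule (1) nc_trans | erule nc_sym | rule nc_refl)+

fun star_expr :: "'b::cstar_algebra ncexpr \<Rightarrow> 'b ncexpr" where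
  "star_expr (Const b) = Const (star b)"
| "star_expr Var = Var"
| "star_expr (Plus p q) = Plus (star_expr p) (star_expr q)"
| "star_expr (Times p q) = Times (star_expr q) (star_expr p)"

lemma star_zero: "star (0::'b::cstar_algebra) = 0"
  using star_add[of "0::'b" 0] by simp

lemma star_one: "star (1::'b::cstar_algebra) = 1"
  by (metis mult.left_neutral mult.right_neutral star_mult star_star)

lemmas nceq_basics = nc_refl nc_Plus nc_Times nc_add_assoc nc_add_comm nc_add_zero
  nc_mult_assoc nc_sym[OF nc_mult_assoc] nc_one_left nc_one_right nc_zero_left nc_zero_right
  nc_distrib_right nc_distrib_left nc_Const_add nc_Const_mult

lemma nceq_star_expr: "nceq (p :: 'b::cstar_algebra ncexpr) q \<Longrightarrow> nceq (star_expr p) (star_expr q)"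
proof (induction rule: nceq.induct)
  case (nc_scalar c)
  have "nceq (Times Var (Const (scaleC (cnj c) (1::'b)))) (Times (Const (scaleC (cnj c) 1)) Var)"
    by (rule nceq.nc_sym[OF nceq.nc_scalar])
  then show ?case by (simp add: star_scaleC star_one)
next
  case (nc_sym p q)
  show ?case by (rule nceq.nc_sym[OF nc_sym.IH])
next
  case (nc_trans p q r)
  show ?case by (rule nceq.nc_trans[OF nc_trans.IH])
qed (simp_all only: star_expr.simps star_zero star_one star_add star_mult,
    (rule nceq_basics; assumption?)+)

fun dil_expr :: "real \<Rightarrow> 'b::cstar_algebra ncexpr \<Rightarrow> 'b ncexpr" where
  "dil_expr r (Const b) = Const b"
| "dil_expr r Var = Times (Const (of_real r)) Var"
| "dil_expr r (Plus p q) = Plus (dil_expr r p) (dil_expr r q)"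
| "dil_expr r (Times p q) = Times (dil_expr r p) (dil_expr r q)"

lemma nceq_dil_expr: "nceq (p :: 'b::cstar_algebra ncexpr) q \<Longrightarrow> nceq (dil_expr r p) (dil_expr r q)"
proof (induction rule: nceq.induct)
  case (nc_scalar c)
  let ?c = "scaleC c (1::'b)" and ?r = "of_real r :: 'b"
  have comm: "?c * ?r = ?r * ?c"
    by (simp add: of_real_def mult_scaleC_left)
  have "nceq (Times (Const ?c) (Times (Const ?r) Var)) (Times (Times (Const ?c) (Const ?r)) Var)"
    by (rule nceq.nc_sym[OF nceq.nc_mult_assoc])
  also have "nceq \<dots> (Times (Const (?c * ?r)) Var)"
    by (rule nceq.nc_Times[OF nceq.nc_sym[OF nceq.nc_Const_mult] nceq.nc_refl])
  also have "nceq (Times (Const (?c * ?r)) Var) (Times (Times (Const ?r) (Const ?c)) Var)"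
    unfolding comm by (rule nceq.nc_Times[OF nceq.nc_Const_mult nceq.nc_refl])
  also have "nceq (Times (Times (Const ?r) (Const ?c)) Var) (Times (Const ?r) (Times (Const ?c) Var))"
    by (rule nceq.nc_mult_assoc)
  also have "nceq \<dots> (Times (Const ?r) (Times Var (Const ?c)))"
    by (rule nceq.nc_Times[OF nceq.nc_refl nceq.nc_scalar])
  also have "nceq \<dots> (Times (Times (Const ?r) Var) (Const ?c))"
    by (rule nceq.nc_sym[OF nceq.nc_mult_assoc])
  finally show ?case by simp
next
  case (nc_sym p q)
  show ?case by (rule nceq.nc_sym[OF nc_sym.IH])
next
  case (nc_trans p q r)
  show ?case by (rule nceq.nc_trans[OF nc_trans.IH])
qed (simp_all only: dil_expr.simps, (rule nceq_basics; assumption?)+)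

fun eval0_expr :: "'b::cstar_algebra ncexpr \<Rightarrow> 'b" where
  "eval0_expr (Const b) = b"
| "eval0_expr Var = 0"
| "eval0_expr (Plus p q) = eval0_expr p + eval0_expr q"
| "eval0_expr (Times p q) = eval0_expr p * eval0_expr q"

lemma nceq_eval0: "nceq p q \<Longrightarrow> eval0_expr p = eval0_expr q"
  by (induction rule: nceq.induct) (auto simp: algebra_simps)

instantiation ncpoly :: (cstar_algebra) ring_1
begin

lift_definition zero_ncpoly :: "'a ncpoly" is "Const 0" .
lift_definition one_ncpoly :: "'a ncpoly" is "Const 1" .
lift_definition plus_ncpoly :: "'a ncpoly \<Rightarrow> 'a ncpoly \<Rightarrow> 'a ncpoly" is Plus
  by (rule nc_Plus)
lift_definition times_ncpoly :: "'a ncpoly \<Rightarrow> 'a ncpoly \<Rightarrow> 'a ncpoly" is Times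
  by (rule nc_Times)
lift_definition uminus_ncpoly :: "'a ncpoly \<Rightarrow> 'a ncpoly" is "Times (Const (- 1))"
  by (rule nc_Times[OF nc_refl])
definition minus_ncpoly :: "'a ncpoly \<Rightarrow> 'a ncpoly \<Rightarrow> 'a ncpoly" where
  "minus_ncpoly p q = p + - q"

instance
proof
  fix p q r :: "'a ncpoly"
  show "p + q + r = p + (q + r)" by transfer (rule nc_add_assoc)
  show "p + q = q + p" by transfer (rule nc_add_comm)
  show "0 + p = p" by transfer (rule nc_add_zero)
  show "p * q * r = p * (q * r)" by transfer (rule nc_mult_assoc)
  show "1 * p = p" by transfer (rule nc_one_left)
  show "p * 1 = p" by transfer (rule nc_one_right)
  show "(p + q) * r = p * r + q * r" by transfer (rule nc_distrib_right)
  show "p * (q + r) = p * q + p * r" by transfer (rule nc_distrib_left)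
  show "p - q = p + - q" by (rule minus_ncpoly_def)
  show "(0::'a ncpoly) \<noteq> 1"
  proof transfer
    show "\<not> nceq (Const 0) (Const (1::'a))"
      using nceq_eval0[of "Const 0" "Const (1::'a)"] by auto
  qed
  show "- p + p = 0"
  proof transfer
    fix p :: "'a ncexpr"
    have "nceq (Plus (Times (Const (- 1)) p) p) (Plus (Times (Const (- 1)) p) (Times (Const 1) p))"
      by (rule nc_Plus[OF nc_refl nc_sym[OF nc_one_left]])
    also have "nceq \<dots> (Times (Plus (Const (- 1)) (Const 1)) p)"
      by (rule nc_sym[OF nc_distrib_right])
    also have "nceq \<dots> (Times (Const (- 1 + 1)) p)"
      by (rule nc_Times[OF nc_sym[OF nc_Const_add] nc_refl])
    also have "nceq \<dots> (Const 0)"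
      by (simp add: nc_zero_left)
    finally show "nceq (Plus (Times (Const (- 1)) p) p) (Const 0)" .
  qed
qed

end

lift_definition nc_const :: "'b::cstar_algebra \<Rightarrow> 'b ncpoly" is Const .
lift_definition nc_var :: "'b::cstar_algebra ncpoly" is Var .
lift_definition nc_star :: "'b::cstar_algebra ncpoly \<Rightarrow> 'b ncpoly" is star_expr
  by (rule nceq_star_expr)

text \<open>\<open>nc_dil r f\<close> is \<open>f(rX)\<close>, and \<open>nc_monom b\<^sub>0 [b\<^sub>1, \<dots>, b\<^sub>l]\<close> is \<open>b\<^sub>0 X b\<^sub>1 \<cdots> X b\<^sub>l\<close>.\<close>

lift_definition nc_dil :: "real \<Rightarrow> 'b::cstar_algebra ncpoly \<Rightarrow> 'b ncpoly" is dil_expr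
  by (rule nceq_dil_expr)

fun nc_monom :: "'b::cstar_algebra \<Rightarrow> 'b list \<Rightarrow> 'b ncpoly" where
  "nc_monom b [] = nc_const b"
| "nc_monom b (c # cs) = nc_const b * nc_var * nc_monom c cs"

text \<open>\<open>nc_eval A \<iota> x f\<close> is \<open>f(x)\<close> in a ring \<open>A\<close> containing \<open>\<B>\<close> via \<open>\<iota>\<close>. It is used
  only where \<open>\<iota>\<close> is a unital homomorphism and \<open>x\<close> commutes with the image of the scalars, so
  the value does not depend on the chosen representative of \<open>f\<close>.\<close>

fun eval_expr :: "('a, 'm) ring_scheme \<Rightarrow> ('b \<Rightarrow> 'a) \<Rightarrow> 'a \<Rightarrow> 'b ncexpr \<Rightarrow> 'a" where
  "eval_expr A \<iota> x (Const b) = \<iota> b"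
| "eval_expr A \<iota> x Var = x"
| "eval_expr A \<iota> x (Plus p q) = eval_expr A \<iota> x p \<oplus>\<^bsub>A\<^esub> eval_expr A \<iota> x q"
| "eval_expr A \<iota> x (Times p q) = eval_expr A \<iota> x p \<otimes>\<^bsub>A\<^esub> eval_expr A \<iota> x q"

definition nc_eval :: "('a, 'm) ring_scheme \<Rightarrow> ('b::cstar_algebra \<Rightarrow> 'a) \<Rightarrow> 'a \<Rightarrow> 'b ncpoly \<Rightarrow> 'a" where
  "nc_eval A \<iota> x f = eval_expr A \<iota> x (rep_ncpoly f)"

section \<open>\<open>\<B>\<close>-valued laws\<close>

definition exp_bounded_by :: "('b::cstar_algebra ncpoly \<Rightarrow> 'b) \<Rightarrow> real \<Rightarrow> bool" where
  "exp_bounded_by \<mu> R \<longleftrightarrow> R > 0 \<and>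
     (\<exists>M>0. \<forall>b bs. norm (\<mu> (nc_monom b bs)) \<le> M * R ^ length bs * (norm b * prod_list (map norm bs)))"

definition law_radius :: "('b::cstar_algebra ncpoly \<Rightarrow> 'b) \<Rightarrow> real" where
  "law_radius \<mu> = Inf {R. exp_bounded_by \<mu> R}"

text \<open>Complex linearity is the bimodule property for the scalars \<open>c1\<^sub>\<B>\<close>.\<close>

definition bvalued_law :: "('b::cstar_algebra ncpoly \<Rightarrow> 'b) \<Rightarrow> bool" where
  "bvalued_law \<mu> \<longleftrightarrow>
     \<mu> 1 = 1 \<and>
     (\<forall>p q. \<mu> (p + q) = \<mu> p + \<mu> q) \<and>
     (\<forall>b c p. \<mu> (nc_const b * p * nc_const c) = b * \<mu> p * c) \<and>
     (\<forall>m P. pos_matrix m (\<lambda>i j. \<mu> (\<Sum>k<m. nc_star (P k i) * P k j))) \<and>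
     (\<exists>R. exp_bounded_by \<mu> R)"

definition mean_zero :: "('b::cstar_algebra ncpoly \<Rightarrow> 'b) \<Rightarrow> bool" where
  "mean_zero \<mu> \<longleftrightarrow> \<mu> nc_var = 0"

definition has_variance :: "('b::cstar_algebra ncpoly \<Rightarrow> 'b) \<Rightarrow> ('b \<Rightarrow> 'b) \<Rightarrow> bool" where
  "has_variance \<mu> \<eta> \<longleftrightarrow> (\<forall>b. \<mu> (nc_var * nc_const b * nc_var) = \<eta> b)"

definition dil_law :: "real \<Rightarrow> ('b::cstar_algebra ncpoly \<Rightarrow> 'b) \<Rightarrow> 'b ncpoly \<Rightarrow> 'b" where
  "dil_law r \<mu> f = \<mu> (nc_dil r f)"

text \<open>The supremum over all \<open>\<B>\<close>-valued probability spaces is taken over those whose carrier is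
  a set of sequences in \<open>\<B>\<close>. This is no restriction up to isomorphism: \<open>E[f(X) - f(Y)]\<close> only
  depends on the \<open>C\<^sup>*\<close>-algebra generated by \<open>\<B>\<close>, \<open>X\<close> and \<open>Y\<close>, divided by the ideal of all \<open>a\<close>
  with \<open>E[a\<^sub>1 a a\<^sub>2] = 0\<close> for all \<open>a\<^sub>1\<close>, \<open>a\<^sub>2\<close> (so that \<open>E\<close> stays faithful), and the elements of
  that algebra are limits of sequences of noncommutative polynomials over \<open>\<B>\<close>. There are at most
  as many of these limits as there are sequences in \<open>\<B>\<close>.\<close>

definition Mod :: "'b::cstar_algebra ncpoly \<Rightarrow> real \<Rightarrow> real \<Rightarrow> real" where
  "Mod f R \<epsilon> = Sup {norm (E (nc_eval A \<iota> X f \<ominus>\<^bsub>A\<^esub> nc_eval A \<iota> Y f)) |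
       (A :: (nat \<Rightarrow> 'b) cstar) \<iota> E X Y.
       bvalued_prob_space A \<iota> E \<and>
       X \<in> carrier A \<and> cstar A X = X \<and> cnorm A X \<le> R \<and>
       Y \<in> carrier A \<and> cstar A Y = Y \<and> cnorm A Y \<le> R \<and>
       cnorm A (X \<ominus>\<^bsub>A\<^esub> Y) \<le> \<epsilon>}"

section \<open>Hilbert modules and correspondences\<close>

text \<open>The data of a \<open>\<B>\<close>-\<open>\<B>\<close>-correspondence, or of a space with a \<open>\<B>\<close>-valued semi-inner
  product that has yet to be separated and completed. The inner product is linear in the second
  variable. Scalar multiplication is the right action of \<open>c1\<^sub>\<B>\<close>.\<close>

record ('b, 'h) corr =
  hcarrier :: "'h set"
  hzero :: 'h
  hadd :: "'h \<Rightarrow> 'h \<Rightarrow> 'h"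
  lact :: "'b \<Rightarrow> 'h \<Rightarrow> 'h"
  ract :: "'h \<Rightarrow> 'b \<Rightarrow> 'h"
  hinner :: "'h \<Rightarrow> 'h \<Rightarrow> 'b"

definition hminus :: "('b::cstar_algebra, 'h) corr \<Rightarrow> 'h \<Rightarrow> 'h \<Rightarrow> 'h" where
  "hminus H h k = hadd H h (ract H k (- 1))"

definition hnorm :: "('b::cstar_algebra, 'h) corr \<Rightarrow> 'h \<Rightarrow> real" where
  "hnorm H h = sqrt (norm (hinner H h h))"

text \<open>Separation-completion: Cauchy sequences modulo null sequences.\<close>

definition cauchy_seqs :: "('b::cstar_algebra, 'h) corr \<Rightarrow> (nat \<Rightarrow> 'h) set" where
  "cauchy_seqs H = {u. (\<forall>i. u i \<in> hcarrier H) \<and>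
     (\<forall>e>0. \<exists>K. \<forall>i\<ge>K. \<forall>j\<ge>K. hnorm H (hminus H (u i) (u j)) < e)}"

definition cauchy_class :: "('b::cstar_algebra, 'h) corr \<Rightarrow> (nat \<Rightarrow> 'h) \<Rightarrow> (nat \<Rightarrow> 'h) set" where
  "cauchy_class H u = {v \<in> cauchy_seqs H. (\<lambda>i. hnorm H (hminus H (u i) (v i))) \<longlonglongrightarrow> 0}"

definition some_rep :: "(nat \<Rightarrow> 'h) set \<Rightarrow> nat \<Rightarrow> 'h" where
  "some_rep U = (SOME u. u \<in> U)"

definition embed_compl :: "('b::cstar_algebra, 'h) corr \<Rightarrow> 'h \<Rightarrow> (nat \<Rightarrow> 'h) set" where
  "embed_compl H h = cauchy_class H (\<lambda>_. h)"

definition sep_completion :: "('b::cstar_algebra, 'h) corr \<Rightarrow> ('b, (nat \<Rightarrow> 'h) set) corr" where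
  "sep_completion H =
     \<lparr> hcarrier = cauchy_class H ` cauchy_seqs H,
       hzero = embed_compl H (hzero H),
       hadd = (\<lambda>U V. cauchy_class H (\<lambda>i. hadd H (some_rep U i) (some_rep V i))),
       lact = (\<lambda>b U. cauchy_class H (\<lambda>i. lact H b (some_rep U i))),
       ract = (\<lambda>U b. cauchy_class H (\<lambda>i. ract H (some_rep U i) b)),
       hinner = (\<lambda>U V. lim (\<lambda>i. hinner H (some_rep U i) (some_rep V i))) \<rparr>"

text \<open>\<open>\<L>(\<H>)\<close>. Operators are extensional functions, so that equality of operators is equality
  on the carrier.\<close>

definition adjointable :: "('b::cstar_algebra, 'h) corr \<Rightarrow> ('h \<Rightarrow> 'h) set" where
  "adjointable H = {y \<in> hcarrier H \<rightarrow>\<^sub>E hcarrier H.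
     (\<forall>h\<in>hcarrier H. \<forall>k\<in>hcarrier H. y (hadd H h k) = hadd H (y h) (y k)) \<and>
     (\<forall>h\<in>hcarrier H. \<forall>b. y (ract H h b) = ract H (y h) b) \<and>
     (\<exists>C. \<forall>h\<in>hcarrier H. hnorm H (y h) \<le> C * hnorm H h) \<and>
     (\<exists>z \<in> hcarrier H \<rightarrow> hcarrier H.
        \<forall>h\<in>hcarrier H. \<forall>k\<in>hcarrier H. hinner H (y h) k = hinner H h (z k))}"

definition op_ring :: "('b::cstar_algebra, 'h) corr \<Rightarrow> ('h \<Rightarrow> 'h) ring" where
  "op_ring H =
     \<lparr> carrier = adjointable H,
       mult = compose (hcarrier H),
       one = (\<lambda>h\<in>hcarrier H. h),
       zero = (\<lambda>h\<in>hcarrier H. hzero H),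
       add = (\<lambda>x y. \<lambda>h\<in>hcarrier H. hadd H (x h) (y h)) \<rparr>"

definition left_op :: "('b::cstar_algebra, 'h) corr \<Rightarrow> 'b \<Rightarrow> 'h \<Rightarrow> 'h" where
  "left_op H b = (\<lambda>h\<in>hcarrier H. lact H b h)"

definition law_of_op :: "('b::cstar_algebra, 'h) corr \<Rightarrow> 'h \<Rightarrow> ('h \<Rightarrow> 'h) \<Rightarrow> 'b ncpoly \<Rightarrow> 'b" where
  "law_of_op H \<xi> y f = hinner H \<xi> (nc_eval (op_ring H) (left_op H) y f \<xi>)"

text \<open>The submodule \<open>\<H>\<degree>\<close> and the projection of \<open>\<H> = \<B>\<xi> \<oplus> \<H>\<degree>\<close> onto it.\<close>

definition compl_vec :: "('b::cstar_algebra, 'h) corr \<Rightarrow> 'h \<Rightarrow> ('b, 'h) corr" where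
  "compl_vec H \<xi> = H\<lparr>hcarrier := {h \<in> hcarrier H. hinner H h \<xi> = 0}\<rparr>"

definition proj_compl :: "('b::cstar_algebra, 'h) corr \<Rightarrow> 'h \<Rightarrow> 'h \<Rightarrow> 'h" where
  "proj_compl H \<xi> h = hminus H h (ract H \<xi> (hinner H \<xi> h))"

text \<open>Tensor products over \<open>\<B>\<close>. The pair \<open>([h\<^sub>1, \<dots>, h\<^sub>m], b)\<close> stands for the elementary tensor
  \<open>h\<^sub>1 \<otimes> \<cdots> \<otimes> h\<^sub>m b\<close>; for \<open>m = 0\<close> it is the element \<open>b\<close> of the empty tensor product \<open>\<B>\<close>. A
  finite sum of elementary tensors is a list of such pairs. All relations of the algebraic tensor
  product over \<open>\<B>\<close>, and those making the sums a vector space, hold up to vectors of length zero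
  and so become equalities under separation.

  The inner product is determined by
  \<open>\<langle>h \<otimes> t, k \<otimes> t'\<rangle> = \<langle>t, \<langle>h, k\<rangle> t'\<rangle>\<close>; \<open>tensor_inner Hs a hs ks\<close> is
  \<open>\<langle>h\<^sub>1 \<otimes> \<cdots> \<otimes> h\<^sub>m, a (k\<^sub>1 \<otimes> \<cdots> \<otimes> k\<^sub>m)\<rangle>\<close>.\<close>

fun tensor_inner :: "('b::cstar_algebra, 'h) corr list \<Rightarrow> 'b \<Rightarrow> 'h list \<Rightarrow> 'h list \<Rightarrow> 'b" where
  "tensor_inner (H # Hs) a (h # hs) (k # ks) = tensor_inner Hs (hinner H h (lact H a k)) hs ks"
| "tensor_inner _ a _ _ = a"

fun elem_lact :: "('b::cstar_algebra, 'h) corr list \<Rightarrow> 'b \<Rightarrow> 'h list \<times> 'b \<Rightarrow> 'h list \<times> 'b" where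
  "elem_lact (H # Hs) a (h # hs, b) = (lact H a h # hs, b)"
| "elem_lact _ a (hs, b) = (hs, a * b)"

definition elem_tensors :: "('b::cstar_algebra, 'h) corr list \<Rightarrow> ('h list \<times> 'b) set" where
  "elem_tensors Hs = {(hs, b). list_all2 (\<lambda>h H. h \<in> hcarrier H) hs Hs}"

definition pre_tensor :: "('b::cstar_algebra, 'h) corr list \<Rightarrow> ('b, ('h list \<times> 'b) list) corr" where
  "pre_tensor Hs =
     \<lparr> hcarrier = lists (elem_tensors Hs),
       hzero = [],
       hadd = (@),
       lact = (\<lambda>a. map (elem_lact Hs a)),
       ract = (\<lambda>t c. map (\<lambda>(hs, b). (hs, b * c)) t),
       hinner = (\<lambda>t t'. \<Sum>(hs, b)\<leftarrow>t. \<Sum>(ks, c)\<leftarrow>t'. star b * tensor_inner Hs 1 hs ks * c) \<rparr>"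

definition tensor_product ::
    "('b::cstar_algebra, 'h) corr list \<Rightarrow> ('b, (nat \<Rightarrow> ('h list \<times> 'b) list) set) corr" where
  "tensor_product Hs = sep_completion (pre_tensor Hs)"

definition elem_embed :: "('b::cstar_algebra, 'h) corr list \<Rightarrow> 'h list \<times> 'b \<Rightarrow> (nat \<Rightarrow> ('h list \<times> 'b) list) set" where
  "elem_embed Hs t = embed_compl (pre_tensor Hs) [t]"

definition direct_sum :: "'i set \<Rightarrow> ('i \<Rightarrow> ('b::cstar_algebra, 'h) corr) \<Rightarrow> ('b, 'i \<Rightarrow> 'h) corr" where
  "direct_sum I K =
     \<lparr> hcarrier = {h \<in> (\<Pi>\<^sub>E s\<in>I. hcarrier (K s)). (\<lambda>s. hinner (K s) (h s) (h s)) summable_on I},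
       hzero = (\<lambda>s\<in>I. hzero (K s)),
       hadd = (\<lambda>h k. \<lambda>s\<in>I. hadd (K s) (h s) (k s)),
       lact = (\<lambda>b h. \<lambda>s\<in>I. lact (K s) b (h s)),
       ract = (\<lambda>h b. \<lambda>s\<in>I. ract (K s) (h s) b),
       hinner = (\<lambda>h k. \<Sum>\<^sub>\<infinity>s\<in>I. hinner (K s) (h s) (k s)) \<rparr>"

section \<open>Trees\<close>

definition alternating_strings :: "nat \<Rightarrow> nat list set" where
  "alternating_strings N = {s. set s \<subseteq> {1..N} \<and> distinct_adj s}"

definition free_tree_edges :: "nat \<Rightarrow> (nat list \<times> nat list) set" where
  "free_tree_edges N = {(s, t). s \<in> alternating_strings N \<and> t \<in> alternating_strings N \<and>
     ((\<exists>j. t = j # s) \<or> (\<exists>j. s = j # t))}"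

definition Tree :: "nat \<Rightarrow> nat list set set" where
  "Tree N = {T. T \<subseteq> alternating_strings N \<and> [] \<in> T \<and>
     (\<forall>s\<in>T. \<forall>t\<in>T. (s, t) \<in> (free_tree_edges N \<inter> T \<times> T)\<^sup>*)}"

text \<open>\<open>tree_comp T S n\<close> is \<open>\<T>(\<T>\<^sub>1, \<dots>, \<T>\<^sub>k)\<close> with \<open>\<T>\<^sub>j = S j \<in> Tree (n j)\<close>; the value of \<open>k\<close>
  enters only through the letters of \<open>T\<close>. The shift of the \<open>j\<close>-th alphabet is \<open>\<iota>\<^sub>j\<close>.\<close>

definition tree_shift :: "(nat \<Rightarrow> nat) \<Rightarrow> nat \<Rightarrow> nat \<Rightarrow> nat" where
  "tree_shift n j i = (\<Sum>l\<in>{1..<j}. n l) + i"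

definition tree_comp :: "nat list set \<Rightarrow> (nat \<Rightarrow> nat list set) \<Rightarrow> (nat \<Rightarrow> nat) \<Rightarrow> nat list set" where
  "tree_comp T S n =
     {concat (map2 (\<lambda>i s. map (tree_shift n i) s) w ss) | w ss.
        w \<in> T \<and> list_all2 (\<lambda>i s. s \<in> S i - {[]}) w ss}"

fun tree_pow :: "nat \<Rightarrow> nat list set \<Rightarrow> nat \<Rightarrow> nat list set" where
  "tree_pow N T 0 = {[], [1]}"
| "tree_pow N T (Suc k) = tree_comp T (\<lambda>_. tree_pow N T k) (\<lambda>_. N ^ k)"

section \<open>Convolution along a tree\<close>

context
  fixes T :: "nat list set"
    and H :: "nat \<Rightarrow> ('b::cstar_algebra, 'h) corr"
    and \<xi> :: "nat \<Rightarrow> 'h"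
begin

definition legs :: "nat list \<Rightarrow> ('b, 'h) corr list" where
  "legs s = map (\<lambda>j. compl_vec (H j) (\<xi> j)) s"

definition tree_product :: "('b, nat list \<Rightarrow> (nat \<Rightarrow> ('h list \<times> 'b) list) set) corr" where
  "tree_product = direct_sum T (\<lambda>s. tensor_product (legs s))"

definition tree_vacuum :: "nat list \<Rightarrow> (nat \<Rightarrow> ('h list \<times> 'b) list) set" where
  "tree_vacuum = (\<lambda>s\<in>T. if s = [] then elem_embed (legs []) ([], 1) else hzero (tensor_product (legs s)))"

text \<open>The image of \<open>h \<otimes> t\<close>, for \<open>h \<in> \<H>\<^sub>j\<close> and an elementary tensor \<open>t\<close> in \<open>\<H>\<^sub>s\<degree>\<close>, under
  \<open>\<H>\<^sub>j \<otimes>\<^sub>\<B> \<H>\<^sub>s\<degree> \<cong> \<H>\<^sub>s\<degree> \<oplus> \<H>\<^sub>j\<^sub>s\<degree>\<close>, obtained from \<open>h = \<langle>\<xi>\<^sub>j, h\<rangle>\<xi>\<^sub>j + h\<degree>\<close> with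
  \<open>h\<degree> \<in> \<H>\<^sub>j\<degree>\<close>.\<close>

definition attach :: "nat \<Rightarrow> nat list \<Rightarrow> 'h \<Rightarrow> 'h list \<times> 'b \<Rightarrow> nat list \<Rightarrow> (nat \<Rightarrow> ('h list \<times> 'b) list) set"
  where
  "attach j s h t = (\<lambda>r\<in>T.
     if r = s then elem_embed (legs s) (elem_lact (legs s) (hinner (H j) (\<xi> j) h) t)
     else if r = j # s then elem_embed (legs (j # s)) (proj_compl (H j) (\<xi> j) h # fst t, snd t)
     else hzero (tensor_product (legs r)))"

definition single :: "nat list \<Rightarrow> (nat \<Rightarrow> ('h list \<times> 'b) list) set
    \<Rightarrow> nat list \<Rightarrow> (nat \<Rightarrow> ('h list \<times> 'b) list) set" where
  "single s t = (\<lambda>r\<in>T. if r = s then t else hzero (tensor_product (legs r)))"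

text \<open>The operator \<open>\<lambda>\<^sub>\<T>\<^sub>,\<^sub>j(x)\<close>. It is determined by its values on the vectors below, since these
  span a dense submodule of the tree product.\<close>

definition tree_lambda :: "nat \<Rightarrow> ('h \<Rightarrow> 'h)
    \<Rightarrow> (nat list \<Rightarrow> (nat \<Rightarrow> ('h list \<times> 'b) list) set)
    \<Rightarrow> (nat list \<Rightarrow> (nat \<Rightarrow> ('h list \<times> 'b) list) set)" where
  "tree_lambda j x = (THE y. y \<in> adjointable tree_product \<and>
     (\<forall>s\<in>T. \<not> (\<exists>s'. s = j # s') \<longrightarrow>
        (if j # s \<in> T
         then \<forall>h\<in>hcarrier (H j). \<forall>t\<in>elem_tensors (legs s). y (attach j s h t) = attach j s (x h) t
         else \<forall>t\<in>hcarrier (tensor_product (legs s)). y (single s t) = hzero tree_product)))"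

end

definition pre_L2 :: "('b::cstar_algebra ncpoly \<Rightarrow> 'b) \<Rightarrow> ('b, 'b ncpoly) corr" where
  "pre_L2 \<mu> =
     \<lparr> hcarrier = UNIV,
       hzero = 0,
       hadd = (+),
       lact = (\<lambda>b p. nc_const b * p),
       ract = (\<lambda>p b. p * nc_const b),
       hinner = (\<lambda>p q. \<mu> (nc_star p * q)) \<rparr>"

definition L2 :: "('b::cstar_algebra ncpoly \<Rightarrow> 'b) \<Rightarrow> ('b, (nat \<Rightarrow> 'b ncpoly) set) corr" where
  "L2 \<mu> = sep_completion (pre_L2 \<mu>)"

definition L2_one :: "('b::cstar_algebra ncpoly \<Rightarrow> 'b) \<Rightarrow> (nat \<Rightarrow> 'b ncpoly) set" where
  "L2_one \<mu> = embed_compl (pre_L2 \<mu>) 1"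

text \<open>The continuous extension to \<open>L\<^sup>2(\<B>\<langle>X\<rangle>, \<mu>)\<close> of left multiplication by \<open>X\<close>.\<close>

definition L2_var :: "('b::cstar_algebra ncpoly \<Rightarrow> 'b) \<Rightarrow> (nat \<Rightarrow> 'b ncpoly) set \<Rightarrow> (nat \<Rightarrow> 'b ncpoly) set"
  where
  "L2_var \<mu> = (\<lambda>U\<in>hcarrier (L2 \<mu>). cauchy_class (pre_L2 \<mu>) (\<lambda>i. nc_var * some_rep U i))"

definition boxplus :: "nat \<Rightarrow> nat list set \<Rightarrow> (nat \<Rightarrow> 'b::cstar_algebra ncpoly \<Rightarrow> 'b) \<Rightarrow> 'b ncpoly \<Rightarrow> 'b" where
  "boxplus N T \<mu> =
     (let H = (\<lambda>j. L2 (\<mu> j)); \<xi> = (\<lambda>j. L2_one (\<mu> j)); K = tree_product T H \<xi>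
      in law_of_op K (tree_vacuum T H \<xi>)
           (\<Oplus>\<^bsub>op_ring K\<^esub>j\<in>{1..N}. tree_lambda T H \<xi> j (L2_var (\<mu> j))))"

end

theory Submission
  imports Defs
begin

text \<open>On the tree product write the sum of the operators as \<open>C + C\<^sup>* + Z\<close>, where \<open>C\<close> creates: it sends
  \<open>h \<in> \<H>\<^sub>s\<degree>\<close> to the sum of \<open>X\<^sub>j\<xi>\<^sub>j \<otimes> h\<close> over the children \<open>js\<close> of \<open>s\<close>, and \<open>Z\<close> is the sum of the compressions of
  the \<open>X\<^sub>j\<close> to \<open>\<H>\<^sub>j\<degree>\<close>. The mean being zero, there is no further term. The summands of \<open>Z\<close> have orthogonal
  supports, so \<open>\<parallel>Z\<parallel> \<le> R\<close>, and \<open>\<parallel>C\<parallel>\<^sup>2 \<le> D\<parallel>\<eta>(1)\<parallel>\<close> where \<open>D \<le> n\<^sup>k(N - 1)/(n - 1)\<close> bounds the number of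
  children of a vertex. The law of \<open>C + C\<^sup>*\<close> only depends on \<open>\<eta>\<close> and the tree: it is the same for
  the \<open>\<mu>\<^sub>j\<close> and the \<open>\<nu>\<^sub>j\<close>. The dilations of \<open>C + C\<^sup>* + Z\<close> and \<open>C + C\<^sup>*\<close> are at distance at most
  \<open>n\<^sup>-\<^sup>k\<^sup>/\<^sup>2R\<close>, and comparing through \<open>C + C\<^sup>*\<close> twice gives the factor \<open>2\<close>.

  To pass to a \<open>\<B>\<close>-valued probability space as in \<open>Mod\<close>, restrict the two operators to the submodule
  generated by the vacuum and complete the algebra of polynomials in them in the operator norm; its
  elements are coded as sequences in \<open>\<B>\<close>. There \<open>E\<close> is faithful because the vacuum is cyclic.\<close>

section \<open>Positive elements of a \<open>C\<^sup>*\<close>-algebra\<close>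

text \<open>One series replaces functional calculus: the binomial series of (1 - x)^(1/2),
  absolutely convergent on the closed unit ball. It gives roots in the algebra, roots of matrices
  over it and, applied to moments, an operator bound for X. The last is needed because the radius of
  a law only controls the growth of moments.

  The constant in R' counts children. The root of the k-th power has at most n^k children, any other
  vertex at most (N - 1)(1 + n + ... + n^(k-1)); both are at most n^k (N - 1)/(n - 1). Dilation
  cancels n^k, and the factor 2 comes from creation together with its adjoint.

  Identities in the tree product are proved weakly, by testing against vectors, since sums of
  tensors are lists and agree only modulo null vectors. \<open>tree_lambda\<close> is a definite
  description, so an explicit operator is exhibited and shown to be the only candidate.
  \<open>Mod\<close> is a supremum of reals and bounds its elements only because the set is bounded;
  hence the uniform bounds on expectations at the end.\<close>

definition sqrt_coeff :: "nat \<Rightarrow> real" where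
  "sqrt_coeff n = (-1) ^ n * ((1/2) gchoose n)"

text \<open>The coefficients are those of (1 - x)^(1/2), with the sign of (-x)^n absorbed.
  Vandermonde's identity for 1/2 + 1/2 = 1 shows that the Cauchy square of the series is 1 -
  x.\<close>

lemma sqrt_coeff_conv:
  "(\<Sum>i\<le>n. sqrt_coeff i * sqrt_coeff (n - i)) = (if n = 0 then 1 else if n = 1 then -1 else 0)"
proof -
  have "(\<Sum>i\<le>n. sqrt_coeff i * sqrt_coeff (n - i))
      = (-1) ^ n * (\<Sum>i=0..n. ((1/2::real) gchoose i) * ((1/2) gchoose (n - i)))"
    unfolding sum_distrib_left atLeast0AtMost sqrt_coeff_def
    by (rule sum.cong) (auto simp: power_add[symmetric])
  also have "\<dots> = (-1) ^ n * ((1::real) gchoose n)"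
    by (subst gbinomial_Vandermonde) simp
  also have "(1::real) gchoose n = of_nat (1 choose n)"
    using binomial_gbinomial[of 1 n, where 'a = real] by simp
  finally show ?thesis
    by (cases n rule: nat.exhaust) (auto simp: binomial_eq_0 less_Suc_eq_0_disj)
qed

lemma sqrt_coeff_0: "sqrt_coeff 0 = 1"
  by (simp add: sqrt_coeff_def)

text \<open>The first coefficient after the constant is -1/2, and from there on consecutive
  coefficients have nonnegative ratio. With the signs known, absolute sums are read off from
  ordinary partial sums.\<close>

lemma sqrt_coeff_nonpos: "sqrt_coeff (Suc n) \<le> 0"
proof (induction n)
  case (Suc n)
  define q where "q = (real (Suc n) - 1/2) / real (Suc (Suc n))"
  have "((1/2::real) gchoose Suc (Suc n)) = - q * ((1/2) gchoose Suc n)"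
    using gbinomial_mult_1[of "1/2::real" "Suc n"] by (simp add: q_def field_simps)
  then have "sqrt_coeff (Suc (Suc n)) = q * sqrt_coeff (Suc n)"
    unfolding sqrt_coeff_def by simp
  moreover have "q \<ge> 0" by (simp add: q_def)
  ultimately show ?case using Suc by (metis mult_nonneg_nonpos)
qed (simp add: sqrt_coeff_def)

text \<open>The alternating partial sum of the coefficients for 1/2 is, up to sign, a single
  coefficient for -1/2, whose sign is known from the ratio of consecutive ones.\<close>

lemma sqrt_coeff_partial_sum_nonneg: "0 \<le> (\<Sum>i\<le>n. sqrt_coeff i)"
proof -
  have "(\<Sum>i\<le>n. sqrt_coeff i) = (-1) ^ n * ((-1/2::real) gchoose n)"
    using gbinomial_sum_lower_neg[of "1/2::real" n] by (simp add: sqrt_coeff_def mult.commute)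
  also have "\<dots> \<ge> 0"
  proof (induction n)
    case (Suc n)
    define q where "q = (real n + 1/2) / real (Suc n)"
    have "((-1/2::real) gchoose Suc n) = - q * ((-1/2) gchoose n)"
      using gbinomial_mult_1[of "-1/2::real" n] by (simp add: q_def field_simps)
    then have "(-1) ^ Suc n * ((-1/2::real) gchoose Suc n) = q * ((-1) ^ n * ((-1/2) gchoose n))"
      by simp
    moreover have "q \<ge> 0" by (simp add: q_def)
    ultimately have ?case using Suc by (metis mult_nonneg_nonneg)
    then show ?case .
  qed simp
  finally show ?thesis .
qed

text \<open>The partial sum at x = 1 equals 1 minus the absolute sum of the other coefficients, and
  it is nonnegative. The bound 1 serves twice: for absolute convergence on the closed unit ball, and
  for the distance of the root from 1.\<close>

lemma sqrt_coeff_abs_sum: "(\<Sum>i<n. \<bar>sqrt_coeff (Suc i)\<bar>) \<le> 1"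
proof -
  have "(\<Sum>i\<le>n. sqrt_coeff i) = 1 + (\<Sum>i<n. sqrt_coeff (Suc i))"
    by (simp add: sum.atMost_shift sqrt_coeff_0)
  moreover have "(\<Sum>i<n. \<bar>sqrt_coeff (Suc i)\<bar>) = - (\<Sum>i<n. sqrt_coeff (Suc i))"
    using sqrt_coeff_nonpos by (simp add: abs_of_nonpos sum_negf)
  ultimately show ?thesis using sqrt_coeff_partial_sum_nonneg[of n] by simp
qed

lemma sqrt_coeff_summable: "summable (\<lambda>n. \<bar>sqrt_coeff n\<bar>)"
proof -
  have "summable (\<lambda>n. \<bar>sqrt_coeff (Suc n)\<bar>)"
    by (rule summableI_nonneg_bounded[where x = 1]) (use sqrt_coeff_abs_sum in auto)
  then show ?thesis by (subst (asm) summable_Suc_iff)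
qed

lemma sqrt_coeff_abs_suminf: "(\<Sum>n. \<bar>sqrt_coeff (Suc n)\<bar>) \<le> 1"
  by (rule suminf_le_const[OF _ sqrt_coeff_abs_sum])
    (use sqrt_coeff_summable in \<open>subst summable_Suc_iff\<close>)

section \<open>Calculus of the involution and of complex scalars\<close>

lemma scaleR_scaleC: "r *\<^sub>R (x::'b::cstar_algebra) = scaleC (of_real r) x"
  by (rule scaleC_of_real[symmetric])

lemma star_scaleR: "star (r *\<^sub>R (x::'b::cstar_algebra)) = r *\<^sub>R star x"
  by (simp add: scaleR_scaleC star_scaleC)

lemma star_minus: "star (- (x::'b::cstar_algebra)) = - star x"
  using star_scaleR[of "-1" x] by simp

lemma star_diff: "star ((x::'b::cstar_algebra) - y) = star x - star y"
  using star_add[of x "- y"] by (simp add: star_minus)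

lemma star_sum: "star (\<Sum>i\<in>A. f i :: 'b::cstar_algebra) = (\<Sum>i\<in>A. star (f i))"
  by (induction A rule: infinite_finite_induct) (auto simp: star_zero star_add)

lemma star_sum_list: "star (\<Sum>x\<leftarrow>xs. f x :: 'b::cstar_algebra) = (\<Sum>x\<leftarrow>xs. star (f x))"
  by (induction xs) (auto simp: star_zero star_add)

lemma star_power: "star ((x::'b::cstar_algebra) ^ n) = star x ^ n"
  by (induction n) (auto simp: star_one star_mult power_commutes)

lemma star_of_real: "star (of_real r :: 'b::cstar_algebra) = of_real r"
  by (simp add: of_real_def star_scaleR star_one)

lemma norm_star: "norm (star (x::'b::cstar_algebra)) = norm x"
proof -
  have le: "norm y \<le> norm (star y)" for y :: 'b
  proof (cases "y = 0")
    case False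
    have "norm y * norm y \<le> norm (star y) * norm y"
      using norm_star_mult_self[of y] norm_mult_ineq[of "star y" y] by (simp add: power2_eq_square)
    with False show ?thesis by simp
  qed simp
  from le[of x] le[of "star x"] show ?thesis by (simp add: star_star)
qed

lemma norm_mult_star_self: "norm (x * star (x::'b::cstar_algebra)) = (norm x)\<^sup>2"
  using norm_star_mult_self[of "star x"] by (simp add: star_star norm_star)

lemma bounded_linear_star: "bounded_linear (star :: 'b::cstar_algebra \<Rightarrow> 'b)"
  by (rule bounded_linear_intro[where K = 1]) (auto simp: star_add star_scaleR norm_star)

lemmas tendsto_star = bounded_linear.tendsto[OF bounded_linear_star]

lemma scaleC_left: "scaleC c (x::'b::cstar_algebra) = scaleC c 1 * x"
  by (simp add: mult_scaleC_left)

lemma scaleC_one: "scaleC 1 (x::'b::cstar_algebra) = x"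
  using scaleC_of_real[of 1 x] by simp

lemma scaleC_minus_left: "scaleC (- c) (x::'b::cstar_algebra) = - scaleC c x"
  using scaleC_scaleC[of "-1" c x] scaleC_of_real[of "-1" "scaleC c x"] by simp

lemma scaleC_minus_right: "scaleC c (- (x::'b::cstar_algebra)) = - scaleC c x"
  using scaleC_left[of c "- x"] scaleC_left[of c x] by simp

lemma scaleC_diff_right: "scaleC c ((x::'b::cstar_algebra) - y) = scaleC c x - scaleC c y"
  using scaleC_add_right[of c x "- y"] by (simp add: scaleC_minus_right)

text \<open>The binomial series for \<open>(1 - a)\<^sup>1\<^sup>/\<^sup>2\<close> converges absolutely even for \<open>\<parallel>a\<parallel> = 1\<close>.\<close>

lemma sqrt_series_norm_le:
  fixes a :: "'b::cstar_algebra"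
  assumes "norm a \<le> 1"
  shows "norm (sqrt_coeff n *\<^sub>R a ^ n) \<le> \<bar>sqrt_coeff n\<bar>"
proof -
  have "norm (a ^ n) \<le> 1"
    using norm_power_ineq[of a n] power_le_one[of "norm a" n] assms by simp
  then show ?thesis by (simp add: mult_left_le)
qed

lemma sqrt_series:
  fixes a :: "'b::cstar_algebra"
  assumes sa: "star a = a" and na: "norm a \<le> 1"
  obtains w where "star w = w" "w * w = 1 - a" "\<And>x. x * a = a * x \<Longrightarrow> x * w = w * x"
    "norm (1 - w) \<le> 1"
proof -
  let ?f = "\<lambda>n. sqrt_coeff n *\<^sub>R a ^ n"
  have nsum: "summable (\<lambda>n. norm (?f n))"
    by (rule summable_comparison_test'[OF sqrt_coeff_summable, of 0])
      (use sqrt_series_norm_le[OF na] in auto)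
  then have sum: "summable ?f" by (rule summable_norm_cancel)
  define w where "w = suminf ?f"
  have "star w = w"
    unfolding w_def by (subst bounded_linear.suminf[OF bounded_linear_star sum])
      (simp add: star_scaleR star_power sa)
  moreover have "w * w = 1 - a"
  proof -
    have "w * w = (\<Sum>k. \<Sum>i\<le>k. ?f i * ?f (k - i))"
      unfolding w_def by (rule Cauchy_product[OF nsum nsum])
    also have "(\<lambda>k. \<Sum>i\<le>k. ?f i * ?f (k - i)) = (\<lambda>k. (\<Sum>i\<le>k. sqrt_coeff i * sqrt_coeff (k - i)) *\<^sub>R a ^ k)"
      by (rule ext) (auto simp: scaleR_sum_left power_add[symmetric] intro!: sum.cong)
    also have "\<dots> = (\<lambda>k. (if k = 0 then 1 else if k = 1 then -1 else 0) *\<^sub>R a ^ k)"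
      by (simp add: sqrt_coeff_conv)
    also have "suminf \<dots> = (\<Sum>k\<in>{0,1}. (if k = 0 then 1 else if k = 1 then -1 else 0) *\<^sub>R a ^ k)"
      by (rule suminf_finite) auto
    finally show ?thesis by simp
  qed
  moreover have "x * w = w * x" if "x * a = a * x" for x
  proof -
    have "x * a ^ n = a ^ n * x" for n
      by (rule power_commuting_commutes[symmetric]) (simp add: that)
    then show ?thesis
      unfolding w_def suminf_mult[OF sum, symmetric] suminf_mult2[OF sum] by simp
  qed
  \<comment> \<open>The tail of the series has absolute coefficient sum at most 1. The root
    therefore lies in the unit ball about 1, which later makes the root itself positive.\<close>
  moreover have "norm (1 - w) \<le> 1"
  proof -
    have "w = (\<Sum>n. ?f (Suc n)) + 1"
      unfolding w_def using suminf_split_head[OF sum] by (simp add: sqrt_coeff_0)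
    then have "norm (1 - w) = norm (\<Sum>n. ?f (Suc n))" by simp
    also have "\<dots> \<le> (\<Sum>n. norm (?f (Suc n)))"
      by (rule summable_norm) (use nsum in \<open>simp add: summable_Suc_iff[of "\<lambda>n. norm (?f n)"] del: power_Suc norm_scaleR\<close>)
    also have "\<dots> \<le> (\<Sum>n. \<bar>sqrt_coeff (Suc n)\<bar>)"
      by (rule suminf_le) (use sqrt_series_norm_le[OF na] nsum sqrt_coeff_summable in
          \<open>simp_all add: summable_Suc_iff[of "\<lambda>n. norm (?f n)"] summable_Suc_iff[of "\<lambda>n. \<bar>sqrt_coeff n\<bar>"] del: power_Suc norm_scaleR\<close>)
    also have "\<dots> \<le> 1" by (rule sqrt_coeff_abs_suminf)
    finally show ?thesis .
  qed
  ultimately show thesis using that by blast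
qed

text \<open>With \<open>w = (1 - s\<^sup>2)\<^sup>1\<^sup>/\<^sup>2\<close> the element \<open>s + iw\<close> is unitary and \<open>w\<close> is its imaginary part.\<close>

lemma norm_le_sqrt_of_commuting:
  fixes s r :: "'b::cstar_algebra"
  assumes "star s = s" "star r = r" "s * r = r * s" "s * s + r * r = of_real t" "t \<ge> 0"
  shows "norm s \<le> sqrt t" "norm r \<le> sqrt t"
proof -
  let ?u = "s + scaleC \<i> r"
  have u': "star ?u = s - scaleC \<i> r"
    using assms by (simp add: star_add star_scaleC scaleC_minus_left)
  have "star ?u * ?u = of_real t"
    unfolding u' using assms(3,4)
    by (simp add: algebra_simps mult_scaleC_left mult_scaleC_right scaleC_diff_right scaleC_add_right
        scaleC_scaleC scaleC_minus_left scaleC_one)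
  then have "(norm ?u)\<^sup>2 = t" using norm_star_mult_self[of ?u] assms(5) by simp
  then have nu: "norm ?u = sqrt t" by (metis norm_ge_zero real_sqrt_unique)
  have "2 *\<^sub>R s = ?u + star ?u" unfolding u' by (simp add: scaleR_2)
  then have "2 * norm s \<le> 2 * sqrt t"
    using norm_triangle_ineq[of ?u "star ?u"] nu norm_star[of ?u]
    by (metis norm_scaleR abs_numeral mult_2)
  then show "norm s \<le> sqrt t" by simp
  have "2 *\<^sub>R (scaleC \<i> r) = ?u - star ?u" unfolding u' by (simp add: scaleR_2)
  then have "2 * norm (scaleC \<i> r) \<le> 2 * sqrt t"
    using norm_triangle_ineq4[of ?u "star ?u"] nu norm_star[of ?u]
    by (metis norm_scaleR abs_numeral mult_2)
  then show "norm r \<le> sqrt t" by (simp add: norm_scaleC)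
qed

text \<open>Positivity in the form best suited to the norm: squares of self-adjoint elements. That
  every \<open>star c * c\<close> is of this kind is the harder statement
  \<open>sa_square_star_mult\<close>; sums and limits are settled before it.\<close>

definition sa_square :: "'b::cstar_algebra \<Rightarrow> bool" where
  "sa_square a \<longleftrightarrow> (\<exists>s. star s = s \<and> a = s * s)"

lemma sa_square_star: "sa_square a \<Longrightarrow> star a = a"
  by (auto simp: sa_square_def star_mult)

lemma norm_sa_square: "star s = s \<Longrightarrow> norm (s * s) = (norm (s::'b::cstar_algebra))\<^sup>2"
  using norm_star_mult_self[of s] by simp

text \<open>\<open>1 - s * s\<close> is again the square of some \<open>w\<close> commuting with
  \<open>s\<close>, and the two squares add up to 1, so neither root exceeds norm 1.\<close>

lemma square_norm_diff_le:
  fixes s :: "'b::cstar_algebra"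
  assumes sa: "star s = s" and ns: "norm s \<le> 1"
  shows "norm (1 - s * s) \<le> 1"
proof -
  have "norm (s * s) \<le> 1" using norm_sa_square[OF sa] ns by (simp add: power_le_one)
  moreover have "star (s * s) = s * s" by (simp add: star_mult sa)
  ultimately obtain w where w: "star w = w" "w * w = 1 - s * s" "\<And>x. x * (s * s) = (s * s) * x \<Longrightarrow> x * w = w * x"
    using sqrt_series by blast
  have "norm w \<le> sqrt 1"
    by (rule norm_le_sqrt_of_commuting(2)[OF sa w(1) w(3)]) (simp_all add: mult.assoc w)
  then have "norm (w * w) \<le> 1" using norm_sa_square[OF w(1)] by (simp add: power_le_one)
  then show ?thesis by (simp add: w)
qed

lemma sa_square_scaleR:
  assumes "sa_square a" "r \<ge> 0" shows "sa_square (r *\<^sub>R a)"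
proof -
  from assms obtain s where "star s = s" "a = s * s" by (auto simp: sa_square_def)
  then show ?thesis unfolding sa_square_def
    by (intro exI[of _ "sqrt r *\<^sub>R s"]) (use assms in \<open>auto simp: star_scaleR real_sqrt_mult_self\<close>)
qed

text \<open>One half of a norm criterion that takes the place of the spectrum: a self-adjoint
  \<open>a\<close> is positive iff, for some t > 0, it lies in the closed ball of radius t about the
  scalar t. Rescaling by t reduces this half to \<open>square_norm_diff_le\<close>.\<close>

lemma sa_square_norm_diff_le:
  fixes a :: "'b::cstar_algebra"
  assumes "sa_square a" "norm a \<le> t"
  shows "norm (of_real t - a) \<le> t"
proof (cases "t = 0")
  case True with assms show ?thesis by simp
next
  case False
  with assms have t: "t > 0" using norm_ge_zero[of a] by linarith
  from sa_square_scaleR[OF assms(1), of "1/t"] t obtain s where s: "star s = s" "(1/t) *\<^sub>R a = s * s"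
    by (auto simp: sa_square_def divide_inverse)
  have "norm (s * s) \<le> 1" unfolding s(2)[symmetric] using assms t by (simp add: field_simps)
  then have "norm s \<le> 1"
    unfolding norm_sa_square[OF s(1)] by (simp add: power2_eq_square abs_square_le_1[unfolded power2_eq_square])
  then have "norm (1 - (1/t) *\<^sub>R a) \<le> 1" unfolding s(2) by (rule square_norm_diff_le[OF s(1)])
  moreover have "of_real t - a = t *\<^sub>R (1 - (1/t) *\<^sub>R a)"
    using t by (simp add: scaleR_diff_right of_real_def)
  ultimately show ?thesis using t by simp
qed

lemma sqrt_of_norm_diff_le:
  fixes a :: "'b::cstar_algebra"
  assumes sa: "star a = a" and t: "t > 0" and n: "norm (of_real t - a) \<le> t"
  obtains w where "star w = w" "w * w = a" "\<And>x. x * a = a * x \<Longrightarrow> x * w = w * x"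
    "norm (of_real (sqrt t) - w) \<le> sqrt t"
proof -
  let ?x = "1 - (1/t) *\<^sub>R a"
  have "star ?x = ?x" by (simp add: star_diff star_one star_scaleR sa)
  moreover have "norm ?x \<le> 1"
  proof -
    have "?x = (1/t) *\<^sub>R (of_real t - a)" using t by (simp add: scaleR_diff_right of_real_def)
    then have "norm ?x = norm (of_real t - a) / t" using t by simp
    then show ?thesis using n t by simp
  qed
  ultimately obtain w where w: "star w = w" "w * w = 1 - ?x" "\<And>y. y * ?x = ?x * y \<Longrightarrow> y * w = w * y"
     "norm (1 - w) \<le> 1"
    using sqrt_series by blast
  show thesis
  proof (rule that[of "sqrt t *\<^sub>R w"])
    show "star (sqrt t *\<^sub>R w) = sqrt t *\<^sub>R w" by (simp add: star_scaleR w)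
    show "sqrt t *\<^sub>R w * sqrt t *\<^sub>R w = a" using w(2) t by (simp add: real_sqrt_mult_self)
    show "y * sqrt t *\<^sub>R w = sqrt t *\<^sub>R w * y" if "y * a = a * y" for y
      using w(3)[of y] that by (simp add: algebra_simps)
    have "of_real (sqrt t) - sqrt t *\<^sub>R w = sqrt t *\<^sub>R (1 - w)"
      by (simp add: scaleR_diff_right of_real_def)
    then show "norm (of_real (sqrt t) - sqrt t *\<^sub>R w) \<le> sqrt t"
      using w(4) t by (simp add: mult_left_le)
  qed
qed

text \<open>The converse half of the criterion, for any positive radius. The triangle inequality for
  such balls and their closedness yield sums and limits of positive elements.\<close>

lemma sa_square_of_norm: "star a = a \<Longrightarrow> t > 0 \<Longrightarrow> norm (of_real t - a) \<le> t \<Longrightarrow> sa_square a"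
  unfolding sa_square_def by (erule (2) sqrt_of_norm_diff_le) metis

lemma sa_square_0: "sa_square 0"
  unfolding sa_square_def by (intro exI[of _ 0]) (simp add: star_zero)

text \<open>The root obtained from the series satisfies the ball criterion itself, with the square
  root of the radius, and is therefore positive. Kaplansky's argument takes a root of such a
  root.\<close>

lemma sa_square_sqrt:
  assumes "sa_square a"
  obtains w where "sa_square w" "w * w = a" "\<And>x. x * a = a * x \<Longrightarrow> x * w = w * x"
proof -
  define t where "t = norm a + 1"
  have t: "t > 0" "norm a \<le> t" by (auto simp: t_def add_nonneg_pos)
  obtain w where w: "star w = w" "w * w = a" "\<And>x. x * a = a * x \<Longrightarrow> x * w = w * x"
    "norm (of_real (sqrt t) - w) \<le> sqrt t"
    using sqrt_of_norm_diff_le[OF sa_square_star[OF assms] t(1) sa_square_norm_diff_le[OF assms t(2)]] by blast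
  show thesis by (rule that[OF sa_square_of_norm[OF w(1) _ w(4)] w(2,3)]) (use t in auto)
qed

lemma sa_square_add:
  assumes "sa_square a" "sa_square b" shows "sa_square (a + b)"
\<comment> \<open>The ball criterion is used with the radii \<open>norm a + 1\<close> and
  \<open>norm b\<close>; the 1 makes their sum positive even if both elements vanish.\<close>
proof (rule sa_square_of_norm[of _ "norm a + norm b + 1"])
  show "star (a + b) = a + b" using assms by (simp add: star_add sa_square_star)
  show "norm a + norm b + 1 > 0" by (simp add: add_nonneg_pos)
  have "norm (of_real (norm a + 1) - a + (of_real (norm b) - b)) \<le> (norm a + 1) + norm b"
    by (rule norm_triangle_le[OF add_mono]) (simp_all only: sa_square_norm_diff_le assms order_refl less_imp_le less_add_one)
  then show "norm (of_real (norm a + norm b + 1) - (a + b)) \<le> norm a + norm b + 1"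
    by (simp add: algebra_simps)
qed

lemma sa_square_limit:
  assumes "\<And>n. sa_square (u n)" "u \<longlonglongrightarrow> a" shows "sa_square (a::'b::cstar_algebra)"
proof -
  have "Bseq u" using assms(2) by (intro convergent_imp_Bseq convergentI)
  then obtain t where t: "t > 0" "\<And>n. norm (u n) \<le> t" by (auto simp: Bseq_def)
  show ?thesis
  proof (rule sa_square_of_norm[OF _ t(1)])
    have "(\<lambda>n. star (u n)) \<longlonglongrightarrow> star a" by (rule tendsto_star[OF assms(2)])
    then show "star a = a" using assms(1,2) LIMSEQ_unique by (simp add: sa_square_star) blast
    show "norm (of_real t - a) \<le> t"
      by (rule LIMSEQ_le_const2[OF tendsto_norm[OF tendsto_diff[OF tendsto_const assms(2)]]])
        (use sa_square_norm_diff_le[OF assms(1) t(2)] in auto)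
  qed
qed

text \<open>If b is nonzero, ||b|| - a = (||b|| - b) + (b - a) is positive and has a root commuting
  with a root of a; the two squares add up to ||b||. The case b = 0 is separate because the ball
  criterion needs a positive radius: there a and -a are both positive, and the squares of their
  roots add up to 0.\<close>

lemma sa_square_norm_mono:
  assumes "sa_square a" "sa_square (b - a)" shows "norm a \<le> norm b"
proof (cases "norm b = 0")
  case True
  then have "sa_square (- a)" using assms by simp
  from sa_square_norm_diff_le[OF assms(1) order_refl] sa_square_norm_diff_le[OF this] 
  have 1: "norm (of_real (norm a) - a) \<le> norm a" and 2: "norm (of_real (norm a) + a) \<le> norm a" by auto
  obtain s where s: "star s = s" "a = s * s" using assms unfolding sa_square_def by blast
  obtain r where r: "star r = r" "- a = r * r" "\<And>x. x * (-a) = (-a) * x \<Longrightarrow> x * r = r * x"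
    by (rule sa_square_sqrt[OF \<open>sa_square (- a)\<close>]) (metis sa_square_star)
  have "norm s \<le> sqrt 0"
    by (rule norm_le_sqrt_of_commuting(1)[OF s(1) r(1) r(3)]) (simp_all add: r(2)[symmetric] s(2) mult.assoc)
  then show ?thesis using s by simp
next
  case False
  then have t: "norm b > 0" by simp
  have b: "sa_square b" using sa_square_add[OF assms] by simp
  have "sa_square (of_real (norm b) - b)"
    by (rule sa_square_of_norm[OF _ t]) (use b in \<open>auto simp: star_diff star_of_real sa_square_star\<close>)
  from sa_square_add[OF this assms(2)] have "sa_square (of_real (norm b) - a)" by simp
  from sa_square_sqrt[OF this] obtain r where r: "star r = r" "of_real (norm b) - a = r * r"
    "\<And>x. x * (of_real (norm b) - a) = (of_real (norm b) - a) * x \<Longrightarrow> x * r = r * x"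
    using sa_square_star by metis
  obtain s where s: "star s = s" "a = s * s" using assms unfolding sa_square_def by blast
  have "s * of_real (norm b) = of_real (norm b) * s" by (simp add: of_real_def)
  then have "s * (of_real (norm b) - a) = (of_real (norm b) - a) * s"
    by (simp add: algebra_simps s(2))
  from r(3)[OF this] have "norm s \<le> sqrt (norm b)"
    by (rule norm_le_sqrt_of_commuting(1)[OF s(1) r(1)]) (simp_all add: r(2)[symmetric] s(2))
  then show ?thesis using norm_sa_square[OF s(1)] s(2)
    by (metis norm_ge_zero real_sqrt_abs real_sqrt_le_iff abs_of_nonneg)
qed

lemma sa_square_antisym: "sa_square a \<Longrightarrow> sa_square (- a) \<Longrightarrow> a = 0"
  using sa_square_norm_mono[of a 0] by simp

text \<open>Kaplansky's argument: let \<open>h = c\<^sup>*c\<close>, \<open>k = |h|\<close>, \<open>b = k - h\<close>, \<open>d = cb\<close>. Then \<open>d\<^sup>*d\<close> is negative,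
  hence so is \<open>(de)(de)\<^sup>*\<close> for \<open>e\<close> a root of \<open>-d\<^sup>*d\<close>, as \<open>(dd\<^sup>*)\<^sup>2 = -(de)(de)\<^sup>*\<close>; but
  \<open>x\<^sup>*x + xx\<^sup>*\<close> is always positive.\<close>

lemma sa_square_star_mult_add: "sa_square (star d * d + d * star (d::'b::cstar_algebra))"
proof -
  define x where "x = (1/2) *\<^sub>R (d + star d)"
  define y where "y = scaleC (- \<i> / 2) (d - star d)"
  have x: "star x = x" by (simp add: x_def star_scaleR star_add star_star add.commute)
  have y: "star y = y"
    by (simp add: y_def star_scaleC star_diff star_star scaleC_diff_right scaleC_minus_left)
  have "star d * d + d * star d = 2 *\<^sub>R (x * x) + 2 *\<^sub>R (y * y)"
  proof -
    have "4 *\<^sub>R (x * x) = (d + star d) * (d + star d)" by (simp add: x_def)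
    moreover have "y * y = scaleC (- 1 / 4) ((d - star d) * (d - star d))"
      unfolding y_def by (simp add: mult_scaleC_left mult_scaleC_right scaleC_scaleC del: minus_divide_left)
    then have "4 *\<^sub>R (y * y) = - (d - star d) * (d - star d)"
      by (simp only: scaleR_scaleC scaleC_scaleC) (simp add: scaleC_minus_left scaleC_one del: minus_diff_eq)
    ultimately have "4 *\<^sub>R (x * x) + 4 *\<^sub>R (y * y) = 2 *\<^sub>R (star d * d + d * star d)"
      by (simp add: algebra_simps scaleR_2)
    then have "2 *\<^sub>R (2 *\<^sub>R (x * x) + 2 *\<^sub>R (y * y)) = 2 *\<^sub>R (star d * d + d * star d)"
      by (simp add: scaleR_add_right)
    then show ?thesis by (metis scaleR_cancel_left zero_neq_numeral)
  qed
  moreover have "sa_square (x * x)" "sa_square (y * y)" using x y by (auto simp: sa_square_def)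
  ultimately show ?thesis by (metis sa_square_add sa_square_scaleR zero_le_numeral)
qed

text \<open>The sum of the two products is positive by \<open>sa_square_star_mult_add\<close> and
  negative by assumption, hence zero. One product is then the negative of the other, so it is
  positive as well as negative.\<close>

lemma sa_square_both_neg:
  assumes "sa_square (- (star d * d))" "sa_square (- (d * star d))" shows "d * star d = 0"
proof -
  have "star d * d + d * star d = 0"
    by (rule sa_square_antisym[OF sa_square_star_mult_add])
      (use sa_square_add[OF assms] in simp)
  then have "sa_square (d * star d)" using assms(1) by (simp add: add_eq_0_iff)
  then show ?thesis using assms(2) by (rule sa_square_antisym)
qed

lemma zero_of_neg_star_mult:
  assumes "sa_square (- (star d * d))" shows "(d::'b::cstar_algebra) = 0"
proof -
  obtain e where e: "star e = e" "- (star d * d) = e * e" using assms unfolding sa_square_def by blast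
  have dd: "star d * d = - (e * e)" using e(2) by (metis minus_minus)
  have 1: "(d * e) * star (d * e) = - ((d * star d) * (d * star d))"
  proof -
    have "(d * e) * star (d * e) = d * (e * e) * star d" by (simp add: star_mult e mult.assoc)
    also have "\<dots> = - (d * (star d * d) * star d)" by (simp add: dd)
    finally show ?thesis by (simp add: mult.assoc)
  qed
  have 2: "star (d * e) * (d * e) = - ((e * e) * (e * e))"
  proof -
    have "star (d * e) * (d * e) = e * (star d * d) * e" by (simp add: star_mult e mult.assoc)
    then show ?thesis by (simp add: dd mult.assoc)
  qed
  have "(d * e) * star (d * e) = 0"
  proof (rule sa_square_both_neg)
    show "sa_square (- (star (d * e) * (d * e)))" unfolding 2
      unfolding sa_square_def by (intro exI[of _ "e * e"]) (simp add: star_mult e)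
    show "sa_square (- (d * e * star (d * e)))" unfolding 1
      unfolding sa_square_def by (intro exI[of _ "d * star d"]) (simp add: star_mult star_star)
  qed
  then have "(d * star d) * (d * star d) = 0" using 1 by simp
  then have "norm (d * star d) = 0"
    using norm_sa_square[of "d * star d"] by (simp add: star_mult star_star)
  then show ?thesis using norm_mult_star_self[of d] by simp
qed

lemma sa_square_star_mult: "sa_square (star c * (c::'b::cstar_algebra))"
proof -
  define h where "h = star c * c"
  have h: "star h = h" by (simp add: h_def star_mult star_star)
  then have "sa_square (h * h)" by (auto simp: sa_square_def)
  then obtain k where k: "sa_square k" "k * k = h * h" "\<And>x. x * (h * h) = (h * h) * x \<Longrightarrow> x * k = k * x"
    using sa_square_sqrt by blast
  have hk: "h * k = k * h" by (rule k(3)) (simp add: mult.assoc)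
  define b where "b = k - h"
  have b: "star b = b" using h sa_square_star[OF k(1)] by (simp add: b_def star_diff)
  have bk: "b * k = k * b" by (simp add: b_def algebra_simps hk)
  have hb: "h * b = - (k * b)" by (simp add: b_def algebra_simps hk k)
  \<comment> \<open>\<open>m\<close> is a root of \<open>k\<close>, which plays the role of |h|. It
    commutes with \<open>b\<close>, so that b k b becomes the square of the self-adjoint
    \<open>m * b\<close>.\<close>
  obtain m where m: "sa_square m" "m * m = k" "\<And>x. x * k = k * x \<Longrightarrow> x * m = m * x"
    using sa_square_sqrt[OF k(1)] by blast
  have bm: "b * m = m * b" by (rule m(3)[OF bk])
  have mb: "star (m * b) = m * b" using sa_square_star[OF m(1)] by (simp add: star_mult b bm)
  have "star (c * b) * (c * b) = b * h * b" by (simp add: star_mult b h_def mult.assoc)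
  also have "\<dots> = - ((m * b) * (m * b))"
  proof -
    have "b * h * b = - (b * (m * m) * b)" by (simp add: mult.assoc hb m(2))
    also have "b * (m * m) * b = (m * b) * (m * b)" by (simp add: bm mult.assoc[symmetric])
    finally show ?thesis .
  qed
  finally have cb: "star (c * b) * (c * b) = - ((m * b) * (m * b))" .
  \<comment> \<open>\<open>star (c * b) * (c * b)\<close> is minus a square, so \<open>c * b\<close>
    vanishes. Then k b = 0 and \<open>b * b\<close> = k b - h b = 2 k b = 0, so that h = k is
    positive.\<close>
  have "c * b = 0"
    by (rule zero_of_neg_star_mult) (use cb mb in \<open>auto simp: sa_square_def\<close>)
  with cb have "(m * b) * (m * b) = 0" by simp
  then have "m * b = 0" using norm_sa_square[OF mb] by simp
  then have "k * b = 0" by (simp add: m(2)[symmetric] mult.assoc)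
  then have "b * b = 0" using hb by (simp add: b_def algebra_simps)
  then have "b = 0" using norm_sa_square[OF b] by simp
  then show ?thesis using k(1) by (simp add: b_def h_def)
qed

text \<open>The case of size one of \<open>pos_matrix\<close>, and the form in which positivity of
  laws and of inner products is given.\<close>

definition cpos :: "'b::cstar_algebra \<Rightarrow> bool" where
  "cpos a \<longleftrightarrow> (\<exists>c. a = star c * c)"

lemma cpos_iff_sa_square: "cpos a \<longleftrightarrow> sa_square a"
  unfolding cpos_def using sa_square_star_mult by (metis sa_square_def)

lemma cpos_star_mult: "cpos (star c * c)"
  by (auto simp: cpos_def)

lemma cpos_0: "cpos 0"
  and cpos_add: "cpos a \<Longrightarrow> cpos b \<Longrightarrow> cpos (a + b)"
  and cpos_scaleR: "cpos a \<Longrightarrow> r \<ge> 0 \<Longrightarrow> cpos (r *\<^sub>R a)"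
  by (simp_all only: cpos_iff_sa_square sa_square_0 sa_square_add sa_square_scaleR)

lemma cpos_limit: "(\<And>n. cpos (u n)) \<Longrightarrow> u \<longlonglongrightarrow> a \<Longrightarrow> cpos a"
  unfolding cpos_iff_sa_square by (rule sa_square_limit)

lemma cpos_sum: "(\<And>i. i \<in> A \<Longrightarrow> cpos (f i)) \<Longrightarrow> cpos (sum f A)"
  by (induction A rule: infinite_finite_induct) (auto simp: cpos_0 cpos_add)

lemma cpos_conj: "cpos a \<Longrightarrow> cpos (star b * a * b)"
  unfolding cpos_def by (metis mult.assoc star_mult)

section \<open>The order of a C*-algebra\<close>

definition cle :: "'b::cstar_algebra \<Rightarrow> 'b \<Rightarrow> bool" (infix \<open>\<preceq>\<close> 50) where
  "a \<preceq> b \<longleftrightarrow> cpos (b - a)"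

lemma cle_refl: "a \<preceq> a" and cle_0: "0 \<preceq> a \<longleftrightarrow> cpos a"
  by (simp_all add: cle_def cpos_0)

lemma cle_trans [trans]: "a \<preceq> b \<Longrightarrow> b \<preceq> c \<Longrightarrow> a \<preceq> c"
  unfolding cle_def using cpos_add by (metis add.commute diff_add_cancel add_diff_eq)

lemma cle_add: "a \<preceq> b \<Longrightarrow> c \<preceq> d \<Longrightarrow> a + c \<preceq> b + d"
  unfolding cle_def using cpos_add by (metis add_diff_add)

lemma cle_sum: "(\<And>i. i \<in> A \<Longrightarrow> f i \<preceq> g i) \<Longrightarrow> sum f A \<preceq> sum g A"
  by (induction A rule: infinite_finite_induct) (auto simp: cle_refl cle_add)

lemma cle_scaleR: "a \<preceq> b \<Longrightarrow> r \<ge> 0 \<Longrightarrow> r *\<^sub>R a \<preceq> r *\<^sub>R b"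
  unfolding cle_def using cpos_scaleR by (metis scaleR_diff_right)

lemma cle_conj: "a \<preceq> b \<Longrightarrow> star c * a * c \<preceq> star c * b * c"
  unfolding cle_def using cpos_conj by (metis left_diff_distrib right_diff_distrib)

lemma cle_norm_mono: "cpos a \<Longrightarrow> a \<preceq> b \<Longrightarrow> norm a \<le> norm b"
  unfolding cle_def cpos_iff_sa_square by (rule sa_square_norm_mono)

lemma cle_limit: "(\<And>n. u n \<preceq> v n) \<Longrightarrow> u \<longlonglongrightarrow> a \<Longrightarrow> v \<longlonglongrightarrow> b \<Longrightarrow> a \<preceq> b"
  unfolding cle_def by (rule cpos_limit) (auto intro: tendsto_diff)

lemma cpos_mono: "cpos a \<Longrightarrow> a \<preceq> b \<Longrightarrow> cpos b"
  unfolding cle_def using cpos_add by (metis diff_add_cancel)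

lemma cle_of_real_norm:
  assumes "star a = a" "norm a \<le> t" shows "a \<preceq> of_real t"
proof (cases "t = 0")
  case False
  with assms(2) have "t > 0" using norm_ge_zero[of a] by linarith
  then show ?thesis unfolding cle_def cpos_iff_sa_square
    by (intro sa_square_of_norm[of _ t]) (use assms in \<open>auto simp: star_diff star_of_real\<close>)
qed (use assms in \<open>auto simp: cle_refl\<close>)

lemma cle_scaleR_norm: "star a = a \<Longrightarrow> norm a \<le> t \<Longrightarrow> star b * a * b \<preceq> t *\<^sub>R (star b * b)"
  using cle_conj[OF cle_of_real_norm, of a t b] by (simp add: of_real_def)

text \<open>The hypotheses place t + a between 0 and 2 t, so ||t + a|| is at most 2 t. The factor 3
  is crude; the lemma only serves to bound the set in \<open>Mod\<close>.\<close>

lemma norm_le_of_cle: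
  assumes "a \<preceq> of_real t" "- a \<preceq> of_real t" "t \<ge> 0"
  shows "norm a \<le> 3 * t"
proof -
  have p: "cpos (of_real t + a)" and m: "cpos (of_real t - a)" using assms by (auto simp: cle_def add.commute)
  have "of_real t + a \<preceq> of_real (2 * t)" 
  proof -
    have "of_real (2 * t) - (of_real t + a) = of_real t - a"
      unfolding mult_2 of_real_add by simp
    then show ?thesis using m unfolding cle_def by metis
  qed
  from cle_norm_mono[OF p this] have "norm (of_real t + a) \<le> 2 * t"
    unfolding norm_of_real using assms(3) by linarith
  then show ?thesis
    using norm_triangle_ineq4[of "of_real t + a" "of_real t"] assms(3) by simp
qed

lemma cle_Young:
  fixes x y :: "'b::cstar_algebra"
  shows "star x * y + star y * x \<preceq> star x * x + star y * y"
  unfolding cle_def using cpos_star_mult[of "x - y"]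
  by (simp add: star_diff algebra_simps)

text \<open>Young's inequality after scaling \<open>x\<close> by s and \<open>a * y\<close> by 1/s
  with s^2 = ||a||, which balances the two terms.\<close>

lemma cle_Young_mult:
  fixes x y a :: "'b::cstar_algebra"
  shows "star x * a * y + star y * star a * x \<preceq> norm a *\<^sub>R (star x * x + star y * y)"
proof (cases "a = 0")
  case False
  define s where "s = sqrt (norm a)"
  have s: "s > 0" "s * s = norm a" using False by (auto simp: s_def)
  have "star x * a * y + star y * star a * x
      = star (s *\<^sub>R x) * ((1/s) *\<^sub>R (a * y)) + star ((1/s) *\<^sub>R (a * y)) * (s *\<^sub>R x)"
    using s(1) by (simp add: star_scaleR star_mult mult.assoc)
  also have "\<dots> \<preceq> star (s *\<^sub>R x) * (s *\<^sub>R x) + star ((1/s) *\<^sub>R (a * y)) * ((1/s) *\<^sub>R (a * y))"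
    by (rule cle_Young)
  also have "\<dots> = norm a *\<^sub>R (star x * x) + (1 / norm a) *\<^sub>R (star y * (star a * a) * y)"
    by (simp add: star_scaleR star_mult mult.assoc s(2))
  also have "\<dots> \<preceq> norm a *\<^sub>R (star x * x) + (1 / norm a) *\<^sub>R ((norm a)\<^sup>2 *\<^sub>R (star y * y))"
    by (intro cle_add cle_refl cle_scaleR cle_scaleR_norm)
      (auto simp: star_mult star_star norm_star_mult_self)
  also have "\<dots> = norm a *\<^sub>R (star x * x + star y * y)"
    using False by (simp add: scaleR_add_right power2_eq_square)
  finally show ?thesis .
qed (simp add: star_zero cle_refl)

section \<open>Positive matrices\<close>

text \<open>A matrix with positive quadratic form is rescaled to \<open>M/t = 1 - A\<close> with \<open>0 \<le> A \<le> 1\<close>. The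
  powers of \<open>A\<close> then have entries of norm at most one, and the root of \<open>M/t\<close> is the binomial series,
  summed entrywise.\<close>

fun mat_pow :: "nat \<Rightarrow> (nat \<Rightarrow> nat \<Rightarrow> 'b::cstar_algebra) \<Rightarrow> nat \<Rightarrow> nat \<Rightarrow> nat \<Rightarrow> 'b" where
  "mat_pow m A 0 i j = (if i = j then 1 else 0)"
| "mat_pow m A (Suc n) i j = (\<Sum>k<m. A i k * mat_pow m A n k j)"

lemma mat_pow_add:
  assumes "i < m"
  shows "mat_pow m A (a + b) i j = (\<Sum>k<m. mat_pow m A a i k * mat_pow m A b k j)"
  using assms
proof (induction a arbitrary: i)
  case 0
  have "(\<Sum>k<m. mat_pow m A 0 i k * mat_pow m A b k j) = (\<Sum>k<m. if i = k then mat_pow m A b k j else 0)"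
    by (rule sum.cong) auto
  then show ?case using 0 by simp
next
  case (Suc a)
  have "mat_pow m A (Suc a + b) i j = (\<Sum>l<m. A i l * (\<Sum>k<m. mat_pow m A a l k * mat_pow m A b k j))"
    using Suc by simp
  also have "\<dots> = (\<Sum>k<m. \<Sum>l<m. A i l * (mat_pow m A a l k * mat_pow m A b k j))"
    unfolding sum_distrib_left by (rule sum.swap)
  finally show ?case by (simp add: sum_distrib_right mult.assoc)
qed

lemma mat_pow_star:
  assumes "\<And>i j. i < m \<Longrightarrow> j < m \<Longrightarrow> star (A i j) = A j i" "i < m" "j < m"
  shows "star (mat_pow m A n i j) = mat_pow m A n j i"
  using assms(2,3)
proof (induction n arbitrary: i j)
  case (Suc n)
  have "(\<Sum>l<m. A k l * (if l = i then 1 else 0)) = A k i" for k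
    using Suc.prems by (simp add: if_distrib[of "\<lambda>x. _ * x"] cong: if_cong)
  then have "mat_pow m A (n + 1) j i = (\<Sum>k<m. mat_pow m A n j k * A k i)"
    using mat_pow_add[OF Suc.prems(2), of A n 1 i] by simp
  moreover have "star (mat_pow m A (Suc n) i j) = (\<Sum>k<m. mat_pow m A n j k * A k i)"
    using Suc assms(1) by (simp add: star_sum star_mult)
  ultimately show ?case by simp
qed (auto simp: star_one star_zero)

text \<open>For 0 <= A <= 1 the form of A at (1 - A) b is positive, that is 2 A^2 <= A + A^3. Using
  A <= 1 at b and at A b, the right side is at most 1 + A^2. The argument is phrased with quadratic
  forms only, as matrices are not given a norm of their own.\<close>

lemma contraction_of_form:
  fixes A :: "nat \<Rightarrow> nat \<Rightarrow> 'b::cstar_algebra"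
  defines "ip \<equiv> \<lambda>m b c. \<Sum>i<m. star (b i) * (c i :: 'b)"
  defines "mv \<equiv> \<lambda>m c i. \<Sum>j<m. A i j * c j"
  assumes herm: "\<And>i j. i < m \<Longrightarrow> j < m \<Longrightarrow> star (A i j) = A j i"
    and pos: "\<And>b. cpos (ip m b (mv m b))" and le: "\<And>b. ip m b (mv m b) \<preceq> ip m b b"
  shows "ip m (mv m b) (mv m b) \<preceq> ip m b b"
proof -
  let ?c = "mv m b" and ?d = "\<lambda>i. b i - mv m b i"
  have sym: "ip m (mv m x) y = ip m x (mv m y)" for x y
  proof -
    have "ip m (mv m x) y = (\<Sum>i<m. \<Sum>j<m. star (x j) * (A j i * y i))"
      unfolding ip_def mv_def star_sum sum_distrib_right
      by (intro sum.cong refl) (auto simp: star_mult herm mult.assoc)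
    also have "\<dots> = ip m x (mv m y)"
      unfolding ip_def mv_def sum_distrib_left by (rule sum.swap)
    finally show ?thesis .
  qed
  have mvd: "mv m ?d = (\<lambda>i. mv m b i - mv m ?c i)"
    unfolding mv_def by (auto simp: right_diff_distrib sum_subtractf)
  have "ip m ?d (mv m ?d) = ip m b ?c - ip m b (mv m ?c) - ip m ?c ?c + ip m ?c (mv m ?c)"
    unfolding mvd by (simp add: ip_def star_diff algebra_simps sum_subtractf sum.distrib)
  also have "\<dots> = (ip m b ?c + ip m ?c (mv m ?c)) - 2 *\<^sub>R ip m ?c ?c"
    by (simp add: sym[symmetric] scaleR_2 algebra_simps)
  finally have "2 *\<^sub>R ip m ?c ?c \<preceq> ip m b ?c + ip m ?c (mv m ?c)"
    using pos[of ?d] by (simp add: cle_def)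
  also have "\<dots> \<preceq> ip m b b + ip m ?c ?c" by (intro cle_add le)
  finally show ?thesis by (simp add: cle_def scaleR_2)
qed

text \<open>Each entry is paired with its mirror image, which doubles the form, and the pair is
  estimated by Young's inequality with weight \<open>norm (M i j)\<close>. Every
  \<open>star (b i) * b i\<close> is at most the whole sum of such terms.\<close>

lemma cle_form_norm:
  fixes M :: "nat \<Rightarrow> nat \<Rightarrow> 'b::cstar_algebra"
  assumes herm: "\<And>i j. i < m \<Longrightarrow> j < m \<Longrightarrow> star (M i j) = M j i"
    and t: "(\<Sum>i<m. \<Sum>j<m. norm (M i j)) \<le> t"
  shows "(\<Sum>i<m. \<Sum>j<m. star (b i) * M i j * b j) \<preceq> t *\<^sub>R (\<Sum>i<m. star (b i) * b i)"
proof -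
  let ?S = "\<Sum>i<m. star (b i) * b i"
  have S: "star (b i) * b i \<preceq> ?S" if "i < m" for i
  proof -
    have "?S - star (b i) * b i = (\<Sum>i\<in>{..<m}-{i}. star (b i) * b i)"
      using that by (simp add: sum_diff1)
    then show ?thesis unfolding cle_def by (simp add: cpos_sum cpos_star_mult)
  qed
  have "2 *\<^sub>R (\<Sum>i<m. \<Sum>j<m. star (b i) * M i j * b j)
      = (\<Sum>i<m. \<Sum>j<m. star (b i) * M i j * b j) + (\<Sum>j<m. \<Sum>i<m. star (b i) * M i j * b j)"
    unfolding scaleR_2 by (subst (2) sum.swap) simp
  also have "\<dots> = (\<Sum>i<m. \<Sum>j<m. star (b i) * M i j * b j + star (b j) * star (M i j) * b i)"
    unfolding sum.distrib[symmetric] by (intro sum.cong refl) (auto simp: herm)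
  also have "\<dots> \<preceq> (\<Sum>i<m. \<Sum>j<m. norm (M i j) *\<^sub>R (star (b i) * b i + star (b j) * b j))"
    by (intro cle_sum cle_Young_mult)
  also have "\<dots> \<preceq> (\<Sum>i<m. \<Sum>j<m. norm (M i j) *\<^sub>R (?S + ?S))"
    by (intro cle_sum cle_scaleR cle_add S) auto
  also have "\<dots> = (\<Sum>i<m. \<Sum>j<m. norm (M i j)) *\<^sub>R (?S + ?S)"
    by (simp add: scaleR_sum_left)
  also have "\<dots> \<preceq> t *\<^sub>R (?S + ?S)"
    unfolding cle_def scaleR_left_diff_distrib[symmetric] using t
    by (intro cpos_scaleR cpos_add cpos_sum cpos_star_mult) auto
  finally have "(1/2) *\<^sub>R (2 *\<^sub>R (\<Sum>i<m. \<Sum>j<m. star (b i) * M i j * b j)) \<preceq> (1/2) *\<^sub>R (t *\<^sub>R (?S + ?S))"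
    by (rule cle_scaleR) simp
  moreover have "(1/2) *\<^sub>R (t *\<^sub>R (?S + ?S)) = t *\<^sub>R ?S"
    by (simp add: scaleR_2[symmetric])
  ultimately show ?thesis by simp
qed

theorem pos_matrix_of_form:
  fixes M :: "nat \<Rightarrow> nat \<Rightarrow> 'b::cstar_algebra"
  assumes herm: "\<And>i j. i < m \<Longrightarrow> j < m \<Longrightarrow> star (M i j) = M j i"
    and form: "\<And>b. cpos (\<Sum>i<m. \<Sum>j<m. star (b i) * M i j * b j)"
  shows "pos_matrix m M"
proof -
  \<comment> \<open>The 1 keeps \<open>t\<close> positive for the zero matrix.\<close>
  define t where "t = (\<Sum>i<m. \<Sum>j<m. norm (M i j)) + 1"
  have t: "t > 0" unfolding t_def by (intro add_nonneg_pos sum_nonneg) auto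
  define A where "A i j = (if i = j then 1 else 0) - (1/t) *\<^sub>R M i j" for i j
  have A_herm: "star (A i j) = A j i" if "i < m" "j < m" for i j
    using that by (auto simp: A_def star_diff star_scaleR star_one star_zero herm)
  have ipA: "(\<Sum>i<m. star (b i) * (\<Sum>j<m. A i j * b j))
      = (\<Sum>i<m. star (b i) * b i) - (1/t) *\<^sub>R (\<Sum>i<m. \<Sum>j<m. star (b i) * M i j * b j)" for b
  proof -
    have "(\<Sum>j<m. A i j * b j) = b i - (1/t) *\<^sub>R (\<Sum>j<m. M i j * b j)" if "i < m" for i
    proof -
      have "(\<Sum>j<m. A i j * b j) = (\<Sum>j<m. if i = j then b j else 0) - (\<Sum>j<m. (1/t) *\<^sub>R (M i j * b j))"
        unfolding sum_subtractf[symmetric] A_def by (rule sum.cong) (auto simp: left_diff_distrib)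
      then show ?thesis using that by (simp add: scaleR_sum_right)
    qed
    then have "(\<Sum>i<m. star (b i) * (\<Sum>j<m. A i j * b j))
        = (\<Sum>i<m. star (b i) * b i - (1/t) *\<^sub>R (star (b i) * (\<Sum>j<m. M i j * b j)))"
      by (intro sum.cong refl) (simp add: right_diff_distrib)
    then show ?thesis
      by (simp add: sum_subtractf scaleR_sum_right sum_distrib_left mult.assoc)
  qed
  have contr: "(\<Sum>i<m. star (\<Sum>j<m. A i j * b j) * (\<Sum>j<m. A i j * b j)) \<preceq> (\<Sum>i<m. star (b i) * b i)" for b
  proof (rule contraction_of_form[OF A_herm])
    fix b :: "nat \<Rightarrow> 'b"
    have "(\<Sum>i<m. \<Sum>j<m. star (b i) * M i j * b j) \<preceq> t *\<^sub>R (\<Sum>i<m. star (b i) * b i)"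
      by (rule cle_form_norm[OF herm]) (auto simp: t_def)
    from cle_scaleR[OF this, of "1/t"] t
    show "cpos (\<Sum>i<m. star (b i) * (\<Sum>j<m. A i j * b j))"
      unfolding ipA cle_def by simp
    show "(\<Sum>i<m. star (b i) * (\<Sum>j<m. A i j * b j)) \<preceq> (\<Sum>i<m. star (b i) * b i)"
      unfolding ipA cle_def using cpos_scaleR[OF form, of "1/t"] t by simp
  qed auto
  \<comment> \<open>Column \<open>j\<close> of the power \<open>n\<close> arises by applying A n
    times to a unit vector, and A does not increase the sum of squares.\<close>
  have col: "(\<Sum>i<m. star (mat_pow m A n i j) * mat_pow m A n i j) \<preceq> 1" if "j < m" for n j
  proof (induction n)
    case 0
    have "(\<Sum>i<m. star (mat_pow m A 0 i j) * mat_pow m A 0 i j) = (\<Sum>i<m. if i = j then 1 else 0)"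
      by (rule sum.cong) (auto simp: star_one)
    then show ?case using that by (simp add: cle_refl)
  next
    case (Suc n)
    show ?case using cle_trans[OF contr[of "\<lambda>i. mat_pow m A n i j"] Suc] by simp
  qed
  have entry: "norm (mat_pow m A n i j) \<le> 1" if "i < m" "j < m" for n i j
  proof -
    have "star (mat_pow m A n i j) * mat_pow m A n i j
        \<preceq> (\<Sum>i<m. star (mat_pow m A n i j) * mat_pow m A n i j)"
    proof -
      have "(\<Sum>i<m. star (mat_pow m A n i j) * mat_pow m A n i j) - star (mat_pow m A n i j) * mat_pow m A n i j
          = (\<Sum>i\<in>{..<m}-{i}. star (mat_pow m A n i j) * mat_pow m A n i j)"
        using that by (simp add: sum_diff1)
      then show ?thesis unfolding cle_def by (simp add: cpos_sum cpos_star_mult)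
    qed
    also have "\<dots> \<preceq> 1" by (rule col[OF that(2)])
    finally have "(norm (mat_pow m A n i j))\<^sup>2 \<le> 1"
      using cle_norm_mono[OF cpos_star_mult, of "mat_pow m A n i j" 1] by (simp add: norm_star_mult_self)
    then show ?thesis by (simp add: abs_square_le_1)
  qed
  let ?f = "\<lambda>i j n. sqrt_coeff n *\<^sub>R mat_pow m A n i j"
  have nsum: "summable (\<lambda>n. norm (?f i j n))" if "i < m" "j < m" for i j
    by (rule summable_comparison_test'[OF sqrt_coeff_summable, of 0])
      (use entry[OF that] in \<open>auto simp: mult_left_le\<close>)
  define S where "S i j = (\<Sum>n. ?f i j n)" for i j
  have S_star: "star (S i j) = S j i" if "i < m" "j < m" for i j
    unfolding S_def
    by (subst bounded_linear.suminf[OF bounded_linear_star summable_norm_cancel[OF nsum[OF that]]])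
      (simp add: star_scaleR mat_pow_star[OF A_herm] that)
  have SS: "(\<Sum>k<m. S i k * S k j) = (1/t) *\<^sub>R M i j" if "i < m" "j < m" for i j
  proof -
    have "(\<lambda>n. \<Sum>k<m. \<Sum>l\<le>n. ?f i k l * ?f k j (n - l)) sums (\<Sum>k<m. S i k * S k j)"
      unfolding S_def using that by (intro sums_sum Cauchy_product_sums nsum) auto
    also have "(\<lambda>n. \<Sum>k<m. \<Sum>l\<le>n. ?f i k l * ?f k j (n - l))
        = (\<lambda>n. (\<Sum>l\<le>n. sqrt_coeff l * sqrt_coeff (n - l)) *\<^sub>R mat_pow m A n i j)"
    proof
      fix n
      have "(\<Sum>k<m. \<Sum>l\<le>n. ?f i k l * ?f k j (n - l))
          = (\<Sum>l\<le>n. \<Sum>k<m. (sqrt_coeff l * sqrt_coeff (n - l)) *\<^sub>R (mat_pow m A l i k * mat_pow m A (n - l) k j))"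
        by (subst sum.swap) (simp add: mult.commute)
      also have "\<dots> = (\<Sum>l\<le>n. (sqrt_coeff l * sqrt_coeff (n - l)) *\<^sub>R mat_pow m A n i j)"
        unfolding scaleR_sum_right[symmetric]
        by (intro sum.cong refl) (simp add: mat_pow_add[OF that(1), symmetric])
      finally show "(\<Sum>k<m. \<Sum>l\<le>n. ?f i k l * ?f k j (n - l))
          = (\<Sum>l\<le>n. sqrt_coeff l * sqrt_coeff (n - l)) *\<^sub>R mat_pow m A n i j"
        by (simp add: scaleR_sum_left)
    qed
    also have "\<dots> = (\<lambda>n. (if n = 0 then 1 else if n = 1 then -1 else 0) *\<^sub>R mat_pow m A n i j)"
      by (simp add: sqrt_coeff_conv)
    finally have 1: "\<dots> sums (\<Sum>k<m. S i k * S k j)" .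
    have "(\<lambda>n. (if n = 0 then 1 else if n = 1 then -1 else 0) *\<^sub>R mat_pow m A n i j)
        sums (\<Sum>n\<in>{0,1}. (if n = 0 then 1 else if n = 1 then -1 else 0) *\<^sub>R mat_pow m A n i j)"
      by (rule sums_finite) auto
    with 1 have "(\<Sum>k<m. S i k * S k j) = (\<Sum>n\<in>{0,1}. (if n = 0 then 1 else if n = 1 then -1 else 0) *\<^sub>R mat_pow m A n i j)"
      by (rule sums_unique2)
    also have "\<dots> = mat_pow m A 0 i j - mat_pow m A 1 i j" by simp
    also have "mat_pow m A 1 i j = A i j"
      using that by (simp add: if_distrib[of "\<lambda>x. _ * x"] cong: if_cong)
    finally show ?thesis by (simp add: A_def)
  qed
  show ?thesis unfolding pos_matrix_def
  proof (intro exI[of _ "\<lambda>k i. sqrt t *\<^sub>R S k i"] allI impI)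
    fix i j assume "i < m" "j < m"
    have "(\<Sum>k<m. star (sqrt t *\<^sub>R S k i) * (sqrt t *\<^sub>R S k j)) = (\<Sum>k<m. t *\<^sub>R (S i k * S k j))"
      using t \<open>i < m\<close> by (intro sum.cong refl) (auto simp: star_scaleR S_star)
    then show "M i j = (\<Sum>k<m. star (sqrt t *\<^sub>R S k i) * (sqrt t *\<^sub>R S k j))"
      using SS[OF \<open>i < m\<close> \<open>j < m\<close>] t by (simp add: scaleR_sum_right[symmetric])
  qed
qed

section \<open>Moment sequences\<close>

text \<open>For \<open>m k = \<langle>h, S\<^sup>k h\<rangle>\<close> with \<open>S\<close> positive this is the operator inequality \<open>S \<le> Q\<close>, read off
  from the growth of the moments: with \<open>p\<close> a partial sum of the series for \<open>(1 - x)\<^sup>1\<^sup>/\<^sup>2\<close>, the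
  positive elements \<open>\<langle>h, p(S/q)\<^sup>2 h\<rangle>\<close> converge to \<open>\<langle>h, (1 - S/q)h\<rangle>\<close> for \<open>q > Q\<close>.\<close>

lemma moment_bound:
  fixes m :: "nat \<Rightarrow> 'b::cstar_algebra"
  assumes hankel: "\<And>N a. cpos (\<Sum>i\<le>N. \<Sum>j\<le>N. (a i * a j) *\<^sub>R m (i + j))"
    and bound: "\<And>k. norm (m k) \<le> C * Q ^ k" and Q: "Q \<ge> 0"
  shows "m 1 \<preceq> Q *\<^sub>R m 0"
proof -
  have C: "C \<ge> 0" using order_trans[OF norm_ge_zero bound[of 0]] by simp
  \<comment> \<open>A \<open>q\<close> strictly above \<open>Q\<close> makes the ratio Q/q less than
    1; the value \<open>Q\<close> itself is reached at the end by a limit.\<close>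
  have step: "m 1 \<preceq> q *\<^sub>R m 0" if q: "q > Q" for q
  proof -
    have q0: "q > 0" using q Q by simp
    define f where "f i j = (sqrt_coeff i / q ^ i * (sqrt_coeff j / q ^ j)) *\<^sub>R m (i + j)" for i j
    define x where "x N = (\<Sum>i\<le>N. \<Sum>j\<le>N. f i j)" for N
    have "cpos (x N)" for N unfolding x_def f_def by (rule hankel)
    define r where "r = Q / q"
    have r: "0 \<le> r" "r < 1" using q Q q0 by (auto simp: r_def)
    have fb: "norm (f i j) \<le> \<bar>sqrt_coeff i\<bar> * \<bar>sqrt_coeff j\<bar> * (C * r ^ (i + j))" for i j
    proof -
      have "norm (f i j) = \<bar>sqrt_coeff i\<bar> * \<bar>sqrt_coeff j\<bar> * (norm (m (i + j)) / q ^ (i + j))"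
        using q0 by (simp add: f_def abs_mult power_add)
      also have "\<dots> \<le> \<bar>sqrt_coeff i\<bar> * \<bar>sqrt_coeff j\<bar> * (C * Q ^ (i + j) / q ^ (i + j))"
        using q0 by (intro mult_left_mono divide_right_mono bound) auto
      finally show ?thesis by (simp add: r_def power_divide)
    qed
    have sb: "(\<Sum>i\<le>N. \<bar>sqrt_coeff i\<bar>) \<le> 2" for N
      using sqrt_coeff_abs_sum[of N] by (simp add: sum.atMost_shift sqrt_coeff_0)
    \<comment> \<open>In the square of the partial sum, the terms with i + j <= N add up exactly to
      1 - x by \<open>sqrt_coeff_conv\<close>. All others carry a power of \<open>r\<close> above N,
      and the two absolute coefficient sums, at most 2 each, give the 4.\<close>
    have rem: "norm (x N - (m 0 - (1/q) *\<^sub>R m 1)) \<le> 4 * C * r ^ N" if "N \<ge> 1" for N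
    proof -
      let ?P = "{..N} \<times> {..N}" and ?T = "{(i, j). i + j \<le> N}"
      have T: "?T \<subseteq> ?P" by auto
      have "(\<Sum>(i,j)\<in>?T. f i j) = (\<Sum>n\<le>N. \<Sum>i\<le>n. f i (n - i))"
        by (rule sum.triangle_reindex_eq)
      also have "\<dots> = (\<Sum>n\<le>N. (\<Sum>i\<le>n. sqrt_coeff i * sqrt_coeff (n - i)) *\<^sub>R ((1 / q ^ n) *\<^sub>R m n))"
        unfolding scaleR_sum_left
        by (intro sum.cong refl) (auto simp: f_def power_add[symmetric])
      also have "\<dots> = (\<Sum>n\<le>N. (if n = 0 then 1 else if n = 1 then -1 else 0) *\<^sub>R ((1 / q ^ n) *\<^sub>R m n))"
        by (simp add: sqrt_coeff_conv)
      also have "\<dots> = (\<Sum>n\<in>{0,1}. (if n = 0 then 1 else if n = 1 then -1 else 0) *\<^sub>R ((1 / q ^ n) *\<^sub>R m n))"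
        by (rule sum.mono_neutral_right) (use that in auto)
      finally have tri: "(\<Sum>(i,j)\<in>?T. f i j) = m 0 - (1/q) *\<^sub>R m 1" by simp
      have "x N = (\<Sum>(i,j)\<in>?P. f i j)" unfolding x_def by (rule sum.cartesian_product)
      also have "\<dots> = (\<Sum>(i,j)\<in>?P - ?T. f i j) + (\<Sum>(i,j)\<in>?T. f i j)"
        by (rule sum.subset_diff[OF T]) simp
      finally have "x N - (m 0 - (1/q) *\<^sub>R m 1) = (\<Sum>(i,j)\<in>?P - ?T. f i j)" by (simp add: tri)
      also have "norm \<dots> \<le> (\<Sum>(i,j)\<in>?P - ?T. \<bar>sqrt_coeff i\<bar> * \<bar>sqrt_coeff j\<bar> * (C * r ^ N))"
      proof (rule sum_norm_le)
        fix p assume "p \<in> ?P - ?T"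
        then obtain i j where p: "p = (i, j)" and "\<not> i + j \<le> N" by auto
        then have "C * r ^ (i + j) \<le> C * r ^ N" using r C by (intro mult_left_mono power_decreasing) auto
        from order_trans[OF fb mult_left_mono[OF this]]
        show "norm (case p of (i, j) \<Rightarrow> f i j)
            \<le> (case p of (i, j) \<Rightarrow> \<bar>sqrt_coeff i\<bar> * \<bar>sqrt_coeff j\<bar> * (C * r ^ N))" by (simp add: p)
      qed
      also have "\<dots> \<le> (\<Sum>(i,j)\<in>?P. \<bar>sqrt_coeff i\<bar> * \<bar>sqrt_coeff j\<bar> * (C * r ^ N))"
        using C r by (intro sum_mono2) auto
      also have "\<dots> = (\<Sum>i\<le>N. \<bar>sqrt_coeff i\<bar>) * (\<Sum>j\<le>N. \<bar>sqrt_coeff j\<bar>) * (C * r ^ N)"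
        unfolding sum.cartesian_product[symmetric] by (simp only: sum_distrib_right sum_distrib_left) (rule sum.swap)
      also have "\<dots> \<le> 2 * 2 * (C * r ^ N)"
        using C r by (intro mult_right_mono mult_mono sb) (auto intro: sum_nonneg)
      finally show ?thesis by simp
    qed
    have "x \<longlonglongrightarrow> m 0 - (1/q) *\<^sub>R m 1"
    proof (rule LIM_zero_cancel, rule Lim_null_comparison)
      show "\<forall>\<^sub>F N in sequentially. norm (x N - (m 0 - (1/q) *\<^sub>R m 1)) \<le> 4 * C * r ^ N"
        using rem by (auto simp: eventually_sequentially)
      show "(\<lambda>N. 4 * C * r ^ N) \<longlonglongrightarrow> 0"
        using tendsto_mult_right_zero[OF LIMSEQ_realpow_zero[OF r]] by blast
    qed
    then have "cpos (m 0 - (1/q) *\<^sub>R m 1)" by (rule cpos_limit[rotated]) fact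
    from cpos_scaleR[OF this, of q] q0 show ?thesis unfolding cle_def by (simp add: scaleR_diff_right)
  qed
  show ?thesis
  proof (rule cle_limit)
    show "m 1 \<preceq> (Q + inverse (real (Suc n))) *\<^sub>R m 0" for n by (rule step) simp
    show "(\<lambda>n. (Q + inverse (real (Suc n))) *\<^sub>R m 0) \<longlonglongrightarrow> Q *\<^sub>R m 0"
      using LIMSEQ_inverse_real_of_nat_add[of Q] by (intro tendsto_scaleR tendsto_const)
  qed simp
qed

section \<open>Spaces with a \<open>\<B>\<close>-valued semi-inner product\<close>

text \<open>The axioms of the bimodule structure are only imposed under the inner product, since in
  \<open>pre_tensor\<close> they fail as equations between lists.\<close>

locale semi_corr =
  fixes H :: "('b::cstar_algebra, 'h) corr"
  assumes zero_in: "hzero H \<in> hcarrier H"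
    and add_in: "\<lbrakk>h \<in> hcarrier H; k \<in> hcarrier H\<rbrakk> \<Longrightarrow> hadd H h k \<in> hcarrier H"
    and lact_in: "h \<in> hcarrier H \<Longrightarrow> lact H a h \<in> hcarrier H"
    and ract_in: "h \<in> hcarrier H \<Longrightarrow> ract H h a \<in> hcarrier H"
    and inner_sym: "\<lbrakk>h \<in> hcarrier H; k \<in> hcarrier H\<rbrakk> \<Longrightarrow> star (hinner H h k) = hinner H k h"
    and inner_add: "\<lbrakk>h \<in> hcarrier H; k \<in> hcarrier H; l \<in> hcarrier H\<rbrakk> \<Longrightarrow>
          hinner H h (hadd H k l) = hinner H h k + hinner H h l"
    and inner_zero: "h \<in> hcarrier H \<Longrightarrow> hinner H h (hzero H) = 0"
    and inner_ract: "\<lbrakk>h \<in> hcarrier H; k \<in> hcarrier H\<rbrakk> \<Longrightarrow> hinner H h (ract H k a) = hinner H h k * a"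
    and inner_lact: "\<lbrakk>h \<in> hcarrier H; k \<in> hcarrier H\<rbrakk> \<Longrightarrow>
          hinner H h (lact H a k) = hinner H (lact H (star a) h) k"
    and lact_mult: "\<lbrakk>h \<in> hcarrier H; k \<in> hcarrier H\<rbrakk> \<Longrightarrow>
          hinner H h (lact H (a * b) k) = hinner H h (lact H a (lact H b k))"
    and lact_add: "\<lbrakk>h \<in> hcarrier H; k \<in> hcarrier H\<rbrakk> \<Longrightarrow>
          hinner H h (lact H (a + b) k) = hinner H h (lact H a k) + hinner H h (lact H b k)"
    and lact_scalar: "\<lbrakk>h \<in> hcarrier H; k \<in> hcarrier H\<rbrakk> \<Longrightarrow>
          hinner H h (lact H (scaleC c 1) k) = hinner H h k * scaleC c 1"
    and inner_pos: "h \<in> hcarrier H \<Longrightarrow> cpos (hinner H h h)"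
begin

lemmas closed = zero_in add_in lact_in ract_in

lemma minus_in: "\<lbrakk>h \<in> hcarrier H; k \<in> hcarrier H\<rbrakk> \<Longrightarrow> hminus H h k \<in> hcarrier H"
  by (simp add: hminus_def closed)

lemma inner_add_left: "\<lbrakk>h \<in> hcarrier H; k \<in> hcarrier H; l \<in> hcarrier H\<rbrakk> \<Longrightarrow>
    hinner H (hadd H k l) h = hinner H k h + hinner H l h"
  using arg_cong[OF inner_add, of h k l star] by (simp add: star_add inner_sym add_in)

lemma inner_zero_left: "h \<in> hcarrier H \<Longrightarrow> hinner H (hzero H) h = 0"
  using arg_cong[OF inner_zero, of h star] by (simp add: star_zero inner_sym zero_in)

lemma inner_ract_left: "\<lbrakk>h \<in> hcarrier H; k \<in> hcarrier H\<rbrakk> \<Longrightarrow> hinner H (ract H k a) h = star a * hinner H k h"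
  using arg_cong[OF inner_ract, of h k star a] by (simp add: star_mult inner_sym ract_in)

lemma inner_minus: "\<lbrakk>h \<in> hcarrier H; k \<in> hcarrier H; l \<in> hcarrier H\<rbrakk> \<Longrightarrow>
    hinner H h (hminus H k l) = hinner H h k - hinner H h l"
  by (simp add: hminus_def inner_add inner_ract closed)

lemma inner_minus_left: "\<lbrakk>h \<in> hcarrier H; k \<in> hcarrier H; l \<in> hcarrier H\<rbrakk> \<Longrightarrow>
    hinner H (hminus H k l) h = hinner H k h - hinner H l h"
  by (simp add: hminus_def inner_add_left inner_ract_left closed star_minus star_one)

lemma inner_lact_left: "\<lbrakk>h \<in> hcarrier H; k \<in> hcarrier H\<rbrakk> \<Longrightarrow>
    hinner H (lact H a h) k = hinner H h (lact H (star a) k)"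
  by (simp add: inner_lact star_star)

lemmas inner_simps = inner_add inner_add_left inner_zero inner_zero_left inner_ract inner_ract_left
  inner_minus inner_minus_left

lemma lact_one: "\<lbrakk>h \<in> hcarrier H; k \<in> hcarrier H\<rbrakk> \<Longrightarrow> hinner H h (lact H 1 k) = hinner H h k"
  using lact_scalar[of h k 1] by (simp add: scaleC_one)

lemma lact_of_real: "\<lbrakk>h \<in> hcarrier H; k \<in> hcarrier H\<rbrakk> \<Longrightarrow> hinner H h (lact H (of_real r) k) = r *\<^sub>R hinner H h k"
  using lact_scalar[of h k "of_real r"] by (simp add: scaleC_of_real of_real_def[where 'a = 'b])

lemma hnorm_sq: "(hnorm H h)\<^sup>2 = norm (hinner H h h)"
  by (simp add: hnorm_def)

lemma hnorm_nonneg: "hnorm H h \<ge> 0"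
  by (simp add: hnorm_def)

text \<open>||a||^2 - \<open>star a * a\<close> is positive, hence of the form
  \<open>star c * c\<close>, and the gap between the two sides is the inner square of c h.\<close>

lemma lact_le:
  assumes "h \<in> hcarrier H"
  shows "hinner H (lact H a h) (lact H a h) \<preceq> (norm a)\<^sup>2 *\<^sub>R hinner H h h"
proof -
  have "star a * a \<preceq> of_real ((norm a)\<^sup>2)"
    by (rule cle_of_real_norm) (auto simp: star_mult star_star norm_star_mult_self)
  then obtain c where c: "of_real ((norm a)\<^sup>2) - star a * a = star c * c"
    by (auto simp: cle_def cpos_def)
  then have "of_real ((norm a)\<^sup>2) = star a * a + star c * c" by (simp add: algebra_simps)
  then have "(norm a)\<^sup>2 *\<^sub>R hinner H h h = hinner H h (lact H (star a * a) h) + hinner H h (lact H (star c * c) h)"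
    using lact_of_real[OF assms assms, of "(norm a)\<^sup>2"] lact_add[OF assms assms] by simp
  also have "\<dots> = hinner H (lact H a h) (lact H a h) + hinner H (lact H c h) (lact H c h)"
    using assms by (simp add: lact_mult inner_lact_left closed)
  finally show ?thesis unfolding cle_def using inner_pos[OF lact_in[OF assms]] by simp
qed

lemma Cauchy_Schwarz_cle:
  assumes "h \<in> hcarrier H" "k \<in> hcarrier H" "t > 0" "norm (hinner H h h) \<le> t"
  shows "star (hinner H h k) * hinner H h k \<preceq> t *\<^sub>R hinner H k k"
proof -
  let ?x = "hinner H h k"
  let ?y = "(1/t) *\<^sub>R ?x"
  let ?d = "hminus H (ract H h ?y) k"
  have "hinner H ?d ?d = star ?y * hinner H h h * ?y - star ?y * ?x - star ?x * ?y + hinner H k k"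
    using assms by (simp add: inner_simps closed minus_in inner_sym algebra_simps)
  also have "\<dots> \<preceq> t *\<^sub>R (star ?y * ?y) - star ?y * ?x - star ?x * ?y + hinner H k k"
    unfolding cle_def diff_diff_eq2 using cle_scaleR_norm[OF inner_sym[OF assms(1,1)] assms(4), of ?y]
    by (simp add: cle_def algebra_simps)
  also have "\<dots> = hinner H k k - (1/t) *\<^sub>R (star ?x * ?x)"
    using assms(3) by (simp add: star_scaleR)
  finally have "cpos (hinner H k k - (1/t) *\<^sub>R (star ?x * ?x))"
    by (rule cpos_mono[OF inner_pos[OF minus_in[OF ract_in[OF assms(1)] assms(2)]]])
  from cpos_scaleR[OF this, of t] assms(3) show ?thesis
    by (simp add: cle_def scaleR_diff_right)
qed

lemma Cauchy_Schwarz: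
  assumes "h \<in> hcarrier H" "k \<in> hcarrier H"
  shows "norm (hinner H h k) \<le> hnorm H h * hnorm H k"
proof -
  have le: "(norm (hinner H h k))\<^sup>2 \<le> t * (hnorm H k)\<^sup>2" if "t > (hnorm H h)\<^sup>2" for t
  proof -
    have t: "t > 0" using that hnorm_sq[of h] by (metis norm_ge_zero order_le_less_trans)
    show ?thesis
      using cle_norm_mono[OF cpos_star_mult Cauchy_Schwarz_cle[OF assms t]] that t
      by (simp add: hnorm_sq norm_star_mult_self)
  qed
  \<comment> \<open>\<open>t\<close> decreases to the squared length of \<open>h\<close>, which may
    be 0.\<close>
  have "(norm (hinner H h k))\<^sup>2 \<le> (hnorm H h)\<^sup>2 * (hnorm H k)\<^sup>2"
  proof (rule LIMSEQ_le_const)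
    show "(\<lambda>n. ((hnorm H h)\<^sup>2 + inverse (real (Suc n))) * (hnorm H k)\<^sup>2) \<longlonglongrightarrow> (hnorm H h)\<^sup>2 * (hnorm H k)\<^sup>2"
      using LIMSEQ_inverse_real_of_nat_add by (intro tendsto_mult tendsto_const)
  qed (use le in auto)
  then show ?thesis
    unfolding power_mult_distrib[symmetric] by (rule power2_le_imp_le) (simp add: hnorm_nonneg)
qed

lemma hnorm_add:
  assumes "h \<in> hcarrier H" "k \<in> hcarrier H"
  shows "hnorm H (hadd H h k) \<le> hnorm H h + hnorm H k"
proof (rule power2_le_imp_le)
  have "hinner H (hadd H h k) (hadd H h k) = hinner H h h + hinner H h k + (hinner H k h + hinner H k k)"
    using assms by (simp add: inner_simps closed)
  then have "(hnorm H (hadd H h k))\<^sup>2 \<le> (hnorm H h)\<^sup>2 + hnorm H h * hnorm H k + (hnorm H k * hnorm H h + (hnorm H k)\<^sup>2)"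
    unfolding hnorm_sq by (simp only:) (intro norm_triangle_mono Cauchy_Schwarz order_refl assms)
  then show "(hnorm H (hadd H h k))\<^sup>2 \<le> (hnorm H h + hnorm H k)\<^sup>2"
    by (simp add: power2_eq_square algebra_simps)
qed (simp add: hnorm_nonneg)

lemma hnorm_ract: "h \<in> hcarrier H \<Longrightarrow> hnorm H (ract H h a) \<le> norm a * hnorm H h"
proof (rule power2_le_imp_le)
  assume "h \<in> hcarrier H"
  then have "(hnorm H (ract H h a))\<^sup>2 = norm (star a * hinner H h h * a)"
    by (simp add: hnorm_sq inner_simps closed mult.assoc)
  also have "\<dots> \<le> norm a * norm (hinner H h h) * norm a"
    using norm_mult_ineq[of "star a * hinner H h h" a] norm_mult_ineq[of "star a" "hinner H h h"]
    by (smt (verit) mult_right_mono norm_ge_zero norm_star)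
  finally show "(hnorm H (ract H h a))\<^sup>2 \<le> (norm a * hnorm H h)\<^sup>2"
    by (simp add: hnorm_sq power_mult_distrib power2_eq_square[of "norm a"] mult_ac)
qed (simp add: hnorm_nonneg)

text \<open>Equality modulo vectors of length zero. Before completion the vector space laws hold
  only in this sense, which is enough for computing lengths.\<close>

definition weq :: "'h \<Rightarrow> 'h \<Rightarrow> bool" where
  "weq h k \<longleftrightarrow> h \<in> hcarrier H \<and> k \<in> hcarrier H \<and> (\<forall>l\<in>hcarrier H. hinner H l h = hinner H l k)"

lemma hnorm_weq: "weq h k \<Longrightarrow> hnorm H h = hnorm H k"
proof -
  assume "weq h k"
  then have hk: "h \<in> hcarrier H" "k \<in> hcarrier H"
    and eq: "\<And>l. l \<in> hcarrier H \<Longrightarrow> hinner H l h = hinner H l k" by (auto simp: weq_def)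
  have "hinner H h h = star (hinner H k h)" using eq[OF hk(1)] inner_sym[OF hk(2,1)] by simp
  also have "\<dots> = hinner H k k" using eq[OF hk(2)] inner_sym[OF hk(2,2)] by simp
  finally show ?thesis by (simp add: hnorm_def)
qed

lemma hnorm_minus_self: "h \<in> hcarrier H \<Longrightarrow> hnorm H (hminus H h h) = 0"
  by (simp add: hnorm_def inner_simps minus_in)

lemma hnorm_minus_commute:
  assumes "h \<in> hcarrier H" "k \<in> hcarrier H"
  shows "hnorm H (hminus H h k) = hnorm H (hminus H k h)"
proof -
  have "hinner H (hminus H h k) (hminus H h k) = hinner H (hminus H k h) (hminus H k h)"
    using assms by (simp add: inner_simps minus_in)
  then show ?thesis by (simp add: hnorm_def)
qed

lemma hnorm_minus_triangle:
  assumes "h \<in> hcarrier H" "k \<in> hcarrier H" "l \<in> hcarrier H"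
  shows "hnorm H (hminus H h l) \<le> hnorm H (hminus H h k) + hnorm H (hminus H k l)"
proof -
  have "weq (hminus H h l) (hadd H (hminus H h k) (hminus H k l))"
    unfolding weq_def using assms by (simp add: inner_simps minus_in closed)
  from hnorm_weq[OF this] show ?thesis
    using hnorm_add[of "hminus H h k" "hminus H k l"] assms minus_in by simp
qed

lemma hnorm_minus_add:
  assumes "h \<in> hcarrier H" "k \<in> hcarrier H" "h' \<in> hcarrier H" "k' \<in> hcarrier H"
  shows "hnorm H (hminus H (hadd H h k) (hadd H h' k')) \<le> hnorm H (hminus H h h') + hnorm H (hminus H k k')"
proof -
  have "weq (hminus H (hadd H h k) (hadd H h' k')) (hadd H (hminus H h h') (hminus H k k'))"
    unfolding weq_def using assms by (simp add: inner_simps minus_in closed)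
  from hnorm_weq[OF this] show ?thesis
    using hnorm_add[of "hminus H h h'" "hminus H k k'"] assms minus_in by simp
qed

lemma hnorm_le_add_minus:
  assumes "h \<in> hcarrier H" "k \<in> hcarrier H"
  shows "hnorm H h \<le> hnorm H k + hnorm H (hminus H h k)"
proof -
  have "weq h (hadd H k (hminus H h k))"
    unfolding weq_def using assms by (simp add: inner_simps minus_in closed)
  from hnorm_weq[OF this] show ?thesis
    using hnorm_add[of k "hminus H h k"] assms minus_in by simp
qed

lemma inner_diff_le:
  assumes "h \<in> hcarrier H" "k \<in> hcarrier H" "h' \<in> hcarrier H" "k' \<in> hcarrier H"
  shows "norm (hinner H h k - hinner H h' k')
      \<le> hnorm H h * hnorm H (hminus H k k') + hnorm H (hminus H h h') * hnorm H k'"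
proof -
  have "hinner H h k - hinner H h' k' = hinner H h (hminus H k k') + hinner H (hminus H h h') k'"
    using assms by (simp add: inner_simps)
  then show ?thesis
    using assms by (auto intro!: norm_triangle_le add_mono Cauchy_Schwarz minus_in)
qed

section \<open>Separation-completion\<close>

lemma cauchy_seqsD: "u \<in> cauchy_seqs H \<Longrightarrow> u i \<in> hcarrier H"
  by (simp add: cauchy_seqs_def)

lemma cauchy_seqsI:
  assumes "\<And>i. u i \<in> hcarrier H"
    and "\<And>e. e > 0 \<Longrightarrow> \<exists>K. \<forall>i\<ge>K. \<forall>j\<ge>K. hnorm H (hminus H (u i) (u j)) < e"
  shows "u \<in> cauchy_seqs H"
  using assms by (simp add: cauchy_seqs_def)

lemma const_cauchy: "h \<in> hcarrier H \<Longrightarrow> (\<lambda>_. h) \<in> cauchy_seqs H"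
  by (rule cauchy_seqsI) (auto simp: hnorm_minus_self)

lemma cauchy_class_eq_iff:
  assumes u: "u \<in> cauchy_seqs H" and v: "v \<in> cauchy_seqs H"
  shows "cauchy_class H u = cauchy_class H v \<longleftrightarrow> (\<lambda>i. hnorm H (hminus H (u i) (v i))) \<longlonglongrightarrow> 0"
proof
  assume "cauchy_class H u = cauchy_class H v"
  moreover have "v \<in> cauchy_class H v"
    using v by (simp add: cauchy_class_def hnorm_minus_self[OF cauchy_seqsD[OF v]])
  ultimately show "(\<lambda>i. hnorm H (hminus H (u i) (v i))) \<longlonglongrightarrow> 0"
    by (auto simp: cauchy_class_def)
next
  have tr: "(\<lambda>i. hnorm H (hminus H (a i) (c i))) \<longlonglongrightarrow> 0"
    if "a \<in> cauchy_seqs H" "b \<in> cauchy_seqs H" "c \<in> cauchy_seqs H"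
      "(\<lambda>i. hnorm H (hminus H (a i) (b i))) \<longlonglongrightarrow> 0" "(\<lambda>i. hnorm H (hminus H (b i) (c i))) \<longlonglongrightarrow> 0" for a b c
  proof (rule tendsto_sandwich[OF _ _ tendsto_const])
    show "(\<lambda>i. hnorm H (hminus H (a i) (b i)) + hnorm H (hminus H (b i) (c i))) \<longlonglongrightarrow> 0"
      using tendsto_add[OF that(4,5)] by simp
  qed (simp_all add: hnorm_nonneg hnorm_minus_triangle that(1-3)[THEN cauchy_seqsD])
  assume uv: "(\<lambda>i. hnorm H (hminus H (u i) (v i))) \<longlonglongrightarrow> 0"
  moreover have "(\<lambda>i. hnorm H (hminus H (v i) (u i))) \<longlonglongrightarrow> 0"
    using uv by (simp add: hnorm_minus_commute u[THEN cauchy_seqsD] v[THEN cauchy_seqsD])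
  ultimately show "cauchy_class H u = cauchy_class H v"
    unfolding cauchy_class_def using tr u v by blast
qed

lemma some_rep:
  assumes u: "u \<in> cauchy_seqs H"
  shows "some_rep (cauchy_class H u) \<in> cauchy_seqs H"
    "(\<lambda>i. hnorm H (hminus H (u i) (some_rep (cauchy_class H u) i))) \<longlonglongrightarrow> 0"
proof -
  have "u \<in> cauchy_class H u"
    using u by (simp add: cauchy_class_def hnorm_minus_self[OF cauchy_seqsD[OF u]])
  then have "some_rep (cauchy_class H u) \<in> cauchy_class H u"
    unfolding some_rep_def by (rule someI[of "\<lambda>v. v \<in> cauchy_class H u"])
  then show "some_rep (cauchy_class H u) \<in> cauchy_seqs H"
    "(\<lambda>i. hnorm H (hminus H (u i) (some_rep (cauchy_class H u) i))) \<longlonglongrightarrow> 0"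
    by (auto simp: cauchy_class_def)
qed

lemma hnorm_bounded:
  assumes "u \<in> cauchy_seqs H"
  obtains B where "B > 0" "\<And>i. hnorm H (u i) \<le> B"
proof -
  from assms obtain K where K: "\<forall>i\<ge>K. \<forall>j\<ge>K. hnorm H (hminus H (u i) (u j)) < 1"
    unfolding cauchy_seqs_def by (auto dest: spec[of _ 1])
  define B where "B = (\<Sum>i\<le>K. hnorm H (u i)) + 1"
  have le: "hnorm H (u i) \<le> (\<Sum>i\<le>K. hnorm H (u i))" if "i \<le> K" for i
    using that by (intro member_le_sum) (auto simp: hnorm_nonneg)
  show thesis
  proof (rule that[of B])
    show "B > 0" unfolding B_def by (intro add_nonneg_pos sum_nonneg) (auto simp: hnorm_nonneg)
    show "hnorm H (u i) \<le> B" for i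
    proof (cases "i \<le> K")
      case False
      then have "hnorm H (hminus H (u i) (u K)) < 1" using K by simp
      then show ?thesis
        using hnorm_le_add_minus[of "u i" "u K"] le[of K] by (simp add: B_def cauchy_seqsD[OF assms])
    qed (use le[of i] in \<open>simp add: B_def\<close>)
  qed
qed

lemma inner_convergent:
  assumes u: "u \<in> cauchy_seqs H" and v: "v \<in> cauchy_seqs H"
  shows "convergent (\<lambda>i. hinner H (u i) (v i))"
proof (rule Cauchy_convergent, rule CauchyI)
  fix e :: real assume "e > 0"
  obtain B where B: "B > 0" "\<And>i. hnorm H (u i) \<le> B" by (rule hnorm_bounded[OF u]) blast
  obtain C where C: "C > 0" "\<And>i. hnorm H (v i) \<le> C" by (rule hnorm_bounded[OF v]) blast
  define d where "d = e / (B + C)"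
  have d: "d > 0" using \<open>e > 0\<close> B C by (simp add: d_def)
  from u d obtain K where K: "\<forall>i\<ge>K. \<forall>j\<ge>K. hnorm H (hminus H (u i) (u j)) < d" by (auto simp: cauchy_seqs_def)
  from v d obtain L where L: "\<forall>i\<ge>L. \<forall>j\<ge>L. hnorm H (hminus H (v i) (v j)) < d" by (auto simp: cauchy_seqs_def)
  show "\<exists>M. \<forall>m\<ge>M. \<forall>n\<ge>M. norm (hinner H (u m) (v m) - hinner H (u n) (v n)) < e"
  proof (intro exI[of _ "max K L"] allI impI)
    fix i j assume ij: "max K L \<le> i" "max K L \<le> j"
    have "norm (hinner H (u i) (v i) - hinner H (u j) (v j))
        \<le> hnorm H (u i) * hnorm H (hminus H (v i) (v j)) + hnorm H (hminus H (u i) (u j)) * hnorm H (v j)"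
      by (rule inner_diff_le) (simp_all add: u[THEN cauchy_seqsD] v[THEN cauchy_seqsD])
    also have "\<dots> \<le> B * hnorm H (hminus H (v i) (v j)) + hnorm H (hminus H (u i) (u j)) * C"
      by (intro add_mono mult_right_mono mult_left_mono B C hnorm_nonneg)
    also have "\<dots> < B * d + d * C"
      by (intro add_strict_mono mult_strict_left_mono mult_strict_right_mono B C) (use K L ij in auto)
    also have "\<dots> = (B + C) * d" by (simp only: distrib_right mult.commute[of d C])
    also have "\<dots> = e" using B C by (simp add: d_def)
    finally show "norm (hinner H (u i) (v i) - hinner H (u j) (v j)) < e" .
  qed
qed

lemma inner_null_diff:
  assumes u: "u \<in> cauchy_seqs H" and v: "v \<in> cauchy_seqs H"
    and u': "u' \<in> cauchy_seqs H" and v': "v' \<in> cauchy_seqs H"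
    and uu: "(\<lambda>i. hnorm H (hminus H (u i) (u' i))) \<longlonglongrightarrow> 0"
    and vv: "(\<lambda>i. hnorm H (hminus H (v i) (v' i))) \<longlonglongrightarrow> 0"
  shows "(\<lambda>i. hinner H (u i) (v i) - hinner H (u' i) (v' i)) \<longlonglongrightarrow> 0"
proof -
  obtain B where B: "B > 0" "\<And>i. hnorm H (u i) \<le> B" by (rule hnorm_bounded[OF u]) blast
  obtain C where C: "C > 0" "\<And>i. hnorm H (v' i) \<le> C" by (rule hnorm_bounded[OF v']) blast
  show ?thesis
  proof (rule Lim_null_comparison)
    show "(\<lambda>i. B * hnorm H (hminus H (v i) (v' i)) + hnorm H (hminus H (u i) (u' i)) * C) \<longlonglongrightarrow> 0"
      using tendsto_add[OF tendsto_mult_left[OF vv, of B] tendsto_mult_right[OF uu, of C]] by simp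
    show "\<forall>\<^sub>F i in sequentially. norm (hinner H (u i) (v i) - hinner H (u' i) (v' i))
        \<le> B * hnorm H (hminus H (v i) (v' i)) + hnorm H (hminus H (u i) (u' i)) * C"
    proof (intro always_eventually allI)
      fix i
      have "norm (hinner H (u i) (v i) - hinner H (u' i) (v' i))
          \<le> hnorm H (u i) * hnorm H (hminus H (v i) (v' i)) + hnorm H (hminus H (u i) (u' i)) * hnorm H (v' i)"
        by (rule inner_diff_le) (simp_all add: u[THEN cauchy_seqsD] v[THEN cauchy_seqsD] u'[THEN cauchy_seqsD] v'[THEN cauchy_seqsD])
      also have "\<dots> \<le> B * hnorm H (hminus H (v i) (v' i)) + hnorm H (hminus H (u i) (u' i)) * C"
        by (intro add_mono mult_right_mono mult_left_mono B C hnorm_nonneg)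
      finally show "norm (hinner H (u i) (v i) - hinner H (u' i) (v' i)) \<le> \<dots>" .
    qed
  qed
qed

text \<open>\<open>hinner\<close> of the completion is a limit along the representatives chosen by
  \<open>some_rep\<close>; any other representatives give the same limit.\<close>

lemma sep_inner:
  assumes u: "u \<in> cauchy_seqs H" and v: "v \<in> cauchy_seqs H"
  shows "(\<lambda>i. hinner H (u i) (v i)) \<longlonglongrightarrow> hinner (sep_completion H) (cauchy_class H u) (cauchy_class H v)"
proof -
  let ?u = "some_rep (cauchy_class H u)" and ?v = "some_rep (cauchy_class H v)"
  have "(\<lambda>i. hinner H (?u i) (?v i)) \<longlonglongrightarrow> lim (\<lambda>i. hinner H (?u i) (?v i))"
    using inner_convergent[OF some_rep(1)[OF u] some_rep(1)[OF v]] by (simp add: convergent_LIMSEQ_iff)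
  moreover have "(\<lambda>i. hinner H (u i) (v i) - hinner H (?u i) (?v i)) \<longlonglongrightarrow> 0"
    by (rule inner_null_diff[OF u v some_rep(1)[OF u] some_rep(1)[OF v] some_rep(2)[OF u] some_rep(2)[OF v]])
  ultimately show ?thesis
    unfolding sep_completion_def by (auto dest: tendsto_add)
qed

lemma add_cauchy:
  assumes u: "u \<in> cauchy_seqs H" and v: "v \<in> cauchy_seqs H"
  shows "(\<lambda>i. hadd H (u i) (v i)) \<in> cauchy_seqs H"
proof (rule cauchy_seqsI)
  fix e :: real assume "e > 0"
  then have "e / 2 > 0" by simp
  with u obtain K where K: "\<forall>i\<ge>K. \<forall>j\<ge>K. hnorm H (hminus H (u i) (u j)) < e / 2" unfolding cauchy_seqs_def by blast
  from v \<open>e / 2 > 0\<close> obtain L where L: "\<forall>i\<ge>L. \<forall>j\<ge>L. hnorm H (hminus H (v i) (v j)) < e / 2" unfolding cauchy_seqs_def by blast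
  show "\<exists>K. \<forall>i\<ge>K. \<forall>j\<ge>K. hnorm H (hminus H (hadd H (u i) (v i)) (hadd H (u j) (v j))) < e"
  proof (intro exI[of _ "max K L"] allI impI)
    fix i j assume ij: "max K L \<le> i" "max K L \<le> j"
    have "hnorm H (hminus H (hadd H (u i) (v i)) (hadd H (u j) (v j)))
        \<le> hnorm H (hminus H (u i) (u j)) + hnorm H (hminus H (v i) (v j))"
      by (rule hnorm_minus_add) (simp_all add: u[THEN cauchy_seqsD] v[THEN cauchy_seqsD])
    also have "\<dots> < e / 2 + e / 2" by (intro add_strict_mono) (use K L ij in auto)
    finally show "hnorm H (hminus H (hadd H (u i) (v i)) (hadd H (u j) (v j))) < e" by simp
  qed
qed (simp add: add_in u[THEN cauchy_seqsD] v[THEN cauchy_seqsD])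

lemma sep_add:
  assumes u: "u \<in> cauchy_seqs H" and v: "v \<in> cauchy_seqs H"
  shows "hadd (sep_completion H) (cauchy_class H u) (cauchy_class H v) = cauchy_class H (\<lambda>i. hadd H (u i) (v i))"
proof -
  let ?u = "some_rep (cauchy_class H u)" and ?v = "some_rep (cauchy_class H v)"
  note su = some_rep[OF u] and sv = some_rep[OF v]
  have "(\<lambda>i. hnorm H (hminus H (hadd H (u i) (v i)) (hadd H (?u i) (?v i)))) \<longlonglongrightarrow> 0"
  proof (rule tendsto_sandwich[OF _ _ tendsto_const])
    show "(\<lambda>i. hnorm H (hminus H (u i) (?u i)) + hnorm H (hminus H (v i) (?v i))) \<longlonglongrightarrow> 0"
      using tendsto_add[OF su(2) sv(2)] by simp
    show "\<forall>\<^sub>F i in sequentially. hnorm H (hminus H (hadd H (u i) (v i)) (hadd H (?u i) (?v i)))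
        \<le> hnorm H (hminus H (u i) (?u i)) + hnorm H (hminus H (v i) (?v i))"
      by (intro always_eventually allI hnorm_minus_add) (simp_all add: u[THEN cauchy_seqsD] v[THEN cauchy_seqsD] su(1)[THEN cauchy_seqsD] sv(1)[THEN cauchy_seqsD])
  qed (auto simp: hnorm_nonneg)
  then show ?thesis
    using cauchy_class_eq_iff[OF add_cauchy[OF u v] add_cauchy[OF su(1) sv(1)]]
    by (simp add: sep_completion_def)
qed

lemma sep_carrierE:
  assumes "U \<in> hcarrier (sep_completion H)"
  obtains u where "u \<in> cauchy_seqs H" "U = cauchy_class H u"
  using assms by (auto simp: sep_completion_def)

lemma sep_carrierI: "u \<in> cauchy_seqs H \<Longrightarrow> cauchy_class H u \<in> hcarrier (sep_completion H)"
  by (simp add: sep_completion_def)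

lemma embed_in: "h \<in> hcarrier H \<Longrightarrow> embed_compl H h \<in> hcarrier (sep_completion H)"
  unfolding embed_compl_def by (rule sep_carrierI[OF const_cauchy])

lemma sep_inner_embed:
  assumes "h \<in> hcarrier H" "k \<in> hcarrier H"
  shows "hinner (sep_completion H) (embed_compl H h) (embed_compl H k) = hinner H h k"
  using sep_inner[OF const_cauchy[OF assms(1)] const_cauchy[OF assms(2)]]
  unfolding embed_compl_def by (simp add: LIMSEQ_const_iff)

end

section \<open>Extension of maps to completions\<close>

definition lift_op :: "('b::cstar_algebra, 'k) corr \<Rightarrow> ('h \<Rightarrow> 'k) \<Rightarrow> (nat \<Rightarrow> 'h) set \<Rightarrow> (nat \<Rightarrow> 'k) set" where
  "lift_op H' f U = cauchy_class H' (\<lambda>i. f (some_rep U i))"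

text \<open>The bound is imposed on differences and not on \<open>f h\<close> alone, because
  additivity is not part of the interface: it is derived from an adjoint, and then only up to
  vectors of length zero.\<close>

locale lipschitz_map = H: semi_corr H + H': semi_corr H'
  for H :: "('b::cstar_algebra, 'h) corr" and H' :: "('b, 'k) corr" +
  fixes f :: "'h \<Rightarrow> 'k" and C :: real
  assumes map_in: "h \<in> hcarrier H \<Longrightarrow> f h \<in> hcarrier H'"
    and lipschitz: "\<lbrakk>h \<in> hcarrier H; k \<in> hcarrier H\<rbrakk> \<Longrightarrow>
      hnorm H' (hminus H' (f h) (f k)) \<le> C * hnorm H (hminus H h k)"
    and C_nonneg: "C \<ge> 0"
begin

lemma map_cauchy:
  assumes u: "u \<in> cauchy_seqs H"
  shows "(\<lambda>i. f (u i)) \<in> cauchy_seqs H'"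
proof (rule H'.cauchy_seqsI)
  fix e :: real assume "e > 0"
  then have "e / (C + 1) > 0" using C_nonneg by simp
  with u obtain K where K: "\<forall>i\<ge>K. \<forall>j\<ge>K. hnorm H (hminus H (u i) (u j)) < e / (C + 1)" unfolding cauchy_seqs_def by blast
  show "\<exists>K. \<forall>i\<ge>K. \<forall>j\<ge>K. hnorm H' (hminus H' (f (u i)) (f (u j))) < e"
  proof (intro exI[of _ K] allI impI)
    fix i j assume ij: "K \<le> i" "K \<le> j"
    have "hnorm H' (hminus H' (f (u i)) (f (u j))) \<le> C * hnorm H (hminus H (u i) (u j))"
      by (rule lipschitz) (simp_all add: u[THEN H.cauchy_seqsD])
    also have "\<dots> \<le> (C + 1) * hnorm H (hminus H (u i) (u j))"
      by (intro mult_right_mono) (auto simp: H.hnorm_nonneg)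
    also have "\<dots> < e" using K ij C_nonneg by (simp add: pos_less_divide_eq mult.commute)
    finally show "hnorm H' (hminus H' (f (u i)) (f (u j))) < e" .
  qed
qed (simp add: map_in u[THEN H.cauchy_seqsD])

lemma lift_class:
  assumes u: "u \<in> cauchy_seqs H"
  shows "lift_op H' f (cauchy_class H u) = cauchy_class H' (\<lambda>i. f (u i))"
proof -
  let ?u = "some_rep (cauchy_class H u)"
  note su = H.some_rep[OF u]
  have "(\<lambda>i. hnorm H' (hminus H' (f (u i)) (f (?u i)))) \<longlonglongrightarrow> 0"
  proof (rule tendsto_sandwich[OF _ _ tendsto_const])
    show "(\<lambda>i. C * hnorm H (hminus H (u i) (?u i))) \<longlonglongrightarrow> 0"
      using tendsto_mult_left[OF su(2), of C] by simp
    show "\<forall>\<^sub>F i in sequentially. hnorm H' (hminus H' (f (u i)) (f (?u i))) \<le> C * hnorm H (hminus H (u i) (?u i))"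
      by (intro always_eventually allI lipschitz) (simp_all add: u[THEN H.cauchy_seqsD] su(1)[THEN H.cauchy_seqsD])
  qed (auto simp: H'.hnorm_nonneg)
  then show ?thesis
    using H'.cauchy_class_eq_iff[OF map_cauchy[OF u] map_cauchy[OF su(1)]] by (simp add: lift_op_def)
qed

lemma lift_in: "U \<in> hcarrier (sep_completion H) \<Longrightarrow> lift_op H' f U \<in> hcarrier (sep_completion H')"
  by (erule H.sep_carrierE) (simp add: lift_class H'.sep_carrierI map_cauchy)

lemma lift_embed: "h \<in> hcarrier H \<Longrightarrow> lift_op H' f (embed_compl H h) = embed_compl H' (f h)"
  unfolding embed_compl_def by (rule lift_class[OF H.const_cauchy])

end

lemma (in semi_corr) lipschitz_ract: "lipschitz_map H H (\<lambda>h. ract H h a) (norm a)"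
proof
  fix h k assume hk: "h \<in> hcarrier H" "k \<in> hcarrier H"
  have "weq (hminus H (ract H h a) (ract H k a)) (ract H (hminus H h k) a)"
    unfolding weq_def using hk by (simp add: inner_simps minus_in closed left_diff_distrib)
  from hnorm_weq[OF this]
  show "hnorm H (hminus H (ract H h a) (ract H k a)) \<le> norm a * hnorm H (hminus H h k)"
    using hnorm_ract[OF minus_in[OF hk]] by simp
qed (auto simp: ract_in)

text \<open>The bound is an operator inequality, with \<open>C\<close> bounding the square of the
  norm, since in this form it survives tensoring with further legs and summation over the vertices
  of a tree. Linearity, up to vectors of length zero, follows from the adjoint.\<close>

definition adj_pair :: "('b::cstar_algebra, 'h) corr \<Rightarrow> ('b, 'k) corr \<Rightarrow> ('h \<Rightarrow> 'k) \<Rightarrow> ('k \<Rightarrow> 'h) \<Rightarrow> real \<Rightarrow> bool" where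
  "adj_pair H H' f g C \<longleftrightarrow> C \<ge> 0 \<and> f \<in> hcarrier H \<rightarrow> hcarrier H' \<and> g \<in> hcarrier H' \<rightarrow> hcarrier H \<and>
     (\<forall>h\<in>hcarrier H. \<forall>k\<in>hcarrier H'. hinner H' (f h) k = hinner H h (g k)) \<and>
     (\<forall>h\<in>hcarrier H. hinner H' (f h) (f h) \<preceq> C *\<^sub>R hinner H h h)"

text \<open>With \<open>a = \<langle>gk, gk\<rangle> = \<langle>k, fgk\<rangle>\<close> the Young inequality gives
  \<open>2a \<le> C\<langle>k, k\<rangle> + C\<^sup>-\<^sup>1\<langle>fgk, fgk\<rangle> \<le> C\<langle>k, k\<rangle> + a\<close>.\<close>

lemma adj_bound:
  assumes "semi_corr H" "semi_corr H'" and C: "C > 0"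
    and f: "f \<in> hcarrier H \<rightarrow> hcarrier H'" and g: "g k \<in> hcarrier H" and k: "k \<in> hcarrier H'"
    and adj: "\<And>h. h \<in> hcarrier H \<Longrightarrow> hinner H' (f h) k = hinner H h (g k)"
    and le: "hinner H' (f (g k)) (f (g k)) \<preceq> C *\<^sub>R hinner H (g k) (g k)"
  shows "hinner H (g k) (g k) \<preceq> C *\<^sub>R hinner H' k k"
proof -
  interpret H: semi_corr H by fact
  interpret H': semi_corr H' by fact
  let ?a = "hinner H (g k) (g k)"
  let ?x = "f (g k)"
  have x: "?x \<in> hcarrier H'" using f g by auto
  have xk: "hinner H' ?x k = ?a" using adj[OF g] .
  then have kx: "hinner H' k ?x = ?a" using H'.inner_sym[OF x k] H.inner_sym[OF g g] by simp
  let ?d = "hminus H' (ract H' k (of_real C)) ?x"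
  have "hinner H' ?d ?d = C *\<^sub>R (C *\<^sub>R hinner H' k k) + hinner H' ?x ?x - (C *\<^sub>R ?a + C *\<^sub>R ?a)"
    using k x by (simp add: H'.inner_simps H'.closed H'.minus_in xk kx star_scaleR star_one of_real_def
        scaleR_diff_right)
  moreover have "cpos (hinner H' ?d ?d)" using H'.inner_pos H'.minus_in H'.closed k x by auto
  ultimately have "C *\<^sub>R ?a + C *\<^sub>R ?a \<preceq> C *\<^sub>R (C *\<^sub>R hinner H' k k) + hinner H' ?x ?x"
    by (simp only: cle_def)
  also have "\<dots> \<preceq> C *\<^sub>R (C *\<^sub>R hinner H' k k) + C *\<^sub>R ?a" by (intro cle_add cle_refl le)
  finally have "C *\<^sub>R ?a \<preceq> C *\<^sub>R (C *\<^sub>R hinner H' k k)" by (simp add: cle_def)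
  from cle_scaleR[OF this, of "1/C"] C show ?thesis by simp
qed

lemma adj_pair_mono:
  assumes "semi_corr H" "adj_pair H H' f g C" "C \<le> D"
  shows "adj_pair H H' f g D"
proof -
  interpret H: semi_corr H by fact
  have "hinner H' (f h) (f h) \<preceq> D *\<^sub>R hinner H h h" if h: "h \<in> hcarrier H" for h
  proof -
    have "hinner H' (f h) (f h) \<preceq> C *\<^sub>R hinner H h h" using assms(2) h by (auto simp: adj_pair_def)
    also have "\<dots> \<preceq> D *\<^sub>R hinner H h h"
      using cpos_scaleR[OF H.inner_pos[OF h], of "D - C"] assms(3) by (simp add: cle_def scaleR_diff_left)
    finally show ?thesis .
  qed
  then show ?thesis using assms(2,3) by (auto simp: adj_pair_def)
qed

lemma cle_scaleR_limit:
  assumes "\<And>D. D > C \<Longrightarrow> a \<preceq> D *\<^sub>R b" shows "a \<preceq> C *\<^sub>R (b :: 'b::cstar_algebra)"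
proof (rule cle_limit)
  show "a \<preceq> (C + inverse (real (Suc n))) *\<^sub>R b" for n by (rule assms) simp
  show "(\<lambda>n. (C + inverse (real (Suc n))) *\<^sub>R b) \<longlonglongrightarrow> C *\<^sub>R b"
    using LIMSEQ_inverse_real_of_nat_add[of C] by (intro tendsto_scaleR tendsto_const)
qed simp

lemma adj_pair_sym:
  assumes H: "semi_corr H" "semi_corr H'" and p: "adj_pair H H' f g C"
  shows "adj_pair H' H g f C"
proof -
  interpret H: semi_corr H by fact
  interpret H': semi_corr H' by fact
  have f: "f \<in> hcarrier H \<rightarrow> hcarrier H'" and g: "g \<in> hcarrier H' \<rightarrow> hcarrier H"
    and adj: "\<And>h k. \<lbrakk>h \<in> hcarrier H; k \<in> hcarrier H'\<rbrakk> \<Longrightarrow> hinner H' (f h) k = hinner H h (g k)"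
    using p by (auto simp: adj_pair_def)
  have "hinner H (g k) h = hinner H' k (f h)" if "k \<in> hcarrier H'" "h \<in> hcarrier H" for h k
    using that f g adj[of h k] H.inner_sym[of h "g k"] H'.inner_sym[of "f h" k] by (auto simp: Pi_iff)
  moreover have "hinner H (g k) (g k) \<preceq> C *\<^sub>R hinner H' k k" if k: "k \<in> hcarrier H'" for k
  \<comment> \<open>\<open>adj_bound\<close> divides by the constant, so \<open>C\<close> is
    approached from above; this covers C = 0.\<close>
  proof (rule cle_scaleR_limit)
    fix D assume D: "D > C"
    then have "adj_pair H H' f g D" using adj_pair_mono[OF H(1) p] by simp
    moreover have "D > 0" using p D by (auto simp: adj_pair_def)
    ultimately show "hinner H (g k) (g k) \<preceq> D *\<^sub>R hinner H' k k"
      using k f g by (intro adj_bound[OF H, where f = f]) (auto simp: adj_pair_def Pi_iff)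
  qed
  ultimately show ?thesis using p f g by (auto simp: adj_pair_def)
qed

lemma adj_pair_norm:
  assumes "semi_corr H" "semi_corr H'" "adj_pair H H' f g C" "h \<in> hcarrier H"
  shows "hnorm H' (f h) \<le> sqrt C * hnorm H h"
proof -
  interpret H: semi_corr H by fact
  interpret H': semi_corr H' by fact
  have "f h \<in> hcarrier H'" "hinner H' (f h) (f h) \<preceq> C *\<^sub>R hinner H h h" "C \<ge> 0"
    using assms(3,4) by (auto simp: adj_pair_def)
  from cle_norm_mono[OF H'.inner_pos[OF this(1)] this(2)] this(3)
  show ?thesis unfolding hnorm_def real_sqrt_mult[symmetric] by simp
qed

text \<open>The adjoint makes \<open>f\<close> preserve differences under the inner product, and the
  operator bound then becomes a Lipschitz bound.\<close>

lemma adj_pair_lipschitz: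
  assumes H: "semi_corr H" "semi_corr H'" and p: "adj_pair H H' f g C"
  shows "lipschitz_map H H' f (sqrt C)"
proof -
  interpret H: semi_corr H by fact
  interpret H': semi_corr H' by fact
  have f: "f h \<in> hcarrier H'" if "h \<in> hcarrier H" for h using p that by (auto simp: adj_pair_def)
  have g: "g h \<in> hcarrier H" if "h \<in> hcarrier H'" for h using p that by (auto simp: adj_pair_def)
  have adj: "hinner H' k (f h) = hinner H (g k) h" if "h \<in> hcarrier H" "k \<in> hcarrier H'" for h k
    using adj_pair_sym[OF H p] that by (auto simp: adj_pair_def)
  show ?thesis
  proof
    fix h k assume hk: "h \<in> hcarrier H" "k \<in> hcarrier H"
    have "H'.weq (hminus H' (f h) (f k)) (f (hminus H h k))"
      unfolding H'.weq_def using hk f g by (simp add: H'.minus_in H.minus_in H'.inner_simps H.inner_simps adj)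
    from H'.hnorm_weq[OF this]
    show "hnorm H' (hminus H' (f h) (f k)) \<le> sqrt C * hnorm H (hminus H h k)"
      using adj_pair_norm[OF H p H.minus_in[OF hk]] by simp
  qed (use p f in \<open>auto simp: adj_pair_def\<close>)
qed

lemma (in semi_corr) adj_pair_lact: "adj_pair H H (lact H a) (lact H (star a)) ((norm a)\<^sup>2)"
  using lact_le by (auto simp: adj_pair_def closed inner_lact_left)

lemma (in semi_corr) hnorm_lact: "h \<in> hcarrier H \<Longrightarrow> hnorm H (lact H a h) \<le> norm a * hnorm H h"
  using adj_pair_norm[OF semi_corr_axioms semi_corr_axioms adj_pair_lact] by simp

lemma (in semi_corr) hnorm_lact_of_real:
  "h \<in> hcarrier H \<Longrightarrow> r \<ge> 0 \<Longrightarrow> hnorm H (lact H (of_real r) h) \<le> r * hnorm H h"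
  using hnorm_lact[of h "of_real r"] by simp

text \<open>Vectors are determined by their inner products. Equations in completions and direct sums
  are proved by testing, with \<open>ext\<close> or its mirror image
  \<open>ext_left\<close>.\<close>

locale nondegenerate_corr = semi_corr H for H :: "('b::cstar_algebra, 'h) corr" +
  assumes ext: "\<lbrakk>h \<in> hcarrier H; k \<in> hcarrier H; \<And>l. l \<in> hcarrier H \<Longrightarrow> hinner H l h = hinner H l k\<rbrakk> \<Longrightarrow> h = k"

context semi_corr
begin

lemma sep_ract:
  assumes "u \<in> cauchy_seqs H"
  shows "ract (sep_completion H) (cauchy_class H u) a = cauchy_class H (\<lambda>i. ract H (u i) a)"
    "(\<lambda>i. ract H (u i) a) \<in> cauchy_seqs H"
proof -
  interpret m: lipschitz_map H H "\<lambda>h. ract H h a" "norm a" by (rule lipschitz_ract)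
  show "ract (sep_completion H) (cauchy_class H u) a = cauchy_class H (\<lambda>i. ract H (u i) a)"
    using m.lift_class[OF assms] by (simp add: lift_op_def sep_completion_def)
  show "(\<lambda>i. ract H (u i) a) \<in> cauchy_seqs H" by (rule m.map_cauchy[OF assms])
qed

lemma sep_lact:
  assumes "u \<in> cauchy_seqs H"
  shows "lact (sep_completion H) a (cauchy_class H u) = cauchy_class H (\<lambda>i. lact H a (u i))"
    "(\<lambda>i. lact H a (u i)) \<in> cauchy_seqs H"
proof -
  interpret m: lipschitz_map H H "lact H a" "sqrt ((norm a)\<^sup>2)"
    by (rule adj_pair_lipschitz[OF _ _ adj_pair_lact]) (rule semi_corr_axioms)+
  show "lact (sep_completion H) a (cauchy_class H u) = cauchy_class H (\<lambda>i. lact H a (u i))"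
    using m.lift_class[OF assms] by (simp add: lift_op_def sep_completion_def)
  show "(\<lambda>i. lact H a (u i)) \<in> cauchy_seqs H" by (rule m.map_cauchy[OF assms])
qed

lemma sep_zero: "hzero (sep_completion H) = cauchy_class H (\<lambda>_. hzero H)"
  by (simp add: sep_completion_def embed_compl_def)

lemma sep_inner_eqI:
  assumes "u \<in> cauchy_seqs H" "v \<in> cauchy_seqs H" "(\<lambda>i. hinner H (u i) (v i)) \<longlonglongrightarrow> x"
  shows "hinner (sep_completion H) (cauchy_class H u) (cauchy_class H v) = x"
  using sep_inner[OF assms(1,2)] assms(3) by (rule LIMSEQ_unique)

lemma semi_corr_sep: "semi_corr (sep_completion H)"
proof
  fix h k l :: "(nat \<Rightarrow> 'h) set" and a b :: 'b and c :: complex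
  let ?S = "sep_completion H"
  assume "h \<in> hcarrier ?S" then obtain u where u: "u \<in> cauchy_seqs H" "h = cauchy_class H u" by (rule sep_carrierE)
  note lim = sep_inner[OF u(1)]
  show "lact ?S a h \<in> hcarrier ?S" "ract ?S h a \<in> hcarrier ?S"
    using u by (auto simp: sep_lact sep_ract sep_carrierI)
  show "hinner ?S h (hzero ?S) = 0"
    unfolding u(2) sep_zero
    by (rule sep_inner_eqI) (simp_all add: u(1) const_cauchy zero_in inner_zero[OF cauchy_seqsD[OF u(1)]])
  show "cpos (hinner ?S h h)"
    unfolding u(2) by (rule cpos_limit[OF inner_pos[OF cauchy_seqsD[OF u(1)]] lim[OF u(1)]])
  assume "k \<in> hcarrier ?S" then obtain v where v: "v \<in> cauchy_seqs H" "k = cauchy_class H v" by (rule sep_carrierE)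
  note uv = cauchy_seqsD[OF u(1)] cauchy_seqsD[OF v(1)]
  show "hadd ?S h k \<in> hcarrier ?S"
    using u v by (auto simp: sep_add sep_carrierI add_cauchy)
  show "star (hinner ?S h k) = hinner ?S k h"
    unfolding u(2) v(2) using tendsto_star[OF lim[OF v(1)]]
    by (intro sep_inner_eqI[symmetric] u v) (simp add: inner_sym uv)
  show "hinner ?S h (ract ?S k a) = hinner ?S h k * a"
    unfolding u(2) v(2) sep_ract(1)[OF v(1)] using tendsto_mult[OF lim[OF v(1)] tendsto_const[of a]]
    by (intro sep_inner_eqI u sep_ract(2)[OF v(1)]) (simp add: inner_ract uv)
  show "hinner ?S h (lact ?S a k) = hinner ?S (lact ?S (star a) h) k"
    unfolding u(2) v(2) sep_lact(1)[OF v(1)] sep_lact(1)[OF u(1)]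
    using sep_inner[OF sep_lact(2)[OF u(1)] v(1)]
    by (intro sep_inner_eqI u sep_lact(2)[OF v(1)]) (simp add: inner_lact uv)
  note slact = sep_inner[OF u(1) sep_lact(2)[OF v(1)]]
  show "hinner ?S h (lact ?S (a * b) k) = hinner ?S h (lact ?S a (lact ?S b k))"
    unfolding u(2) v(2) sep_lact(1)[OF v(1)] sep_lact(1)[OF sep_lact(2)[OF v(1)]]
    using sep_inner[OF u(1) sep_lact(2)[OF sep_lact(2)[OF v(1)]]]
    by (intro sep_inner_eqI u sep_lact(2)[OF v(1)]) (simp add: lact_mult uv)
  show "hinner ?S h (lact ?S (a + b) k) = hinner ?S h (lact ?S a k) + hinner ?S h (lact ?S b k)"
    unfolding u(2) v(2) sep_lact(1)[OF v(1)]
    using tendsto_add[OF slact[of a] slact[of b]]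
    by (intro sep_inner_eqI u sep_lact(2)[OF v(1)]) (simp add: lact_add uv)
  show "hinner ?S h (lact ?S (scaleC c 1) k) = hinner ?S h k * scaleC c 1"
    unfolding u(2) v(2) sep_lact(1)[OF v(1)]
    using tendsto_mult[OF lim[OF v(1)] tendsto_const[of "scaleC c 1"]]
    by (intro sep_inner_eqI u sep_lact(2)[OF v(1)]) (simp add: lact_scalar uv)
  assume "l \<in> hcarrier ?S" then obtain w where w: "w \<in> cauchy_seqs H" "l = cauchy_class H w" by (rule sep_carrierE)
  show "hinner ?S h (hadd ?S k l) = hinner ?S h k + hinner ?S h l"
    unfolding u(2) v(2) w(2) sep_add[OF v(1) w(1)]
    using tendsto_add[OF lim[OF v(1)] lim[OF w(1)]]
    by (intro sep_inner_eqI u add_cauchy[OF v(1) w(1)]) (simp add: inner_add uv cauchy_seqsD[OF w(1)])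
next
  show "hzero (sep_completion H) \<in> hcarrier (sep_completion H)"
    by (simp add: sep_zero sep_carrierI const_cauchy zero_in)
qed

lemma sep_minus:
  assumes "u \<in> cauchy_seqs H" "v \<in> cauchy_seqs H"
  shows "hminus (sep_completion H) (cauchy_class H u) (cauchy_class H v) = cauchy_class H (\<lambda>i. hminus H (u i) (v i))"
    "(\<lambda>i. hminus H (u i) (v i)) \<in> cauchy_seqs H"
  unfolding hminus_def using assms by (simp_all add: sep_ract sep_add add_cauchy)

lemma nondegenerate_sep: "nondegenerate_corr (sep_completion H)"
proof (intro nondegenerate_corr.intro nondegenerate_corr_axioms.intro semi_corr_sep)
  fix h k
  assume hk: "h \<in> hcarrier (sep_completion H)" "k \<in> hcarrier (sep_completion H)"
    and eq: "\<And>l. l \<in> hcarrier (sep_completion H) \<Longrightarrow> hinner (sep_completion H) l h = hinner (sep_completion H) l k"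
  interpret S: semi_corr "sep_completion H" by (rule semi_corr_sep)
  obtain u where u: "u \<in> cauchy_seqs H" "h = cauchy_class H u" using hk(1) by (rule sep_carrierE)
  obtain v where v: "v \<in> cauchy_seqs H" "k = cauchy_class H v" using hk(2) by (rule sep_carrierE)
  let ?d = "hminus (sep_completion H) h k"
  have "hinner (sep_completion H) ?d ?d = 0"
    using S.inner_minus[OF S.minus_in[OF hk] hk] eq[OF S.minus_in[OF hk]] by simp
  then have "(\<lambda>i. hinner H (hminus H (u i) (v i)) (hminus H (u i) (v i))) \<longlonglongrightarrow> 0"
    using sep_inner[OF sep_minus(2) sep_minus(2), OF u(1) v(1) u(1) v(1)]
    by (simp add: u v sep_minus)
  from tendsto_real_sqrt[OF tendsto_norm_zero[OF this]]
  have "(\<lambda>i. hnorm H (hminus H (u i) (v i))) \<longlonglongrightarrow> 0" by (simp add: hnorm_def)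
  then show "h = k" using cauchy_class_eq_iff u v by simp
qed

text \<open>Embedded vectors are dense, hence separate the completion.\<close>

lemma embed_tendsto:
  assumes U: "U \<in> hcarrier (sep_completion H)" and u: "u \<in> cauchy_seqs H"
  shows "(\<lambda>i. hinner (sep_completion H) U (embed_compl H (u i))) \<longlonglongrightarrow> hinner (sep_completion H) U (cauchy_class H u)"
proof -
  interpret S: semi_corr "sep_completion H" by (rule semi_corr_sep)
  let ?S = "sep_completion H"
  have e: "embed_compl H (u i) \<in> hcarrier ?S" for i using embed_in cauchy_seqsD[OF u] by simp
  have dist: "hnorm ?S (hminus ?S (embed_compl H (u i)) (cauchy_class H u)) \<le> d"
    if "\<forall>j\<ge>K. hnorm H (hminus H (u i) (u j)) < d" for i d K
  proof -
    have c: "(\<lambda>_. u i) \<in> cauchy_seqs H" using const_cauchy cauchy_seqsD[OF u] by simp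
    have "(\<lambda>j. hinner H (hminus H (u i) (u j)) (hminus H (u i) (u j)))
        \<longlonglongrightarrow> hinner ?S (hminus ?S (embed_compl H (u i)) (cauchy_class H u)) (hminus ?S (embed_compl H (u i)) (cauchy_class H u))"
      unfolding embed_compl_def sep_minus(1)[OF c u] by (rule sep_inner[OF sep_minus(2)[OF c u] sep_minus(2)[OF c u]])
    from tendsto_real_sqrt[OF tendsto_norm[OF this]]
    have "(\<lambda>j. hnorm H (hminus H (u i) (u j))) \<longlonglongrightarrow> hnorm ?S (hminus ?S (embed_compl H (u i)) (cauchy_class H u))"
      by (simp add: hnorm_def)
    then show ?thesis
      by (rule LIMSEQ_le_const2) (use that in \<open>auto intro: less_imp_le exI[of _ K]\<close>)
  qed
  have "(\<lambda>i. hnorm ?S (hminus ?S (embed_compl H (u i)) (cauchy_class H u))) \<longlonglongrightarrow> 0"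
  proof (rule LIMSEQ_I)
    fix r :: real assume "r > 0"
    then have "r / 2 > 0" by simp
    with u obtain K where K: "\<forall>i\<ge>K. \<forall>j\<ge>K. hnorm H (hminus H (u i) (u j)) < r / 2"
      unfolding cauchy_seqs_def by blast
    then show "\<exists>no. \<forall>n\<ge>no. norm (hnorm ?S (hminus ?S (embed_compl H (u n)) (cauchy_class H u)) - 0) < r"
      using dist[of K _ "r / 2"] \<open>r > 0\<close> S.hnorm_nonneg by (intro exI[of _ K]) fastforce
  qed
  from tendsto_mult_left[OF this, of "hnorm ?S U"]
  have "(\<lambda>i. hnorm ?S U * hnorm ?S (hminus ?S (embed_compl H (u i)) (cauchy_class H u))) \<longlonglongrightarrow> 0" by simp
  then have "(\<lambda>i. hinner ?S U (embed_compl H (u i)) - hinner ?S U (cauchy_class H u)) \<longlonglongrightarrow> 0"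
  proof (rule Lim_null_comparison[rotated])
    show "\<forall>\<^sub>F i in sequentially. norm (hinner ?S U (embed_compl H (u i)) - hinner ?S U (cauchy_class H u))
      \<le> hnorm ?S U * hnorm ?S (hminus ?S (embed_compl H (u i)) (cauchy_class H u))"
      using S.Cauchy_Schwarz[OF U S.minus_in[OF e sep_carrierI[OF u]]] S.inner_minus[OF U e sep_carrierI[OF u]]
      by (intro always_eventually) simp
  qed
  then show ?thesis by (simp add: LIM_zero_iff)
qed

lemma sep_eqI:
  assumes U: "U \<in> hcarrier (sep_completion H)" and V: "V \<in> hcarrier (sep_completion H)"
    and eq: "\<And>h. h \<in> hcarrier H \<Longrightarrow>
      hinner (sep_completion H) U (embed_compl H h) = hinner (sep_completion H) V (embed_compl H h)"
  shows "U = V"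
proof -
  interpret S: nondegenerate_corr "sep_completion H" by (rule nondegenerate_sep)
  show ?thesis
  proof (rule S.ext[OF U V])
    fix W assume W: "W \<in> hcarrier (sep_completion H)"
    then obtain w where w: "w \<in> cauchy_seqs H" "W = cauchy_class H w" by (rule sep_carrierE)
    have "hinner (sep_completion H) U W = hinner (sep_completion H) V W"
      unfolding w(2) using embed_tendsto[OF U w(1)] embed_tendsto[OF V w(1)]
      unfolding eq[OF cauchy_seqsD[OF w(1)]] by (rule LIMSEQ_unique)
    then show "hinner (sep_completion H) W U = hinner (sep_completion H) W V"
      using S.inner_sym[OF U W] S.inner_sym[OF V W] by simp
  qed
qed

lemma embed_add: "\<lbrakk>h \<in> hcarrier H; k \<in> hcarrier H\<rbrakk> \<Longrightarrow>
    hadd (sep_completion H) (embed_compl H h) (embed_compl H k) = embed_compl H (hadd H h k)"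
  unfolding embed_compl_def by (rule sep_add[OF const_cauchy const_cauchy])

lemma embed_ract: "h \<in> hcarrier H \<Longrightarrow> ract (sep_completion H) (embed_compl H h) a = embed_compl H (ract H h a)"
  unfolding embed_compl_def by (rule sep_ract(1)[OF const_cauchy])

lemma embed_lact: "h \<in> hcarrier H \<Longrightarrow> lact (sep_completion H) a (embed_compl H h) = embed_compl H (lact H a h)"
  unfolding embed_compl_def by (rule sep_lact(1)[OF const_cauchy])

end

text \<open>The adjoint relation and the operator inequality are both closed under limits of Cauchy
  sequences, so the constant is preserved.\<close>

theorem adj_pair_lift:
  assumes H: "semi_corr H" "semi_corr H'" and p: "adj_pair H H' f g C"
  shows "adj_pair (sep_completion H) (sep_completion H') (lift_op H' f) (lift_op H g) C"
    "h \<in> hcarrier H \<Longrightarrow> lift_op H' f (embed_compl H h) = embed_compl H' (f h)"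
proof -
  interpret f: lipschitz_map H H' f "sqrt C" by (rule adj_pair_lipschitz[OF H p])
  interpret g: lipschitz_map H' H g "sqrt C" by (rule adj_pair_lipschitz[OF H(2,1) adj_pair_sym[OF H p]])
  show "h \<in> hcarrier H \<Longrightarrow> lift_op H' f (embed_compl H h) = embed_compl H' (f h)" by (rule f.lift_embed)
  have fD: "\<And>h. h \<in> hcarrier H \<Longrightarrow> hinner H' (f h) (f h) \<preceq> C *\<^sub>R hinner H h h"
    "\<And>h k. h \<in> hcarrier H \<Longrightarrow> k \<in> hcarrier H' \<Longrightarrow> hinner H' (f h) k = hinner H h (g k)" "C \<ge> 0"
    using p by (auto simp: adj_pair_def)
  have "hinner (sep_completion H') (lift_op H' f U) V = hinner (sep_completion H) U (lift_op H g V)"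
    if UV: "U \<in> hcarrier (sep_completion H)" "V \<in> hcarrier (sep_completion H')" for U V
  proof -
    obtain u where u: "u \<in> cauchy_seqs H" "U = cauchy_class H u" using UV(1) by (rule f.H.sep_carrierE)
    obtain v where v: "v \<in> cauchy_seqs H'" "V = cauchy_class H' v" using UV(2) by (rule f.H'.sep_carrierE)
    show ?thesis
      unfolding u(2) v(2) f.lift_class[OF u(1)] g.lift_class[OF v(1)]
      by (rule f.H'.sep_inner_eqI[OF f.map_cauchy[OF u(1)] v(1)])
        (use f.H.sep_inner[OF u(1) g.map_cauchy[OF v(1)]] in
          \<open>simp add: fD(2)[OF f.H.cauchy_seqsD[OF u(1)] f.H'.cauchy_seqsD[OF v(1)]]\<close>)
  qed
  moreover have "hinner (sep_completion H') (lift_op H' f U) (lift_op H' f U) \<preceq> C *\<^sub>R hinner (sep_completion H) U U"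
    if U: "U \<in> hcarrier (sep_completion H)" for U
  proof -
    obtain u where u: "u \<in> cauchy_seqs H" "U = cauchy_class H u" using U by (rule f.H.sep_carrierE)
    show ?thesis
      unfolding u(2) f.lift_class[OF u(1)]
      by (rule cle_limit[OF _ f.H'.sep_inner[OF f.map_cauchy f.map_cauchy, OF u(1) u(1)]
            tendsto_scaleR[OF tendsto_const f.H.sep_inner[OF u(1) u(1)]]])
        (rule fD(1)[OF f.H.cauchy_seqsD[OF u(1)]])
  qed
  ultimately show "adj_pair (sep_completion H) (sep_completion H') (lift_op H' f) (lift_op H g) C"
    using fD(3) f.lift_in g.lift_in by (auto simp: adj_pair_def)
qed

context semi_corr
begin

fun lin_comb :: "(nat \<Rightarrow> 'h) \<Rightarrow> (nat \<Rightarrow> 'b) \<Rightarrow> nat \<Rightarrow> 'h" where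
  "lin_comb h b 0 = hzero H"
| "lin_comb h b (Suc n) = hadd H (lin_comb h b n) (ract H (h n) (b n))"

lemma lin_comb_in: "(\<And>i. i < n \<Longrightarrow> h i \<in> hcarrier H) \<Longrightarrow> lin_comb h b n \<in> hcarrier H"
  by (induction n) (auto simp: closed)

lemma inner_lin_comb:
  "(\<And>i. i < n \<Longrightarrow> h i \<in> hcarrier H) \<Longrightarrow> l \<in> hcarrier H \<Longrightarrow>
    hinner H l (lin_comb h b n) = (\<Sum>i<n. hinner H l (h i) * b i)"
  by (induction n) (auto simp: inner_simps closed lin_comb_in)

lemma inner_lin_comb_left:
  "(\<And>i. i < n \<Longrightarrow> h i \<in> hcarrier H) \<Longrightarrow> l \<in> hcarrier H \<Longrightarrow>
    hinner H (lin_comb h b n) l = (\<Sum>i<n. star (b i) * hinner H (h i) l)"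
  by (induction n) (auto simp: inner_simps closed lin_comb_in)

end

text \<open>At \<open>b\<close> the form is C <l, l> - <f l, f l> for the combination l of the
  \<open>h i\<close> with coefficients \<open>b i\<close>. This lets a bound on one leg pass to
  tensor products, where matrices of this kind occur as coefficients.\<close>

lemma adj_pair_form_pos:
  fixes n :: nat
  assumes H: "semi_corr H" "semi_corr H'" and p: "adj_pair H H' f g C"
    and h: "\<And>i. i < n \<Longrightarrow> h i \<in> hcarrier H"
  shows "cpos (\<Sum>i<n. \<Sum>j<n. star (b i) * (C *\<^sub>R hinner H (h i) (h j) - hinner H' (f (h i)) (f (h j))) * b j)"
proof -
  interpret H: semi_corr H by fact
  interpret H': semi_corr H' by fact
  have f: "f x \<in> hcarrier H'" if "x \<in> hcarrier H" for x using p that by (auto simp: adj_pair_def)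
  have g: "g x \<in> hcarrier H" if "x \<in> hcarrier H'" for x using p that by (auto simp: adj_pair_def)
  have adj: "hinner H' (f x) y = hinner H x (g y)" if "x \<in> hcarrier H" "y \<in> hcarrier H'" for x y
    using p that by (auto simp: adj_pair_def)
  let ?l = "H.lin_comb h b n"
  have l: "?l \<in> hcarrier H" by (rule H.lin_comb_in) (rule h)
  have "hinner H ?l ?l = (\<Sum>i<n. \<Sum>j<n. star (b i) * hinner H (h i) (h j) * b j)"
    by (subst H.inner_lin_comb_left) (simp_all add: l h H.inner_lin_comb sum_distrib_left mult.assoc)
  moreover have "hinner H' (f ?l) (f ?l) = (\<Sum>i<n. \<Sum>j<n. star (b i) * hinner H' (f (h i)) (f (h j)) * b j)"
  proof -
    \<comment> \<open>\<open>f\<close> is expanded over the combination by moving it across with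
      \<open>g\<close>, so that linearity is only used for the inner product.\<close>
    have right: "hinner H' k (f ?l) = (\<Sum>j<n. hinner H' k (f (h j)) * b j)" if k: "k \<in> hcarrier H'" for k
    proof -
      have "hinner H' k (f ?l) = star (hinner H' (f ?l) k)" using H'.inner_sym f l k by simp
      also have "\<dots> = star (\<Sum>i<n. star (b i) * hinner H' (f (h i)) k)"
        using l k h by (simp add: adj H.inner_lin_comb_left g)
      also have "\<dots> = (\<Sum>j<n. hinner H' k (f (h j)) * b j)"
        using k f h by (simp add: star_sum star_mult star_star H'.inner_sym)
      finally show ?thesis .
    qed
    have left: "hinner H' (f ?l) k = (\<Sum>i<n. star (b i) * hinner H' (f (h i)) k)" if k: "k \<in> hcarrier H'" for k
      using l k h by (simp add: adj H.inner_lin_comb_left g)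
    show ?thesis
      by (subst left) (simp_all add: right f l h sum_distrib_left mult.assoc)
  qed
  ultimately have "(\<Sum>i<n. \<Sum>j<n. star (b i) * (C *\<^sub>R hinner H (h i) (h j) - hinner H' (f (h i)) (f (h j))) * b j)
      = C *\<^sub>R hinner H ?l ?l - hinner H' (f ?l) (f ?l)"
    by (simp add: algebra_simps sum_subtractf scaleR_sum_right)
  then show ?thesis using p l by (auto simp: adj_pair_def cle_def)
qed

section \<open>Tensor products\<close>

abbreviation elems :: "('b::cstar_algebra, 'h) corr list \<Rightarrow> 'h list \<Rightarrow> bool" where
  "elems Hs hs \<equiv> list_all2 (\<lambda>h H. h \<in> hcarrier H) hs Hs"

lemma tensor_inner_add:
  assumes "\<forall>H\<in>set Hs. semi_corr H" "elems Hs hs" "elems Hs ks"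
  shows "tensor_inner Hs (a + b) hs ks = tensor_inner Hs a hs ks + tensor_inner Hs b hs ks"
  using assms
proof (induction Hs arbitrary: a b hs ks)
  case (Cons H Hs)
  then interpret H: semi_corr H by simp
  from Cons.prems Cons.IH show ?case
    by (auto simp: list_all2_Cons2 H.lact_add)
qed auto

lemma tensor_inner_zero:
  assumes "\<forall>H\<in>set Hs. semi_corr H" "elems Hs hs" "elems Hs ks"
  shows "tensor_inner Hs 0 hs ks = 0"
  using tensor_inner_add[OF assms, of 0 0] by simp

lemma tensor_inner_sum:
  assumes "\<forall>H\<in>set Hs. semi_corr H" "elems Hs hs" "elems Hs ks"
  shows "tensor_inner Hs (\<Sum>i\<in>I. a i) hs ks = (\<Sum>i\<in>I. tensor_inner Hs (a i) hs ks)"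
  by (induction I rule: infinite_finite_induct)
    (auto simp: tensor_inner_zero[OF assms] tensor_inner_add[OF assms])

lemma tensor_inner_minus:
  assumes "\<forall>H\<in>set Hs. semi_corr H" "elems Hs hs" "elems Hs ks"
  shows "tensor_inner Hs (a - b) hs ks = tensor_inner Hs a hs ks - tensor_inner Hs b hs ks"
  using tensor_inner_add[OF assms, of "a - b" b] by simp

lemma tensor_inner_scalar:
  assumes "\<forall>H\<in>set Hs. semi_corr H" "elems Hs hs" "elems Hs ks"
  shows "tensor_inner Hs (a * scaleC c 1) hs ks = tensor_inner Hs a hs ks * scaleC c 1"
  using assms
proof (induction Hs arbitrary: a hs ks)
  case (Cons H Hs)
  then interpret H: semi_corr H by simp
  have "hinner H h (lact H (a * scaleC c 1) k) = hinner H h (lact H a k) * scaleC c 1"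
    if "h \<in> hcarrier H" "k \<in> hcarrier H" for h k
    using that by (simp add: H.lact_mult H.inner_lact[of h] H.closed H.lact_scalar)
  with Cons.prems Cons.IH show ?case
    by (auto simp: list_all2_Cons2)
qed auto

lemma tensor_inner_scaleR:
  assumes "\<forall>H\<in>set Hs. semi_corr H" "elems Hs hs" "elems Hs ks"
  shows "tensor_inner Hs (r *\<^sub>R a) hs ks = r *\<^sub>R tensor_inner Hs a hs ks"
  using tensor_inner_scalar[OF assms, of a "of_real r"] by (simp add: scaleC_of_real)

lemma tensor_inner_sym:
  assumes "\<forall>H\<in>set Hs. semi_corr H" "elems Hs hs" "elems Hs ks"
  shows "star (tensor_inner Hs a hs ks) = tensor_inner Hs (star a) ks hs"
  using assms
proof (induction Hs arbitrary: a hs ks)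
  case (Cons H Hs)
  then interpret H: semi_corr H by simp
  have "star (hinner H h (lact H a k)) = hinner H k (lact H (star a) h)"
    if "h \<in> hcarrier H" "k \<in> hcarrier H" for h k
    using that by (simp add: H.inner_sym H.closed H.inner_lact_left)
  with Cons.prems Cons.IH show ?case
    by (auto simp: list_all2_Cons2)
qed auto

definition elem_inner :: "('b::cstar_algebra, 'h) corr list \<Rightarrow> 'h list \<times> 'b \<Rightarrow> 'h list \<times> 'b \<Rightarrow> 'b" where
  "elem_inner Hs x y = star (snd x) * tensor_inner Hs 1 (fst x) (fst y) * snd y"

lemma elem_tensors_iff: "x \<in> elem_tensors Hs \<longleftrightarrow> elems Hs (fst x)"
  by (auto simp: elem_tensors_def)

lemma elem_lact_in:
  assumes "\<forall>H\<in>set Hs. semi_corr H" "x \<in> elem_tensors Hs"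
  shows "elem_lact Hs a x \<in> elem_tensors Hs"
  using assms by (cases "(Hs, a, x)" rule: elem_lact.cases)
    (auto simp: elem_tensors_iff semi_corr.lact_in)

text \<open>A left action on the second tensor can be read as the middle coefficient of
  \<open>tensor_inner\<close>. Without legs it acts on the trailing coefficient, hence the separate
  case.\<close>

lemma elem_inner_lact:
  assumes "\<forall>H\<in>set Hs. semi_corr H" "x \<in> elem_tensors Hs" "y \<in> elem_tensors Hs"
  shows "elem_inner Hs x (elem_lact Hs a y) = star (snd x) * tensor_inner Hs a (fst x) (fst y) * snd y"
proof (cases Hs)
  case Nil
  with assms show ?thesis by (cases y) (auto simp: elem_inner_def elem_tensors_iff mult.assoc)
next
  case (Cons H Hs')
  then interpret H: semi_corr H using assms by simp
  from Cons assms obtain h hs b k ks c where xy: "x = (h # hs, b)" "y = (k # ks, c)"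
    "h \<in> hcarrier H" "k \<in> hcarrier H"
    by (cases x, cases y) (auto simp: elem_tensors_iff list_all2_Cons2)
  have "hinner H h (lact H 1 (lact H a k)) = hinner H h (lact H a k)"
    using xy by (simp add: H.lact_one H.closed)
  then show ?thesis by (simp add: Cons xy elem_inner_def)
qed

lemma elem_inner_sym:
  assumes "\<forall>H\<in>set Hs. semi_corr H" "x \<in> elem_tensors Hs" "y \<in> elem_tensors Hs"
  shows "star (elem_inner Hs x y) = elem_inner Hs y x"
  using assms tensor_inner_sym[OF assms(1), of "fst x" "fst y" 1]
  by (simp add: elem_inner_def star_mult star_star elem_tensors_iff star_one mult.assoc)

lemma elem_inner_lact_left:
  assumes "\<forall>H\<in>set Hs. semi_corr H" "x \<in> elem_tensors Hs" "y \<in> elem_tensors Hs"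
  shows "elem_inner Hs (elem_lact Hs a x) y = elem_inner Hs x (elem_lact Hs (star a) y)"
proof -
  have "elem_inner Hs (elem_lact Hs a x) y = star (elem_inner Hs y (elem_lact Hs a x))"
    using assms by (simp add: elem_inner_sym elem_lact_in)
  also have "\<dots> = star (snd x) * tensor_inner Hs (star a) (fst x) (fst y) * snd y"
    using assms by (simp add: elem_inner_lact star_mult star_star mult.assoc tensor_inner_sym elem_tensors_iff)
  also have "\<dots> = elem_inner Hs x (elem_lact Hs (star a) y)"
    using assms by (simp add: elem_inner_lact)
  finally show ?thesis .
qed

lemma elem_inner_lact_lact:
  assumes "\<forall>H\<in>set Hs. semi_corr H" "x \<in> elem_tensors Hs" "y \<in> elem_tensors Hs"
  shows "elem_inner Hs (elem_lact Hs a x) (elem_lact Hs b y)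
    = star (snd x) * tensor_inner Hs (star a * b) (fst x) (fst y) * snd y"
proof (cases Hs)
  case Nil
  with assms show ?thesis by (cases x, cases y) (auto simp: elem_inner_def elem_tensors_iff star_mult mult.assoc)
next
  case (Cons H Hs')
  then interpret H: semi_corr H using assms by simp
  from Cons assms obtain h hs c k ks d where xy: "x = (h # hs, c)" "y = (k # ks, d)"
    "h \<in> hcarrier H" "k \<in> hcarrier H"
    by (cases x, cases y) (auto simp: elem_tensors_iff list_all2_Cons2)
  have "hinner H (lact H a h) (lact H 1 (lact H b k)) = hinner H h (lact H (star a * b) k)"
    using xy by (simp add: H.lact_one H.closed H.lact_mult H.inner_lact_left)
  then show ?thesis by (simp add: Cons xy elem_inner_def)
qed

text \<open>A factorization of \<open>M\<close> distributes its entries over both sides: the form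
  becomes a sum over \<open>k\<close> of plain forms at the tensors obtained from \<open>x i\<close>
  by the left action of \<open>C k i\<close>.\<close>

lemma tensor_form_pos:
  assumes Hs: "\<forall>H\<in>set Hs. semi_corr H"
    and pos: "\<And>x. (\<And>i. i < m \<Longrightarrow> x i \<in> elem_tensors Hs) \<Longrightarrow> cpos (\<Sum>i<m. \<Sum>j<m. elem_inner Hs (x i) (x j))"
    and x: "\<And>i. i < m \<Longrightarrow> x i \<in> elem_tensors Hs"
    and M: "pos_matrix m M"
  shows "cpos (\<Sum>i<m. \<Sum>j<m. star (snd (x i)) * tensor_inner Hs (M i j) (fst (x i)) (fst (x j)) * snd (x j))"
proof -
  from M obtain C where C: "\<And>i j. i < m \<Longrightarrow> j < m \<Longrightarrow> M i j = (\<Sum>k<m. star (C k i) * C k j)"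
    by (auto simp: pos_matrix_def)
  have "(\<Sum>i<m. \<Sum>j<m. star (snd (x i)) * tensor_inner Hs (M i j) (fst (x i)) (fst (x j)) * snd (x j))
      = (\<Sum>i<m. \<Sum>j<m. \<Sum>k<m. elem_inner Hs (elem_lact Hs (C k i) (x i)) (elem_lact Hs (C k j) (x j)))"
  proof (intro sum.cong refl)
    fix i j assume ij: "i \<in> {..<m}" "j \<in> {..<m}"
    then have xi: "x i \<in> elem_tensors Hs" "x j \<in> elem_tensors Hs" using x by auto
    have "tensor_inner Hs (M i j) (fst (x i)) (fst (x j))
        = (\<Sum>k<m. tensor_inner Hs (star (C k i) * C k j) (fst (x i)) (fst (x j)))"
      using ij xi C by (simp add: tensor_inner_sum[OF Hs] elem_tensors_iff)
    then show "star (snd (x i)) * tensor_inner Hs (M i j) (fst (x i)) (fst (x j)) * snd (x j)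
        = (\<Sum>k<m. elem_inner Hs (elem_lact Hs (C k i) (x i)) (elem_lact Hs (C k j) (x j)))"
      using xi by (simp add: elem_inner_lact_lact[OF Hs] sum_distrib_left sum_distrib_right)
  qed
  also have "\<dots> = (\<Sum>k<m. \<Sum>i<m. \<Sum>j<m. elem_inner Hs (elem_lact Hs (C k i) (x i)) (elem_lact Hs (C k j) (x j)))"
  proof -
    have "(\<Sum>i<m. \<Sum>j<m. \<Sum>k<m. F k i j) = (\<Sum>k<m. \<Sum>i<m. \<Sum>j<m. F k i j)" for F :: "nat \<Rightarrow> nat \<Rightarrow> nat \<Rightarrow> 'a"
    proof -
      have "(\<Sum>i<m. \<Sum>j<m. \<Sum>k<m. F k i j) = (\<Sum>i<m. \<Sum>k<m. \<Sum>j<m. F k i j)"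
        by (intro sum.cong refl sum.swap)
      also have "\<dots> = (\<Sum>k<m. \<Sum>i<m. \<Sum>j<m. F k i j)" by (rule sum.swap)
      finally show ?thesis .
    qed
    then show ?thesis .
  qed
  also have "cpos \<dots>"
    by (intro cpos_sum pos elem_lact_in[OF Hs] x)
  finally show ?thesis .
qed

text \<open>Induction on the number of legs. The first legs contribute their Gram matrix as
  coefficients for the remaining ones; its form is the inner square of a combination, and
  \<open>pos_matrix_of_form\<close> factors it. Positivity of the single entries would not
  suffice.\<close>

lemma elem_inner_pos:
  fixes m :: nat
  assumes "\<forall>H\<in>set Hs. semi_corr H" "\<And>i. i < m \<Longrightarrow> x i \<in> elem_tensors Hs"
  shows "cpos (\<Sum>i<m. \<Sum>j<m. elem_inner Hs (x i) (x j))"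
  using assms
proof (induction Hs arbitrary: x)
  case Nil
  have "(\<Sum>i<m. \<Sum>j<m. elem_inner [] (x i) (x j)) = star (\<Sum>i<m. snd (x i)) * (\<Sum>j<m. snd (x j))"
    by (simp add: elem_inner_def star_sum sum_product)
  then show ?case by (simp add: cpos_star_mult)
next
  case (Cons H Hs)
  interpret H: semi_corr H using Cons.prems by simp
  define h where "h i = hd (fst (x i))" for i :: nat
  define y where "y i = (tl (fst (x i)), snd (x i))" for i :: nat
  have x: "x i = (h i # fst (y i), snd (y i))" "h i \<in> hcarrier H" "y i \<in> elem_tensors Hs" if "i < m" for i
    using Cons.prems(2)[OF that] by (cases "x i"; auto simp: elem_tensors_iff list_all2_Cons2 h_def y_def)+
  have "(\<Sum>i<m. \<Sum>j<m. elem_inner (H # Hs) (x i) (x j))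
      = (\<Sum>i<m. \<Sum>j<m. star (snd (y i)) * tensor_inner Hs (hinner H (h i) (h j)) (fst (y i)) (fst (y j)) * snd (y j))"
    by (intro sum.cong refl) (simp add: elem_inner_def x H.lact_one)
  also have "cpos \<dots>"
  proof (rule tensor_form_pos[where x = y and M = "\<lambda>i j. hinner H (h i) (h j)" and Hs = Hs])
    show "pos_matrix m (\<lambda>i j. hinner H (h i) (h j))"
    proof (rule pos_matrix_of_form)
      fix b :: "nat \<Rightarrow> 'a"
      have "H.lin_comb h b m \<in> hcarrier H" by (rule H.lin_comb_in) (rule x)
      then have "cpos (hinner H (H.lin_comb h b m) (H.lin_comb h b m))" by (rule H.inner_pos)
      moreover have "hinner H (H.lin_comb h b m) (H.lin_comb h b m) = (\<Sum>i<m. \<Sum>j<m. star (b i) * hinner H (h i) (h j) * b j)"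
        by (subst H.inner_lin_comb_left) (simp_all add: H.inner_lin_comb H.lin_comb_in x sum_distrib_left mult.assoc)
      ultimately show "cpos (\<Sum>i<m. \<Sum>j<m. star (b i) * hinner H (h i) (h j) * b j)" by simp
    qed (simp add: H.inner_sym x)
  qed (use Cons x in auto)
  finally show ?case .
qed

lemma pre_tensor_inner: "hinner (pre_tensor Hs) t t' = (\<Sum>x\<leftarrow>t. \<Sum>y\<leftarrow>t'. elem_inner Hs x y)"
  unfolding pre_tensor_def elem_inner_def case_prod_unfold by simp

lemma pre_tensor_carrier: "hcarrier (pre_tensor Hs) = lists (elem_tensors Hs)"
  by (simp add: pre_tensor_def)

lemma pre_tensor_carrierD: "t \<in> hcarrier (pre_tensor Hs) \<Longrightarrow> x \<in> set t \<Longrightarrow> x \<in> elem_tensors Hs"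
  by (auto simp: pre_tensor_carrier)

lemma pre_tensor_carrierI: "(\<And>x. x \<in> set t \<Longrightarrow> x \<in> elem_tensors Hs) \<Longrightarrow> t \<in> hcarrier (pre_tensor Hs)"
  by (auto simp: pre_tensor_carrier)

lemma sum_list_swap: "(\<Sum>x\<leftarrow>xs. \<Sum>y\<leftarrow>ys. f x y) = (\<Sum>y\<leftarrow>ys. \<Sum>x\<leftarrow>xs. f x y :: 'a::comm_monoid_add)"
  by (induction xs) (auto simp: sum_list_addf)

lemma sum_list_nth: "(\<Sum>x\<leftarrow>xs. f x) = (\<Sum>i<length xs. f (xs ! i) :: 'a::comm_monoid_add)"
  by (simp add: sum_list_sum_nth atLeast0LessThan)

lemma pre_tensor_simps:
  "hzero (pre_tensor Hs) = []" "hadd (pre_tensor Hs) = (@)"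
  "lact (pre_tensor Hs) a t = map (elem_lact Hs a) t"
  "ract (pre_tensor Hs) t c = map (\<lambda>x. (fst x, snd x * c)) t"
  by (simp_all add: pre_tensor_def case_prod_beta)

lemma semi_corr_pre_tensor:
  assumes Hs: "\<forall>H\<in>set Hs. semi_corr H"
  shows "semi_corr (pre_tensor Hs)"
proof
  fix h k l :: "('b list \<times> 'a) list" and a b :: 'a and c :: complex
  let ?P = "pre_tensor Hs"
  assume h: "h \<in> hcarrier ?P"
  note hD = pre_tensor_carrierD[OF h]
  show "lact ?P a h \<in> hcarrier ?P"
    unfolding pre_tensor_simps pre_tensor_carrier in_lists_conv_set set_map using elem_lact_in[OF Hs hD] by blast
  show "ract ?P h a \<in> hcarrier ?P"
    using hD by (intro pre_tensor_carrierI) (auto simp: pre_tensor_simps elem_tensors_iff)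
  show "hinner ?P h (hzero ?P) = 0" by (simp add: pre_tensor_inner pre_tensor_simps)
  show "cpos (hinner ?P h h)"
    unfolding pre_tensor_inner sum_list_nth by (rule elem_inner_pos[OF Hs]) (auto intro: hD)
  assume k: "k \<in> hcarrier ?P"
  note kD = pre_tensor_carrierD[OF k]
  show "hadd ?P h k \<in> hcarrier ?P"
    by (rule pre_tensor_carrierI) (auto simp: pre_tensor_simps dest: hD kD)
  show "star (hinner ?P h k) = hinner ?P k h"
    unfolding pre_tensor_inner sum_list_swap[of _ h] star_sum_list
    by (intro arg_cong[of _ _ sum_list] map_cong refl elem_inner_sym[OF Hs] hD kD)
  show "hinner ?P h (ract ?P k a) = hinner ?P h k * a"
    by (simp add: pre_tensor_inner pre_tensor_simps o_def elem_inner_def mult.assoc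
        sum_list_mult_const[symmetric])
  have inner_lact: "hinner ?P h (lact ?P a k)
      = (\<Sum>x\<leftarrow>h. \<Sum>y\<leftarrow>k. star (snd x) * tensor_inner Hs a (fst x) (fst y) * snd y)" for a
    unfolding pre_tensor_inner pre_tensor_simps map_map o_def
    by (intro arg_cong[of _ _ sum_list] map_cong refl elem_inner_lact[OF Hs] hD kD)
  show "hinner ?P h (lact ?P a k) = hinner ?P (lact ?P (star a) h) k"
    unfolding pre_tensor_inner pre_tensor_simps map_map o_def
    by (intro arg_cong[of _ _ sum_list] map_cong refl, subst elem_inner_lact_left[OF Hs])
      (auto simp: star_star hD kD)
  show "hinner ?P h (lact ?P (a + b) k) = hinner ?P h (lact ?P a k) + hinner ?P h (lact ?P b k)"
    unfolding inner_lact sum_list_addf[symmetric]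
    by (intro arg_cong[of _ _ sum_list] map_cong refl, subst tensor_inner_add[OF Hs])
      (auto simp: algebra_simps dest!: hD kD simp: elem_tensors_iff)
  have scalar_comm: "scaleC c 1 * x = x * scaleC c 1" for x :: 'a
    by (simp add: mult_scaleC_left mult_scaleC_right)
  show "hinner ?P h (lact ?P (scaleC c 1) k) = hinner ?P h k * scaleC c 1"
  proof -
    have "star (snd x) * tensor_inner Hs (scaleC c 1) (fst x) (fst y) * snd y = elem_inner Hs x y * scaleC c 1"
      if "x \<in> set h" "y \<in> set k" for x y
      using tensor_inner_scalar[OF Hs, of "fst x" "fst y" 1 c] hD[OF that(1)] kD[OF that(2)]
      by (simp add: elem_inner_def elem_tensors_iff mult.assoc scalar_comm)
    then have "hinner ?P h (lact ?P (scaleC c 1) k) = (\<Sum>x\<leftarrow>h. \<Sum>y\<leftarrow>k. elem_inner Hs x y * scaleC c 1)"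
      unfolding inner_lact by (intro arg_cong[of _ _ sum_list] map_cong refl) auto
    then show ?thesis by (simp add: pre_tensor_inner sum_list_mult_const)
  qed
  show "hinner ?P h (lact ?P (a * b) k) = hinner ?P h (lact ?P a (lact ?P b k))"
    unfolding pre_tensor_inner pre_tensor_simps map_map o_def
  proof (intro arg_cong[of _ _ sum_list] map_cong refl)
    fix x y assume xy: "x \<in> set h" "y \<in> set k"
    have "elem_inner Hs x (elem_lact Hs a (elem_lact Hs b y)) = elem_inner Hs (elem_lact Hs (star a) x) (elem_lact Hs b y)"
      using hD kD xy by (simp add: elem_inner_lact_left[OF Hs] elem_lact_in[OF Hs] star_star)
    also have "\<dots> = elem_inner Hs x (elem_lact Hs (a * b) y)"
      using hD kD xy by (simp add: elem_inner_lact_lact[OF Hs] elem_inner_lact[OF Hs] star_star)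
    finally show "elem_inner Hs x (elem_lact Hs (a * b) y) = elem_inner Hs x (elem_lact Hs a (elem_lact Hs b y))" ..
  qed
  assume l: "l \<in> hcarrier ?P"
  show "hinner ?P h (hadd ?P k l) = hinner ?P h k + hinner ?P h l"
    by (simp add: pre_tensor_inner pre_tensor_simps sum_list_addf)
next
  show "hzero (pre_tensor Hs) \<in> hcarrier (pre_tensor Hs)"
    by (simp add: pre_tensor_simps pre_tensor_carrier)
qed

section \<open>Creation, annihilation and compression on tensors\<close>

definition create :: "'h \<Rightarrow> ('h list \<times> 'b) list \<Rightarrow> ('h list \<times> 'b) list" where
  "create e = map (\<lambda>x. (e # fst x, snd x))"

definition annihilate :: "('b::cstar_algebra, 'h) corr \<Rightarrow> ('b, 'h) corr list \<Rightarrow> 'h \<Rightarrow> ('h list \<times> 'b) list \<Rightarrow> ('h list \<times> 'b) list"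
  where "annihilate H Hs e = map (\<lambda>x. elem_lact Hs (hinner H e (hd (fst x))) (tl (fst x), snd x))"

definition on_head :: "('h \<Rightarrow> 'h) \<Rightarrow> ('h list \<times> 'b) list \<Rightarrow> ('h list \<times> 'b) list" where
  "on_head z = map (\<lambda>x. (z (hd (fst x)) # tl (fst x), snd x))"

lemma elem_inner_Cons:
  assumes "\<forall>H\<in>set (H # Hs). semi_corr H" "h \<in> hcarrier H" "k \<in> hcarrier H"
  shows "elem_inner (H # Hs) (h # hs, b) (k # ks, c) = star b * tensor_inner Hs (hinner H h k) hs ks * c"
  using assms semi_corr.lact_one[of H h k] by (simp add: elem_inner_def)

lemma elem_tensors_ConsE:
  assumes "x \<in> elem_tensors (H # Hs)"
  obtains h hs b where "x = (h # hs, b)" "h \<in> hcarrier H" "(hs, b) \<in> elem_tensors Hs"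
  using assms by (cases x) (auto simp: elem_tensors_iff list_all2_Cons2)

text \<open>If <e, e> is \<open>star c * c\<close>, tensoring with \<open>e\<close> from the left
  gives the same inner products as the left action of \<open>c\<close>, whose bound is ||c||^2 =
  ||<e, e>||.\<close>

lemma adj_pair_create:
  assumes Hs: "\<forall>H\<in>set (H # Hs). semi_corr H" and e: "e \<in> hcarrier H"
  shows "adj_pair (pre_tensor Hs) (pre_tensor (H # Hs)) (create e) (annihilate H Hs e) (norm (hinner H e e))"
proof -
  have Hs': "\<forall>H\<in>set Hs. semi_corr H" using Hs by simp
  interpret H: semi_corr H using Hs by simp
  interpret P: semi_corr "pre_tensor Hs" by (rule semi_corr_pre_tensor[OF Hs'])
  have cr: "create e t \<in> hcarrier (pre_tensor (H # Hs))" if "t \<in> hcarrier (pre_tensor Hs)" for t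
    using pre_tensor_carrierD[OF that] e
    by (intro pre_tensor_carrierI) (auto simp: create_def elem_tensors_iff)
  have an: "annihilate H Hs e t \<in> hcarrier (pre_tensor Hs)" if "t \<in> hcarrier (pre_tensor (H # Hs))" for t
    using pre_tensor_carrierD[OF that]
    by (intro pre_tensor_carrierI)
      (auto simp: annihilate_def intro!: elem_lact_in[OF Hs'] elim!: elem_tensors_ConsE dest!: pre_tensor_carrierD[OF that])
  have adj: "hinner (pre_tensor (H # Hs)) (create e t) u = hinner (pre_tensor Hs) t (annihilate H Hs e u)"
    if t: "t \<in> hcarrier (pre_tensor Hs)" and u: "u \<in> hcarrier (pre_tensor (H # Hs))" for t u
    unfolding pre_tensor_inner create_def annihilate_def map_map o_def
  proof (intro arg_cong[of _ _ sum_list] map_cong refl)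
    fix x y assume xy: "x \<in> set t" "y \<in> set u"
    obtain k ks c where y: "y = (k # ks, c)" "k \<in> hcarrier H" "(ks, c) \<in> elem_tensors Hs"
      using pre_tensor_carrierD[OF u xy(2)] by (rule elem_tensors_ConsE)
    show "elem_inner (H # Hs) (e # fst x, snd x) y
        = elem_inner Hs x (elem_lact Hs (hinner H e (hd (fst y))) (tl (fst y), snd y))"
      using elem_inner_lact[OF Hs' pre_tensor_carrierD[OF t xy(1)] y(3)]
      by (simp add: y elem_inner_Cons[OF Hs e])
  qed
  have "hinner (pre_tensor (H # Hs)) (create e t) (create e t) \<preceq> norm (hinner H e e) *\<^sub>R hinner (pre_tensor Hs) t t"
    if t: "t \<in> hcarrier (pre_tensor Hs)" for t
  proof -
    obtain c where c: "hinner H e e = star c * c" using H.inner_pos[OF e] by (auto simp: cpos_def)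
    have "hinner (pre_tensor (H # Hs)) (create e t) (create e t)
        = hinner (pre_tensor Hs) (lact (pre_tensor Hs) c t) (lact (pre_tensor Hs) c t)"
      unfolding pre_tensor_inner create_def pre_tensor_simps map_map o_def
      using pre_tensor_carrierD[OF t]
      by (intro arg_cong[of _ _ sum_list] map_cong refl)
        (simp add: elem_inner_Cons[OF Hs e e] elem_inner_lact_lact[OF Hs'] c)
    also have "\<dots> \<preceq> (norm c)\<^sup>2 *\<^sub>R hinner (pre_tensor Hs) t t" by (rule P.lact_le[OF t])
    also have "(norm c)\<^sup>2 = norm (hinner H e e)" by (simp add: c norm_star_mult_self)
    finally show ?thesis .
  qed
  with cr an adj show ?thesis by (auto simp: adj_pair_def)
qed

text \<open>The difference of the two sides is the tensor form with coefficients C <h_i, h_j> - <z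
  h_i, z h_j>. These form a positive matrix by \<open>adj_pair_form_pos\<close>, and
  \<open>tensor_form_pos\<close> applies to the remaining legs.\<close>

lemma adj_pair_on_head:
  assumes Hs: "\<forall>H\<in>set (H # Hs). semi_corr H" and p: "adj_pair H H z z' C"
  shows "adj_pair (pre_tensor (H # Hs)) (pre_tensor (H # Hs)) (on_head z) (on_head z') C"
proof -
  have Hs': "\<forall>H\<in>set Hs. semi_corr H" using Hs by simp
  interpret H: semi_corr H using Hs by simp
  have z: "z h \<in> hcarrier H" "z' h \<in> hcarrier H" if "h \<in> hcarrier H" for h using p that by (auto simp: adj_pair_def)
  have on: "on_head w t \<in> hcarrier (pre_tensor (H # Hs))"
    if "t \<in> hcarrier (pre_tensor (H # Hs))" and w: "\<And>h. h \<in> hcarrier H \<Longrightarrow> w h \<in> hcarrier H" for t w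
  proof (rule pre_tensor_carrierI)
    fix x assume "x \<in> set (on_head w t)"
    then obtain y where y: "y \<in> set t" "x = (w (hd (fst y)) # tl (fst y), snd y)" by (auto simp: on_head_def)
    from pre_tensor_carrierD[OF that(1) y(1)] show "x \<in> elem_tensors (H # Hs)"
      by (rule elem_tensors_ConsE) (auto simp: y(2) elem_tensors_iff w)
  qed
  have adj: "hinner (pre_tensor (H # Hs)) (on_head z t) u = hinner (pre_tensor (H # Hs)) t (on_head z' u)"
    if t: "t \<in> hcarrier (pre_tensor (H # Hs))" and u: "u \<in> hcarrier (pre_tensor (H # Hs))" for t u
    unfolding pre_tensor_inner on_head_def map_map o_def
  proof (intro arg_cong[of _ _ sum_list] map_cong refl)
    fix x y assume xy: "x \<in> set t" "y \<in> set u"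
    obtain h hs b where x: "x = (h # hs, b)" "h \<in> hcarrier H"
      using pre_tensor_carrierD[OF t xy(1)] by (rule elem_tensors_ConsE)
    obtain k ks c where y: "y = (k # ks, c)" "k \<in> hcarrier H"
      using pre_tensor_carrierD[OF u xy(2)] by (rule elem_tensors_ConsE)
    have "hinner H (z h) k = hinner H h (z' k)" using p x y by (auto simp: adj_pair_def)
    then show "elem_inner (H # Hs) (z (hd (fst x)) # tl (fst x), snd x) y
        = elem_inner (H # Hs) x (z' (hd (fst y)) # tl (fst y), snd y)"
      by (simp add: x y z elem_inner_Cons[OF Hs])
  qed
  have "hinner (pre_tensor (H # Hs)) (on_head z t) (on_head z t) \<preceq> C *\<^sub>R hinner (pre_tensor (H # Hs)) t t"
    if t: "t \<in> hcarrier (pre_tensor (H # Hs))" for t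
  proof -
    let ?m = "length t"
    define h where "h i = hd (fst (t ! i))" for i
    define y where "y i = (tl (fst (t ! i)), snd (t ! i))" for i
    have x: "t ! i = (h i # fst (y i), snd (y i))" "h i \<in> hcarrier H" "y i \<in> elem_tensors Hs" if "i < ?m" for i
      using pre_tensor_carrierD[OF t nth_mem[OF that]] by (auto elim!: elem_tensors_ConsE simp: h_def y_def)
    define M where "M i j = C *\<^sub>R hinner H (h i) (h j) - hinner H (z (h i)) (z (h j))" for i j
    have "C *\<^sub>R hinner (pre_tensor (H # Hs)) t t - hinner (pre_tensor (H # Hs)) (on_head z t) (on_head z t)
        = (\<Sum>i<?m. \<Sum>j<?m. star (snd (y i)) * tensor_inner Hs (M i j) (fst (y i)) (fst (y j)) * snd (y j))"
      unfolding pre_tensor_inner on_head_def map_map o_def sum_list_nth scaleR_sum_right sum_subtractf[symmetric]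
    proof (intro sum.cong refl)
      fix i j assume ij: "i \<in> {..<?m}" "j \<in> {..<?m}"
      have yy: "elems Hs (fst (y i))" "elems Hs (fst (y j))"
        using x ij by (auto simp: elem_tensors_iff)
      show "C *\<^sub>R elem_inner (H # Hs) (t ! i) (t ! j)
          - elem_inner (H # Hs) (z (hd (fst (t ! i))) # tl (fst (t ! i)), snd (t ! i))
              (z (hd (fst (t ! j))) # tl (fst (t ! j)), snd (t ! j))
        = star (snd (y i)) * tensor_inner Hs (M i j) (fst (y i)) (fst (y j)) * snd (y j)"
        using ij by (simp add: x z elem_inner_Cons[OF Hs] M_def tensor_inner_minus[OF Hs' yy]
            tensor_inner_scaleR[OF Hs' yy] algebra_simps)
    qed
    moreover have "cpos \<dots>"
    proof (rule tensor_form_pos[OF Hs'])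
      show "pos_matrix ?m M"
      proof (rule pos_matrix_of_form)
        fix b :: "nat \<Rightarrow> 'a"
        show "cpos (\<Sum>i<?m. \<Sum>j<?m. star (b i) * M i j * b j)"
          unfolding M_def by (rule adj_pair_form_pos[OF _ _ p]) (use Hs x in auto)
      qed (simp add: M_def star_diff star_scaleR H.inner_sym x z)
    qed (auto intro: elem_inner_pos[OF Hs'] x)
    ultimately show ?thesis by (simp add: cle_def)
  qed
  with on z p adj show ?thesis by (auto simp: adj_pair_def)
qed

section \<open>Noncommutative polynomials\<close>

lemma nc_const_add: "nc_const (a + b) = nc_const a + nc_const b"
  by transfer (rule nc_Const_add)

lemma nc_const_1: "nc_const 1 = 1"
  by transfer (rule nc_refl)

lemma nc_star_mult: "nc_star (p * q) = nc_star q * nc_star p"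
  and nc_star_const: "nc_star (nc_const b) = nc_const (star b)"
  and nc_star_var: "nc_star nc_var = nc_var"
  by (transfer, simp add: nc_refl)+

lemma nc_const_mult: "nc_const (a * b) = nc_const a * nc_const b"
  by transfer (rule nc_Const_mult)

lemma ncpoly_induct [case_names const var add mult]:
  assumes "\<And>b. P (nc_const b)" "P nc_var" "\<And>p q. P p \<Longrightarrow> P q \<Longrightarrow> P (p + q)" "\<And>p q. P p \<Longrightarrow> P q \<Longrightarrow> P (p * q)"
  shows "P p"
proof -
  have "P (abs_ncpoly e)" for e
    by (induction e) (use assms in \<open>simp_all add: nc_const.abs_eq[symmetric] nc_var.abs_eq[symmetric]
      plus_ncpoly.abs_eq[symmetric] times_ncpoly.abs_eq[symmetric]\<close>)
  then show ?thesis by (metis Quotient3_abs_rep Quotient3_ncpoly)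
qed

lemma nc_scalar_commute: "nc_const (scaleC c 1) * p = p * nc_const (scaleC c 1)"
proof (induction p rule: ncpoly_induct)
  case (const b)
  have "scaleC c 1 * b = b * scaleC c 1" by (simp add: mult_scaleC_left mult_scaleC_right)
  then show ?case by (metis nc_const_mult)
next
  case var
  show ?case by transfer (rule nc_scalar)
next
  case (mult p q)
  then show ?case by (metis mult.assoc)
qed (simp add: distrib_left distrib_right)

lemma nc_star_power: "nc_star (nc_var ^ k) = nc_var ^ k"
  by (induction k) (simp_all add: nc_star_mult nc_star_var power_commutes nc_const_1[symmetric] nc_star_const star_one)

text \<open>\<open>R\<close>-weighted \<open>l\<^sup>1\<close>-bounds for representations of a polynomial as a sum of monomials.\<close>

inductive nc_bound :: "real \<Rightarrow> 'b::cstar_algebra ncpoly \<Rightarrow> real \<Rightarrow> bool" for R where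
  monom: "R ^ length bs * (norm b * prod_list (map norm bs)) \<le> c \<Longrightarrow> nc_bound R (nc_monom b bs) c"
| add: "nc_bound R p c \<Longrightarrow> nc_bound R q d \<Longrightarrow> nc_bound R (p + q) (c + d)"

lemma prod_list_norm_nonneg: "prod_list (map norm bs) \<ge> 0"
  by (induction bs) auto

lemma nc_bound_nonneg: "nc_bound R p c \<Longrightarrow> R \<ge> 0 \<Longrightarrow> c \<ge> 0"
proof (induction rule: nc_bound.induct)
  case (monom bs b c)
  then show ?case using prod_list_norm_nonneg[of bs]
    by (meson mult_nonneg_nonneg norm_ge_zero order_trans zero_le_power)
qed simp

text \<open>The last coefficient of the first monomial and the first one of the second merge into
  one; submultiplicativity of the norm leaves an inequality.\<close>

lemma nc_monom_mult:
  assumes "R \<ge> 0"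
  shows "\<exists>b' bs'. nc_monom b bs * nc_monom c cs = nc_monom b' bs' \<and>
    R ^ length bs' * (norm b' * prod_list (map norm bs'))
      \<le> (R ^ length bs * (norm b * prod_list (map norm bs))) * (R ^ length cs * (norm c * prod_list (map norm cs)))"
proof (induction bs arbitrary: b)
  case Nil
  have "nc_monom b [] * nc_monom c cs = nc_monom (b * c) cs"
    by (cases cs) (simp_all add: nc_const_mult mult.assoc)
  moreover have "R ^ length cs * (norm (b * c) * prod_list (map norm cs))
      \<le> R ^ length cs * ((norm b * norm c) * prod_list (map norm cs))"
    using assms by (intro mult_left_mono mult_right_mono norm_mult_ineq prod_list_norm_nonneg) auto
  ultimately show ?case by (intro exI[of _ "b * c"] exI[of _ cs]) (simp add: mult_ac)
next
  case (Cons a bs)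
  from Cons[of a] obtain b' bs' where IH: "nc_monom a bs * nc_monom c cs = nc_monom b' bs'"
    "R ^ length bs' * (norm b' * prod_list (map norm bs'))
      \<le> (R ^ length bs * (norm a * prod_list (map norm bs))) * (R ^ length cs * (norm c * prod_list (map norm cs)))"
    by blast
  have "nc_monom b (a # bs) * nc_monom c cs = nc_monom b (b' # bs')"
    by (simp add: mult.assoc IH(1))
  moreover have "(R * norm b) * (R ^ length bs' * (norm b' * prod_list (map norm bs')))
      \<le> (R * norm b) * ((R ^ length bs * (norm a * prod_list (map norm bs))) * (R ^ length cs * (norm c * prod_list (map norm cs))))"
    by (intro mult_left_mono IH(2)) (use assms in auto)
  ultimately show ?case by (intro exI[of _ b] exI[of _ "b' # bs'"]) (simp add: mult_ac)
qed

lemma nc_bound_mult: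
  assumes "nc_bound R p c" "nc_bound R q d" "R \<ge> 0"
  shows "nc_bound R (p * q) (c * d)"
  using assms(1)
proof (induction rule: nc_bound.induct)
  case (monom bs b c)
  have "nc_bound R (nc_monom b bs * q) (c * d)"
    using assms(2)
  proof (induction rule: nc_bound.induct)
    case (monom cs a d)
    obtain b' bs' where m: "nc_monom b bs * nc_monom a cs = nc_monom b' bs'"
      "R ^ length bs' * (norm b' * prod_list (map norm bs'))
        \<le> (R ^ length bs * (norm b * prod_list (map norm bs))) * (R ^ length cs * (norm a * prod_list (map norm cs)))"
      using nc_monom_mult[OF assms(3)] by blast
    note m(2)
    also have "(R ^ length bs * (norm b * prod_list (map norm bs))) * (R ^ length cs * (norm a * prod_list (map norm cs))) \<le> c * d"
      using \<open>R ^ length bs * (norm b * prod_list (map norm bs)) \<le> c\<close> monom assms(3) prod_list_norm_nonneg[of cs]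
        nc_bound_nonneg[OF nc_bound.monom[OF \<open>R ^ length bs * (norm b * prod_list (map norm bs)) \<le> c\<close>] assms(3)]
      by (intro mult_mono) auto
    finally show ?case unfolding m(1) by (rule nc_bound.monom)
  qed (simp add: distrib_left nc_bound.add)
  then show ?case .
next
  case (add p c q' d')
  then show ?case by (simp add: distrib_right nc_bound.add)
qed

lemma nc_bound_var: "R \<ge> 0 \<Longrightarrow> nc_bound R nc_var R"
  using nc_bound.monom[of R "[1]" 1 R] by (simp add: nc_const_1)

lemma nc_bound_var_power: "R \<ge> 0 \<Longrightarrow> nc_bound R (nc_var ^ k) (R ^ k)"
proof (induction k)
  case 0
  show ?case using nc_bound.monom[of R "[]" 1 1] by (simp add: nc_const_1)
next
  case (Suc k)
  then show ?case using nc_bound_mult[OF nc_bound_var Suc.IH] by simp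
qed

lemma nc_bound_exists: "R \<ge> 0 \<Longrightarrow> \<exists>c. nc_bound R p c"
proof (induction p rule: ncpoly_induct)
  case (const b)
  show ?case using nc_bound.monom[of R "[]" b "norm b"] by auto
qed (blast intro: nc_bound_var nc_bound.add nc_bound_mult)+

section \<open>The space \<open>L\<^sup>2(\<B>\<langle>X\<rangle>, \<mu>)\<close>\<close>

context
  fixes \<mu> :: "'b::cstar_algebra ncpoly \<Rightarrow> 'b"
  assumes law: "bvalued_law \<mu>"
begin

lemma law_add: "\<mu> (p + q) = \<mu> p + \<mu> q"
  and law_one: "\<mu> 1 = 1"
  and law_bimod: "\<mu> (nc_const b * p * nc_const c) = b * \<mu> p * c"
  using law by (auto simp: bvalued_law_def)

lemma law_right: "\<mu> (p * nc_const c) = \<mu> p * c"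
  using law_bimod[of 1 p c] by (simp add: nc_const_1)

lemma law_0: "\<mu> 0 = 0"
  using law_add[of 0 0] by simp

lemma law_pos_matrix: "pos_matrix m (\<lambda>i j. \<mu> (\<Sum>k<m. nc_star (P k i) * P k j))"
  using law unfolding bvalued_law_def by (elim conjE allE)

lemma law_pos: "cpos (\<mu> (nc_star p * p))"
proof -
  have "pos_matrix 1 (\<lambda>i j. \<mu> (\<Sum>k<1::nat. nc_star p * p))"
    by (rule law_pos_matrix[of 1 "\<lambda>_ _. p"])
  then show ?thesis by (auto simp: pos_matrix_def cpos_def)
qed

text \<open>Hermitian symmetry is not an axiom of a law. It is read off from the off-diagonal
  entries of a positive 2 by 2 matrix, with \<open>p\<close> and \<open>q\<close> placed in row 0 of
  \<open>P\<close>.\<close>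

lemma law_star: "star (\<mu> (nc_star p * q)) = \<mu> (nc_star q * p)"
proof -
  define P where "P k i = (if k = (0::nat) then if i = (0::nat) then p else q else 0)" for k i
  have "pos_matrix 2 (\<lambda>i j. \<mu> (\<Sum>k<2. nc_star (P k i) * P k j))"
    by (rule law_pos_matrix)
  then obtain C where C: "\<forall>i<2. \<forall>j<2. \<mu> (\<Sum>k<2. nc_star (P k i) * P k j) = (\<Sum>k<2::nat. star (C k i) * C k j)"
    unfolding pos_matrix_def by (elim exE)
  have S: "(\<Sum>k<2. F k) = F 0 + F 1" for F :: "nat \<Rightarrow> 'x::comm_monoid_add"
    by (simp add: numeral_2_eq_2)
  have "\<mu> (nc_star p * q) = star (C 0 0) * C 0 1 + star (C 1 0) * C 1 1"
    "\<mu> (nc_star q * p) = star (C 0 1) * C 0 0 + star (C 1 1) * C 1 0"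
    using C[rule_format, of 0 1] C[rule_format, of 1 0] unfolding S P_def by auto
  then show ?thesis by (simp add: star_add star_mult star_star)
qed

lemma semi_corr_pre_L2: "semi_corr (pre_L2 \<mu>)"
proof
  fix h k l :: "'b ncpoly" and a b :: 'b and c :: complex
  have s: "hinner (pre_L2 \<mu>) p q = \<mu> (nc_star p * q)" "lact (pre_L2 \<mu>) a p = nc_const a * p"
    "ract (pre_L2 \<mu>) p a = p * nc_const a" for p q a
    by (simp_all add: pre_L2_def)
  show "star (hinner (pre_L2 \<mu>) h k) = hinner (pre_L2 \<mu>) k h" by (simp add: s law_star)
  show "hinner (pre_L2 \<mu>) h (ract (pre_L2 \<mu>) k a) = hinner (pre_L2 \<mu>) h k * a"
    by (simp add: s law_right mult.assoc[symmetric])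
  show "hinner (pre_L2 \<mu>) h (lact (pre_L2 \<mu>) a k) = hinner (pre_L2 \<mu>) (lact (pre_L2 \<mu>) (star a) h) k"
    by (simp add: s nc_star_mult nc_star_const star_star mult.assoc)
  show "hinner (pre_L2 \<mu>) h (lact (pre_L2 \<mu>) (scaleC c 1) k) = hinner (pre_L2 \<mu>) h k * scaleC c 1"
    by (simp add: s nc_scalar_commute law_right mult.assoc[symmetric])
  show "cpos (hinner (pre_L2 \<mu>) h h)" by (simp add: s law_pos)
qed (simp_all add: pre_L2_def law_add law_0 distrib_left distrib_right nc_const_mult nc_const_add mult.assoc)

text \<open>The moments \<mu>(p^* X^(2k) p) grow at most like R^(2k), with a constant depending on
  p. Their Hankel forms are inner squares of combinations of the X^(2i) p, so
  \<open>moment_bound\<close> turns the growth rate into the inequality X^2 <= R^2 at p, free of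
  that constant.\<close>

lemma adj_pair_var_exp_bounded:
  assumes "exp_bounded_by \<mu> R"
  shows "adj_pair (pre_L2 \<mu>) (pre_L2 \<mu>) ((*) nc_var) ((*) nc_var) (R\<^sup>2)"
proof -
  interpret P: semi_corr "pre_L2 \<mu>" by (rule semi_corr_pre_L2)
  from assms obtain M where R: "R > 0" and M: "M > 0"
    "\<And>b bs. norm (\<mu> (nc_monom b bs)) \<le> M * R ^ length bs * (norm b * prod_list (map norm bs))"
    unfolding exp_bounded_by_def by blast
  have bound: "norm (\<mu> p) \<le> M * c" if "nc_bound R p c" for p c
    using that
  proof (induction rule: nc_bound.induct)
    case (monom bs b c)
    then have "M * (R ^ length bs * (norm b * prod_list (map norm bs))) \<le> M * c" using M(1) by simp
    then show ?case using M(2)[of b bs] by (simp add: mult.assoc)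
  next
    case (add p c q d)
    then show ?case using norm_triangle_ineq[of "\<mu> p" "\<mu> q"] by (simp add: law_add distrib_left)
  qed
  have main: "\<mu> (nc_star (nc_var * p) * (nc_var * p)) \<preceq> R\<^sup>2 *\<^sub>R \<mu> (nc_star p * p)" for p
  proof -
    have car: "q \<in> hcarrier (pre_L2 \<mu>)" for q by (simp add: pre_L2_def)
    define m where "m k = \<mu> (nc_star p * nc_var ^ (2 * k) * p)" for k
    obtain c where c: "nc_bound R p c" using nc_bound_exists R by (metis less_imp_le)
    obtain d where d: "nc_bound R (nc_star p) d" using nc_bound_exists R by (metis less_imp_le)
    have "m 1 \<preceq> R\<^sup>2 *\<^sub>R m 0"
    proof (rule moment_bound)
      fix N :: nat and a :: "nat \<Rightarrow> real"
      let ?h = "\<lambda>i. nc_var ^ (2 * i) * p" and ?b = "\<lambda>i. of_real (a i) :: 'b"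
      \<comment> \<open>Hankel sums include the index \<open>N\<close>, while
        \<open>lin_comb\<close> stops before its bound.\<close>
      define n where "n = Suc N"
      let ?l = "P.lin_comb ?h ?b n"
      have "cpos (hinner (pre_L2 \<mu>) ?l ?l)" by (rule P.inner_pos[OF car])
      also have "hinner (pre_L2 \<mu>) ?l ?l = (\<Sum>i<n. \<Sum>j<n. ?b i * hinner (pre_L2 \<mu>) (?h i) (?h j) * ?b j)"
        by (subst P.inner_lin_comb_left)
          (simp_all add: car P.inner_lin_comb star_of_real sum_distrib_left mult.assoc)
      also have "\<dots> = (\<Sum>i\<le>N. \<Sum>j\<le>N. (a i * a j) *\<^sub>R m (i + j))"
        unfolding n_def lessThan_Suc_atMost
        by (intro sum.cong refl) (simp add: pre_L2_def m_def nc_star_mult nc_star_power of_real_def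
            mult.assoc power_add distrib_left)
      finally show "cpos (\<Sum>i\<le>N. \<Sum>j\<le>N. (a i * a j) *\<^sub>R m (i + j))" .
    next
      fix k
      have "nc_bound R (nc_star p * nc_var ^ (2 * k) * p) (d * R ^ (2 * k) * c)"
        using R by (intro nc_bound_mult nc_bound_var_power c d) auto
      from bound[OF this] show "norm (m k) \<le> (M * d * c) * (R\<^sup>2) ^ k"
        by (simp add: m_def power_mult[symmetric] mult_ac)
    qed simp
    then show ?thesis by (simp add: m_def nc_star_mult nc_star_var power2_eq_square mult.assoc)
  qed
  then show ?thesis
    unfolding adj_pair_def by (simp add: pre_L2_def nc_star_mult nc_star_var mult.assoc)
qed

text \<open>The radius is an infimum that need not be attained, so the bound is proved for every
  constant above R^2 and passed to the limit.\<close>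

lemma adj_pair_var:
  assumes "law_radius \<mu> \<le> R"
  shows "R \<ge> 0" "adj_pair (pre_L2 \<mu>) (pre_L2 \<mu>) ((*) nc_var) ((*) nc_var) (R\<^sup>2)"
proof -
  let ?S = "{R. exp_bounded_by \<mu> R}"
  have ne: "?S \<noteq> {}" using law by (auto simp: bvalued_law_def)
  have pos: "\<And>R. R \<in> ?S \<Longrightarrow> R > 0" by (auto simp: exp_bounded_by_def)
  then have "0 \<le> Inf ?S" by (intro cInf_greatest ne) (auto intro: less_imp_le)
  then show R: "R \<ge> 0" using assms by (simp add: law_radius_def)
  have "hinner (pre_L2 \<mu>) (nc_var * h) (nc_var * h) \<preceq> R\<^sup>2 *\<^sub>R hinner (pre_L2 \<mu>) h h" for h
  proof (rule cle_scaleR_limit)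
    fix D assume D: "D > R\<^sup>2"
    then have "sqrt D > R" using R real_less_rsqrt by blast
    then have "Inf ?S < sqrt D" using assms by (simp add: law_radius_def)
    then obtain r where r: "exp_bounded_by \<mu> r" "r < sqrt D" using cInf_lessD[OF ne] by blast
    have "r\<^sup>2 \<le> (sqrt D)\<^sup>2" using r pos[of r] by (intro power_mono) auto
    also have "\<dots> = D" using D zero_le_power2[of R] by (intro real_sqrt_pow2) linarith
    finally have "adj_pair (pre_L2 \<mu>) (pre_L2 \<mu>) ((*) nc_var) ((*) nc_var) D"
      by (rule adj_pair_mono[OF semi_corr_pre_L2 adj_pair_var_exp_bounded[OF r(1)]])
    then show "hinner (pre_L2 \<mu>) (nc_var * h) (nc_var * h) \<preceq> D *\<^sub>R hinner (pre_L2 \<mu>) h h"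
      by (auto simp: adj_pair_def pre_L2_def)
  qed
  then show "adj_pair (pre_L2 \<mu>) (pre_L2 \<mu>) ((*) nc_var) ((*) nc_var) (R\<^sup>2)"
    unfolding adj_pair_def by (simp add: pre_L2_def nc_star_mult nc_star_var mult.assoc)
qed

end

text \<open>What the tree construction uses of a law: a central unit vector, a symmetric
  \<open>X\<close> bounded by \<open>R\<close>, mean zero and the variance. All higher moments sit
  in the compression of \<open>X\<close>, which is estimated and never computed.\<close>

locale leg = nondegenerate_corr H for H :: "('b::cstar_algebra, 'h) corr" +
  fixes \<xi> :: 'h and X :: "'h \<Rightarrow> 'h" and \<eta> :: "'b \<Rightarrow> 'b" and R :: real
  assumes \<xi>_in: "\<xi> \<in> hcarrier H"
    and \<xi>_unit: "hinner H \<xi> \<xi> = 1"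
    and \<xi>_central: "lact H b \<xi> = ract H \<xi> b"
    and R_nonneg: "R \<ge> 0"
    and X_adj: "adj_pair H H X X (R\<^sup>2)"
    and X_mean: "hinner H \<xi> (X \<xi>) = 0"
    and X_variance: "hinner H (X \<xi>) (lact H b (X \<xi>)) = \<eta> b"

lemma leg_L2:
  assumes law: "bvalued_law \<mu>" and R: "law_radius \<mu> \<le> R" and mean: "mean_zero \<mu>" and var: "has_variance \<mu> \<eta>"
  shows "leg (L2 \<mu>) (L2_one \<mu>) (L2_var \<mu>) \<eta> R"
proof -
  note sc = semi_corr_pre_L2[OF law]
  interpret P: semi_corr "pre_L2 \<mu>" by (rule sc)
  interpret S: nondegenerate_corr "L2 \<mu>" unfolding L2_def by (rule P.nondegenerate_sep)
  note lift = adj_pair_lift[OF sc sc adj_pair_var(2)[OF law R]]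
  have car: "p \<in> hcarrier (pre_L2 \<mu>)" for p by (simp add: pre_L2_def)
  have var_eq: "L2_var \<mu> U = lift_op (pre_L2 \<mu>) ((*) nc_var) U" if "U \<in> hcarrier (L2 \<mu>)" for U
    using that by (simp add: L2_var_def lift_op_def)
  have one_in: "L2_one \<mu> \<in> hcarrier (L2 \<mu>)" unfolding L2_one_def L2_def by (rule P.embed_in[OF car])
  have X1: "L2_var \<mu> (L2_one \<mu>) = embed_compl (pre_L2 \<mu>) nc_var"
    unfolding var_eq[OF one_in] unfolding L2_one_def lift(2)[OF car] by simp
  have inner: "hinner (L2 \<mu>) (embed_compl (pre_L2 \<mu>) p) (embed_compl (pre_L2 \<mu>) q) = \<mu> (nc_star p * q)" for p q
    unfolding L2_def P.sep_inner_embed[OF car car] by (simp add: pre_L2_def)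
  have lact: "lact (L2 \<mu>) b (embed_compl (pre_L2 \<mu>) p) = embed_compl (pre_L2 \<mu>) (nc_const b * p)" for b p
    unfolding L2_def P.embed_lact[OF car] by (simp add: pre_L2_def)
  have ract: "ract (L2 \<mu>) (embed_compl (pre_L2 \<mu>) p) b = embed_compl (pre_L2 \<mu>) (p * nc_const b)" for b p
    unfolding L2_def P.embed_ract[OF car] by (simp add: pre_L2_def)
  have star1: "nc_star 1 = (1 :: 'a ncpoly)" by (metis nc_const_1 nc_star_const star_one)
  show ?thesis
  proof
    show "L2_one \<mu> \<in> hcarrier (L2 \<mu>)" by (rule one_in)
    show "hinner (L2 \<mu>) (L2_one \<mu>) (L2_one \<mu>) = 1"
      unfolding L2_one_def inner by (simp add: star1 law_one[OF law])
    show "lact (L2 \<mu>) b (L2_one \<mu>) = ract (L2 \<mu>) (L2_one \<mu>) b" for b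
      unfolding L2_one_def lact ract by simp
    show "R \<ge> 0" by (rule adj_pair_var(1)[OF law R])
    show "adj_pair (L2 \<mu>) (L2 \<mu>) (L2_var \<mu>) (L2_var \<mu>) (R\<^sup>2)"
      using lift(1) var_eq unfolding adj_pair_def L2_def by (auto simp: Pi_iff)
    show "hinner (L2 \<mu>) (L2_one \<mu>) (L2_var \<mu> (L2_one \<mu>)) = 0"
      unfolding X1 unfolding L2_one_def inner using mean by (simp add: star1 mean_zero_def)
    show "hinner (L2 \<mu>) (L2_var \<mu> (L2_one \<mu>)) (lact (L2 \<mu>) b (L2_var \<mu> (L2_one \<mu>))) = \<eta> b" for b
      unfolding X1 lact inner using var by (simp add: nc_star_var has_variance_def mult.assoc)
  qed
qed

context leg
begin

abbreviation "Hc \<equiv> compl_vec H \<xi>"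
abbreviation "e \<equiv> X \<xi>"

definition z :: "'h \<Rightarrow> 'h" where
  "z h = proj_compl H \<xi> (X h)"

lemma X_in: "h \<in> hcarrier H \<Longrightarrow> X h \<in> hcarrier H"
  using X_adj by (auto simp: adj_pair_def)

lemma X_sym: "\<lbrakk>h \<in> hcarrier H; k \<in> hcarrier H\<rbrakk> \<Longrightarrow> hinner H (X h) k = hinner H h (X k)"
  using X_adj by (auto simp: adj_pair_def)

lemma Hc_carrier: "h \<in> hcarrier Hc \<longleftrightarrow> h \<in> hcarrier H \<and> hinner H h \<xi> = 0"
  by (auto simp: compl_vec_def)

lemma Hc_carrierD: "h \<in> hcarrier Hc \<Longrightarrow> h \<in> hcarrier H" "h \<in> hcarrier Hc \<Longrightarrow> hinner H \<xi> h = 0"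
  using inner_sym[of h \<xi>] \<xi>_in by (auto simp: Hc_carrier star_zero)

lemma Hc_simps: "hzero Hc = hzero H" "hadd Hc = hadd H" "lact Hc = lact H" "ract Hc = ract H" "hinner Hc = hinner H"
  by (simp_all add: compl_vec_def)

lemma semi_corr_Hc: "semi_corr Hc"
proof
  fix h a assume h: "h \<in> hcarrier Hc"
  then show "lact Hc a h \<in> hcarrier Hc"
    by (simp add: Hc_carrier Hc_simps closed inner_lact_left \<xi>_in \<xi>_central inner_ract)
qed (auto simp: Hc_carrier Hc_simps closed inner_simps \<xi>_in inner_sym lact_mult lact_add lact_scalar inner_pos
    intro: inner_lact)

lemma proj_in_H: "h \<in> hcarrier H \<Longrightarrow> proj_compl H \<xi> h \<in> hcarrier H"
  by (simp add: proj_compl_def minus_in closed \<xi>_in)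

lemma proj_in: "h \<in> hcarrier H \<Longrightarrow> proj_compl H \<xi> h \<in> hcarrier Hc"
  by (simp add: Hc_carrier proj_in_H) (simp add: proj_compl_def minus_in closed \<xi>_in inner_simps \<xi>_unit inner_sym)

lemma inner_proj: "h \<in> hcarrier H \<Longrightarrow> k \<in> hcarrier Hc \<Longrightarrow> hinner H k (proj_compl H \<xi> h) = hinner H k h"
  by (simp add: proj_compl_def inner_simps closed \<xi>_in Hc_carrier)

lemma inner_proj_left: "h \<in> hcarrier H \<Longrightarrow> k \<in> hcarrier Hc \<Longrightarrow> hinner H (proj_compl H \<xi> h) k = hinner H h k"
  by (simp add: proj_compl_def inner_simps closed \<xi>_in Hc_carrierD)

lemma proj_id:
  assumes "h \<in> hcarrier Hc" shows "proj_compl H \<xi> h = h"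
proof (rule ext)
  show "hinner H l (proj_compl H \<xi> h) = hinner H l h" if "l \<in> hcarrier H" for l
    using that assms by (simp add: proj_compl_def inner_simps closed \<xi>_in Hc_carrierD)
qed (use assms in \<open>simp_all add: proj_in_H Hc_carrierD\<close>)

lemma proj_le:
  assumes "h \<in> hcarrier H"
  shows "hinner H (proj_compl H \<xi> h) (proj_compl H \<xi> h) \<preceq> hinner H h h"
proof -
  have "hinner H (proj_compl H \<xi> h) (proj_compl H \<xi> h) = hinner H h h - star (hinner H \<xi> h) * hinner H \<xi> h"
    using assms by (simp add: inner_proj_left proj_in)
      (simp add: proj_compl_def inner_simps closed \<xi>_in inner_sym)
  then show ?thesis by (simp add: cle_def cpos_star_mult)
qed

lemma z_in: "h \<in> hcarrier Hc \<Longrightarrow> z h \<in> hcarrier Hc"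
  by (simp add: z_def proj_in X_in Hc_carrierD)

lemma z_adj: "adj_pair Hc Hc z z (R\<^sup>2)"
  unfolding adj_pair_def Hc_simps
proof (intro conjI ballI)
  fix h k assume hk: "h \<in> hcarrier Hc" "k \<in> hcarrier Hc"
  show "hinner H (z h) k = hinner H h (z k)"
    using hk by (simp add: z_def inner_proj inner_proj_left X_in Hc_carrierD X_sym)
next
  fix h assume h: "h \<in> hcarrier Hc"
  have "hinner H (z h) (z h) \<preceq> hinner H (X h) (X h)"
    unfolding z_def by (rule proj_le) (simp add: X_in Hc_carrierD h)
  also have "\<dots> \<preceq> R\<^sup>2 *\<^sub>R hinner H h h"
    using X_adj Hc_carrierD[OF h] by (auto simp: adj_pair_def)
  finally show "hinner H (z h) (z h) \<preceq> R\<^sup>2 *\<^sub>R hinner H h h" .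
qed (auto simp: z_in)

lemma e_in: "e \<in> hcarrier Hc"
  by (simp add: Hc_carrier X_in X_sym \<xi>_in X_mean)

lemma e_variance: "hinner Hc e (lact Hc b e) = \<eta> b"
  by (simp add: Hc_simps X_variance)

lemma e_norm: "norm (hinner Hc e e) = norm (\<eta> 1)"
  using e_variance[of 1] lact_one[of e e] e_in by (simp add: Hc_simps Hc_carrierD)

text \<open>The complement part of X h, tested against \<open>k\<close>: the vacuum part of
  \<open>h\<close> is sent to X \<xi>, and the complement part of \<open>h\<close> is
  compressed.\<close>

lemma X_decomp:
  assumes h: "h \<in> hcarrier H" and k: "k \<in> hcarrier Hc"
  shows "hinner H (X h) k = star (hinner H \<xi> h) * hinner H e k + hinner H (z (proj_compl H \<xi> h)) k"
proof -
  have Xk: "X k \<in> hcarrier H" using X_in Hc_carrierD k by simp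
  have "hinner H (z (proj_compl H \<xi> h)) k = hinner H (proj_compl H \<xi> h) (X k)"
    using k h by (simp add: z_def inner_proj_left X_in proj_in_H X_sym Hc_carrierD)
  also have "\<dots> = hinner H h (X k) - star (hinner H \<xi> h) * hinner H \<xi> (X k)"
    using h Xk by (simp add: proj_compl_def inner_simps closed \<xi>_in)
  finally show ?thesis using h k by (simp add: X_sym Hc_carrierD \<xi>_in)
qed

text \<open>The vacuum part of X h pairs X \<xi> with the complement part of \<open>h\<close> alone,
  since X \<xi> is orthogonal to \<xi> by the vanishing mean.\<close>

lemma inner_\<xi>_X:
  assumes h: "h \<in> hcarrier H"
  shows "hinner H \<xi> (X h) = hinner H e (proj_compl H \<xi> h)"
  using h X_sym[OF \<xi>_in h] e_in by (simp add: inner_proj)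

end

section \<open>Direct sums\<close>

text \<open>The Cauchy criterion for unconditional sums. Sums of positive elements of a C*-algebra
  need not converge absolutely, so domination has to go through the norms of finite sums over remote
  index sets.\<close>

lemma summable_on_vanishing:
  fixes f :: "'i \<Rightarrow> 'b::banach"
  assumes van: "\<And>d. d > 0 \<Longrightarrow> \<exists>A. finite A \<and> A \<subseteq> I \<and> (\<forall>F. finite F \<and> F \<subseteq> I \<and> F \<inter> A = {} \<longrightarrow> norm (sum f F) < d)"
  shows "f summable_on I"
proof -
  have "\<exists>P. eventually P (finite_subsets_at_top I) \<and> (\<forall>F F'. P F \<and> P F' \<longrightarrow> dist (sum f F) (sum f F') < d)"
    if "d > 0" for d
  proof -
    have "d / 2 > 0" using that by simp
    from van[OF this] obtain A where A: "finite A" "A \<subseteq> I"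
      "\<forall>F. finite F \<and> F \<subseteq> I \<and> F \<inter> A = {} \<longrightarrow> norm (sum f F) < d / 2" by (elim exE conjE)
    let ?P = "\<lambda>F. finite F \<and> A \<subseteq> F \<and> F \<subseteq> I"
    have "dist (sum f F) (sum f F') < d" if F: "?P F" and F': "?P F'" for F F'
    proof -
      have "sum f F - sum f F' = sum f (F - A) - sum f (F' - A)"
        using A(1) F F' by (simp add: sum_diff)
      moreover have "norm (sum f (F - A)) < d / 2" "norm (sum f (F' - A)) < d / 2"
        using A(3)[rule_format, of "F - A"] A(3)[rule_format, of "F' - A"] F F' by auto
      ultimately show ?thesis
        using norm_triangle_ineq4[of "sum f (F - A)" "sum f (F' - A)"] by (simp add: dist_norm)
    qed
    moreover have "eventually ?P (finite_subsets_at_top I)"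
      unfolding eventually_finite_subsets_at_top using A by auto
    ultimately show ?thesis by (intro exI[of _ ?P]) blast
  qed
  then have "cauchy_filter (filtermap (sum f) (finite_subsets_at_top I))"
    by (simp add: cauchy_filter_metric_filtermap)
  moreover have "complete (UNIV :: 'b set)"
    by (meson Cauchy_convergent UNIV_I complete_def convergent_def)
  ultimately obtain L where "(sum f \<longlongrightarrow> L) (finite_subsets_at_top I)"
    using complete_uniform[where S = UNIV] by (force simp add: filterlim_def)
  then show ?thesis using summable_on_def has_sum_def by blast
qed

lemma summable_on_tail:
  fixes f :: "'i \<Rightarrow> 'b::banach"
  assumes "f summable_on I" "d > 0"
  shows "\<exists>A. finite A \<and> A \<subseteq> I \<and> (\<forall>F. finite F \<and> F \<subseteq> I \<and> F \<inter> A = {} \<longrightarrow> norm (sum f F) < d)"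
proof -
  from assms have "(sum f \<longlongrightarrow> infsum f I) (finite_subsets_at_top I)"
    by (simp add: has_sum_def[symmetric])
  then have "\<forall>\<^sub>F F in finite_subsets_at_top I. dist (sum f F) (infsum f I) < d / 2"
    using assms(2) by (intro tendstoD) auto
  then obtain A where A: "finite A" "A \<subseteq> I"
    "\<forall>F. finite F \<and> A \<subseteq> F \<and> F \<subseteq> I \<longrightarrow> dist (sum f F) (infsum f I) < d / 2"
    unfolding eventually_finite_subsets_at_top by (elim exE conjE)
  have "norm (sum f F) < d" if F: "finite F" "F \<subseteq> I" "F \<inter> A = {}" for F
  proof -
    have "dist (sum f (A \<union> F)) (infsum f I) < d / 2" "dist (sum f A) (infsum f I) < d / 2"
      using A F by (auto intro!: A(3)[rule_format])
    then have "dist (sum f (A \<union> F)) (sum f A) < d"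
      using dist_triangle2[of "sum f (A \<union> F)" "sum f A" "infsum f I"] by linarith
    moreover have "sum f (A \<union> F) = sum f A + sum f F"
      using A F by (intro sum.union_disjoint) auto
    ultimately show ?thesis by (simp add: dist_norm)
  qed
  with A(1,2) show ?thesis by (intro exI[of _ A]) simp
qed

text \<open>Positive elements form a closed set. With \<open>r = 1\<close> this gives upper bounds
  of a sum, with \<open>r = -1\<close> lower bounds by finite partial sums.\<close>

lemma has_sum_cpos_diff:
  fixes f :: "'i \<Rightarrow> 'b::cstar_algebra"
  assumes "(f has_sum S) I" "\<And>F. finite F \<Longrightarrow> F \<subseteq> I \<Longrightarrow> A \<subseteq> F \<Longrightarrow> cpos (c - r *\<^sub>R sum f F)" "finite A" "A \<subseteq> I"
  shows "cpos (c - r *\<^sub>R S)"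
proof -
  have "closed {a :: 'b. cpos a}"
    unfolding closed_sequential_limits using cpos_limit by blast
  moreover have "((\<lambda>F. c - r *\<^sub>R sum f F) \<longlongrightarrow> c - r *\<^sub>R S) (finite_subsets_at_top I)"
    using assms(1) unfolding has_sum_def by (intro tendsto_intros)
  moreover have "\<forall>\<^sub>F F in finite_subsets_at_top I. c - r *\<^sub>R sum f F \<in> {a. cpos a}"
    unfolding eventually_finite_subsets_at_top using assms(2-4) by auto
  ultimately have "c - r *\<^sub>R S \<in> {a. cpos a}"
    by (intro Lim_in_closed_set[of _ "\<lambda>F. c - r *\<^sub>R sum f F" "finite_subsets_at_top I"]) auto
  then show ?thesis by simp
qed

lemma has_sum_cle_bound:
  assumes "(f has_sum S) I" "\<And>F. finite F \<Longrightarrow> F \<subseteq> I \<Longrightarrow> sum f F \<preceq> c"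
  shows "S \<preceq> (c::'b::cstar_algebra)"
  using has_sum_cpos_diff[OF assms(1), of "{}" c 1] assms(2) by (simp add: cle_def)

lemma sum_cle_infsum:
  assumes "f summable_on I" "\<And>i. i \<in> I \<Longrightarrow> cpos (f i)" "finite A" "A \<subseteq> I"
  shows "sum f A \<preceq> (infsum f I :: 'b::cstar_algebra)"
proof -
  have "cpos (- sum f A - (-1) *\<^sub>R infsum f I)"
  proof (rule has_sum_cpos_diff[OF has_sum_infsum[OF assms(1)] _ assms(3,4)])
    fix F assume F: "finite F" "F \<subseteq> I" "A \<subseteq> F"
    then have "sum f F - sum f A = sum f (F - A)" by (simp add: sum_diff)
    then show "cpos (- sum f A - (-1) *\<^sub>R sum f F)"
      using cpos_sum[of "F - A" f] assms(2) F by auto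
  qed
  then show ?thesis by (simp add: cle_def)
qed

lemma cpos_infsum:
  assumes "\<And>i. i \<in> I \<Longrightarrow> cpos (f i)" shows "cpos (infsum f I)"
proof (cases "f summable_on I")
  case True
  from sum_cle_infsum[OF this assms, of "{}"] show ?thesis by (simp add: cle_0)
qed (simp add: infsum_not_exists cpos_0)

text \<open>Domination along a map \<open>m\<close> whose fibres have at most \<open>D\<close>
  points: the total grows at most by the factor D c. For creation \<open>m\<close> sends a vertex to
  its parent and the fibres are sets of children; for annihilation it prepends a letter, and for the
  compressions it is the identity.\<close>

lemma summable_on_comparison:
  fixes a f :: "'i \<Rightarrow> 'b::cstar_algebra"
  assumes a: "a summable_on I" "\<And>i. i \<in> I \<Longrightarrow> cpos (a i)"
    and I': "I' \<subseteq> I" "m ` I' \<subseteq> I"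
    and fib: "\<And>s. s \<in> I \<Longrightarrow> finite {i \<in> I'. m i = s}" "\<And>s. s \<in> I \<Longrightarrow> card {i \<in> I'. m i = s} \<le> D"
    and f: "\<And>i. i \<in> I' \<Longrightarrow> cpos (f i)" "\<And>i. i \<in> I' \<Longrightarrow> f i \<preceq> c *\<^sub>R a (m i)" "\<And>i. i \<in> I \<Longrightarrow> i \<notin> I' \<Longrightarrow> f i = 0"
    and c: "c \<ge> 0"
  shows "f summable_on I" "infsum f I \<preceq> (real D * c) *\<^sub>R infsum a I"
proof -
  have fin: "sum f F \<preceq> (real D * c) *\<^sub>R sum a (m ` (F \<inter> I'))" if F: "finite F" "F \<subseteq> I" for F
  proof -
    let ?F = "F \<inter> I'"
    have "sum f F = sum f ?F"
      by (rule sum.mono_neutral_right) (use F f(3) in auto)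
    also have "\<dots> \<preceq> (\<Sum>i\<in>?F. c *\<^sub>R a (m i))" by (rule cle_sum) (use f in auto)
    also have "\<dots> = (\<Sum>s\<in>m ` ?F. \<Sum>i\<in>{i \<in> ?F. m i = s}. c *\<^sub>R a (m i))"
      by (rule sum.image_gen) (use F in auto)
    also have "\<dots> = (\<Sum>s\<in>m ` ?F. (real (card {i \<in> ?F. m i = s}) * c) *\<^sub>R a s)"
    proof (rule sum.cong[OF refl])
      fix s
      have "(\<Sum>i\<in>{i \<in> ?F. m i = s}. c *\<^sub>R a (m i)) = (\<Sum>i\<in>{i \<in> ?F. m i = s}. c *\<^sub>R a s)"
        by (rule sum.cong) auto
      then show "(\<Sum>i\<in>{i \<in> ?F. m i = s}. c *\<^sub>R a (m i)) = (real (card {i \<in> ?F. m i = s}) * c) *\<^sub>R a s"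
        by (simp only: sum_constant_scaleR scaleR_scaleR)
    qed
    also have "\<dots> \<preceq> (\<Sum>s\<in>m ` ?F. (real D * c) *\<^sub>R a s)"
    proof (rule cle_sum)
      fix s assume "s \<in> m ` ?F"
      then have s: "s \<in> I" using I' by auto
      have "card {i \<in> ?F. m i = s} \<le> card {i \<in> I'. m i = s}"
        by (rule card_mono[OF fib(1)[OF s]]) auto
      then have "real (card {i \<in> ?F. m i = s}) * c \<le> real D * c"
        using fib(2)[OF s] c by (intro mult_right_mono) auto
      then show "(real (card {i \<in> ?F. m i = s}) * c) *\<^sub>R a s \<preceq> (real D * c) *\<^sub>R a s"
        unfolding cle_def scaleR_left_diff_distrib[symmetric] by (intro cpos_scaleR a(2) s) simp
    qed
    finally show ?thesis by (simp add: scaleR_sum_right)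
  qed
  have fpos: "cpos (sum f F)" if "F \<subseteq> I" for F
    using f(1,3) that by (intro cpos_sum) (metis cpos_0 subsetD)
  show summ: "f summable_on I"
  proof (rule summable_on_vanishing)
    fix d :: real assume d: "d > 0"
    \<comment> \<open>The 1 avoids a division by zero when D c = 0.\<close>
    define d' where "d' = d / (real D * c + 1)"
    have "d' > 0" using d c by (simp add: d'_def add_nonneg_pos)
    from summable_on_tail[OF a(1) this] obtain A where A: "finite A" "A \<subseteq> I"
      "\<forall>F. finite F \<and> F \<subseteq> I \<and> F \<inter> A = {} \<longrightarrow> norm (sum a F) < d'" by (elim exE conjE)
    define A' where "A' = (\<Union>s\<in>A. {i \<in> I'. m i = s})"
    have "finite A'" "A' \<subseteq> I" using A fib(1) I' by (auto simp: A'_def)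
    moreover have "norm (sum f F) < d" if F: "finite F" "F \<subseteq> I" "F \<inter> A' = {}" for F
    proof -
      have "m ` (F \<inter> I') \<inter> A = {}" using F by (auto simp: A'_def)
      then have n: "norm (sum a (m ` (F \<inter> I'))) < d'" using F I' by (intro A(3)[rule_format]) auto
      have "norm (sum f F) \<le> norm ((real D * c) *\<^sub>R sum a (m ` (F \<inter> I')))"
        by (rule cle_norm_mono[OF fpos[OF F(2)] fin[OF F(1,2)]])
      also have "\<dots> = (real D * c) * norm (sum a (m ` (F \<inter> I')))" using c by simp
      also have "\<dots> \<le> (real D * c) * d'" using n c by (intro mult_left_mono) auto
      also have "\<dots> < (real D * c + 1) * d'" using \<open>d' > 0\<close> by simp
      also have "\<dots> = d" using c by (simp add: d'_def add_nonneg_pos less_imp_neq[symmetric])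
      finally show ?thesis .
    qed
    ultimately show "\<exists>A. finite A \<and> A \<subseteq> I \<and> (\<forall>F. finite F \<and> F \<subseteq> I \<and> F \<inter> A = {} \<longrightarrow> norm (sum f F) < d)"
      by (intro exI[of _ A']) simp
  qed
  show "infsum f I \<preceq> (real D * c) *\<^sub>R infsum a I"
  proof (rule has_sum_cle_bound[OF has_sum_infsum[OF summ]])
    fix F assume F: "finite F" "F \<subseteq> I"
    have "sum f F \<preceq> (real D * c) *\<^sub>R sum a (m ` (F \<inter> I'))" by (rule fin[OF F])
    also have "\<dots> \<preceq> (real D * c) *\<^sub>R infsum a I"
      by (intro cle_scaleR sum_cle_infsum a) (use F I' c in auto)
    finally show "sum f F \<preceq> (real D * c) *\<^sub>R infsum a I" .
  qed
qed

lemma summable_on_cle: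
  fixes a f :: "'i \<Rightarrow> 'b::cstar_algebra"
  assumes "a summable_on I" "\<And>i. i \<in> I \<Longrightarrow> cpos (f i)" "\<And>i. i \<in> I \<Longrightarrow> f i \<preceq> a i"
  shows "f summable_on I"
proof (rule summable_on_comparison(1)[where a = a and I' = I and m = id and D = 1 and c = 1])
  show "cpos (a i)" if "i \<in> I" for i using cpos_mono assms(2,3) that by blast
  show "finite {i \<in> I. id i = s}" "card {i \<in> I. id i = s} \<le> 1" if "s \<in> I" for s
  proof -
    have "{i \<in> I. id i = s} = {s}" using that by auto
    then show "finite {i \<in> I. id i = s}" "card {i \<in> I. id i = s} \<le> 1" by auto
  qed
qed (use assms in auto)

text \<open>Expresses mixed inner products through inner squares, so that in a direct sum the
  summability of squares implies that of all inner products.\<close>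

lemma (in semi_corr) polarization:
  fixes h k :: 'h
  defines "q \<equiv> \<lambda>w. hinner H (hadd H (ract H h (scaleC w 1)) k) (hadd H (ract H h (scaleC w 1)) k)"
  assumes "h \<in> hcarrier H" "k \<in> hcarrier H"
  shows "hinner H h k = (1/4) *\<^sub>R ((q 1 - q (-1)) + scaleC \<i> (q \<i> - q (-\<i>)))"
proof -
  have q: "q w = scaleC (cnj w * w) (hinner H h h) + scaleC (cnj w) (hinner H h k) + scaleC w (hinner H k h) + hinner H k k" for w
    unfolding q_def using assms
    by (simp add: inner_simps closed star_scaleC star_one mult_scaleC_left mult_scaleC_right scaleC_scaleC scaleC_add_right mult.commute add_ac)
  have "(q 1 - q (-1)) + scaleC \<i> (q \<i> - q (-\<i>)) = 4 *\<^sub>R hinner H h k"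
    unfolding q
    by (simp add: scaleC_one scaleC_minus_left scaleC_diff_right scaleC_add_right scaleC_scaleC scaleC_minus_right)
      (simp add: scaleR_left_distrib[of 1 3, simplified] scaleR_left_distrib[of 1 2, simplified] scaleR_2)
  then show ?thesis by simp
qed

lemma (in semi_corr) inner_add_le:
  assumes "h \<in> hcarrier H" "k \<in> hcarrier H"
  shows "hinner H (hadd H h k) (hadd H h k) \<preceq> 2 *\<^sub>R hinner H h h + 2 *\<^sub>R hinner H k k"
  using inner_pos[OF minus_in[OF assms]] assms
  by (simp add: cle_def inner_simps closed minus_in scaleR_2 algebra_simps)

locale corr_family =
  fixes I :: "'i set" and K :: "'i \<Rightarrow> ('b::cstar_algebra, 'h) corr"
  assumes nondegenerate: "s \<in> I \<Longrightarrow> nondegenerate_corr (K s)"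
begin

abbreviation "S \<equiv> direct_sum I K"

lemma semi: "s \<in> I \<Longrightarrow> semi_corr (K s)"
  using nondegenerate by (simp add: nondegenerate_corr_def)

lemma S_carrier: "h \<in> hcarrier S \<longleftrightarrow>
    h \<in> (\<Pi>\<^sub>E s\<in>I. hcarrier (K s)) \<and> (\<lambda>s. hinner (K s) (h s) (h s)) summable_on I"
  by (simp add: direct_sum_def)

lemma S_comp: "h \<in> hcarrier S \<Longrightarrow> s \<in> I \<Longrightarrow> h s \<in> hcarrier (K s)"
  by (auto simp: S_carrier)

lemma S_summable: "h \<in> hcarrier S \<Longrightarrow> (\<lambda>s. hinner (K s) (h s) (h s)) summable_on I"
  by (simp add: S_carrier)

lemma S_carrierI:
  assumes "\<And>s. s \<in> I \<Longrightarrow> h s \<in> hcarrier (K s)" "\<And>s. s \<notin> I \<Longrightarrow> h s = undefined"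
    "a summable_on I" "\<And>s. s \<in> I \<Longrightarrow> hinner (K s) (h s) (h s) \<preceq> a s"
  shows "h \<in> hcarrier S"
  unfolding S_carrier
  using assms semi_corr.inner_pos[OF semi]
  by (auto intro!: PiE_I summable_on_cle[OF assms(3)])

lemma S_inner: "hinner S h k = (\<Sum>\<^sub>\<infinity>s\<in>I. hinner (K s) (h s) (k s))"
  by (simp add: direct_sum_def)

lemma S_ops: "s \<in> I \<Longrightarrow> hadd S h k s = hadd (K s) (h s) (k s)"
  "s \<in> I \<Longrightarrow> lact S b h s = lact (K s) b (h s)"
  "s \<in> I \<Longrightarrow> ract S h b s = ract (K s) (h s) b"
  "s \<in> I \<Longrightarrow> hzero S s = hzero (K s)"
  by (simp_all add: direct_sum_def)

lemma S_undefined: "s \<notin> I \<Longrightarrow> hadd S h k s = undefined" "s \<notin> I \<Longrightarrow> lact S b h s = undefined"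
  "s \<notin> I \<Longrightarrow> ract S h b s = undefined" "s \<notin> I \<Longrightarrow> hzero S s = undefined"
  by (simp_all add: direct_sum_def)

lemma S_ract_in:
  assumes h: "h \<in> hcarrier S" shows "ract S h b \<in> hcarrier S"
proof (rule S_carrierI[where a = "\<lambda>s. star b * hinner (K s) (h s) (h s) * b"])
  show "(\<lambda>s. star b * hinner (K s) (h s) (h s) * b) summable_on I"
    by (intro summable_on_cmult_left summable_on_cmult_right S_summable h)
  fix s assume s: "s \<in> I"
  interpret semi_corr "K s" by (rule semi[OF s])
  have hs: "h s \<in> hcarrier (K s)" by (rule S_comp[OF h s])
  show "ract S h b s \<in> hcarrier (K s)" by (simp add: S_ops s closed hs)
  show "hinner (K s) (ract S h b s) (ract S h b s) \<preceq> star b * hinner (K s) (h s) (h s) * b"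
    by (simp add: S_ops s inner_simps closed hs mult.assoc cle_refl)
qed (simp add: S_undefined)

lemma S_lact_in:
  assumes h: "h \<in> hcarrier S" shows "lact S b h \<in> hcarrier S"
proof (rule S_carrierI[where a = "\<lambda>s. (norm b)\<^sup>2 *\<^sub>R hinner (K s) (h s) (h s)"])
  show "(\<lambda>s. (norm b)\<^sup>2 *\<^sub>R hinner (K s) (h s) (h s)) summable_on I"
    by (intro summable_on_scaleR_right S_summable h)
  fix s assume s: "s \<in> I"
  interpret semi_corr "K s" by (rule semi[OF s])
  have hs: "h s \<in> hcarrier (K s)" by (rule S_comp[OF h s])
  show "lact S b h s \<in> hcarrier (K s)" by (simp add: S_ops s closed hs)
  show "hinner (K s) (lact S b h s) (lact S b h s) \<preceq> (norm b)\<^sup>2 *\<^sub>R hinner (K s) (h s) (h s)"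
    by (simp add: S_ops s lact_le hs)
qed (simp add: S_undefined)

lemma S_add_in:
  assumes h: "h \<in> hcarrier S" and k: "k \<in> hcarrier S" shows "hadd S h k \<in> hcarrier S"
proof (rule S_carrierI[where a = "\<lambda>s. 2 *\<^sub>R hinner (K s) (h s) (h s) + 2 *\<^sub>R hinner (K s) (k s) (k s)"])
  show "(\<lambda>s. 2 *\<^sub>R hinner (K s) (h s) (h s) + 2 *\<^sub>R hinner (K s) (k s) (k s)) summable_on I"
    by (intro summable_on_add summable_on_scaleR_right S_summable h k)
  fix s assume s: "s \<in> I"
  interpret semi_corr "K s" by (rule semi[OF s])
  have hs: "h s \<in> hcarrier (K s)" "k s \<in> hcarrier (K s)" by (rule S_comp[OF h s] S_comp[OF k s])+
  show "hadd S h k s \<in> hcarrier (K s)" by (simp add: S_ops s closed hs)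
  show "hinner (K s) (hadd S h k s) (hadd S h k s) \<preceq> 2 *\<^sub>R hinner (K s) (h s) (h s) + 2 *\<^sub>R hinner (K s) (k s) (k s)"
    by (simp only: S_ops s inner_add_le hs)
qed (simp add: S_undefined)

lemma S_pair_summable:
  assumes h: "h \<in> hcarrier S" and k: "k \<in> hcarrier S"
  shows "(\<lambda>s. hinner (K s) (h s) (k s)) summable_on I"
proof -
  define q where "q w s = hinner (K s) (hadd (K s) (ract (K s) (h s) (scaleC w 1)) (k s)) (hadd (K s) (ract (K s) (h s) (scaleC w 1)) (k s))" for w s
  have q: "(\<lambda>s. q w s) summable_on I" for w
    using S_summable[OF S_add_in[OF S_ract_in[OF h] k], of "scaleC w 1"]
    by (rule summable_on_cong[THEN iffD1, rotated]) (simp add: q_def S_ops)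
  have "(\<lambda>s. (1/4) *\<^sub>R ((q 1 s - q (-1) s) + scaleC \<i> 1 * (q \<i> s - q (-\<i>) s))) summable_on I"
    unfolding diff_conv_add_uminus
    by (intro summable_on_scaleR_right summable_on_add summable_on_cmult_right summable_on_uminus[THEN iffD2] q)
  then show ?thesis
    by (rule summable_on_cong[THEN iffD1, rotated])
      (simp add: q_def semi_corr.polarization[OF semi S_comp[OF h] S_comp[OF k]] mult_scaleC_left)
qed

lemma S_has_sum: "h \<in> hcarrier S \<Longrightarrow> k \<in> hcarrier S \<Longrightarrow>
    ((\<lambda>s. hinner (K s) (h s) (k s)) has_sum hinner S h k) I"
  unfolding S_inner by (rule has_sum_infsum[OF S_pair_summable])

lemma S_inner_eqI:
  assumes "(f has_sum x) I" "\<And>s. s \<in> I \<Longrightarrow> hinner (K s) (h s) (k s) = f s"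
  shows "hinner S h k = x"
  unfolding S_inner using assms by (simp add: infsumI cong: infsum_cong)

definition single_vec :: "'i \<Rightarrow> 'h \<Rightarrow> 'i \<Rightarrow> 'h" where
  "single_vec s x = (\<lambda>r\<in>I. if r = s then x else hzero (K r))"

lemma single_vec_in:
  assumes "s \<in> I" "x \<in> hcarrier (K s)" shows "single_vec s x \<in> hcarrier S"
proof (rule S_carrierI[where a = "\<lambda>r. if r = s then hinner (K s) x x else 0"])
  show "(\<lambda>r. if r = s then hinner (K s) x x else 0) summable_on I"
    by (rule summable_on_cong_neutral[where S = "{s}" and T = I and f = "\<lambda>r. hinner (K s) x x", THEN iffD1])
      (use assms in auto)
  fix r assume r: "r \<in> I"
  interpret semi_corr "K r" by (rule semi[OF r])
  show "single_vec s x r \<in> hcarrier (K r)" "hinner (K r) (single_vec s x r) (single_vec s x r) \<preceq> (if r = s then hinner (K s) x x else 0)"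
    using r assms by (auto simp: single_vec_def closed inner_zero cle_refl)
qed (simp add: single_vec_def)

lemma inner_single:
  assumes s: "s \<in> I" "x \<in> hcarrier (K s)" and h: "h \<in> hcarrier S"
  shows "hinner S (single_vec s x) h = hinner (K s) x (h s)"
proof (rule S_inner_eqI[where f = "\<lambda>r. if r = s then hinner (K s) x (h s) else 0"])
  show "((\<lambda>r. if r = s then hinner (K s) x (h s) else 0) has_sum hinner (K s) x (h s)) I"
    by (rule has_sum_cong_neutral[where S = "{s}" and T = I and f = "\<lambda>r. hinner (K s) x (h s)", THEN iffD1])
      (use s in \<open>auto intro!: has_sum_finiteI\<close>)
  fix r assume r: "r \<in> I"
  interpret semi_corr "K r" by (rule semi[OF r])
  show "hinner (K r) (single_vec s x r) (h r) = (if r = s then hinner (K s) x (h s) else 0)"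
    using r S_comp[OF h r] by (auto simp: single_vec_def inner_zero_left)
qed

sublocale S: nondegenerate_corr S
proof
  show "hzero S \<in> hcarrier S"
  proof (rule S_carrierI[where a = "\<lambda>_. 0"])
    fix s assume s: "s \<in> I"
    interpret semi_corr "K s" by (rule semi[OF s])
    show "hzero S s \<in> hcarrier (K s)" "hinner (K s) (hzero S s) (hzero S s) \<preceq> 0"
      by (simp_all add: S_ops s closed inner_zero cle_refl)
  qed (simp_all add: S_undefined)
next
  fix h assume h: "h \<in> hcarrier S"
  note hc = S_comp[OF h]
  show "lact S a h \<in> hcarrier S" "ract S h a \<in> hcarrier S" for a
    by (rule S_lact_in[OF h] S_ract_in[OF h])+
  show "hinner S h (hzero S) = 0"
    unfolding S_inner by (rule infsum_0) (simp add: S_ops semi_corr.inner_zero[OF semi] hc)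
  show "cpos (hinner S h h)"
    unfolding S_inner by (rule cpos_infsum) (rule semi_corr.inner_pos[OF semi hc])
  fix k assume k: "k \<in> hcarrier S"
  note kc = S_comp[OF k]
  show "hadd S h k \<in> hcarrier S" by (rule S_add_in[OF h k])
  show "star (hinner S h k) = hinner S k h"
    by (rule S_inner_eqI[OF has_sum_bounded_linear[OF bounded_linear_star S_has_sum[OF h k]], symmetric])
      (simp add: semi_corr.inner_sym[OF semi] hc kc)
  show "hinner S h (ract S k a) = hinner S h k * a" for a
    by (rule S_inner_eqI[OF has_sum_cmult_left[OF S_has_sum[OF h k]]])
      (simp add: S_ops semi_corr.inner_ract[OF semi] hc kc)
  have lact: "hinner S h (lact S a k) = x" if "((\<lambda>s. hinner (K s) (h s) (lact (K s) a (k s))) has_sum x) I" for a x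
    by (rule S_inner_eqI[OF that]) (simp add: S_ops)
  show "hinner S h (lact S a k) = hinner S (lact S (star a) h) k" for a
    by (rule S_inner_eqI[OF S_has_sum[OF S_lact_in[OF h] k]])
      (simp add: S_ops semi_corr.inner_lact[OF semi] hc kc)
  show "hinner S h (lact S (a * b) k) = hinner S h (lact S a (lact S b k))" for a b
    by (rule S_inner_eqI[OF S_has_sum[OF h S_lact_in[OF S_lact_in[OF k]]]])
      (simp add: S_ops semi_corr.lact_mult[OF semi] hc kc)
  show "hinner S h (lact S (a + b) k) = hinner S h (lact S a k) + hinner S h (lact S b k)" for a b
    by (rule S_inner_eqI[OF has_sum_add[OF S_has_sum[OF h S_lact_in[OF k]] S_has_sum[OF h S_lact_in[OF k]]]])
      (simp add: S_ops semi_corr.lact_add[OF semi] hc kc)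
  show "hinner S h (lact S (scaleC c 1) k) = hinner S h k * scaleC c 1" for c
    by (rule S_inner_eqI[OF has_sum_cmult_left[OF S_has_sum[OF h k]]])
      (simp add: S_ops semi_corr.lact_scalar[OF semi] hc kc)
  show "hinner S h (hadd S k l) = hinner S h k + hinner S h l" if l: "l \<in> hcarrier S" for l
    by (rule S_inner_eqI[OF has_sum_add[OF S_has_sum[OF h k] S_has_sum[OF h l]]])
      (simp add: S_ops semi_corr.inner_add[OF semi] hc kc S_comp[OF l])
  show "h = k" if eq: "\<And>l. l \<in> hcarrier S \<Longrightarrow> hinner S l h = hinner S l k"
  proof
    fix s
    show "h s = k s"
    proof (cases "s \<in> I")
      case True
      interpret nondegenerate_corr "K s" by (rule nondegenerate[OF True])
      show ?thesis
      proof (rule ext[OF hc kc, OF True True])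
        fix x assume x: "x \<in> hcarrier (K s)"
        show "hinner (K s) x (h s) = hinner (K s) x (k s)"
          using eq[OF single_vec_in[OF True x]] by (simp add: inner_single[OF True x] h k)
      qed
    next
      case False
      have "h \<in> (\<Pi>\<^sub>E s\<in>I. hcarrier (K s))" "k \<in> (\<Pi>\<^sub>E s\<in>I. hcarrier (K s))"
        using h k by (simp_all add: S_carrier)
      from this[THEN PiE_arb, OF False] show ?thesis by simp
    qed
  qed
qed

lemma inner_single_right:
  assumes "s \<in> I" "x \<in> hcarrier (K s)" "h \<in> hcarrier S"
  shows "hinner S h (single_vec s x) = hinner (K s) (h s) x"
proof -
  interpret semi_corr "K s" by (rule semi) fact
  show ?thesis
    using S.inner_sym[OF single_vec_in[OF assms(1,2)] assms(3)] inner_single[OF assms]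
      inner_sym[OF assms(2) S_comp[OF assms(3,1)]] by simp
qed

end

context nondegenerate_corr
begin

lemma ext_left:
  assumes "h \<in> hcarrier H" "k \<in> hcarrier H" "\<And>l. l \<in> hcarrier H \<Longrightarrow> hinner H h l = hinner H k l"
  shows "h = k"
proof (rule ext[OF assms(1,2)])
  fix l assume "l \<in> hcarrier H"
  then show "hinner H l h = hinner H l k"
    using inner_sym[of h l] inner_sym[of k l] assms by simp
qed

lemma add_zero: "h \<in> hcarrier H \<Longrightarrow> hadd H h (hzero H) = h"
  by (rule ext) (auto simp: closed inner_simps)

lemma zero_add: "h \<in> hcarrier H \<Longrightarrow> hadd H (hzero H) h = h"
  by (rule ext) (auto simp: closed inner_simps)

end

section \<open>Operators on the tree product\<close>

text \<open>\<open>J\<close> is the alphabet and \<open>D\<close> bounds the number of children of a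
  vertex. Connectedness of the tree appears as closure under removal of the first letter. One family
  of laws is fixed at a time.\<close>

locale tree_legs =
  fixes T :: "nat list set" and J :: "nat set"
    and H :: "nat \<Rightarrow> ('b::cstar_algebra, 'h) corr" and \<xi> :: "nat \<Rightarrow> 'h" and X :: "nat \<Rightarrow> 'h \<Rightarrow> 'h"
    and \<eta> :: "'b \<Rightarrow> 'b" and R :: real and D :: nat
  assumes nil_in: "[] \<in> T"
    and suffix: "j # s \<in> T \<Longrightarrow> s \<in> T"
    and letter: "j # s \<in> T \<Longrightarrow> j \<in> J"
    and alternating: "j # j # s \<notin> T"
    and finite_J: "finite J"
    and children: "s \<in> T \<Longrightarrow> card {j. j # s \<in> T} \<le> D"
    and leg: "j \<in> J \<Longrightarrow> leg (H j) (\<xi> j) (X j) \<eta> R"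
begin

abbreviation "Hs \<equiv> legs H \<xi>"
abbreviation "P s \<equiv> pre_tensor (Hs s)"
abbreviation "K s \<equiv> tensor_product (Hs s)"
abbreviation "S \<equiv> tree_product T H \<xi>"
abbreviation "Hc j \<equiv> compl_vec (H j) (\<xi> j)"
abbreviation "e j \<equiv> X j (\<xi> j)"
abbreviation "zj j \<equiv> leg.z (H j) (\<xi> j) (X j)"
abbreviation "el s \<equiv> elem_embed (Hs s)"

lemma Hs_simps: "Hs [] = []" "Hs (j # s) = Hc j # Hs s"
  by (simp_all add: legs_def)

lemma letters: "s \<in> T \<Longrightarrow> set s \<subseteq> J"
proof (induction s)
  case (Cons j s)
  then show ?case using suffix[of j s] letter[of j s] by auto
qed simp

lemma semi_Hs: "s \<in> T \<Longrightarrow> \<forall>G\<in>set (Hs s). semi_corr G"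
  using letters[of s] by (auto simp: legs_def intro!: leg.semi_corr_Hc leg)

lemma semi_P: "s \<in> T \<Longrightarrow> semi_corr (P s)"
  by (rule semi_corr_pre_tensor[OF semi_Hs])

lemma nd_K: "s \<in> T \<Longrightarrow> nondegenerate_corr (K s)"
  unfolding tensor_product_def by (rule semi_corr.nondegenerate_sep[OF semi_P])

sublocale F: corr_family T K
  rewrites "direct_sum T K = S"
proof -
  show "corr_family T K" by (rule corr_family.intro) (rule nd_K)
  show "direct_sum T K = S" by (simp add: tree_product_def)
qed

lemma elem_singleton: "x \<in> elem_tensors (Hs s) \<Longrightarrow> [x] \<in> hcarrier (P s)"
  by (rule pre_tensor_carrierI) simp

lemma elem_in: "s \<in> T \<Longrightarrow> x \<in> elem_tensors (Hs s) \<Longrightarrow> el s x \<in> hcarrier (K s)"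
  unfolding elem_embed_def tensor_product_def
  by (rule semi_corr.embed_in[OF semi_P elem_singleton])

lemma inner_elem:
  assumes "s \<in> T" "x \<in> elem_tensors (Hs s)" "y \<in> elem_tensors (Hs s)"
  shows "hinner (K s) (el s x) (el s y) = elem_inner (Hs s) x y"
  unfolding elem_embed_def tensor_product_def
  by (simp add: semi_corr.sep_inner_embed[OF semi_P] assms elem_singleton pre_tensor_inner)

text \<open>Finite sums of elementary tensors are dense, and the inner product is additive, so
  single elementary tensors suffice for testing.\<close>

lemma K_eqI:
  assumes s: "s \<in> T" and U: "U \<in> hcarrier (K s)" and V: "V \<in> hcarrier (K s)"
    and eq: "\<And>x. x \<in> elem_tensors (Hs s) \<Longrightarrow> hinner (K s) U (el s x) = hinner (K s) V (el s x)"
  shows "U = V"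
proof -
  interpret P: semi_corr "P s" by (rule semi_P[OF s])
  interpret K: nondegenerate_corr "K s" by (rule nd_K[OF s])
  have "hinner (K s) U (embed_compl (P s) t) = hinner (K s) V (embed_compl (P s) t)"
    if "t \<in> hcarrier (P s)" for t
    using that
  proof (induction t)
    case Nil
    have "embed_compl (P s) [] = hzero (K s)"
      unfolding tensor_product_def P.sep_zero embed_compl_def by (simp add: pre_tensor_simps)
    then show ?case using U V by (simp add: K.inner_zero)
  next
    case (Cons x t)
    then have x: "x \<in> elem_tensors (Hs s)" and t: "t \<in> hcarrier (P s)"
      by (auto simp: pre_tensor_carrier)
    have "embed_compl (P s) (x # t) = hadd (K s) (el s x) (embed_compl (P s) t)"
      unfolding elem_embed_def tensor_product_def P.embed_add[OF elem_singleton[OF x] t]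
      by (simp add: pre_tensor_simps)
    moreover have "embed_compl (P s) t \<in> hcarrier (K s)"
      unfolding tensor_product_def by (rule P.embed_in[OF t])
    ultimately show ?case
      using Cons.IH[OF t] eq[OF x] U V elem_in[OF s x] by (simp add: K.inner_add)
  qed
  then show ?thesis
    using P.sep_eqI U V unfolding tensor_product_def by blast
qed

definition "cr j s = lift_op (P (j # s)) (create (e j))"
definition "an j s = lift_op (P s) (annihilate (Hc j) (Hs s) (e j))"
definition "zz j s = lift_op (P (j # s)) (on_head (zj j))"
definition "c = norm (\<eta> 1)"

lemma leg_facts:
  assumes "j # s \<in> T"
  shows "leg (H j) (\<xi> j) (X j) \<eta> R" "s \<in> T" "\<forall>G\<in>set (Hc j # Hs s). semi_corr G"
  using leg[OF letter[OF assms]] suffix[OF assms] semi_Hs[OF assms] by (simp_all add: Hs_simps)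

lemma cr_adj_pre:
  assumes "j # s \<in> T"
  shows "adj_pair (P s) (P (j # s)) (create (e j)) (annihilate (Hc j) (Hs s) (e j)) c"
  using adj_pair_create[OF leg_facts(3)[OF assms] leg.e_in[OF leg_facts(1)[OF assms]]]
  unfolding c_def leg.e_norm[OF leg_facts(1)[OF assms]] Hs_simps .

lemma cr_adj:
  assumes "j # s \<in> T" shows "adj_pair (K s) (K (j # s)) (cr j s) (an j s) c"
  unfolding tensor_product_def cr_def an_def
  by (rule adj_pair_lift(1)[OF semi_P semi_P cr_adj_pre]) (use assms leg_facts(2) in auto)

lemma zz_adj_pre:
  assumes "j # s \<in> T" shows "adj_pair (P (j # s)) (P (j # s)) (on_head (zj j)) (on_head (zj j)) (R\<^sup>2)"
  using adj_pair_on_head[OF leg_facts(3)[OF assms] leg.z_adj[OF leg_facts(1)[OF assms]]]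
  unfolding Hs_simps .

lemma zz_adj:
  assumes "j # s \<in> T" shows "adj_pair (K (j # s)) (K (j # s)) (zz j s) (zz j s) (R\<^sup>2)"
  unfolding tensor_product_def zz_def
  by (rule adj_pair_lift(1)[OF semi_P semi_P zz_adj_pre]) (use assms in auto)

lemma cr_elem:
  assumes "j # s \<in> T" "x \<in> elem_tensors (Hs s)"
  shows "cr j s (el s x) = el (j # s) (e j # fst x, snd x)"
  using adj_pair_lift(2)[OF semi_P semi_P cr_adj_pre elem_singleton, OF leg_facts(2) assms(1) assms(1) assms(2), OF assms(1)]
  by (simp add: cr_def elem_embed_def create_def)

lemma an_elem:
  assumes "j # s \<in> T" "x \<in> elem_tensors (Hs (j # s))"
  shows "an j s (el (j # s) x) = el s (elem_lact (Hs s) (hinner (H j) (e j) (hd (fst x))) (tl (fst x), snd x))"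
proof -
  note s = leg_facts(2)[OF assms(1)]
  have "adj_pair (P (j # s)) (P s) (annihilate (Hc j) (Hs s) (e j)) (create (e j)) c"
    by (rule adj_pair_sym[OF semi_P[OF s] semi_P[OF assms(1)] cr_adj_pre[OF assms(1)]])
  from adj_pair_lift(2)[OF semi_P[OF assms(1)] semi_P[OF s] this elem_singleton[OF assms(2)]]
  show ?thesis by (simp add: an_def elem_embed_def annihilate_def compl_vec_def)
qed

lemma zz_elem:
  assumes "j # s \<in> T" "x \<in> elem_tensors (Hs (j # s))"
  shows "zz j s (el (j # s) x) = el (j # s) (zj j (hd (fst x)) # tl (fst x), snd x)"
  using adj_pair_lift(2)[OF semi_P semi_P zz_adj_pre elem_singleton, OF assms(1) assms(1) assms(1) assms(2)]
  by (simp add: zz_def elem_embed_def on_head_def)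

lemma adj_pairD:
  assumes "adj_pair G G' f g C"
  shows "h \<in> hcarrier G \<Longrightarrow> f h \<in> hcarrier G'" "k \<in> hcarrier G' \<Longrightarrow> g k \<in> hcarrier G" "C \<ge> 0"
    "h \<in> hcarrier G \<Longrightarrow> k \<in> hcarrier G' \<Longrightarrow> hinner G' (f h) k = hinner G h (g k)"
    "h \<in> hcarrier G \<Longrightarrow> hinner G' (f h) (f h) \<preceq> C *\<^sub>R hinner G h h"
  using assms by (auto simp: adj_pair_def)

lemma c_nonneg: "c \<ge> 0"
  by (simp add: c_def)

text \<open>The set \<open>L\<close> of letters is a parameter: a singleton gives the creation part
  of one operator along the tree, the whole alphabet that of the sum. The sum is bounded at once,
  because the children of a vertex carry orthogonal components; adding norms letter by letter would
  cost the number of children in place of its square root.\<close>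

definition CC :: "nat set \<Rightarrow> (nat list \<Rightarrow> (nat \<Rightarrow> ('h list \<times> 'b) list) set) \<Rightarrow> nat list \<Rightarrow> (nat \<Rightarrow> ('h list \<times> 'b) list) set" where
  "CC L h = (\<lambda>r\<in>T. if r \<noteq> [] \<and> hd r \<in> L then cr (hd r) (tl r) (h (tl r)) else hzero (K r))"

definition AN :: "nat \<Rightarrow> (nat list \<Rightarrow> (nat \<Rightarrow> ('h list \<times> 'b) list) set) \<Rightarrow> nat list \<Rightarrow> (nat \<Rightarrow> ('h list \<times> 'b) list) set" where
  "AN j h = (\<lambda>s\<in>T. if j # s \<in> T then an j s (h (j # s)) else hzero (K s))"

definition ZZ :: "nat set \<Rightarrow> (nat list \<Rightarrow> (nat \<Rightarrow> ('h list \<times> 'b) list) set) \<Rightarrow> nat list \<Rightarrow> (nat \<Rightarrow> ('h list \<times> 'b) list) set" where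
  "ZZ L h = (\<lambda>r\<in>T. if r \<noteq> [] \<and> hd r \<in> L then zz (hd r) (tl r) (h r) else hzero (K r))"

text \<open>The explicit candidate for \<open>tree_lambda\<close>: creation of the letter
  \<open>j\<close>, its adjoint, and compression on strings that begin with
  \<open>j\<close>.\<close>

definition lam :: "nat \<Rightarrow> (nat list \<Rightarrow> (nat \<Rightarrow> ('h list \<times> 'b) list) set) \<Rightarrow> nat list \<Rightarrow> (nat \<Rightarrow> ('h list \<times> 'b) list) set" where
  "lam j = (\<lambda>h\<in>hcarrier S. hadd S (hadd S (CC {j} h) (AN j h)) (ZZ {j} h))"

lemma T_ConsD: "r \<in> T \<Longrightarrow> r \<noteq> [] \<Longrightarrow> hd r # tl r \<in> T \<and> tl r \<in> T"
  using suffix[of "hd r" "tl r"] by simp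

lemma K_zero: "s \<in> T \<Longrightarrow> hzero (K s) \<in> hcarrier (K s)"
  by (rule semi_corr.zero_in[OF F.semi])

text \<open>The component at a vertex comes from its parent, at the cost of a factor
  \<open>c\<close>, and each parent is used by at most \<open>D\<close> children.\<close>

lemma CC_in_le:
  assumes h: "h \<in> hcarrier S"
  shows "CC L h \<in> hcarrier S" "hinner S (CC L h) (CC L h) \<preceq> (real D * c) *\<^sub>R hinner S h h"
proof -
  let ?I = "{r \<in> T. r \<noteq> [] \<and> hd r \<in> L}"
  let ?a = "\<lambda>s. hinner (K s) (h s) (h s)" and ?f = "\<lambda>s. hinner (K s) (CC L h s) (CC L h s)"
  have hs: "h s \<in> hcarrier (K s)" if "s \<in> T" for s by (rule F.S_comp[OF h that])
  have car: "CC L h r \<in> hcarrier (K r)" if "r \<in> T" for r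
    using that T_ConsD[of r] adj_pairD(1)[OF cr_adj hs, of "hd r" "tl r"] by (auto simp: CC_def K_zero)
  have 1: "?a summable_on T" by (rule F.S_summable[OF h])
  have 2: "cpos (?a s)" if "s \<in> T" for s
    by (rule semi_corr.inner_pos[OF F.semi hs]) (rule that)+
  have 3: "tl ` ?I \<subseteq> T" using T_ConsD by auto
  have sub: "{i \<in> ?I. tl i = s} \<subseteq> (\<lambda>j. j # s) ` {j. j # s \<in> T}" for s
    by (auto simp: image_iff) (metis list.collapse)
  have finj: "finite {j. j # s \<in> T}" for s
    by (rule finite_subset[OF _ finite_J]) (use letter in auto)
  have 4: "finite {i \<in> ?I. tl i = s}" for s
    by (rule finite_subset[OF sub]) (use finj in auto)
  have 5: "card {i \<in> ?I. tl i = s} \<le> D" if "s \<in> T" for s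
  proof -
    have "card {i \<in> ?I. tl i = s} \<le> card ((\<lambda>j. j # s) ` {j. j # s \<in> T})"
      by (rule card_mono[OF _ sub]) (use finj in auto)
    also have "\<dots> \<le> D" using card_image_le[OF finj, of "\<lambda>j. j # s"] children[OF that] by (rule order_trans)
    finally show ?thesis .
  qed
  have 6: "cpos (?f r)" if "r \<in> ?I" for r
    by (rule semi_corr.inner_pos[OF F.semi car]) (use that in auto)
  have 7: "?f r \<preceq> c *\<^sub>R ?a (tl r)" if "r \<in> ?I" for r
    using that T_ConsD[of r] adj_pairD(5)[OF cr_adj hs, of "hd r" "tl r"] by (auto simp: CC_def)
  have 8: "?f r = 0" if "r \<in> T" "r \<notin> ?I" for r
    using that semi_corr.inner_zero[OF F.semi K_zero, of r] by (auto simp: CC_def)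
  note comp = summable_on_comparison[of ?a T ?I tl D ?f c, OF 1 2 _ 3 4 5 6 7 8 c_nonneg]
  show in_S: "CC L h \<in> hcarrier S"
    unfolding F.S_carrier using car comp(1) by (auto simp: CC_def)
  show "hinner S (CC L h) (CC L h) \<preceq> (real D * c) *\<^sub>R hinner S h h"
    unfolding F.S_inner using comp(2) by auto
qed

lemma ZZ_in_le:
  assumes h: "h \<in> hcarrier S"
  shows "ZZ L h \<in> hcarrier S" "hinner S (ZZ L h) (ZZ L h) \<preceq> R\<^sup>2 *\<^sub>R hinner S h h"
proof -
  let ?I = "{r \<in> T. r \<noteq> [] \<and> hd r \<in> L}"
  let ?a = "\<lambda>s. hinner (K s) (h s) (h s)" and ?f = "\<lambda>s. hinner (K s) (ZZ L h s) (ZZ L h s)"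
  have hs: "h s \<in> hcarrier (K s)" if "s \<in> T" for s by (rule F.S_comp[OF h that])
  have zz: "zz (hd r) (tl r) (h r) \<in> hcarrier (K r) \<and>
      hinner (K r) (zz (hd r) (tl r) (h r)) (zz (hd r) (tl r) (h r)) \<preceq> R\<^sup>2 *\<^sub>R ?a r" if "r \<in> T" "r \<noteq> []" for r
    using that adj_pairD(1,5)[OF zz_adj, of "hd r" "tl r" "h r"] hs[of r] by simp
  have car: "ZZ L h r \<in> hcarrier (K r)" if "r \<in> T" for r
    using that zz[of r] by (auto simp: ZZ_def K_zero)
  have 1: "?a summable_on T" by (rule F.S_summable[OF h])
  have 2: "cpos (?a s)" if "s \<in> T" for s
    by (rule semi_corr.inner_pos[OF F.semi hs]) (rule that)+
  have fib: "{i \<in> ?I. id i = s} \<subseteq> {s}" for s by auto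
  have 4: "finite {i \<in> ?I. id i = s}" for s by (rule finite_subset[OF fib]) simp
  have 5: "card {i \<in> ?I. id i = s} \<le> 1" for s using card_mono[OF _ fib, of s] by simp
  have 6: "cpos (?f r)" if "r \<in> ?I" for r
    by (rule semi_corr.inner_pos[OF F.semi car]) (use that in auto)
  have 7: "?f r \<preceq> R\<^sup>2 *\<^sub>R ?a (id r)" if "r \<in> ?I" for r
    using that zz[of r] by (auto simp: ZZ_def)
  have 8: "?f r = 0" if "r \<in> T" "r \<notin> ?I" for r
    using that semi_corr.inner_zero[OF F.semi K_zero, of r] by (auto simp: ZZ_def)
  note comp = summable_on_comparison[of ?a T ?I id 1 ?f "R\<^sup>2", OF 1 2 _ _ 4 5 6 7 8]
  show in_S: "ZZ L h \<in> hcarrier S"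
    unfolding F.S_carrier using car comp(1) by (auto simp: ZZ_def)
  show "hinner S (ZZ L h) (ZZ L h) \<preceq> R\<^sup>2 *\<^sub>R hinner S h h"
    unfolding F.S_inner using comp(2) by auto
qed

lemma AN_in:
  assumes h: "h \<in> hcarrier S"
  shows "AN j h \<in> hcarrier S"
proof -
  let ?I = "{s \<in> T. j # s \<in> T}"
  let ?a = "\<lambda>s. hinner (K s) (h s) (h s)" and ?f = "\<lambda>s. hinner (K s) (AN j h s) (AN j h s)"
  have hs: "h s \<in> hcarrier (K s)" if "s \<in> T" for s by (rule F.S_comp[OF h that])
  note adj = adj_pair_sym[OF F.semi F.semi cr_adj, OF suffix]
  have an: "an j s (h (j # s)) \<in> hcarrier (K s) \<and>
      hinner (K s) (an j s (h (j # s))) (an j s (h (j # s))) \<preceq> c *\<^sub>R ?a (j # s)" if "j # s \<in> T" for s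
    using adj_pairD(1,5)[OF adj hs] that by auto
  have car: "AN j h r \<in> hcarrier (K r)" if "r \<in> T" for r
    using that an[of r] by (auto simp: AN_def K_zero)
  have 1: "?a summable_on T" by (rule F.S_summable[OF h])
  have 2: "cpos (?a s)" if "s \<in> T" for s
    by (rule semi_corr.inner_pos[OF F.semi hs]) (rule that)+
  have fib: "{i \<in> ?I. j # i = s} \<subseteq> {tl s}" for s by auto
  have 4: "finite {i \<in> ?I. j # i = s}" for s by (rule finite_subset[OF fib]) simp
  have 5: "card {i \<in> ?I. j # i = s} \<le> 1" for s using card_mono[OF _ fib, of s] by simp
  have 6: "cpos (?f r)" if "r \<in> ?I" for r
    by (rule semi_corr.inner_pos[OF F.semi car]) (use that in auto)
  have 7: "?f r \<preceq> c *\<^sub>R ?a (j # r)" if "r \<in> ?I" for r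
    using that an[of r] by (auto simp: AN_def)
  have 8: "?f r = 0" if "r \<in> T" "r \<notin> ?I" for r
    using that semi_corr.inner_zero[OF F.semi K_zero, of r] by (auto simp: AN_def)
  note comp = summable_on_comparison[of ?a T ?I "(#) j" 1 ?f c, OF 1 2 _ _ 4 5 6 7 8 c_nonneg]
  show in_S: "AN j h \<in> hcarrier S"
    unfolding F.S_carrier using car comp(1) by (auto simp: AN_def)
qed

text \<open>Both inner products are sums over the edges from s to j s. Reindexing by the lower
  vertex s turns one into the other, edge by edge through \<open>cr_adj\<close>.\<close>

lemma CC_AN_adj:
  assumes h: "h \<in> hcarrier S" and k: "k \<in> hcarrier S"
  shows "hinner S (CC {j} h) k = hinner S h (AN j k)"
proof -
  let ?I = "{s \<in> T. j # s \<in> T}"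
  let ?f = "\<lambda>r. hinner (K r) (CC {j} h r) (k r)"
  have hs: "h s \<in> hcarrier (K s)" "k s \<in> hcarrier (K s)" if "s \<in> T" for s
    using F.S_comp[OF h that] F.S_comp[OF k that] .
  have "(?f has_sum hinner S (CC {j} h) k) T"
    by (rule F.S_has_sum[OF CC_in_le(1)[OF h] k])
  then have "(?f has_sum hinner S (CC {j} h) k) ((#) j ` ?I)"
  proof (rule has_sum_cong_neutral[THEN iffD1, rotated 3])
    fix r assume r: "r \<in> T - (#) j ` ?I"
    then have "\<not> (r \<noteq> [] \<and> hd r \<in> {j})"
      using T_ConsD[of r] by (auto simp: image_iff) (metis list.collapse)
    then show "?f r = 0"
      using r semi_corr.inner_zero_left[OF F.semi hs(2), of r] by (auto simp: CC_def)
  qed auto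
  then have "((?f \<circ> (#) j) has_sum hinner S (CC {j} h) k) ?I"
    by (subst (asm) has_sum_reindex) (auto simp: inj_on_def)
  then have "((\<lambda>s. if j # s \<in> T then hinner (K s) (h s) (an j s (k (j # s))) else 0) has_sum hinner S (CC {j} h) k) T"
  proof (rule has_sum_cong_neutral[THEN iffD1, rotated 3])
    fix s assume s: "s \<in> ?I \<inter> T"
    then have js: "j # s \<in> T" by simp
    show "(?f \<circ> (#) j) s = (if j # s \<in> T then hinner (K s) (h s) (an j s (k (j # s))) else 0)"
      using js s adj_pairD(4)[OF cr_adj[OF js] hs(1) hs(2)[OF js]] by (simp add: CC_def)
  qed auto
  then show ?thesis
    by (rule F.S_inner_eqI[symmetric])
      (auto simp: AN_def semi_corr.inner_zero[OF F.semi] hs)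
qed

lemma ZZ_sym:
  assumes h: "h \<in> hcarrier S" and k: "k \<in> hcarrier S"
  shows "hinner S (ZZ L h) k = hinner S h (ZZ L k)"
  unfolding F.S_inner
proof (rule infsum_cong)
  fix r assume r: "r \<in> T"
  have hs: "h r \<in> hcarrier (K r)" "k r \<in> hcarrier (K r)"
    using F.S_comp[OF h r] F.S_comp[OF k r] .
  show "hinner (K r) (ZZ L h r) (k r) = hinner (K r) (h r) (ZZ L k r)"
  proof (cases "r \<noteq> [] \<and> hd r \<in> L")
    case True
    with r T_ConsD[of r] adj_pairD(4)[OF zz_adj, of "hd r" "tl r" "h r" "k r"] hs show ?thesis
      by (simp add: ZZ_def)
  next
    case False
    with r hs show ?thesis
      by (auto simp: ZZ_def semi_corr.inner_zero[OF F.semi] semi_corr.inner_zero_left[OF F.semi])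
  qed
qed

lemma CC_AN_pair: "adj_pair S S (CC {j}) (AN j) (real D * c)"
  unfolding adj_pair_def using c_nonneg
  by (intro conjI ballI Pi_I CC_in_le AN_in CC_AN_adj) simp_all

lemma AN_CC_adj: "h \<in> hcarrier S \<Longrightarrow> k \<in> hcarrier S \<Longrightarrow> hinner S (AN j h) k = hinner S h (CC {j} k)"
  using adj_pairD(4)[OF adj_pair_sym[OF F.S.semi_corr_axioms F.S.semi_corr_axioms CC_AN_pair]] .

lemma ZZ_pair: "adj_pair S S (ZZ L) (ZZ L) (R\<^sup>2)"
  unfolding adj_pair_def
  by (intro conjI ballI Pi_I ZZ_in_le ZZ_sym) simp_all

lemma lam_in: "h \<in> hcarrier S \<Longrightarrow> lam j h \<in> hcarrier S"
  by (simp add: lam_def F.S.closed CC_in_le AN_in ZZ_in_le)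

lemma inner_lam:
  "h \<in> hcarrier S \<Longrightarrow> k \<in> hcarrier S \<Longrightarrow>
    hinner S (lam j h) k = hinner S (CC {j} h) k + hinner S (AN j h) k + hinner S (ZZ {j} h) k"
  by (simp add: lam_def F.S.closed CC_in_le AN_in ZZ_in_le F.S.inner_simps)

lemma lam_sym: "h \<in> hcarrier S \<Longrightarrow> k \<in> hcarrier S \<Longrightarrow> hinner S (lam j h) k = hinner S h (lam j k)"
  by (subst inner_lam) (auto simp: lam_def F.S.closed CC_in_le AN_in ZZ_in_le F.S.inner_simps CC_AN_adj AN_CC_adj ZZ_sym)

lemma lam_comp:
  assumes h: "h \<in> hcarrier S" and r: "r \<in> T" and x: "x \<in> hcarrier (K r)"
  shows "hinner (K r) x (lam j h r)
    = hinner (K r) x (CC {j} h r) + hinner (K r) x (AN j h r) + hinner (K r) x (ZZ {j} h r)"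
  using h r x F.S_comp[OF _ r] CC_in_le(1)[OF h] AN_in[OF h] ZZ_in_le(1)[OF h]
  by (simp add: lam_def F.S_ops semi_corr.inner_add[OF F.semi] semi_corr.add_in[OF F.semi])

end

text \<open>Additivity and modularity are consequences of the adjoint, by testing against all
  vectors.\<close>

lemma adjointableI:
  assumes "nondegenerate_corr G" and y: "y \<in> hcarrier G \<rightarrow>\<^sub>E hcarrier G"
    and w: "w \<in> hcarrier G \<rightarrow> hcarrier G"
    and adj: "\<And>h k. h \<in> hcarrier G \<Longrightarrow> k \<in> hcarrier G \<Longrightarrow> hinner G (y h) k = hinner G h (w k)"
    and bound: "\<And>h. h \<in> hcarrier G \<Longrightarrow> hnorm G (y h) \<le> C * hnorm G h"
  shows "y \<in> adjointable G"
proof -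
  interpret nondegenerate_corr G by fact
  have yin: "y h \<in> hcarrier G" if "h \<in> hcarrier G" for h using y that by auto
  have win: "w h \<in> hcarrier G" if "h \<in> hcarrier G" for h using w that by auto
  have "y (hadd G h k) = hadd G (y h) (y k)" if "h \<in> hcarrier G" "k \<in> hcarrier G" for h k
    by (rule ext_left) (auto simp: that yin win closed inner_simps adj)
  moreover have "y (ract G h b) = ract G (y h) b" if "h \<in> hcarrier G" for h b
    by (rule ext_left) (auto simp: that yin win closed inner_simps adj)
  moreover have "\<exists>C. \<forall>h\<in>hcarrier G. hnorm G (y h) \<le> C * hnorm G h"
    by (intro exI[of _ C] ballI bound)
  moreover have "\<exists>z \<in> hcarrier G \<rightarrow> hcarrier G. \<forall>h\<in>hcarrier G. \<forall>k\<in>hcarrier G. hinner G (y h) k = hinner G h (z k)"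
    by (intro bexI[of _ w] ballI adj w)
  ultimately show ?thesis using y by (simp add: adjointable_def)
qed

section \<open>Identification of the operators defined by description\<close>

context tree_legs
begin

lemma lam_adjointable: "lam j \<in> adjointable S"
proof (rule adjointableI[where w = "lam j"])
  show "nondegenerate_corr S" by (rule F.S.nondegenerate_corr_axioms)
  show "lam j \<in> hcarrier S \<rightarrow>\<^sub>E hcarrier S" by (auto simp: lam_in) (simp add: lam_def)
  show "lam j \<in> hcarrier S \<rightarrow> hcarrier S" by (auto simp: lam_in)
  show "hinner S (lam j h) k = hinner S h (lam j k)" if "h \<in> hcarrier S" "k \<in> hcarrier S" for h k
    by (rule lam_sym[OF that])
  fix h assume h: "h \<in> hcarrier S"
  note sc = F.S.semi_corr_axioms
  have "hnorm S (lam j h) \<le> hnorm S (CC {j} h) + hnorm S (AN j h) + hnorm S (ZZ {j} h)"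
    using h F.S.hnorm_add[OF CC_in_le(1)[OF h] AN_in[OF h], of "{j}" j]
      F.S.hnorm_add[OF F.S.add_in[OF CC_in_le(1)[OF h] AN_in[OF h]] ZZ_in_le(1)[OF h], of "{j}" j "{j}"]
    by (simp add: lam_def)
  also have "\<dots> \<le> sqrt (real D * c) * hnorm S h + sqrt (real D * c) * hnorm S h + sqrt (R\<^sup>2) * hnorm S h"
    by (intro add_mono adj_pair_norm[OF sc sc CC_AN_pair h] adj_pair_norm[OF sc sc ZZ_pair h]
        adj_pair_norm[OF sc sc adj_pair_sym[OF sc sc CC_AN_pair] h])
  finally show "hnorm S (lam j h) \<le> (sqrt (real D * c) + sqrt (real D * c) + sqrt (R\<^sup>2)) * hnorm S h"
    by (simp only: distrib_right)
qed

lemma single_eq: "single T H \<xi> s t = F.single_vec s t"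
  by (simp add: single_def F.single_vec_def)

lemma elem_tensors_Cons: "h \<in> hcarrier (Hc j) \<Longrightarrow> x \<in> elem_tensors (Hs s) \<Longrightarrow> (h # fst x, snd x) \<in> elem_tensors (Hs (j # s))"
  by (simp add: elem_tensors_iff Hs_simps)

lemma attach_eq:
  assumes js: "j # s \<in> T" and h: "h \<in> hcarrier (H j)" and t: "t \<in> elem_tensors (Hs s)"
  defines "u \<equiv> el s (elem_lact (Hs s) (hinner (H j) (\<xi> j) h) t)"
    and "v \<equiv> el (j # s) (proj_compl (H j) (\<xi> j) h # fst t, snd t)"
  shows "attach T H \<xi> j s h t = hadd S (F.single_vec s u) (F.single_vec (j # s) v)"
    "u \<in> hcarrier (K s)" "v \<in> hcarrier (K (j # s))"
proof -
  note s = suffix[OF js]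
  show u: "u \<in> hcarrier (K s)"
    unfolding u_def by (rule elem_in[OF s elem_lact_in[OF semi_Hs[OF s] t]])
  show v: "v \<in> hcarrier (K (j # s))"
    unfolding v_def by (rule elem_in[OF js elem_tensors_Cons[OF leg.proj_in[OF leg_facts(1)[OF js] h] t]])
  show "attach T H \<xi> j s h t = hadd S (F.single_vec s u) (F.single_vec (j # s) v)"
  proof
    fix r
    show "attach T H \<xi> j s h t r = hadd S (F.single_vec s u) (F.single_vec (j # s) v) r"
    proof (cases "r \<in> T")
      case True
      consider "r = s" | "r = j # s" "r \<noteq> s" | "r \<noteq> s" "r \<noteq> j # s" by blast
      then show ?thesis
        using True u v
        by cases (simp_all add: attach_def F.S_ops F.single_vec_def nondegenerate_corr.add_zero[OF nd_K]
            nondegenerate_corr.zero_add[OF nd_K] K_zero u_def v_def)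
    next
      case False
      then show ?thesis by (simp add: attach_def F.S_undefined)
    qed
  qed
qed

lemma inner_attach:
  assumes js: "j # s \<in> T" and h: "h \<in> hcarrier (H j)" and t: "t \<in> elem_tensors (Hs s)" and k: "k \<in> hcarrier S"
  shows "attach T H \<xi> j s h t \<in> hcarrier S"
    "hinner S (attach T H \<xi> j s h t) k
      = hinner (K s) (el s (elem_lact (Hs s) (hinner (H j) (\<xi> j) h) t)) (k s)
      + hinner (K (j # s)) (el (j # s) (proj_compl (H j) (\<xi> j) h # fst t, snd t)) (k (j # s))"
  using attach_eq[OF js h t] suffix[OF js] js k
  by (simp_all add: F.S.closed F.single_vec_in F.S.inner_simps F.inner_single)

text \<open>The decomposition \<open>X_decomp\<close> tensored with \<open>t\<close>: creation from
  the vacuum part of \<open>h\<close> and compression of its complement part add up to the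
  complement part of X h.\<close>

lemma elem_Cons_eq:
  assumes js: "j # s \<in> T" and h: "h \<in> hcarrier (H j)" and t: "t \<in> elem_tensors (Hs s)"
  shows "hadd (K (j # s)) (cr j s (el s (elem_lact (Hs s) (hinner (H j) (\<xi> j) h) t)))
      (zz j s (el (j # s) (proj_compl (H j) (\<xi> j) h # fst t, snd t)))
    = el (j # s) (proj_compl (H j) (\<xi> j) (X j h) # fst t, snd t)"
proof -
  note s = suffix[OF js]
  interpret l: leg "H j" "\<xi> j" "X j" \<eta> R by (rule leg_facts(1)[OF js])
  interpret K: nondegenerate_corr "K (j # s)" by (rule nd_K[OF js])
  note sHs = semi_Hs[OF s]
  note Hs' = leg_facts(3)[OF js]
  let ?a = "hinner (H j) (\<xi> j) h"
  let ?t = "elem_lact (Hs s) ?a t"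
  have t': "?t \<in> elem_tensors (Hs s)" by (rule elem_lact_in[OF sHs t])
  have x1: "(e j # fst ?t, snd ?t) \<in> elem_tensors (Hs (j # s))" by (rule elem_tensors_Cons[OF l.e_in t'])
  note ph = l.proj_in[OF h]
  have x2: "(l.z (proj_compl (H j) (\<xi> j) h) # fst t, snd t) \<in> elem_tensors (Hs (j # s))"
    by (rule elem_tensors_Cons[OF l.z_in[OF ph] t])
  have x3: "(proj_compl (H j) (\<xi> j) (X j h) # fst t, snd t) \<in> elem_tensors (Hs (j # s))"
    by (rule elem_tensors_Cons[OF l.proj_in[OF l.X_in[OF h]] t])
  have "hadd (K (j # s)) (el (j # s) (e j # fst ?t, snd ?t)) (el (j # s) (l.z (proj_compl (H j) (\<xi> j) h) # fst t, snd t))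
      = el (j # s) (proj_compl (H j) (\<xi> j) (X j h) # fst t, snd t)"
  proof (rule K_eqI[OF js])
    show "hadd (K (j # s)) (el (j # s) (e j # fst ?t, snd ?t)) (el (j # s) (l.z (proj_compl (H j) (\<xi> j) h) # fst t, snd t)) \<in> hcarrier (K (j # s))"
      by (intro K.closed elem_in js x1 x2)
    show "el (j # s) (proj_compl (H j) (\<xi> j) (X j h) # fst t, snd t) \<in> hcarrier (K (j # s))"
      by (rule elem_in[OF js x3])
    fix x assume x: "x \<in> elem_tensors (Hs (j # s))"
    then obtain k ks b where xk: "x = (k # ks, b)" "k \<in> hcarrier (Hc j)" "(ks, b) \<in> elem_tensors (Hs s)"
      unfolding Hs_simps by (rule elem_tensors_ConsE)
    let ?x = "(ks, b)"
    have k: "k \<in> hcarrier (H j)" using xk(2) by (rule l.Hc_carrierD)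
    have "elem_inner (Hs (j # s)) (e j # fst ?t, snd ?t) x = star (snd ?t) * tensor_inner (Hs s) (hinner (H j) (e j) k) (fst ?t) ks * b"
      unfolding xk Hs_simps using elem_inner_Cons[OF Hs' l.e_in xk(2)] by (simp add: l.Hc_simps)
    also have "\<dots> = elem_inner (Hs s) ?t (elem_lact (Hs s) (hinner (H j) (e j) k) ?x)"
      using elem_inner_lact[OF sHs t' xk(3)] by simp
    also have "\<dots> = star (snd t) * tensor_inner (Hs s) (star ?a * hinner (H j) (e j) k) (fst t) ks * b"
      using elem_inner_lact_lact[OF sHs t xk(3)] by simp
    finally have 1: "elem_inner (Hs (j # s)) (e j # fst ?t, snd ?t) x = \<dots>" .
    have 2: "elem_inner (Hs (j # s)) (l.z (proj_compl (H j) (\<xi> j) h) # fst t, snd t) x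
        = star (snd t) * tensor_inner (Hs s) (hinner (H j) (l.z (proj_compl (H j) (\<xi> j) h)) k) (fst t) ks * b"
      unfolding xk Hs_simps using elem_inner_Cons[OF Hs' l.z_in[OF ph] xk(2)] by (simp add: l.Hc_simps)
    have 3: "elem_inner (Hs (j # s)) (proj_compl (H j) (\<xi> j) (X j h) # fst t, snd t) x
        = star (snd t) * tensor_inner (Hs s) (hinner (H j) (X j h) k) (fst t) ks * b"
      unfolding xk Hs_simps using elem_inner_Cons[OF Hs' l.proj_in[OF l.X_in[OF h]] xk(2)] xk(2) h
      by (simp add: l.Hc_simps l.inner_proj_left l.X_in)
    have elems: "elems (Hs s) (fst t)" "elems (Hs s) ks" using t xk(3) by (auto simp: elem_tensors_iff)
    show "hinner (K (j # s)) (hadd (K (j # s)) (el (j # s) (e j # fst ?t, snd ?t)) (el (j # s) (l.z (proj_compl (H j) (\<xi> j) h) # fst t, snd t))) (el (j # s) x)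
        = hinner (K (j # s)) (el (j # s) (proj_compl (H j) (\<xi> j) (X j h) # fst t, snd t)) (el (j # s) x)"
      using x1 x2 x3 x js
      by (simp add: K.inner_simps elem_in inner_elem 1 2 3 l.X_decomp[OF h xk(2)] tensor_inner_add[OF sHs elems] algebra_simps)
  qed
  then show ?thesis
    using cr_elem[OF js t'] zz_elem[OF js elem_tensors_Cons[OF ph t]] by simp
qed

text \<open>By symmetry \<open>lam j\<close> is moved to the test vector \<open>k\<close>, of which
  only the components at s and j s matter. The first receives only annihilation, the second only
  creation and compression. The adjoints bring these back to \<open>h\<close> and \<open>t\<close>,
  where \<open>inner_\<xi>_X\<close> and \<open>elem_Cons_eq\<close> assemble X h.\<close>

lemma lam_attach:
  assumes js: "j # s \<in> T" and h: "h \<in> hcarrier (H j)" and t: "t \<in> elem_tensors (Hs s)"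
  shows "lam j (attach T H \<xi> j s h t) = attach T H \<xi> j s (X j h) t"
proof (rule F.S.ext_left)
  note s = suffix[OF js]
  interpret l: leg "H j" "\<xi> j" "X j" \<eta> R by (rule leg_facts(1)[OF js])
  interpret Ks: nondegenerate_corr "K s" by (rule nd_K[OF s])
  interpret K: nondegenerate_corr "K (j # s)" by (rule nd_K[OF js])
  note Xh = l.X_in[OF h]
  let ?u = "el s (elem_lact (Hs s) (hinner (H j) (\<xi> j) h) t)"
  let ?v = "el (j # s) (proj_compl (H j) (\<xi> j) h # fst t, snd t)"
  have u: "?u \<in> hcarrier (K s)" and v: "?v \<in> hcarrier (K (j # s))" using attach_eq(2,3)[OF js h t] .
  show "lam j (attach T H \<xi> j s h t) \<in> hcarrier S"
    by (rule lam_in[OF inner_attach(1)[OF js h t F.S.zero_in]])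
  show "attach T H \<xi> j s (X j h) t \<in> hcarrier S"
    by (rule inner_attach(1)[OF js Xh t F.S.zero_in])
  fix k assume k: "k \<in> hcarrier S"
  note ks = F.S_comp[OF k s] and kjs = F.S_comp[OF k js]
  note cr = adj_pairD[OF cr_adj[OF js]] and zz = adj_pairD[OF zz_adj[OF js]]
  note an = adj_pairD[OF adj_pair_sym[OF F.semi[OF s] F.semi[OF js] cr_adj[OF js]]]
  \<comment> \<open>Alternation excludes the other contributions: \<open>s\<close> does not begin
    with \<open>j\<close>, so nothing is created or compressed there, and \<open>j # j # s\<close>
    is no vertex, so nothing is annihilated into j s.\<close>
  have ns: "\<not> (s \<noteq> [] \<and> hd s \<in> {j})" using js alternating[of j "tl s"] by (cases s) auto
  have njs: "j # j # s \<notin> T" by (rule alternating)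
  have "hinner S (lam j (attach T H \<xi> j s h t)) k = hinner (K s) ?u (lam j k s) + hinner (K (j # s)) ?v (lam j k (j # s))"
    using lam_sym[OF inner_attach(1)[OF js h t k] k] inner_attach(2)[OF js h t lam_in[OF k]] by simp
  also have "hinner (K s) ?u (lam j k s) = hinner (K s) ?u (an j s (k (j # s)))"
    using lam_comp[OF k s u, of j] js s u ns
    by (simp only: CC_def AN_def ZZ_def restrict_apply' if_False if_True Ks.inner_zero) simp
  also have "hinner (K (j # s)) ?v (lam j k (j # s)) = hinner (K (j # s)) ?v (cr j s (k s)) + hinner (K (j # s)) ?v (zz j s (k (j # s)))"
    using lam_comp[OF k js v, of j] js s v njs by (simp add: CC_def AN_def ZZ_def K.inner_zero)
  also have "hinner (K s) ?u (an j s (k (j # s))) + (hinner (K (j # s)) ?v (cr j s (k s)) + hinner (K (j # s)) ?v (zz j s (k (j # s))))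
      = hinner (K s) (an j s ?v) (k s) + hinner (K (j # s)) (hadd (K (j # s)) (cr j s ?u) (zz j s ?v)) (k (j # s))"
    using u v ks kjs by (simp add: cr(1,4) zz(1,4) an(4) K.inner_simps)
  also have "\<dots> = hinner S (attach T H \<xi> j s (X j h) t) k"
  proof -
    have "an j s ?v = el s (elem_lact (Hs s) (hinner (H j) (e j) (proj_compl (H j) (\<xi> j) h)) t)"
      using an_elem[OF js elem_tensors_Cons[OF l.proj_in[OF h] t]] by simp
    then show ?thesis
      unfolding inner_attach(2)[OF js Xh t k] elem_Cons_eq[OF js h t] using l.inner_\<xi>_X[OF h] by simp
  qed
  finally show "hinner S (lam j (attach T H \<xi> j s h t)) k = hinner S (attach T H \<xi> j s (X j h) t) k" .
qed

lemma lam_single_zero: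
  assumes s: "s \<in> T" "\<not> (\<exists>s'. s = j # s')" "j # s \<notin> T" and t: "t \<in> hcarrier (K s)"
  shows "lam j (single T H \<xi> s t) = hzero S"
proof (rule F.S.ext_left)
  interpret Ks: nondegenerate_corr "K s" by (rule nd_K[OF s(1)])
  have ns: "\<not> (s \<noteq> [] \<and> hd s \<in> {j})" using s(2) by (cases s) auto
  fix k assume k: "k \<in> hcarrier S"
  have "hinner S (lam j (single T H \<xi> s t)) k = hinner (K s) t (lam j k s)"
    unfolding single_eq using lam_sym[OF F.single_vec_in[OF s(1) t] k] F.inner_single[OF s(1) t lam_in[OF k]] by simp
  also have "\<dots> = 0"
    unfolding lam_comp[OF k s(1) t] CC_def AN_def ZZ_def
    using ns s t by (simp only: restrict_apply' if_False Ks.inner_zero) simp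
  finally show "hinner S (lam j (single T H \<xi> s t)) k = hinner S (hzero S) k"
    using k by (simp add: F.S.inner_zero_left)
qed (use s t in \<open>auto simp: single_eq lam_in F.single_vec_in F.S.closed\<close>)

text \<open>Two choices of \<open>h\<close> recover the elementary vectors at j s and at s. Together
  with the vertices that have no child by \<open>j\<close>, the conditions defining
  \<open>tree_lambda\<close> thus reach every elementary tensor.\<close>

lemma single_elem_attach:
  assumes js: "j # s \<in> T" and t: "t \<in> elem_tensors (Hs s)"
  shows "h \<in> hcarrier (Hc j) \<Longrightarrow> attach T H \<xi> j s h t = F.single_vec (j # s) (el (j # s) (h # fst t, snd t))"
    "attach T H \<xi> j s (\<xi> j) t = F.single_vec s (el s t)"
proof -
  note s = suffix[OF js]
  interpret l: leg "H j" "\<xi> j" "X j" \<eta> R by (rule leg_facts(1)[OF js])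
  interpret Ks: nondegenerate_corr "K s" by (rule nd_K[OF s])
  interpret K: nondegenerate_corr "K (j # s)" by (rule nd_K[OF js])
  note sHs = semi_Hs[OF s]
  {
    assume h: "h \<in> hcarrier (Hc j)"
    have hH: "h \<in> hcarrier (H j)" using h by (rule l.Hc_carrierD)
    show "attach T H \<xi> j s h t = F.single_vec (j # s) (el (j # s) (h # fst t, snd t))"
    proof (rule F.S.ext_left)
      show "attach T H \<xi> j s h t \<in> hcarrier S" by (rule inner_attach(1)[OF js hH t F.S.zero_in])
      have v: "el (j # s) (h # fst t, snd t) \<in> hcarrier (K (j # s))" by (rule elem_in[OF js elem_tensors_Cons[OF h t]])
      then show "F.single_vec (j # s) (el (j # s) (h # fst t, snd t)) \<in> hcarrier S" by (rule F.single_vec_in[OF js])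
      fix k assume k: "k \<in> hcarrier S"
      have "el s (elem_lact (Hs s) 0 t) = hzero (K s)"
      proof (rule K_eqI[OF s])
        fix x assume x: "x \<in> elem_tensors (Hs s)"
        then have "elems (Hs s) (fst t)" "elems (Hs s) (fst x)" using t by (auto simp: elem_tensors_iff)
        then show "hinner (K s) (el s (elem_lact (Hs s) 0 t)) (el s x) = hinner (K s) (hzero (K s)) (el s x)"
          using t x by (simp add: inner_elem[OF s] elem_lact_in[OF sHs] Ks.inner_zero_left elem_in[OF s]
              elem_inner_lact_left[OF sHs] elem_inner_lact[OF sHs] star_zero tensor_inner_zero[OF sHs])
      qed (auto simp: elem_in[OF s] elem_lact_in[OF sHs] t Ks.closed)
      then show "hinner S (attach T H \<xi> j s h t) k = hinner S (F.single_vec (j # s) (el (j # s) (h # fst t, snd t))) k"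
        unfolding inner_attach(2)[OF js hH t k] l.proj_id[OF h] F.inner_single[OF js v k] l.Hc_carrierD(2)[OF h]
        using F.S_comp[OF k s] by (simp add: Ks.inner_zero_left)
    qed
  }
  show "attach T H \<xi> j s (\<xi> j) t = F.single_vec s (el s t)"
  proof (rule F.S.ext_left)
    show "attach T H \<xi> j s (\<xi> j) t \<in> hcarrier S" by (rule inner_attach(1)[OF js l.\<xi>_in t F.S.zero_in])
    show "F.single_vec s (el s t) \<in> hcarrier S" by (rule F.single_vec_in[OF s elem_in[OF s t]])
    fix k assume k: "k \<in> hcarrier S"
    have p0: "hinner (H j) (proj_compl (H j) (\<xi> j) (\<xi> j)) l = 0" if "l \<in> hcarrier (Hc j)" for l
      using that by (simp add: l.inner_proj_left l.\<xi>_in l.Hc_carrierD)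
    note pin = l.proj_in[OF l.\<xi>_in]
    have 1: "el (j # s) (proj_compl (H j) (\<xi> j) (\<xi> j) # fst t, snd t) = hzero (K (j # s))"
    proof (rule K_eqI[OF js])
      note x0 = elem_tensors_Cons[OF pin t]
      fix x assume x: "x \<in> elem_tensors (Hs (j # s))"
      then obtain k ks b where xk: "x = (k # ks, b)" "k \<in> hcarrier (Hc j)" "(ks, b) \<in> elem_tensors (Hs s)"
        unfolding Hs_simps by (rule elem_tensors_ConsE)
      have "elem_inner (Hs (j # s)) (proj_compl (H j) (\<xi> j) (\<xi> j) # fst t, snd t) x = 0"
        unfolding xk Hs_simps elem_inner_Cons[OF leg_facts(3)[OF js] pin xk(2)]
        using t xk by (simp add: l.Hc_simps p0 tensor_inner_zero[OF sHs] elem_tensors_iff)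
      then show "hinner (K (j # s)) (el (j # s) (proj_compl (H j) (\<xi> j) (\<xi> j) # fst t, snd t)) (el (j # s) x)
          = hinner (K (j # s)) (hzero (K (j # s))) (el (j # s) x)"
        by (simp add: inner_elem[OF js x0 x] K.inner_zero_left elem_in[OF js x])
    qed (auto simp: elem_in[OF js elem_tensors_Cons[OF pin t]] K.closed)
    have 2: "el s (elem_lact (Hs s) 1 t) = el s t"
    proof (rule K_eqI[OF s])
      fix x assume x: "x \<in> elem_tensors (Hs s)"
      then show "hinner (K s) (el s (elem_lact (Hs s) 1 t)) (el s x) = hinner (K s) (el s t) (el s x)"
        using t by (simp add: inner_elem[OF s] elem_lact_in[OF sHs] elem_inner_lact_left[OF sHs] elem_inner_lact[OF sHs] star_one)
          (simp add: elem_inner_def)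
    qed (auto simp: elem_in[OF s] elem_lact_in[OF sHs] t)
    show "hinner S (attach T H \<xi> j s (\<xi> j) t) k = hinner S (F.single_vec s (el s t)) k"
      unfolding inner_attach(2)[OF js l.\<xi>_in t k] 1 F.inner_single[OF s elem_in[OF s t] k] l.\<xi>_unit 2
      using F.S_comp[OF k js] by (simp add: K.inner_zero_left)
  qed
qed

text \<open>Existence is \<open>lam_attach\<close> and \<open>lam_single_zero\<close>. For
  uniqueness, a second operator \<open>y\<close> agrees with \<open>lam j\<close> on elementary
  tensors at single vertices; this determines its adjoint \<open>w\<close> component by component,
  and \<open>w\<close> determines \<open>y\<close>. Passing through the adjoint replaces an
  extension by continuity.\<close>

theorem tree_lambda_eq: "tree_lambda T H \<xi> j (X j) = lam j" if j: "j \<in> J"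
  unfolding tree_lambda_def
proof (rule the_equality, intro conjI)
  show "lam j \<in> adjointable S" by (rule lam_adjointable)
  show "\<forall>s\<in>T. \<not> (\<exists>s'. s = j # s') \<longrightarrow>
      (if j # s \<in> T
       then \<forall>h\<in>hcarrier (H j). \<forall>t\<in>elem_tensors (Hs s). lam j (attach T H \<xi> j s h t) = attach T H \<xi> j s (X j h) t
       else \<forall>t\<in>hcarrier (K s). lam j (single T H \<xi> s t) = hzero S)"
    using lam_attach lam_single_zero by auto
next
  fix y
  assume y: "y \<in> adjointable S \<and> (\<forall>s\<in>T. \<not> (\<exists>s'. s = j # s') \<longrightarrow>
      (if j # s \<in> T
       then \<forall>h\<in>hcarrier (H j). \<forall>t\<in>elem_tensors (Hs s). y (attach T H \<xi> j s h t) = attach T H \<xi> j s (X j h) t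
       else \<forall>t\<in>hcarrier (K s). y (single T H \<xi> s t) = hzero S))"
  then have yP: "y \<in> hcarrier S \<rightarrow>\<^sub>E hcarrier S"
    and "\<exists>w \<in> hcarrier S \<rightarrow> hcarrier S. \<forall>h\<in>hcarrier S. \<forall>k\<in>hcarrier S. hinner S (y h) k = hinner S h (w k)"
    unfolding adjointable_def by simp_all
  then obtain w where w: "w \<in> hcarrier S \<rightarrow> hcarrier S"
    "\<forall>h\<in>hcarrier S. \<forall>k\<in>hcarrier S. hinner S (y h) k = hinner S h (w k)" by (elim bexE)
  have ysp: "y (attach T H \<xi> j s h t) = attach T H \<xi> j s (X j h) t"
    if "j # s \<in> T" "h \<in> hcarrier (H j)" "t \<in> elem_tensors (Hs s)" for s h t
    using y that suffix[OF that(1)] alternating[of j] by auto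
  have ys0: "y (single T H \<xi> s t) = hzero S" if "s \<in> T" "\<not> (\<exists>s'. s = j # s')" "j # s \<notin> T" "t \<in> hcarrier (K s)" for s t
    using y that by auto
  have agree: "y (F.single_vec r (el r t)) = lam j (F.single_vec r (el r t))"
    if r: "r \<in> T" and t: "t \<in> elem_tensors (Hs r)" for r t
  proof (cases "\<exists>s. r = j # s")
    case True
    then obtain s where rs: "r = j # s" by blast
    then have js: "j # s \<in> T" using r by simp
    interpret l: leg "H j" "\<xi> j" "X j" \<eta> R by (rule leg[OF j])
    from t obtain h hs b where th: "t = (h # hs, b)" "h \<in> hcarrier (Hc j)" "(hs, b) \<in> elem_tensors (Hs s)"
      unfolding rs Hs_simps by (rule elem_tensors_ConsE)
    have "F.single_vec r (el r t) = attach T H \<xi> j s h (hs, b)"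
      using single_elem_attach(1)[OF js th(3) th(2)] by (simp add: th rs)
    then show ?thesis
      using ysp[OF js l.Hc_carrierD(1)[OF th(2)] th(3)] lam_attach[OF js l.Hc_carrierD(1)[OF th(2)] th(3)] by simp
  next
    case False
    show ?thesis
    proof (cases "j # r \<in> T")
      case True
      have \<xi>: "\<xi> j \<in> hcarrier (H j)" using leg.\<xi>_in[OF leg[OF j]] .
      show ?thesis
        using single_elem_attach(2)[OF True t] ysp[OF True \<xi> t] lam_attach[OF True \<xi> t] by simp
    next
      case nT: False
      show ?thesis
        using ys0[OF r False nT elem_in[OF r t]] lam_single_zero[OF r False nT elem_in[OF r t]] by (simp add: single_eq)
    qed
  qed
  have wl: "w k = lam j k" if k: "k \<in> hcarrier S" for k
  proof -
    have wk: "w k \<in> hcarrier S" and lk: "lam j k \<in> hcarrier S" using w(1) k lam_in by auto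
    have comp: "w k r = lam j k r" if r: "r \<in> T" for r
    proof (rule K_eqI[OF r F.S_comp[OF wk r] F.S_comp[OF lk r]])
      fix x assume x: "x \<in> elem_tensors (Hs r)"
      interpret Kr: semi_corr "K r" by (rule F.semi[OF r])
      note ex = elem_in[OF r x]
      note sx = F.single_vec_in[OF r ex]
      have "hinner (K r) (el r x) (w k r) = hinner (K r) (el r x) (lam j k r)"
        using F.inner_single[OF r ex wk] F.inner_single[OF r ex lk] w(2)[rule_format, OF sx k]
          lam_sym[OF sx k, of j] agree[OF r x] by simp
      then show "hinner (K r) (w k r) (el r x) = hinner (K r) (lam j k r) (el r x)"
        using Kr.inner_sym[OF ex F.S_comp[OF wk r]] Kr.inner_sym[OF ex F.S_comp[OF lk r]] by simp
    qed
    have lext: "w k r = lam j k r" if "r \<notin> T" for r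
    proof -
      have "w k \<in> (\<Pi>\<^sub>E s\<in>T. hcarrier (K s))" "lam j k \<in> (\<Pi>\<^sub>E s\<in>T. hcarrier (K s))"
        using wk lk by (simp_all add: F.S_carrier)
      from this[THEN PiE_arb, OF that] show ?thesis by simp
    qed
    show ?thesis using comp lext by (intro HOL.ext) blast
  qed
  show "y = lam j"
  proof
    fix h
    show "y h = lam j h"
    proof (cases "h \<in> hcarrier S")
      case True
      have yh: "y h \<in> hcarrier S" using yP True by auto
      show ?thesis
      proof (rule F.S.ext_left[OF yh lam_in[OF True]])
        show "hinner S (y h) k = hinner S (lam j h) k" if "k \<in> hcarrier S" for k
          using w(2)[rule_format, OF True that] wl[OF that] lam_sym[OF True that, of j] by simp
      qed
    next
      case False
      then show ?thesis using PiE_arb[OF yP False] by (simp add: lam_def)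
    qed
  qed
qed

end

section \<open>Evaluation of polynomials in operators\<close>

text \<open>Evaluates an expression directly on a vector, bypassing the restricted functions of
  \<open>op_ring\<close>; \<open>y\<close> may then be any function on vectors.\<close>

fun act :: "('b::cstar_algebra, 'h) corr \<Rightarrow> ('h \<Rightarrow> 'h) \<Rightarrow> 'b ncexpr \<Rightarrow> 'h \<Rightarrow> 'h" where
  "act G y (Const b) h = lact G b h"
| "act G y Var h = y h"
| "act G y (Plus p q) h = hadd G (act G y p h) (act G y q h)"
| "act G y (Times p q) h = act G y p (act G y q h)"

context nondegenerate_corr
begin

lemma lact_zero: "h \<in> hcarrier H \<Longrightarrow> lact H 0 h = hzero H"
proof (rule ext)
  fix l assume "h \<in> hcarrier H" "l \<in> hcarrier H"
  then show "hinner H l (lact H 0 h) = hinner H l (hzero H)"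
    using lact_add[of l h 0 0] by (simp add: inner_zero)
qed (auto simp: closed)

lemma lact_scalar_eq: "h \<in> hcarrier H \<Longrightarrow> lact H (scaleC c 1) h = ract H h (scaleC c 1)"
  by (rule ext) (auto simp: closed inner_simps lact_scalar)

lemma lact_mult_eq: "h \<in> hcarrier H \<Longrightarrow> lact H (a * b) h = lact H a (lact H b h)"
  by (rule ext) (auto simp: closed lact_mult)

lemma lact_add_eq: "h \<in> hcarrier H \<Longrightarrow> lact H (a + b) h = hadd H (lact H a h) (lact H b h)"
  by (rule ext) (auto simp: closed lact_add inner_add)

lemma lact_one_eq: "h \<in> hcarrier H \<Longrightarrow> lact H 1 h = h"
  by (rule ext) (auto simp: closed lact_one)

lemma hadd_assoc: "\<lbrakk>h \<in> hcarrier H; k \<in> hcarrier H; l \<in> hcarrier H\<rbrakk> \<Longrightarrow>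
    hadd H (hadd H h k) l = hadd H h (hadd H k l)"
  by (rule ext) (auto simp: closed inner_simps)

lemma hadd_commute: "\<lbrakk>h \<in> hcarrier H; k \<in> hcarrier H\<rbrakk> \<Longrightarrow> hadd H h k = hadd H k h"
  by (rule ext) (auto simp: closed inner_simps)

end

locale symmetric_op = nondegenerate_corr H for H :: "('b::cstar_algebra, 'h) corr" +
  fixes y :: "'h \<Rightarrow> 'h"
  assumes y_in: "h \<in> hcarrier H \<Longrightarrow> y h \<in> hcarrier H"
    and y_sym: "\<lbrakk>h \<in> hcarrier H; k \<in> hcarrier H\<rbrakk> \<Longrightarrow> hinner H (y h) k = hinner H h (y k)"
begin

lemma act_in: "h \<in> hcarrier H \<Longrightarrow> act H y p h \<in> hcarrier H"
  by (induction p arbitrary: h) (auto simp: closed y_in)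

lemma act_adj: "h \<in> hcarrier H \<Longrightarrow> k \<in> hcarrier H \<Longrightarrow> hinner H (act H y p h) k = hinner H h (act H y (star_expr p) k)"
  by (induction p arbitrary: h k) (auto simp: inner_lact_left y_sym act_in inner_simps)

lemma act_add: "h \<in> hcarrier H \<Longrightarrow> k \<in> hcarrier H \<Longrightarrow> act H y p (hadd H h k) = hadd H (act H y p h) (act H y p k)"
  by (rule ext_left) (auto simp: act_in closed inner_simps act_adj)

lemma act_zero: "act H y p (hzero H) = hzero H"
  by (rule ext_left) (auto simp: act_in closed inner_simps act_adj)

lemma y_ract: "h \<in> hcarrier H \<Longrightarrow> y (ract H h b) = ract H (y h) b"
  by (rule ext_left) (auto simp: y_in closed inner_simps y_sym)

text \<open>Makes the value independent of the expression that \<open>rep_ncpoly\<close> picks. The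
  relation for scalars holds because a scalar acts from the left as it does from the right, and
  \<open>y\<close> commutes with the right action.\<close>

lemma act_nceq: "nceq p q \<Longrightarrow> h \<in> hcarrier H \<Longrightarrow> act H y p h = act H y q h"
proof (induction arbitrary: h rule: nceq.induct)
  case (nc_scalar c)
  then show ?case by (simp add: lact_scalar_eq y_in y_ract)
next
  case (nc_add_comm p q)
  then show ?case by (simp add: hadd_commute act_in)
qed (auto simp: act_in closed hadd_assoc act_add lact_zero act_zero zero_add
    lact_mult_eq lact_add_eq lact_one_eq)

end

lemma nceq_rep_abs: "nceq (rep_ncpoly (abs_ncpoly p)) p"
  by (rule Quotient3_rep_abs[OF Quotient3_ncpoly]) (rule nc_refl)

lemma nceq_rep_dil: "nceq (rep_ncpoly (nc_dil r f)) (dil_expr r (rep_ncpoly f))"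
  unfolding nc_dil_def map_fun_apply id_apply by (rule nceq_rep_abs)

lemma act_dil: "act G y (dil_expr r p) h = act G (\<lambda>h. lact G (of_real r) (y h)) p h"
  by (induction p arbitrary: h) auto

lemma eval_expr_op_ring:
  assumes "semi_corr G" "y \<in> hcarrier G \<rightarrow>\<^sub>E hcarrier G" "h \<in> hcarrier G"
  shows "eval_expr (op_ring G) (left_op G) y p h = act G y p h" "act G y p h \<in> hcarrier G"
proof -
  interpret semi_corr G by fact
  have "eval_expr (op_ring G) (left_op G) y p h = act G y p h \<and> act G y p h \<in> hcarrier G"
    using assms(3)
  proof (induction p arbitrary: h)
    case Var
    then show ?case using assms(2) by auto
  qed (auto simp: op_ring_def left_op_def compose_def closed)
  then show "eval_expr (op_ring G) (left_op G) y p h = act G y p h" "act G y p h \<in> hcarrier G" by auto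
qed

lemma dil_law_of_op:
  assumes "symmetric_op G y" "y \<in> hcarrier G \<rightarrow>\<^sub>E hcarrier G" "\<Omega> \<in> hcarrier G"
  shows "dil_law r (law_of_op G \<Omega> y) f = hinner G \<Omega> (act G (\<lambda>h. lact G (of_real r) (y h)) (rep_ncpoly f) \<Omega>)"
proof -
  interpret symmetric_op G y by fact
  show ?thesis
    unfolding dil_law_def law_of_op_def nc_eval_def eval_expr_op_ring(1)[OF semi_corr_axioms assms(2,3)]
      act_nceq[OF nceq_rep_dil assms(3)] act_dil ..
qed

lemma adjointableE:
  assumes "y \<in> adjointable G"
  obtains C w where "y \<in> hcarrier G \<rightarrow>\<^sub>E hcarrier G" "w \<in> hcarrier G \<rightarrow> hcarrier G"
    "\<And>h k. h \<in> hcarrier G \<Longrightarrow> k \<in> hcarrier G \<Longrightarrow> hinner G (y h) k = hinner G h (w k)"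
    "\<And>h. h \<in> hcarrier G \<Longrightarrow> hnorm G (y h) \<le> C * hnorm G h"
proof -
  have 1: "y \<in> hcarrier G \<rightarrow>\<^sub>E hcarrier G"
    and 2: "\<exists>C. \<forall>h\<in>hcarrier G. hnorm G (y h) \<le> C * hnorm G h"
    and 3: "\<exists>z \<in> hcarrier G \<rightarrow> hcarrier G. \<forall>h\<in>hcarrier G. \<forall>k\<in>hcarrier G. hinner G (y h) k = hinner G h (z k)"
    using assms by (simp_all add: adjointable_def)
  from 2 obtain C where C: "\<forall>h\<in>hcarrier G. hnorm G (y h) \<le> C * hnorm G h" by (elim exE)
  from 3 obtain w where w: "w \<in> hcarrier G \<rightarrow> hcarrier G"
    "\<forall>h\<in>hcarrier G. \<forall>k\<in>hcarrier G. hinner G (y h) k = hinner G h (w k)" by (elim bexE)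
  show thesis
    by (rule that[OF 1 w(1) w(2)[rule_format] C[rule_format]])
qed

text \<open>The sum over the alphabet in \<open>boxplus\<close> is a \<open>finsum\<close>, which
  unfolds only in an abelian monoid.\<close>

lemma (in nondegenerate_corr) abelian_monoid_op_ring: "abelian_monoid (op_ring H)"
proof -
  have s: "carrier (op_ring H) = adjointable H" "zero (op_ring H) = (\<lambda>h\<in>hcarrier H. hzero H)"
    "add (op_ring H) x y = (\<lambda>h\<in>hcarrier H. hadd H (x h) (y h))" for x y
    by (simp_all add: op_ring_def)
  have app: "x h \<in> hcarrier H" if "x \<in> adjointable H" "h \<in> hcarrier H" for x h
    using that by (auto simp: adjointable_def)
  have xeq: "(\<lambda>h\<in>hcarrier H. x h) = x" if "x \<in> adjointable H" for x
    using that by (auto simp: adjointable_def)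
  show ?thesis
  proof (rule abelian_monoidI, unfold s)
    fix x y assume xy: "x \<in> adjointable H" "y \<in> adjointable H"
    obtain C w where x: "x \<in> hcarrier H \<rightarrow>\<^sub>E hcarrier H" "w \<in> hcarrier H \<rightarrow> hcarrier H"
      "\<And>h k. h \<in> hcarrier H \<Longrightarrow> k \<in> hcarrier H \<Longrightarrow> hinner H (x h) k = hinner H h (w k)"
      "\<And>h. h \<in> hcarrier H \<Longrightarrow> hnorm H (x h) \<le> C * hnorm H h"
      by (rule adjointableE[OF xy(1)]) (rule that)
    obtain D v where y: "y \<in> hcarrier H \<rightarrow>\<^sub>E hcarrier H" "v \<in> hcarrier H \<rightarrow> hcarrier H"
      "\<And>h k. h \<in> hcarrier H \<Longrightarrow> k \<in> hcarrier H \<Longrightarrow> hinner H (y h) k = hinner H h (v k)"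
      "\<And>h. h \<in> hcarrier H \<Longrightarrow> hnorm H (y h) \<le> D * hnorm H h"
      by (rule adjointableE[OF xy(2)]) (rule that)
    have wv: "w h \<in> hcarrier H" "v h \<in> hcarrier H" if "h \<in> hcarrier H" for h using x(2) y(2) that by auto
    show "(\<lambda>h\<in>hcarrier H. hadd H (x h) (y h)) \<in> adjointable H"
    proof (rule adjointableI[where w = "\<lambda>h. hadd H (w h) (v h)" and C = "C + D"])
      fix h assume h: "h \<in> hcarrier H"
      show "hnorm H ((\<lambda>h\<in>hcarrier H. hadd H (x h) (y h)) h) \<le> (C + D) * hnorm H h"
        using hnorm_add[OF app[OF xy(1) h] app[OF xy(2) h]] x(4)[OF h] y(4)[OF h] h by (simp add: distrib_right)
    qed (auto simp: nondegenerate_corr_axioms closed app[OF xy(1)] app[OF xy(2)] wv inner_simps x(3) y(3))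
    show "(\<lambda>h\<in>hcarrier H. hadd H (x h) (y h)) = (\<lambda>h\<in>hcarrier H. hadd H (y h) (x h))"
      by (rule restrict_ext, rule ext) (auto simp: closed app[OF xy(1)] app[OF xy(2)] inner_simps)
    fix z assume z: "z \<in> adjointable H"
    show "(\<lambda>h\<in>hcarrier H. hadd H ((\<lambda>h\<in>hcarrier H. hadd H (x h) (y h)) h) (z h))
        = (\<lambda>h\<in>hcarrier H. hadd H (x h) ((\<lambda>h\<in>hcarrier H. hadd H (y h) (z h)) h))"
      by (rule restrict_ext, rule ext) (auto simp: closed app[OF xy(1)] app[OF xy(2)] app[OF z] inner_simps)
  next
    fix x assume x: "x \<in> adjointable H"
    have "(\<lambda>h\<in>hcarrier H. hadd H ((\<lambda>h\<in>hcarrier H. hzero H) h) (x h)) = (\<lambda>h\<in>hcarrier H. x h)"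
      by (rule restrict_ext) (simp add: zero_add app[OF x])
    then show "(\<lambda>h\<in>hcarrier H. hadd H ((\<lambda>h\<in>hcarrier H. hzero H) h) (x h)) = x" by (simp add: xeq[OF x])
  next
    show "(\<lambda>h\<in>hcarrier H. hzero H) \<in> adjointable H"
    proof (rule adjointableI[where w = "\<lambda>_. hzero H" and C = 0])
      fix h assume "h \<in> hcarrier H"
      then show "hnorm H ((\<lambda>h\<in>hcarrier H. hzero H) h) \<le> 0 * hnorm H h"
        by (simp add: hnorm_def inner_zero zero_in)
    qed (auto simp: nondegenerate_corr_axioms closed inner_simps)
  qed
qed

section \<open>The sum of the operators along the tree\<close>

context tree_legs
begin

lemma inner_CC_insert:
  assumes "j \<notin> L" "h \<in> hcarrier S" "k \<in> hcarrier S"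
  shows "hinner S (CC (insert j L) h) k = hinner S (CC {j} h) k + hinner S (CC L h) k"
    "hinner S (ZZ (insert j L) h) k = hinner S (ZZ {j} h) k + hinner S (ZZ L h) k"
proof -
  note kr = F.S_comp[OF assms(3)]
  have z: "hinner (K r) (hzero (K r)) (k r) = 0" if "r \<in> T" for r
    using semi_corr.inner_zero_left[OF F.semi[OF that] kr[OF that]] .
  show "hinner S (CC (insert j L) h) k = hinner S (CC {j} h) k + hinner S (CC L h) k"
    by (rule F.S_inner_eqI[OF has_sum_add[OF F.S_has_sum[OF CC_in_le(1)[OF assms(2)] assms(3)] F.S_has_sum[OF CC_in_le(1)[OF assms(2)] assms(3)]]])
      (use assms(1) in \<open>auto simp: CC_def z\<close>)
  show "hinner S (ZZ (insert j L) h) k = hinner S (ZZ {j} h) k + hinner S (ZZ L h) k"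
    by (rule F.S_inner_eqI[OF has_sum_add[OF F.S_has_sum[OF ZZ_in_le(1)[OF assms(2)] assms(3)] F.S_has_sum[OF ZZ_in_le(1)[OF assms(2)] assms(3)]]])
      (use assms(1) in \<open>auto simp: ZZ_def z\<close>)
qed

lemma inner_CC_empty:
  assumes "h \<in> hcarrier S" "k \<in> hcarrier S"
  shows "hinner S (CC {} h) k = 0" "hinner S (ZZ {} h) k = 0"
  unfolding F.S_inner
  by (rule infsum_0, use semi_corr.inner_zero_left[OF F.semi F.S_comp[OF assms(2)]] in \<open>simp add: CC_def ZZ_def\<close>)+

definition "XX = finsum (op_ring S) (\<lambda>j. tree_lambda T H \<xi> j (X j)) J"

lemma op_ring_simps: "carrier (op_ring S) = adjointable S" "zero (op_ring S) = (\<lambda>h\<in>hcarrier S. hzero S)"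
  "add (op_ring S) x y = (\<lambda>h\<in>hcarrier S. hadd S (x h) (y h))"
  by (simp_all add: op_ring_def)

text \<open>The three parts of the \<open>lam j\<close> are added up over the whole alphabet, by
  induction on finite sets of letters. The adjoint of \<open>CC J\<close> appears only weakly, as
  \<open>CC J\<close> on the second argument.\<close>

lemma inner_XX:
  shows "XX \<in> adjointable S"
    and "h \<in> hcarrier S \<Longrightarrow> k \<in> hcarrier S \<Longrightarrow>
      hinner S (XX h) k = hinner S (CC J h) k + hinner S h (CC J k) + hinner S (ZZ J h) k"
proof -
  interpret O: abelian_monoid "op_ring S" by (rule F.S.abelian_monoid_op_ring)
  have XX: "XX = finsum (op_ring S) lam J"
    unfolding XX_def by (rule O.finsum_cong) (auto simp: op_ring_simps lam_adjointable tree_lambda_eq simp_implies_def)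
  have lamc: "lam \<in> L \<rightarrow> carrier (op_ring S)" for L by (simp add: op_ring_simps lam_adjointable)
  show "XX \<in> adjointable S" unfolding XX using O.finsum_closed[OF lamc] by (simp add: op_ring_simps)
  have "hinner S (finsum (op_ring S) lam L h) k = hinner S (CC L h) k + hinner S h (CC L k) + hinner S (ZZ L h) k"
    if "finite L" "h \<in> hcarrier S" "k \<in> hcarrier S" for L h k
    using that
  proof (induction L arbitrary: h k rule: finite_induct)
    case empty
    have "hinner S h (CC {} k) = 0"
      using inner_CC_empty(1)[OF empty(2,1)] F.S.inner_sym[OF CC_in_le(1)[OF empty(2)] empty(1), of "{}"] by (simp add: star_zero)
    then show ?case using empty by (simp add: op_ring_simps inner_CC_empty F.S.inner_zero_left)
  next
    case (insert j L)
    let ?y = "finsum (op_ring S) lam L"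
    have y: "?y h \<in> hcarrier S" if "h \<in> hcarrier S" for h
      using O.finsum_closed[OF lamc[of L]] that by (auto simp: op_ring_simps adjointable_def)
    have eq: "finsum (op_ring S) lam (insert j L) = (\<lambda>h\<in>hcarrier S. hadd S (lam j h) (?y h))"
      using O.finsum_insert[OF insert(1,2) lamc] lam_adjointable by (simp add: op_ring_simps)
    have right: "hinner S h (CC (insert j L) k) = hinner S (AN j h) k + hinner S h (CC L k)"
    proof -
      have "hinner S h (CC (insert j L) k) = star (hinner S (CC (insert j L) k) h)"
        using insert.prems by (simp add: F.S.inner_sym CC_in_le)
      also have "\<dots> = hinner S h (CC {j} k) + hinner S h (CC L k)"
        using insert.prems by (simp add: inner_CC_insert(1)[OF insert(2)] star_add F.S.inner_sym CC_in_le)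
      finally show ?thesis using insert.prems by (simp add: AN_CC_adj)
    qed
    show ?case
      unfolding eq right inner_CC_insert(1)[OF insert(2) insert.prems] inner_CC_insert(2)[OF insert(2) insert.prems]
      using insert.prems by (simp add: F.S.inner_simps lam_in y inner_lam insert.IH)
  qed
  from this[OF finite_J] show "h \<in> hcarrier S \<Longrightarrow> k \<in> hcarrier S \<Longrightarrow>
      hinner S (XX h) k = hinner S (CC J h) k + hinner S h (CC J k) + hinner S (ZZ J h) k"
    unfolding XX by blast
qed

lemma XX_in: "h \<in> hcarrier S \<Longrightarrow> XX h \<in> hcarrier S"
  using inner_XX(1) by (auto simp: adjointable_def)

text \<open>The creation-annihilation part, obtained by subtracting the compressions from the sum,
  since the adjoint of \<open>CC J\<close> has no formula of its own; \<open>inner_YY\<close>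
  confirms what is left.\<close>

definition YY :: "(nat list \<Rightarrow> (nat \<Rightarrow> ('h list \<times> 'b) list) set) \<Rightarrow> nat list \<Rightarrow> (nat \<Rightarrow> ('h list \<times> 'b) list) set" where
  "YY h = hminus S (XX h) (ZZ J h)"

lemma YY_in: "h \<in> hcarrier S \<Longrightarrow> YY h \<in> hcarrier S"
  by (simp add: YY_def F.S.minus_in XX_in ZZ_in_le)

lemma inner_YY:
  "h \<in> hcarrier S \<Longrightarrow> k \<in> hcarrier S \<Longrightarrow> hinner S (YY h) k = hinner S (CC J h) k + hinner S h (CC J k)"
  by (simp add: YY_def F.S.inner_simps XX_in ZZ_in_le inner_XX(2))

lemma YY_sym:
  assumes "h \<in> hcarrier S" "k \<in> hcarrier S" shows "hinner S (YY h) k = hinner S h (YY k)"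
proof -
  have "hinner S h (YY k) = star (hinner S (YY k) h)" using assms by (simp add: F.S.inner_sym YY_in)
  also have "\<dots> = hinner S (YY h) k"
    using assms by (simp add: inner_YY star_add F.S.inner_sym CC_in_le)
  finally show ?thesis ..
qed

lemma inner_XX_YY:
  assumes "h \<in> hcarrier S" "k \<in> hcarrier S" shows "hinner S (XX h) k = hinner S (YY h) k + hinner S (ZZ J h) k"
  using assms by (simp add: inner_YY inner_XX)

lemma XX_sym:
  assumes "h \<in> hcarrier S" "k \<in> hcarrier S" shows "hinner S (XX h) k = hinner S h (XX k)"
proof -
  have "hinner S h (XX k) = star (hinner S (XX k) h)" using assms by (simp add: F.S.inner_sym XX_in)
  also have "\<dots> = hinner S (YY h) k + hinner S (ZZ J h) k"
    using assms by (simp add: inner_XX_YY star_add F.S.inner_sym YY_in ZZ_in_le YY_sym ZZ_sym)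
  finally show ?thesis using inner_XX_YY[OF assms] by simp
qed

lemma symmetric_XX: "symmetric_op S XX" and symmetric_YY: "symmetric_op S YY"
  by unfold_locales (auto simp: XX_in XX_sym YY_in YY_sym)

lemma CC_norm: 
  assumes h: "h \<in> hcarrier S" shows "hnorm S (CC J h) \<le> sqrt (real D * c) * hnorm S h"
  using cle_norm_mono[OF F.S.inner_pos[OF CC_in_le(1)[OF h]] CC_in_le(2)[OF h]] c_nonneg
  unfolding hnorm_def real_sqrt_mult[symmetric] by simp

text \<open><Y h, Y h> splits into <C h, Y h> and <h, C Y h>. Cauchy-Schwarz for both and division
  by the length of Y h give the factor 2.\<close>

lemma YY_norm:
  assumes h: "h \<in> hcarrier S" shows "hnorm S (YY h) \<le> 2 * sqrt (real D * c) * hnorm S h"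
proof -
  let ?q = "sqrt (real D * c)"
  note Y = YY_in[OF h]
  have q: "?q \<ge> 0" using c_nonneg by simp
  have "(hnorm S (YY h))\<^sup>2 = norm (hinner S (CC J h) (YY h) + hinner S h (CC J (YY h)))"
    unfolding F.S.hnorm_sq inner_YY[OF h Y] ..
  also have "\<dots> \<le> hnorm S (CC J h) * hnorm S (YY h) + hnorm S h * hnorm S (CC J (YY h))"
    by (intro norm_triangle_mono F.S.Cauchy_Schwarz CC_in_le h Y)
  also have "\<dots> \<le> (?q * hnorm S h) * hnorm S (YY h) + hnorm S h * (?q * hnorm S (YY h))"
    by (intro add_mono mult_left_mono mult_right_mono CC_norm h Y F.S.hnorm_nonneg)
  finally have "hnorm S (YY h) * hnorm S (YY h) \<le> (2 * ?q * hnorm S h) * hnorm S (YY h)"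
    by (simp add: power2_eq_square mult_ac)
  then show ?thesis
    using F.S.hnorm_nonneg[of "YY h"] F.S.hnorm_nonneg[of h] q
    by (cases "hnorm S (YY h) = 0") auto
qed

lemma XX_YY_norm:
  assumes h: "h \<in> hcarrier S" shows "hnorm S (hminus S (XX h) (YY h)) \<le> \<bar>R\<bar> * hnorm S h"
proof -
  have "hminus S (XX h) (YY h) = ZZ J h"
    by (rule F.S.ext_left) (auto simp: F.S.minus_in XX_in YY_in ZZ_in_le h F.S.inner_simps inner_XX_YY)
  then show ?thesis
    using adj_pair_norm[OF F.S.semi_corr_axioms F.S.semi_corr_axioms ZZ_pair h, of J] by simp
qed

definition "\<Omega> = tree_vacuum T H \<xi>"

lemma one_elem: "([], b) \<in> elem_tensors (Hs [])"
  by (simp add: elem_tensors_iff Hs_simps)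

lemma \<Omega>_eq: "\<Omega> = F.single_vec [] (el [] ([], 1))"
  by (auto simp: \<Omega>_def tree_vacuum_def F.single_vec_def)

lemma \<Omega>_in: "\<Omega> \<in> hcarrier S"
  unfolding \<Omega>_eq by (rule F.single_vec_in[OF nil_in elem_in[OF nil_in one_elem]])

lemma inner_\<Omega>: "h \<in> hcarrier S \<Longrightarrow> hinner S \<Omega> h = hinner (K []) (el [] ([], 1)) (h [])"
  unfolding \<Omega>_eq by (rule F.inner_single[OF nil_in elem_in[OF nil_in one_elem]])

lemma el_lact:
  assumes "s \<in> T" "x \<in> elem_tensors (Hs s)"
  shows "lact (K s) a (el s x) = el s (elem_lact (Hs s) a x)"
  unfolding elem_embed_def tensor_product_def semi_corr.embed_lact[OF semi_P[OF assms(1)] elem_singleton[OF assms(2)]]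
  by (simp add: pre_tensor_simps)

lemma el_ract:
  assumes "s \<in> T" "x \<in> elem_tensors (Hs s)"
  shows "ract (K s) (el s x) a = el s (fst x, snd x * a)"
  unfolding elem_embed_def tensor_product_def semi_corr.embed_ract[OF semi_P[OF assms(1)] elem_singleton[OF assms(2)]]
  by (simp add: pre_tensor_simps)

lemma \<Omega>_unit: "hinner S \<Omega> \<Omega> = 1"
  unfolding inner_\<Omega>[OF \<Omega>_in] unfolding \<Omega>_eq
  by (simp add: F.single_vec_def nil_in inner_elem one_elem) (simp add: elem_inner_def Hs_simps star_one)

text \<open>Only the component at the empty string matters, where both actions multiply the
  coefficient 1 by \<open>b\<close>.\<close>

lemma \<Omega>_central: "lact S b \<Omega> = ract S \<Omega> b"
proof (rule F.S.ext)
  show "lact S b \<Omega> \<in> hcarrier S" "ract S \<Omega> b \<in> hcarrier S" by (intro F.S.closed \<Omega>_in)+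
  fix l assume l: "l \<in> hcarrier S"
  have "hinner S l (lact S b \<Omega>) = hinner S (lact S (star b) l) \<Omega>"
    by (rule F.S.inner_lact[OF l \<Omega>_in])
  also have "\<dots> = hinner (K []) (lact S (star b) l []) (el [] ([], 1))"
    unfolding \<Omega>_eq by (rule F.inner_single_right[OF nil_in elem_in[OF nil_in one_elem] F.S.lact_in[OF l]])
  also have "\<dots> = hinner (K []) (l []) (lact (K []) b (el [] ([], 1)))"
    using semi_corr.inner_lact[OF F.semi[OF nil_in] F.S_comp[OF l nil_in] elem_in[OF nil_in one_elem]]
    by (simp add: F.S_ops nil_in)
  also have "lact (K []) b (el [] ([], 1)) = ract (K []) (el [] ([], 1)) b"
    unfolding el_lact[OF nil_in one_elem] el_ract[OF nil_in one_elem] by (simp add: Hs_simps)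
  also have "hinner (K []) (l []) \<dots> = hinner S l \<Omega> * b"
    unfolding \<Omega>_eq F.inner_single_right[OF nil_in elem_in[OF nil_in one_elem] l]
    by (rule semi_corr.inner_ract[OF F.semi[OF nil_in] F.S_comp[OF l nil_in] elem_in[OF nil_in one_elem]])
  also have "\<dots> = hinner S l (ract S \<Omega> b)" by (rule F.S.inner_ract[OF l \<Omega>_in, symmetric])
  finally show "hinner S l (lact S b \<Omega>) = hinner S l (ract S \<Omega> b)" .
qed

end

section \<open>The law of the creation-annihilation part\<close>

text \<open>The triple \<open>(j\<^sub>1 \<cdots> j\<^sub>m, [b\<^sub>1, \<dots>, b\<^sub>m], b)\<close> stands for
  \<open>b\<^sub>1 X\<^sub>j\<^sub>1 \<xi> \<otimes> \<cdots> \<otimes> b\<^sub>m X\<^sub>j\<^sub>m \<xi> b\<close>. Creation and annihilation act on sums of such vectors by rules that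
  only involve \<open>T\<close> and \<open>\<eta>\<close>.\<close>

type_synonym 'b word = "nat list \<times> 'b list \<times> 'b"

fun word_lact :: "'b::times \<Rightarrow> 'b word \<Rightarrow> 'b word" where
  "word_lact a (s, [], b) = (s, [], a * b)"
| "word_lact a (s, a' # as, b) = (s, (a * a') # as, b)"

fun word_annihilate :: "('b::times \<Rightarrow> 'b) \<Rightarrow> 'b word \<Rightarrow> 'b word list" where
  "word_annihilate \<eta> (j # s, a # as, b) = [word_lact (\<eta> a) (s, as, b)]"
| "word_annihilate \<eta> _ = []"

definition word_create :: "nat list set \<Rightarrow> nat set \<Rightarrow> 'b::monoid_mult word \<Rightarrow> 'b word list" where
  "word_create T J x = map (\<lambda>j. (j # fst x, 1 # fst (snd x), snd (snd x))) (filter (\<lambda>j. j # fst x \<in> T) (sorted_list_of_set J))"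

fun word_act :: "nat list set \<Rightarrow> nat set \<Rightarrow> ('b::cstar_algebra \<Rightarrow> 'b) \<Rightarrow> real \<Rightarrow> 'b ncexpr \<Rightarrow> 'b word list \<Rightarrow> 'b word list" where
  "word_act T J \<eta> r (Const b) L = map (word_lact b) L"
| "word_act T J \<eta> r Var L = map (word_lact (of_real r)) (concat (map (\<lambda>x. word_create T J x @ word_annihilate \<eta> x) L))"
| "word_act T J \<eta> r (Plus p q) L = word_act T J \<eta> r p L @ word_act T J \<eta> r q L"
| "word_act T J \<eta> r (Times p q) L = word_act T J \<eta> r p (word_act T J \<eta> r q L)"

definition word_vacuum :: "'b::cstar_algebra word list \<Rightarrow> 'b" where
  "word_vacuum L = (\<Sum>x\<leftarrow>L. if fst x = [] then snd (snd x) else 0)"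

lemma sum_list_filter: "(\<Sum>x\<leftarrow>filter P xs. f x) = (\<Sum>x\<leftarrow>xs. if P x then f x else 0 :: 'x::comm_monoid_add)"
  by (induction xs) auto

lemma sum_list_concat_map: "(\<Sum>y\<leftarrow>concat (map g L). f y) = (\<Sum>x\<leftarrow>L. \<Sum>y\<leftarrow>g x. f y :: 'x::comm_monoid_add)"
  by (induction L) auto

section \<open>Words as vectors of the tree product\<close>

context tree_legs
begin

definition valid :: "'b word \<Rightarrow> bool" where
  "valid x \<longleftrightarrow> fst x \<in> T \<and> length (fst (snd x)) = length (fst x)"

definition word_elem :: "'b word \<Rightarrow> 'h list \<times> 'b" where
  "word_elem x = (map2 (\<lambda>j a. lact (H j) a (e j)) (fst x) (fst (snd x)), snd (snd x))"

abbreviation word_vec :: "'b word \<Rightarrow> (nat \<Rightarrow> ('h list \<times> 'b) list) set" where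
  "word_vec x \<equiv> el (fst x) (word_elem x)"

text \<open>Equality of \<open>h\<close> with a sum of word vectors in weak form. The words of
  \<open>L\<close> may repeat vertices, and their sum is never formed as a vector.\<close>

definition represents :: "'b word list \<Rightarrow> (nat list \<Rightarrow> (nat \<Rightarrow> ('h list \<times> 'b) list) set) \<Rightarrow> bool" where
  "represents L h \<longleftrightarrow> h \<in> hcarrier S \<and> (\<forall>x\<in>set L. valid x) \<and>
     (\<forall>k\<in>hcarrier S. hinner S h k = (\<Sum>x\<leftarrow>L. hinner (K (fst x)) (word_vec x) (k (fst x))))"

lemma word_elem_in: "valid x \<Longrightarrow> word_elem x \<in> elem_tensors (Hs (fst x))"
proof -
  have "elems (Hs s) (map2 (\<lambda>j a. lact (H j) a (e j)) s as)" if "s \<in> T" "length as = length s" for s as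
    using that
  proof (induction s arbitrary: as)
    case (Cons j s)
    then obtain a as' where as: "as = a # as'" by (cases as) auto
    interpret l: leg "H j" "\<xi> j" "X j" \<eta> R by (rule leg_facts(1)[OF Cons.prems(1)])
    interpret Hc: semi_corr "Hc j" by (rule l.semi_corr_Hc)
    have "lact (H j) a (e j) \<in> hcarrier (Hc j)" using Hc.lact_in[OF l.e_in, of a] by (simp add: l.Hc_simps)
    then show ?case using Cons.IH[of as'] Cons.prems suffix[OF Cons.prems(1)] by (simp add: as Hs_simps)
  qed (simp add: Hs_simps)
  then show "valid x \<Longrightarrow> word_elem x \<in> elem_tensors (Hs (fst x))"
    by (auto simp: valid_def word_elem_def elem_tensors_iff)
qed

lemma word_vec_in: "valid x \<Longrightarrow> word_vec x \<in> hcarrier (K (fst x))"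
  by (rule elem_in) (auto simp: word_elem_in valid_def)

lemma word_lact_valid: "valid x \<Longrightarrow> valid (word_lact a x)" and fst_word_lact: "fst (word_lact a x) = fst x"
  by (cases "(a, x)" rule: word_lact.cases; simp add: valid_def)+

lemma elem_lact_word:
  assumes "valid x" shows "elem_lact (Hs (fst x)) a (word_elem x) = word_elem (word_lact a x)"
proof (cases "fst x")
  case Nil
  then show ?thesis using assms by (cases x) (auto simp: valid_def word_elem_def Hs_simps)
next
  case (Cons j s)
  then obtain a' as b where x: "x = (j # s, a' # as, b)" and js: "j # s \<in> T"
    using assms by (cases x; cases "fst (snd x)") (auto simp: valid_def)
  interpret l: leg "H j" "\<xi> j" "X j" \<eta> R by (rule leg_facts(1)[OF js])
  have "lact (H j) a (lact (H j) a' (e j)) = lact (H j) (a * a') (e j)"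
    by (rule l.ext) (auto simp: l.closed l.X_in l.\<xi>_in l.lact_mult)
  then show ?thesis by (simp add: x word_elem_def Hs_simps l.Hc_simps)
qed

lemma lact_word_vec: "valid x \<Longrightarrow> lact (K (fst x)) a (word_vec x) = word_vec (word_lact a x)"
  using el_lact[OF _ word_elem_in, of x a] by (simp add: valid_def elem_lact_word fst_word_lact)

lemma represents_lact:
  assumes "represents L h" shows "represents (map (word_lact a) L) (lact S a h)"
  unfolding represents_def
proof (intro conjI ballI)
  have h: "h \<in> hcarrier S" and v: "\<And>x. x \<in> set L \<Longrightarrow> valid x"
    and eq: "\<And>k. k \<in> hcarrier S \<Longrightarrow> hinner S h k = (\<Sum>x\<leftarrow>L. hinner (K (fst x)) (word_vec x) (k (fst x)))"
    using assms by (auto simp: represents_def)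
  show "lact S a h \<in> hcarrier S" by (rule F.S.lact_in[OF h])
  show "valid x" if "x \<in> set (map (word_lact a) L)" for x using that v by (auto intro: word_lact_valid)
  fix k assume k: "k \<in> hcarrier S"
  have "hinner S (lact S a h) k = (\<Sum>x\<leftarrow>L. hinner (K (fst x)) (word_vec x) (lact S (star a) k (fst x)))"
    using k h by (simp add: F.S.inner_lact_left eq F.S.lact_in)
  also have "\<dots> = (\<Sum>x\<leftarrow>L. hinner (K (fst x)) (word_vec (word_lact a x)) (k (fst x)))"
  proof (intro arg_cong[of _ _ sum_list] map_cong refl)
    fix x assume x: "x \<in> set L"
    then have T: "fst x \<in> T" using v by (simp add: valid_def)
    show "hinner (K (fst x)) (word_vec x) (lact S (star a) k (fst x)) = hinner (K (fst x)) (word_vec (word_lact a x)) (k (fst x))"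
      unfolding F.S_ops(2)[OF T] lact_word_vec[OF v[OF x], symmetric]
      using semi_corr.inner_lact_left[OF F.semi[OF T] word_vec_in[OF v[OF x]] F.S_comp[OF k T]] by simp
  qed
  finally show "hinner S (lact S a h) k = (\<Sum>x\<leftarrow>map (word_lact a) L. hinner (K (fst x)) (word_vec x) (k (fst x)))"
    by (simp add: o_def fst_word_lact)
qed

lemma represents_append: "represents L h \<Longrightarrow> represents M k \<Longrightarrow> represents (L @ M) (hadd S h k)"
  unfolding represents_def by (auto simp: F.S.closed F.S.inner_simps)

text \<open>Creation adds a letter with coefficient 1. Annihilation of a first letter with
  coefficient \<open>a\<close> leaves <X_j \<xi>_j, a X_j \<xi>_j> = \<eta>(a), which acts on the
  rest of the word. No moment other than the variance appears in the result.\<close>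

lemma inner_word_YY:
  assumes x: "valid x" and k: "k \<in> hcarrier S"
  shows "hinner (K (fst x)) (word_vec x) (YY k (fst x))
    = (\<Sum>y\<leftarrow>word_create T J x @ word_annihilate \<eta> x. hinner (K (fst y)) (word_vec y) (k (fst y)))"
    and "y \<in> set (word_create T J x @ word_annihilate \<eta> x) \<Longrightarrow> valid y"
proof -
  obtain s as b where xs: "x = (s, as, b)" by (cases x) auto
  have s: "s \<in> T" and las: "length as = length s" using x by (auto simp: valid_def xs)
  let ?v = "F.single_vec s (word_vec x)"
  have w: "word_vec x \<in> hcarrier (K s)" using word_vec_in[OF x] by (simp add: xs)
  have v: "?v \<in> hcarrier S" by (rule F.single_vec_in[OF s w])
  have create: "cr j s (word_vec x) = el (j # s) (word_elem (j # s, 1 # as, b))" if js: "j # s \<in> T" for j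
  proof -
    interpret l: leg "H j" "\<xi> j" "X j" \<eta> R by (rule leg_facts(1)[OF js])
    have "lact (H j) 1 (e j) = e j"
      by (rule l.ext) (auto simp: l.closed l.X_in l.\<xi>_in l.lact_one)
    then show ?thesis
      using cr_elem[OF js, of "word_elem x"] word_elem_in[OF x] by (simp add: xs word_elem_def)
  qed
  have sumJ: "hinner S (CC L ?v) k = (\<Sum>j\<in>L. hinner S (CC {j} ?v) k)" if "finite L" for L
    using that
  proof (induction L rule: finite_induct)
    case (insert j L)
    show ?case unfolding inner_CC_insert(1)[OF insert(2) v k] sum.insert[OF insert(1,2)] insert.IH ..
  qed (simp add: inner_CC_empty[OF v k])
  have "hinner S (CC {j} ?v) k = (if j # s \<in> T then hinner (K (j # s)) (el (j # s) (word_elem (j # s, 1 # as, b))) (k (j # s)) else 0)" for j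
  proof -
    have "hinner S (CC {j} ?v) k = hinner (K s) (word_vec x) (AN j k s)"
      using CC_AN_adj[OF v k] F.inner_single[OF s w AN_in[OF k]] by simp
    then show ?thesis
      using s adj_pairD(4)[OF cr_adj w F.S_comp[OF k], of j] create[of j] w
      by (simp add: AN_def semi_corr.inner_zero[OF F.semi])
  qed
  then have "hinner S (CC J ?v) k = (\<Sum>j\<in>J. if j # s \<in> T then hinner (K (j # s)) (el (j # s) (word_elem (j # s, 1 # as, b))) (k (j # s)) else 0)"
    by (simp add: sumJ[OF finite_J])
  also have "\<dots> = (\<Sum>j\<leftarrow>sorted_list_of_set J. if j # s \<in> T then hinner (K (j # s)) (el (j # s) (word_elem (j # s, 1 # as, b))) (k (j # s)) else 0)"
    using finite_J by (simp add: sum_list_distinct_conv_sum_set)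
  also have "\<dots> = (\<Sum>y\<leftarrow>word_create T J x. hinner (K (fst y)) (word_vec y) (k (fst y)))"
    by (simp add: word_create_def xs o_def sum_list_filter)
  finally have c1: "hinner S (CC J ?v) k = \<dots>" .
  have c2: "hinner S ?v (CC J k) = (\<Sum>y\<leftarrow>word_annihilate \<eta> x. hinner (K (fst y)) (word_vec y) (k (fst y)))"
  proof (cases s)
    case Nil
    then have "CC J k s = hzero (K s)" using s by (simp add: CC_def)
    then have "hinner S ?v (CC J k) = 0"
      using F.inner_single[OF s w CC_in_le(1)[OF k], of J] semi_corr.inner_zero[OF F.semi[OF s] w] by simp
    then show ?thesis using Nil by (simp add: xs)
  next
    case (Cons j s')
    then obtain a as' where as: "as = a # as'" using las by (cases as) auto
    have js: "j # s' \<in> T" using s Cons by simp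
    note s' = suffix[OF js]
    interpret l: leg "H j" "\<xi> j" "X j" \<eta> R by (rule leg_facts(1)[OF js])
    have v': "valid (s', as', b)" using s' las by (simp add: valid_def as Cons)
    have "an j s' (word_vec x) = word_vec (word_lact (\<eta> a) (s', as', b))"
      using an_elem[OF js word_elem_in[OF x, unfolded xs fst_conv Cons]] elem_lact_word[OF v', of "\<eta> a"]
        l.X_variance[of a]
      by (simp add: xs Cons as word_elem_def fst_word_lact)
    moreover have "hinner S ?v (CC J k) = hinner (K s) (word_vec x) (cr j s' (k s'))"
      using F.inner_single[OF s w CC_in_le(1)[OF k], of J] js letter[OF js] by (simp add: CC_def Cons)
    moreover have "\<dots> = hinner (K s') (an j s' (word_vec x)) (k s')"
      using adj_pairD(4)[OF adj_pair_sym[OF F.semi[OF s'] F.semi[OF js] cr_adj[OF js]], of "word_vec x" "k s'"] w F.S_comp[OF k s']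
      by (simp add: Cons)
    ultimately show ?thesis by (simp add: xs Cons as fst_word_lact)
  qed
  have "hinner (K s) (word_vec x) (YY k s) = hinner S ?v (YY k)"
    by (rule F.inner_single[OF s w YY_in[OF k], symmetric])
  also have "\<dots> = hinner S (CC J ?v) k + hinner S ?v (CC J k)"
    using YY_sym[OF v k] inner_YY[OF v k] by simp
  finally show "hinner (K (fst x)) (word_vec x) (YY k (fst x))
      = (\<Sum>y\<leftarrow>word_create T J x @ word_annihilate \<eta> x. hinner (K (fst y)) (word_vec y) (k (fst y)))"
    using c1 c2 by (simp add: xs)
  show "valid y" if "y \<in> set (word_create T J x @ word_annihilate \<eta> x)"
  proof (cases "y \<in> set (word_create T J x)")
    case True
    then show ?thesis using finite_J las by (auto simp: word_create_def valid_def xs)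
  next
    case False
    with that have "y \<in> set (word_annihilate \<eta> x)" by simp
    then obtain j s' a as' where js: "s = j # s'" "as = a # as'" "y = word_lact (\<eta> a) (s', as', b)"
      by (cases s; cases as) (auto simp: xs)
    then have "valid (s', as', b)" using s las suffix[of j s'] by (auto simp: valid_def)
    then show ?thesis using js word_lact_valid by simp
  qed
qed

lemma represents_YY:
  assumes "represents L h"
  shows "represents (concat (map (\<lambda>x. word_create T J x @ word_annihilate \<eta> x) L)) (YY h)"
  unfolding represents_def
proof (intro conjI ballI)
  have h: "h \<in> hcarrier S" and v: "\<And>x. x \<in> set L \<Longrightarrow> valid x"
    and eq: "\<And>k. k \<in> hcarrier S \<Longrightarrow> hinner S h k = (\<Sum>x\<leftarrow>L. hinner (K (fst x)) (word_vec x) (k (fst x)))"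
    using assms by (auto simp: represents_def)
  show "YY h \<in> hcarrier S" by (rule YY_in[OF h])
  show "valid y" if "y \<in> set (concat (map (\<lambda>x. word_create T J x @ word_annihilate \<eta> x) L))" for y
  proof -
    have "\<exists>x\<in>set L. y \<in> set (word_create T J x @ word_annihilate \<eta> x)" using that by simp
    then obtain x where "x \<in> set L" "y \<in> set (word_create T J x @ word_annihilate \<eta> x)" by (elim bexE)
    then show ?thesis using inner_word_YY(2)[OF v h] by simp
  qed
  fix k assume k: "k \<in> hcarrier S"
  have "hinner S (YY h) k = (\<Sum>x\<leftarrow>L. hinner (K (fst x)) (word_vec x) (YY k (fst x)))"
    using YY_sym[OF h k] eq[OF YY_in[OF k]] by simp
  also have "\<dots> = (\<Sum>x\<leftarrow>L. \<Sum>y\<leftarrow>word_create T J x @ word_annihilate \<eta> x. hinner (K (fst y)) (word_vec y) (k (fst y)))"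
    by (intro arg_cong[of _ _ sum_list] map_cong refl inner_word_YY(1) v k)
  finally show "hinner S (YY h) k = (\<Sum>x\<leftarrow>concat (map (\<lambda>x. word_create T J x @ word_annihilate \<eta> x) L). hinner (K (fst x)) (word_vec x) (k (fst x)))"
    unfolding sum_list_concat_map .
qed

lemma represents_act:
  "represents L h \<Longrightarrow> represents (word_act T J \<eta> r p L) (act S (\<lambda>h. lact S (of_real r) (YY h)) p h)"
  by (induction p arbitrary: L h) (auto intro: represents_lact represents_append represents_YY)

text \<open>The right side mentions neither the legs nor their operators, so it is common to all
  families of laws with the same variance. The initial word, without letters and with coefficient 1,
  is the vacuum.\<close>

theorem YY_law: "hinner S \<Omega> (act S (\<lambda>h. lact S (of_real r) (YY h)) p \<Omega>) = word_vacuum (word_act T J \<eta> r p [([], [], 1)])"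
proof -
  let ?h = "act S (\<lambda>h. lact S (of_real r) (YY h)) p \<Omega>" and ?L = "word_act T J \<eta> r p [([], [], 1)]"
  have "represents [([], [], 1)] \<Omega>"
    unfolding represents_def using inner_\<Omega> \<Omega>_in by (auto simp: valid_def nil_in word_elem_def)
  from represents_act[OF this] have L: "represents ?L ?h" .
  then have "hinner S ?h \<Omega> = (\<Sum>x\<leftarrow>?L. hinner (K (fst x)) (word_vec x) (\<Omega> (fst x)))"
    using \<Omega>_in by (auto simp: represents_def)
  also have "\<dots> = (\<Sum>x\<leftarrow>?L. if fst x = [] then star (snd (snd x)) else 0)"
  proof (intro arg_cong[of _ _ sum_list] map_cong refl)
    fix x assume "x \<in> set ?L"
    then have x: "valid x" using L by (auto simp: represents_def)
    then have T: "fst x \<in> T" by (simp add: valid_def)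
    show "hinner (K (fst x)) (word_vec x) (\<Omega> (fst x)) = (if fst x = [] then star (snd (snd x)) else 0)"
    proof (cases "fst x = []")
      case True
      have "word_elem x \<in> elem_tensors (Hs [])" using word_elem_in[OF x] True by simp
      then have "hinner (K []) (el [] (word_elem x)) (el [] ([], 1)) = elem_inner (Hs []) (word_elem x) ([], 1)"
        by (rule inner_elem[OF nil_in _ one_elem])
      then show ?thesis
        using True by (simp add: \<Omega>_eq F.single_vec_def nil_in) (simp add: elem_inner_def Hs_simps word_elem_def)
    next
      case False
      then show ?thesis
        using T semi_corr.inner_zero[OF F.semi[OF T] word_vec_in[OF x]] by (simp add: \<Omega>_eq F.single_vec_def)
    qed
  qed
  finally have "hinner S ?h \<Omega> = (\<Sum>x\<leftarrow>?L. if fst x = [] then star (snd (snd x)) else 0)" .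
  moreover have "hinner S \<Omega> ?h = star (hinner S ?h \<Omega>)"
    using F.S.inner_sym[OF _ \<Omega>_in, of ?h] L by (auto simp: represents_def)
  ultimately show ?thesis
    by (simp add: word_vacuum_def star_sum_list if_distrib[of star] star_star star_zero cong: if_cong)
qed

end

section \<open>Trees and their powers\<close>

text \<open>The children of the root, at most \<open>r\<close>, and those of other vertices, at most
  \<open>c\<close>, are counted separately because composition treats them differently: root counts
  multiply, while the other count grows by a product with the root count of the inner tree.\<close>

definition bounded_tree :: "nat \<Rightarrow> nat list set \<Rightarrow> nat \<Rightarrow> nat \<Rightarrow> bool" where
  "bounded_tree M U r c \<longleftrightarrow> [] \<in> U \<and> (\<forall>j s. j # s \<in> U \<longrightarrow> s \<in> U \<and> j \<in> {1..M}) \<and> (\<forall>j s. j # j # s \<notin> U) \<and>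
     card {j. [j] \<in> U} \<le> r \<and> (\<forall>s. s \<in> U \<longrightarrow> s \<noteq> [] \<longrightarrow> card {j. j # s \<in> U} \<le> c)"

lemma bounded_treeD:
  assumes "bounded_tree M U r c"
  shows "[] \<in> U" "j # s \<in> U \<Longrightarrow> s \<in> U" "j # s \<in> U \<Longrightarrow> j \<in> {1..M}" "j # j # s \<notin> U"
    "card {j. [j] \<in> U} \<le> r" "s \<in> U \<Longrightarrow> s \<noteq> [] \<Longrightarrow> card {j. j # s \<in> U} \<le> c"
    "finite {j. j # s \<in> U}"
proof -
  show "finite {j. j # s \<in> U}"
    by (rule finite_subset[of _ "{1..M}"]) (use assms in \<open>auto simp: bounded_tree_def\<close>)
qed (use assms in \<open>auto simp: bounded_tree_def\<close>)

text \<open>Along a path to the empty string the suffix \<open>j # s\<close> can only disappear when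
  \<open>j\<close> is removed from \<open>j # s\<close> itself, and the next vertex of the path is
  then \<open>s\<close>.\<close>

lemma Tree_suffix:
  assumes T: "T \<in> Tree N" and js: "j # s \<in> T" shows "s \<in> T"
proof -
  let ?R = "free_tree_edges N \<inter> T \<times> T"
  have "(j # s, []) \<in> ?R\<^sup>*" using T js by (auto simp: Tree_def)
  moreover have "(\<exists>p. x = p @ j # s) \<Longrightarrow> s \<in> T" if "(x, []) \<in> ?R\<^sup>*" for x
    using that
  proof (induction rule: converse_rtrancl_induct)
    case (step x y)
    then obtain p where p: "x = p @ j # s" by blast
    from step(1) have y: "y \<in> T" and "(\<exists>i. y = i # x) \<or> (\<exists>i. x = i # y)" by (auto simp: free_tree_edges_def)
    then show ?case
    proof (elim disjE exE)
      fix i assume "y = i # x"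
      then show ?thesis using step.IH p by (metis append_Cons)
    next
      fix i assume x: "x = i # y"
      show ?thesis
      proof (cases p)
        case Nil
        then show ?thesis using p x y by simp
      next
        case (Cons a p')
        then show ?thesis using step.IH p x by auto
      qed
    qed
  qed simp
  ultimately show ?thesis by (metis append_Nil)
qed

lemma bounded_tree_Tree:
  assumes T: "T \<in> Tree N"
  shows "bounded_tree N T (card {j \<in> {1..N}. [j] \<in> T}) (N - 1)"
  unfolding bounded_tree_def
proof (intro conjI allI impI)
  have alt: "s \<in> T \<Longrightarrow> set s \<subseteq> {1..N} \<and> distinct_adj s" for s
    using T by (auto simp: Tree_def alternating_strings_def)
  show "[] \<in> T" using T by (simp add: Tree_def)
  show "s \<in> T" if "j # s \<in> T" for j s by (rule Tree_suffix[OF T that])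
  show "j \<in> {1..N}" if "j # s \<in> T" for j s using alt[OF that] by simp
  show "j # j # s \<notin> T" for j s using alt[of "j # j # s"] by auto
  have "{j. [j] \<in> T} = {j \<in> {1..N}. [j] \<in> T}" using alt[of "[_]"] by auto
  then show "card {j. [j] \<in> T} \<le> card {j \<in> {1..N}. [j] \<in> T}" by simp
  fix s assume s: "s \<in> T" "s \<noteq> []"
  then obtain i s' where i: "s = i # s'" by (cases s) auto
  \<comment> \<open>A child must not repeat the first letter \<open>i\<close>, which excludes one of
    the N letters.\<close>
  have "{j. j # s \<in> T} \<subseteq> {1..N} - {i}" using alt[of "_ # s"] by (auto simp: i)
  then have "card {j. j # s \<in> T} \<le> card ({1..N} - {i})" by (intro card_mono) auto
  also have "\<dots> = N - 1" using alt[OF s(1)] by (simp add: i)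
  finally show "card {j. j # s \<in> T} \<le> N - 1" .
qed

lemma bounded_tree_base: "bounded_tree 1 {[], [1]} 1 0"
proof -
  have "{j. [j] \<in> {[], [1::nat]}} = {1}" "{j. j # s \<in> {[], [1::nat]}} = {}" if "s \<noteq> []" for s
    using that by auto
  then show ?thesis by (auto simp: bounded_tree_def)
qed

section \<open>Composition of trees\<close>

context
  fixes N M :: nat and T U :: "nat list set" and n b r c :: nat
  assumes T: "bounded_tree N T n b" and U: "bounded_tree M U r c"
begin

abbreviation "sh \<equiv> tree_shift (\<lambda>_. M)"
abbreviation "glue w ss \<equiv> concat (map2 (\<lambda>i s. map (sh i) s) w ss)"

text \<open>A factorization of a string of the composition: \<open>w\<close> lists the indices of
  the blocks, \<open>ss\<close> their nonempty contents.\<close>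

definition "decomp w ss \<longleftrightarrow> w \<in> T \<and> list_all2 (\<lambda>i s. s \<in> U - {[]}) w ss"

lemma comp_iff: "l \<in> tree_comp T (\<lambda>_. U) (\<lambda>_. M) \<longleftrightarrow> (\<exists>w ss. decomp w ss \<and> l = glue w ss)"
  by (auto simp: tree_comp_def decomp_def)

lemma sh_eq: "sh i y = (i - 1) * M + y"
  by (simp add: tree_shift_def)

text \<open>Letters of the composition encode pairs of a block index and a letter by division with
  remainder by \<open>M\<close>. Letters start at 1, hence the shift by one before dividing.\<close>

lemma sh_inj:
  assumes "sh i y = sh i' y'" "i \<ge> 1" "i' \<ge> 1" "y \<in> {1..M}" "y' \<in> {1..M}"
  shows "i = i'" "y = y'"
proof -
  have 1: "(i - 1) * M + (y - 1) = (i' - 1) * M + (y' - 1)" using assms by (simp add: sh_eq)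
  have d: "(a * M + z) div M = a" if "z < M" for a z
    using that by simp
  have "((i - 1) * M + (y - 1)) div M = i - 1" "((i' - 1) * M + (y' - 1)) div M = i' - 1"
    by (rule d; use assms(4,5) in auto)+
  then have "i - 1 = i' - 1" unfolding 1 by simp
  then show "i = i'" using assms by linarith
  then show "y = y'" using assms(1) by (simp add: sh_eq)
qed

lemma decomp_ConsE:
  assumes "decomp w ss" "glue w ss = j # l"
  obtains i w' y s' ss' where "w = i # w'" "ss = (y # s') # ss'" "i # w' \<in> T" "y # s' \<in> U"
    "j = sh i y" "l = map (sh i) s' @ glue w' ss'" "decomp w' ss'"
proof -
  from assms obtain i w' s ss' where w: "w = i # w'" "ss = s # ss'" by (cases w; cases ss) (auto simp: decomp_def)
  with assms obtain y s' where s: "s = y # s'" by (cases s) (auto simp: decomp_def)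
  show thesis
    by (rule that[OF w(1)]) (use assms bounded_treeD(2)[OF T] in \<open>auto simp: w s decomp_def\<close>)
qed

lemma decomp_tail: "y # s' \<in> U \<Longrightarrow> s' \<noteq> [] \<Longrightarrow> i # w' \<in> T \<Longrightarrow> decomp w' ss' \<Longrightarrow> decomp (i # w') (s' # ss')"
  using bounded_treeD(2)[OF U] by (auto simp: decomp_def)

lemma letters_T: "i # w \<in> T \<Longrightarrow> i \<ge> 1" and letters_U: "y # s \<in> U \<Longrightarrow> y \<in> {1..M}"
  using bounded_treeD(3)[OF T, of i w] bounded_treeD(3)[OF U, of y s] by auto

text \<open>Each letter determines its block index, and consecutive indices in \<open>w\<close>
  differ, so a block ends exactly where the index changes. The induction removes the first letter of
  the string from both factorizations.\<close>

lemma decomp_unique: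
  "decomp w ss \<Longrightarrow> decomp v tt \<Longrightarrow> glue w ss = l \<Longrightarrow> glue v tt = l \<Longrightarrow> w = v \<and> ss = tt"
proof (induction l arbitrary: w ss v tt)
  case Nil
  have "w' = [] \<and> ss' = []" if "decomp w' ss'" "glue w' ss' = []" for w' ss'
    using that by (cases w'; cases ss') (auto simp: decomp_def)
  then show ?case using Nil by blast
next
  case (Cons j l)
  obtain i w' y s' ss' where w: "w = i # w'" "ss = (y # s') # ss'" and iT: "i # w' \<in> T" and yU: "y # s' \<in> U"
    and j: "j = sh i y" and l: "l = map (sh i) s' @ glue w' ss'" and d: "decomp w' ss'"
    using decomp_ConsE[OF Cons.prems(1,3)] .
  obtain i2 v' y2 t' tt' where v: "v = i2 # v'" "tt = (y2 # t') # tt'" and iT2: "i2 # v' \<in> T" and yU2: "y2 # t' \<in> U"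
    and j2: "j = sh i2 y2" and l2: "l = map (sh i2) t' @ glue v' tt'" and d2: "decomp v' tt'"
    using decomp_ConsE[OF Cons.prems(2,4)] .
  have i: "i2 = i" "y2 = y"
    using sh_inj[of i y i2 y2] letters_T[OF iT] letters_T[OF iT2] letters_U[OF yU] letters_U[OF yU2] j j2
    by simp_all
  have dc: "decomp (i # w') (s' # ss')" "l = glue (i # w') (s' # ss')" if "s' \<noteq> []"
    using decomp_tail[OF yU that iT d] l by simp_all
  have dc2: "decomp (i2 # v') (t' # tt')" "l = glue (i2 # v') (t' # tt')" if "t' \<noteq> []"
    using decomp_tail[OF yU2 that iT2 d2] l2 by simp_all
  show ?case
  proof (cases "s' = []")
    case s': True
    then have lw: "l = glue w' ss'" using l by simp
    show ?thesis
    proof (cases "t' = []")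
      case True
      then have "w' = v' \<and> ss' = tt'" using Cons.IH[OF d d2 lw[symmetric]] l2 by simp
      then show ?thesis using w v i s' True by simp
    next
      case False
      \<comment> \<open>One factorization closes its block here while the other continues it; then
        the index \<open>i\<close> would occur twice in a row in \<open>w\<close>, against
        alternation.\<close>
      have "w' = i2 # v'" using Cons.IH[OF d dc2(1)[OF False] lw[symmetric] dc2(2)[OF False, symmetric]] by simp
      then show ?thesis using iT bounded_treeD(4)[OF T] i by simp
    qed
  next
    case s': False
    show ?thesis
    proof (cases "t' = []")
      case True
      then have lv: "l = glue v' tt'" using l2 by simp
      have "i # w' = v'" using Cons.IH[OF dc(1)[OF s'] d2 dc(2)[OF s', symmetric] lv[symmetric]] by simp
      then show ?thesis using iT2 bounded_treeD(4)[OF T] i by auto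
    next
      case False
      have "i # w' = i2 # v' \<and> s' # ss' = t' # tt'"
        by (rule Cons.IH[OF dc(1)[OF s'] dc2(1)[OF False] dc(2)[OF s', symmetric] dc2(2)[OF False, symmetric]])
      then show ?thesis using w v i by simp
    qed
  qed
qed

text \<open>A nonempty string of the composition is extended in two ways: inside its first block,
  with at most \<open>c\<close> choices since that block is nonempty, or by a new block, with at
  most \<open>b\<close> indices and \<open>r\<close> first letters. At the root only the second way
  exists, with at most \<open>n\<close> indices. Unique factorization tells which block is the
  first.\<close>

lemma bounded_tree_comp: "bounded_tree (N * M) (tree_comp T (\<lambda>_. U) (\<lambda>_. M)) (n * r) (c + b * r)"
  unfolding bounded_tree_def
proof (intro conjI allI impI)
  let ?C = "tree_comp T (\<lambda>_. U) (\<lambda>_. M)"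
  have nilT: "decomp [] []" using bounded_treeD(1)[OF T] by (simp add: decomp_def)
  then show "[] \<in> ?C" by (auto simp: comp_iff intro!: exI[of _ "[]"])
  fix j s
  show "s \<in> ?C" "j \<in> {1..N * M}" if js: "j # s \<in> ?C"
  proof -
    from js obtain w ss where d: "decomp w ss" "glue w ss = j # s" by (metis comp_iff)
    obtain i w' y s' ss' where 1: "w = i # w'" "ss = (y # s') # ss'" "i # w' \<in> T" "y # s' \<in> U"
      "j = sh i y" "s = map (sh i) s' @ glue w' ss'" "decomp w' ss'" using decomp_ConsE[OF d] .
    have i: "i \<in> {1..N}" and y: "y \<in> {1..M}" using bounded_treeD(3)[OF T 1(3)] bounded_treeD(3)[OF U 1(4)] .
    have "(i - 1) * M + y \<le> (N - 1) * M + M" using i y by (intro add_mono mult_right_mono) auto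
    also have "\<dots> = N * M" using i by (cases N) auto
    finally show "j \<in> {1..N * M}" using y by (simp add: 1(5) sh_eq)
    show "s \<in> ?C"
    proof (cases "s' = []")
      case True
      then show ?thesis unfolding comp_iff using 1(6,7) by auto
    next
      case False
      from decomp_tail[OF 1(4) False 1(3,7)] show ?thesis
        unfolding comp_iff using 1(6) by (intro exI[of _ "i # w'"] exI[of _ "s' # ss'"]) simp
    qed
  qed
  show "j # j # s \<notin> ?C"
  proof
    assume "j # j # s \<in> ?C"
    then obtain w ss where d: "decomp w ss" "glue w ss = j # j # s" by (metis comp_iff)
    obtain i w' y s' ss' where 1: "w = i # w'" "ss = (y # s') # ss'" "i # w' \<in> T" "y # s' \<in> U"
      "j = sh i y" "j # s = map (sh i) s' @ glue w' ss'" "decomp w' ss'" using decomp_ConsE[OF d] .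
    show False
    proof (cases s')
      case Nil
      obtain i2 w2 y2 s2 ss2 where 2: "w' = i2 # w2" "ss' = (y2 # s2) # ss2" "i2 # w2 \<in> T" "y2 # s2 \<in> U"
        "j = sh i2 y2" using decomp_ConsE[OF 1(7), of j s] 1(6) Nil by (metis append_Nil list.simps(8))
      have "i = i2"
        using sh_inj[of i y i2 y2] letters_T[OF 1(3)] letters_T[OF 2(3)] letters_U[OF 1(4)] letters_U[OF 2(4)] 1(5) 2(5) by simp
      then show False using bounded_treeD(4)[OF T] 1(3) 2(1) by simp
    next
      case (Cons y' s2)
      then have "y' = y"
        using sh_inj[of i y i y'] letters_T[OF 1(3)] letters_U[OF 1(4)] letters_U[of y' s2] bounded_treeD(2)[OF U 1(4)] 1(5,6) by simp
      then show False using bounded_treeD(4)[OF U] 1(4) Cons by simp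
    qed
  qed
next
  let ?C = "tree_comp T (\<lambda>_. U) (\<lambda>_. M)"
  have "{j. [j] \<in> ?C} \<subseteq> (\<lambda>(i, y). sh i y) ` ({i. [i] \<in> T} \<times> {y. [y] \<in> U})"
  proof
    fix j assume "j \<in> {j. [j] \<in> ?C}"
    then obtain w ss where d: "decomp w ss" "glue w ss = [j]" by (metis comp_iff mem_Collect_eq)
    obtain i w' y s' ss' where 1: "w = i # w'" "ss = (y # s') # ss'" "i # w' \<in> T" "y # s' \<in> U"
      "j = sh i y" "[] = map (sh i) s' @ glue w' ss'" "decomp w' ss'" using decomp_ConsE[OF d] .
    have nilT: "decomp [] []" using bounded_treeD(1)[OF T] by (simp add: decomp_def)
    have "w' = []" using decomp_unique[OF 1(7) nilT, of "[]"] 1(6) by simp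
    moreover have "s' = []" using 1(6) by simp
    ultimately show "j \<in> (\<lambda>(i, y). sh i y) ` ({i. [i] \<in> T} \<times> {y. [y] \<in> U})" using 1(3,4,5) by auto
  qed
  from surj_card_le[OF _ this] have "card {j. [j] \<in> ?C} \<le> card ({i. [i] \<in> T} \<times> {y. [y] \<in> U})"
    using bounded_treeD(7)[OF T] bounded_treeD(7)[OF U] by simp
  also have "\<dots> \<le> n * r"
    unfolding card_cartesian_product by (intro mult_mono bounded_treeD(5)[OF T] bounded_treeD(5)[OF U]) auto
  finally show "card {j. [j] \<in> ?C} \<le> n * r" .
next
  let ?C = "tree_comp T (\<lambda>_. U) (\<lambda>_. M)"
  fix s assume s: "s \<in> ?C" "s \<noteq> []"
  then obtain w0 ss0 where d0: "decomp w0 ss0" "s = glue w0 ss0" by (metis comp_iff)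
  from s obtain j0 r0 where s0: "s = j0 # r0" by (cases s) auto
  obtain i0 w1 y0 s1 ss1 where 0: "w0 = i0 # w1" "ss0 = (y0 # s1) # ss1" "i0 # w1 \<in> T" "y0 # s1 \<in> U"
    using decomp_ConsE[OF d0(1), of j0 r0] d0(2) s0 by metis
  let ?A = "{i. i # w0 \<in> T} \<times> {y. [y] \<in> U}" and ?B = "{y. y # y0 # s1 \<in> U}"
  have "{j. j # s \<in> ?C} \<subseteq> (\<lambda>(i, y). sh i y) ` ?A \<union> sh i0 ` ?B"
  proof
    fix j assume "j \<in> {j. j # s \<in> ?C}"
    then obtain w ss where d: "decomp w ss" "glue w ss = j # s" by (metis comp_iff mem_Collect_eq)
    obtain i w' y s' ss' where 1: "w = i # w'" "ss = (y # s') # ss'" "i # w' \<in> T" "y # s' \<in> U"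
      "j = sh i y" "s = map (sh i) s' @ glue w' ss'" "decomp w' ss'" using decomp_ConsE[OF d] .
    show "j \<in> (\<lambda>(i, y). sh i y) ` ?A \<union> sh i0 ` ?B"
    proof (cases "s' = []")
      case True
      then have "w' = w0" using decomp_unique[OF 1(7) d0(1), of s] 1(6) d0(2) by simp
      then show ?thesis using 1 True by auto
    next
      case False
      have "i # w' = w0 \<and> s' # ss' = ss0"
        by (rule decomp_unique[OF decomp_tail[OF 1(4) False 1(3,7)] d0(1), of s]) (use 1(6) d0(2) in simp_all)
      then show ?thesis using 1 0 by auto
    qed
  qed
  then have "card {j. j # s \<in> ?C} \<le> card ((\<lambda>(i, y). sh i y) ` ?A \<union> sh i0 ` ?B)"
    using bounded_treeD(7)[OF T] bounded_treeD(7)[OF U] by (intro card_mono) auto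
  also have "\<dots> \<le> card ((\<lambda>(i, y). sh i y) ` ?A) + card (sh i0 ` ?B)" by (rule card_Un_le)
  also have "\<dots> \<le> card ?A + card ?B"
    using bounded_treeD(7)[OF T] bounded_treeD(7)[OF U] by (intro add_mono card_image_le) auto
  also have "\<dots> \<le> b * r + c"
    unfolding card_cartesian_product
    using bounded_treeD(6)[OF T, of w0] d0(1) 0
    by (intro add_mono mult_mono bounded_treeD(5)[OF U] bounded_treeD(6)[OF U]) (auto simp: decomp_def)
  finally show "card {j. j # s \<in> ?C} \<le> c + b * r" by simp
qed

end

text \<open>One composition adds b n^k to the count away from the root, as n^k is the root count of
  the inner power; this builds up the geometric sum.\<close>

lemma bounded_tree_pow:
  assumes "bounded_tree N T n b"
  shows "bounded_tree (N ^ k) (tree_pow N T k) (n ^ k) (b * (\<Sum>i<k. n ^ i))"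
proof (induction k)
  case 0
  show ?case using bounded_tree_base by simp
next
  case (Suc k)
  from bounded_tree_comp[OF assms Suc] show ?case by (simp add: distrib_left add.commute)
qed

text \<open>The geometric sum turns the count away from the root into (N - 1)(n^k - 1)/(n - 1). The
  root count n^k obeys the same final bound since N >= n. This is the source of the quotient in
  R'.\<close>

lemma tree_pow_children:
  assumes "T \<in> Tree N" and n: "n = card {j \<in> {1..N}. [j] \<in> T}" "n \<ge> 2"
  obtains D where "bounded_tree (N ^ k) (tree_pow N T k) (n ^ k) D"
    "real (max (n ^ k) D) \<le> (real N - 1) / (real n - 1) * real n ^ k" "N \<ge> n"
proof -
  let ?D = "(N - 1) * (\<Sum>i<k. n ^ i)"
  have "card {j \<in> {1..N}. [j] \<in> T} \<le> card {1..N}" by (intro card_mono) auto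
  then have N: "N \<ge> n" using n(1) by simp
  have "real ?D = (real N - 1) * ((real n ^ k - 1) / (real n - 1))"
    using n N by (simp add: of_nat_diff geometric_sum)
  also have "\<dots> = (real N - 1) / (real n - 1) * (real n ^ k - 1)" by simp
  also have "\<dots> \<le> (real N - 1) / (real n - 1) * real n ^ k"
    using n N by (intro mult_left_mono) auto
  finally have 1: "real ?D \<le> (real N - 1) / (real n - 1) * real n ^ k" .
  have "1 * real n ^ k \<le> (real N - 1) / (real n - 1) * real n ^ k"
    using n N by (intro mult_right_mono) auto
  then have 2: "real (max (n ^ k) ?D) \<le> (real N - 1) / (real n - 1) * real n ^ k"
    using 1 by (simp add: max_def del: of_nat_mult of_nat_sum)
  show thesis
    by (rule that[OF bounded_tree_pow[OF bounded_tree_Tree[OF assms(1)], folded n(1)] 2 N])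
qed

section \<open>Polynomials in two operators\<close>

text \<open>Polynomials in two noncommuting indeterminates, kept as syntax: expressions that act
  equally are identified only in the norm completion. \<open>PVar True\<close> will be the dilated
  sum along the tree, \<open>PVar False\<close> its creation-annihilation part.\<close>

datatype 'b pexpr = PConst 'b | PVar bool | PPlus "'b pexpr" "'b pexpr" | PTimes "'b pexpr" "'b pexpr"

fun pstar :: "'b::cstar_algebra pexpr \<Rightarrow> 'b pexpr" where
  "pstar (PConst b) = PConst (star b)"
| "pstar (PVar c) = PVar c"
| "pstar (PPlus p q) = PPlus (pstar p) (pstar q)"
| "pstar (PTimes p q) = PTimes (pstar q) (pstar p)"

definition pscale :: "complex \<Rightarrow> 'b::cstar_algebra pexpr \<Rightarrow> 'b pexpr" where
  "pscale c p = PTimes (PConst (scaleC c 1)) p"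

definition pminus :: "'b::cstar_algebra pexpr \<Rightarrow> 'b pexpr \<Rightarrow> 'b pexpr" where
  "pminus p q = PPlus p (pscale (-1) q)"

fun pact :: "('b, 'h) corr \<Rightarrow> (bool \<Rightarrow> 'h \<Rightarrow> 'h) \<Rightarrow> 'b pexpr \<Rightarrow> 'h \<Rightarrow> 'h" where
  "pact G z (PConst b) h = lact G b h"
| "pact G z (PVar c) h = z c h"
| "pact G z (PPlus p q) h = hadd G (pact G z p h) (pact G z q h)"
| "pact G z (PTimes p q) h = pact G z p (pact G z q h)"

locale op_pair = nondegenerate_corr H for H :: "('b::cstar_algebra, 'h) corr" +
  fixes z :: "bool \<Rightarrow> 'h \<Rightarrow> 'h"
  assumes z_in: "h \<in> hcarrier H \<Longrightarrow> z c h \<in> hcarrier H"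
    and z_sym: "\<lbrakk>h \<in> hcarrier H; k \<in> hcarrier H\<rbrakk> \<Longrightarrow> hinner H (z c h) k = hinner H h (z c k)"
    and z_bounded: "\<exists>C. \<forall>h\<in>hcarrier H. hnorm H (z c h) \<le> C * hnorm H h"
begin

abbreviation ev :: "'b pexpr \<Rightarrow> 'h \<Rightarrow> 'h" where "ev \<equiv> pact H z"

lemma ev_in: "h \<in> hcarrier H \<Longrightarrow> ev p h \<in> hcarrier H"
  by (induction p arbitrary: h) (auto simp: closed z_in)

lemma ev_adj: "h \<in> hcarrier H \<Longrightarrow> k \<in> hcarrier H \<Longrightarrow> hinner H (ev p h) k = hinner H h (ev (pstar p) k)"
  by (induction p arbitrary: h k) (auto simp: inner_lact_left z_sym ev_in inner_simps)

lemma ev_add: "h \<in> hcarrier H \<Longrightarrow> k \<in> hcarrier H \<Longrightarrow> ev p (hadd H h k) = hadd H (ev p h) (ev p k)"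
  by (rule ext_left) (auto simp: ev_in closed inner_simps ev_adj)

lemma ev_ract: "h \<in> hcarrier H \<Longrightarrow> ev p (ract H h b) = ract H (ev p h) b"
  by (rule ext_left) (auto simp: ev_in closed inner_simps ev_adj)

lemma ev_minus: "h \<in> hcarrier H \<Longrightarrow> k \<in> hcarrier H \<Longrightarrow> ev p (hminus H h k) = hminus H (ev p h) (ev p k)"
  by (simp add: hminus_def ev_add ev_ract closed)

lemma ev_scale: "h \<in> hcarrier H \<Longrightarrow> ev (pscale c p) h = ract H (ev p h) (scaleC c 1)"
  unfolding pscale_def by (rule ext) (auto simp: ev_in closed inner_simps lact_scalar)

lemma ev_pminus: "h \<in> hcarrier H \<Longrightarrow> ev (pminus p q) h = hminus H (ev p h) (ev q h)"
  by (simp add: pminus_def ev_scale hminus_def scaleC_minus_left scaleC_one)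

lemma ev_bounded: "\<exists>C\<ge>0. \<forall>h\<in>hcarrier H. hnorm H (ev p h) \<le> C * hnorm H h"
proof (induction p)
  case (PConst b)
  then show ?case using hnorm_lact by (auto intro!: exI[of _ "norm b"])
next
  case (PVar c)
  obtain C where "\<forall>h\<in>hcarrier H. hnorm H (z c h) \<le> C * hnorm H h" using z_bounded by auto
  then have "hnorm H (z c h) \<le> \<bar>C\<bar> * hnorm H h" if "h \<in> hcarrier H" for h
    using that by (smt (verit) hnorm_nonneg mult_right_mono)
  then show ?case by (auto intro!: exI[of _ "\<bar>C\<bar>"])
next
  case (PPlus p q)
  then obtain C D where CD: "C \<ge> 0" "D \<ge> 0" "\<forall>h\<in>hcarrier H. hnorm H (ev p h) \<le> C * hnorm H h"
      "\<forall>h\<in>hcarrier H. hnorm H (ev q h) \<le> D * hnorm H h" by auto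
  have "hnorm H (ev (PPlus p q) h) \<le> (C + D) * hnorm H h" if "h \<in> hcarrier H" for h
    using hnorm_add[of "ev p h" "ev q h"] CD(3,4) that by (fastforce simp: ev_in distrib_right)
  then show ?case using CD by (intro exI[of _ "C + D"]) auto
next
  case (PTimes p q)
  then obtain C D where CD: "C \<ge> 0" "D \<ge> 0" "\<forall>h\<in>hcarrier H. hnorm H (ev p h) \<le> C * hnorm H h"
      "\<forall>h\<in>hcarrier H. hnorm H (ev q h) \<le> D * hnorm H h" by auto
  have "hnorm H (ev (PTimes p q) h) \<le> (C * D) * hnorm H h" if h: "h \<in> hcarrier H" for h
  proof -
    have "hnorm H (ev p (ev q h)) \<le> C * hnorm H (ev q h)" using CD(3) ev_in[OF h] by auto
    also have "\<dots> \<le> C * (D * hnorm H h)" using CD(1,4) h by (intro mult_left_mono) auto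
    finally show ?thesis by (simp add: mult.assoc)
  qed
  then show ?case using CD by (intro exI[of _ "C * D"]) auto
qed

definition opn :: "'b pexpr \<Rightarrow> real" where
  "opn p = Inf {C. C \<ge> 0 \<and> (\<forall>h\<in>hcarrier H. hnorm H (ev p h) \<le> C * hnorm H h)}"

lemma opn_le: "C \<ge> 0 \<Longrightarrow> (\<And>h. h \<in> hcarrier H \<Longrightarrow> hnorm H (ev p h) \<le> C * hnorm H h) \<Longrightarrow> opn p \<le> C"
  unfolding opn_def by (rule cInf_lower) (auto intro: bdd_belowI[of _ 0])

lemma opn_nonneg: "opn p \<ge> 0"
  unfolding opn_def using ev_bounded[of p] by (intro cInf_greatest) auto

lemma hnorm_ev: "h \<in> hcarrier H \<Longrightarrow> hnorm H (ev p h) \<le> opn p * hnorm H h"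
proof (cases "hnorm H h = 0")
  case True
  assume "h \<in> hcarrier H"
  then show ?thesis using True ev_bounded[of p] by auto
next
  case False
  assume h: "h \<in> hcarrier H"
  have "hnorm H h > 0" using False hnorm_nonneg[of h] by simp
  then have "hnorm H (ev p h) / hnorm H h \<le> opn p"
    unfolding opn_def using ev_bounded[of p] h
    by (intro cInf_greatest) (auto simp: divide_simps)
  then show ?thesis using \<open>hnorm H h > 0\<close> by (simp add: divide_simps)
qed

lemma opn_cong: "(\<And>h. h \<in> hcarrier H \<Longrightarrow> ev p h = ev q h) \<Longrightarrow> opn p = opn q"
  by (simp add: opn_def)

lemma opn_plus: "opn (PPlus p q) \<le> opn p + opn q"
proof (rule opn_le)
  show "hnorm H (ev (PPlus p q) h) \<le> (opn p + opn q) * hnorm H h" if "h \<in> hcarrier H" for h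
    using hnorm_add[of "ev p h" "ev q h"] hnorm_ev[OF that, of p] hnorm_ev[OF that, of q] that
    by (simp add: ev_in distrib_right)
qed (simp add: opn_nonneg)

lemma opn_times: "opn (PTimes p q) \<le> opn p * opn q"
proof (rule opn_le)
  show "hnorm H (ev (PTimes p q) h) \<le> (opn p * opn q) * hnorm H h" if h: "h \<in> hcarrier H" for h
  proof -
    have "hnorm H (ev p (ev q h)) \<le> opn p * hnorm H (ev q h)" by (rule hnorm_ev[OF ev_in[OF h]])
    also have "\<dots> \<le> opn p * (opn q * hnorm H h)"
      by (intro mult_left_mono hnorm_ev h opn_nonneg)
    finally show ?thesis by (simp add: mult.assoc)
  qed
qed (simp add: opn_nonneg)

lemma opn_scale_le: "opn (pscale c p) \<le> cmod c * opn p"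
proof (rule opn_le)
  show "hnorm H (ev (pscale c p) h) \<le> (cmod c * opn p) * hnorm H h" if h: "h \<in> hcarrier H" for h
  proof -
    have "hnorm H (ev (pscale c p) h) \<le> cmod c * hnorm H (ev p h)"
      using hnorm_ract[OF ev_in[OF h], of p "scaleC c 1"] by (simp add: ev_scale h norm_scaleC)
    also have "\<dots> \<le> cmod c * (opn p * hnorm H h)" by (intro mult_left_mono hnorm_ev h) auto
    finally show ?thesis by (simp add: mult.assoc)
  qed
qed (simp add: opn_nonneg)

lemma ract_one: "h \<in> hcarrier H \<Longrightarrow> ract H h 1 = h"
  by (rule ext) (auto simp: closed inner_simps)

lemma ract_mult: "h \<in> hcarrier H \<Longrightarrow> ract H h (a * b) = ract H (ract H h a) b"
  by (rule ext) (auto simp: closed inner_simps mult.assoc)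

lemma ract_add: "h \<in> hcarrier H \<Longrightarrow> ract H h (a + b) = hadd H (ract H h a) (ract H h b)"
  by (rule ext) (auto simp: closed inner_simps distrib_left)

lemma opn_scale: "opn (pscale c p) = cmod c * opn p"
proof (cases "c = 0")
  case True
  then show ?thesis using opn_scale_le[of c p] opn_nonneg[of "pscale c p"] by simp
next
  case False
  have "opn p = opn (pscale (inverse c) (pscale c p))"
    by (rule opn_cong) (simp add: ev_scale ev_in closed ract_mult[symmetric] scaleC_scaleC
        mult_scaleC_left False scaleC_one ract_one)
  also have "\<dots> \<le> cmod (inverse c) * opn (pscale c p)" by (rule opn_scale_le)
  finally have "cmod c * opn p \<le> opn (pscale c p)" using False by (simp add: norm_divide field_simps)
  with opn_scale_le show ?thesis by (rule antisym)
qed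

text \<open>Cauchy-Schwarz applied to <h, p^* p h>; this is the nontrivial half of the
  C*-identity.\<close>

lemma opn_sq_le: "(opn p)\<^sup>2 \<le> opn (PTimes (pstar p) p)"
proof -
  have "opn p \<le> sqrt (opn (PTimes (pstar p) p))"
  proof (rule opn_le)
    fix h assume h: "h \<in> hcarrier H"
    have "(hnorm H (ev p h))\<^sup>2 = norm (hinner H h (ev (PTimes (pstar p) p) h))"
      by (simp add: hnorm_sq ev_adj h ev_in)
    also have "\<dots> \<le> hnorm H h * hnorm H (ev (PTimes (pstar p) p) h)" by (intro Cauchy_Schwarz h ev_in)
    also have "\<dots> \<le> hnorm H h * (opn (PTimes (pstar p) p) * hnorm H h)"
      by (intro mult_left_mono hnorm_ev h hnorm_nonneg)
    also have "\<dots> = (sqrt (opn (PTimes (pstar p) p)) * hnorm H h)\<^sup>2"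
      by (simp add: power_mult_distrib opn_nonneg power2_eq_square[of "hnorm H h"])
    finally show "hnorm H (ev p h) \<le> sqrt (opn (PTimes (pstar p) p)) * hnorm H h"
      by (rule power2_le_imp_le) (simp add: opn_nonneg hnorm_nonneg)
  qed (simp add: opn_nonneg)
  from power_mono[OF this opn_nonneg, of 2] show ?thesis by (simp add: opn_nonneg)
qed

lemma pstar_pstar: "pstar (pstar p) = p"
  by (induction p) (auto simp: star_star)

lemma opn_star_le: "opn p \<le> opn (pstar p)"
proof (cases "opn p = 0")
  case False
  have "opn p * opn p \<le> opn (pstar p) * opn p"
    using opn_sq_le[of p] opn_times[of "pstar p" p] by (simp add: power2_eq_square)
  then show ?thesis using False opn_nonneg[of p] by simp
qed (simp add: opn_nonneg)

lemma opn_star: "opn (pstar p) = opn p"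
  using opn_star_le[of p] opn_star_le[of "pstar p"] by (simp add: pstar_pstar)

lemma opn_cstar: "opn (PTimes (pstar p) p) = (opn p)\<^sup>2"
  using opn_sq_le[of p] opn_times[of "pstar p" p] by (simp add: opn_star power2_eq_square)

definition pd :: "'b pexpr \<Rightarrow> 'b pexpr \<Rightarrow> real" where
  "pd p q = opn (pminus p q)"

definition peq :: "'b pexpr \<Rightarrow> 'b pexpr \<Rightarrow> bool" where
  "peq p q \<longleftrightarrow> (\<forall>h\<in>hcarrier H. ev p h = ev q h)"

lemma pd_nonneg: "pd p q \<ge> 0"
  by (simp add: pd_def opn_nonneg)

lemma pd_le:
  "C \<ge> 0 \<Longrightarrow> (\<And>h. h \<in> hcarrier H \<Longrightarrow> hnorm H (hminus H (ev p h) (ev q h)) \<le> C * hnorm H h) \<Longrightarrow> pd p q \<le> C"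
  unfolding pd_def by (rule opn_le) (auto simp: ev_pminus)

lemma hnorm_pd: "h \<in> hcarrier H \<Longrightarrow> hnorm H (hminus H (ev p h) (ev q h)) \<le> pd p q * hnorm H h"
  using hnorm_ev[of h "pminus p q"] by (simp add: pd_def ev_pminus)

lemma pd_peq: "peq p q \<Longrightarrow> pd p q = 0"
  using pd_le[of 0 p q] pd_nonneg[of p q] by (auto simp: peq_def hnorm_minus_self ev_in)

lemma pd_triangle: "pd p r \<le> pd p q + pd q r"
proof (rule pd_le)
  show "hnorm H (hminus H (ev p h) (ev r h)) \<le> (pd p q + pd q r) * hnorm H h" if h: "h \<in> hcarrier H" for h
    using hnorm_minus_triangle[OF ev_in ev_in ev_in, OF h h h, of p r q] hnorm_pd[OF h, of p q] hnorm_pd[OF h, of q r]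
    by (simp add: distrib_right)
qed (simp add: pd_nonneg)

lemma pd_commute: "pd p q = pd q p"
  unfolding pd_def opn_def
  by (intro arg_cong[where f = Inf] Collect_cong conj_cong ball_cong refl)
     (simp add: ev_pminus ev_in hnorm_minus_commute)

lemma pd_self: "pd p p = 0"
  by (rule pd_peq) (simp add: peq_def)

lemma pd_plus: "pd (PPlus p q) (PPlus p' q') \<le> pd p p' + pd q q'"
proof (rule pd_le)
  show "hnorm H (hminus H (ev (PPlus p q) h) (ev (PPlus p' q') h)) \<le> (pd p p' + pd q q') * hnorm H h"
    if h: "h \<in> hcarrier H" for h
    using hnorm_minus_add[OF ev_in ev_in ev_in ev_in, OF h h h h, of p q p' q'] hnorm_pd[OF h, of p p'] hnorm_pd[OF h, of q q']
    by (simp add: distrib_right)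
qed (simp add: pd_nonneg)

lemma pd_times: "pd (PTimes p q) (PTimes p' q') \<le> opn p * pd q q' + pd p p' * opn q'"
proof -
  have "pd (PTimes p q) (PTimes p q') \<le> opn (PTimes p (pminus q q'))"
    unfolding pd_def by (rule eq_refl, rule opn_cong) (simp add: ev_pminus ev_minus ev_in)
  moreover have "pd (PTimes p q') (PTimes p' q') \<le> opn (PTimes (pminus p p') q')"
    unfolding pd_def by (rule eq_refl, rule opn_cong) (simp add: ev_pminus ev_in)
  ultimately show ?thesis
    using pd_triangle[of "PTimes p q" "PTimes p' q'" "PTimes p q'"] opn_times[of p "pminus q q'"]
      opn_times[of "pminus p p'" q'] by (simp add: pd_def)
qed

lemma pd_star: "pd (pstar p) (pstar q) = pd p q"
proof -
  have "pd (pstar p) (pstar q) = opn (pstar (pminus p q))"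
    unfolding pd_def
    by (rule opn_cong) (rule ext_left, auto simp: ev_in closed minus_in ev_pminus ev_adj pstar_pstar inner_simps)
  then show ?thesis by (simp add: opn_star pd_def)
qed

lemma pd_scale: "pd (pscale c p) (pscale c q) = cmod c * pd p q"
proof -
  have "pd (pscale c p) (pscale c q) = opn (pscale c (pminus p q))"
    unfolding pd_def
  proof (rule opn_cong, rule ext)
    fix h l assume h: "h \<in> hcarrier H" "l \<in> hcarrier H"
    show "hinner H l (ev (pminus (pscale c p) (pscale c q)) h) = hinner H l (ev (pscale c (pminus p q)) h)"
      using h by (simp add: ev_pminus ev_scale inner_simps ev_in closed minus_in left_diff_distrib)
  qed (auto intro: ev_in)
  then show ?thesis by (simp add: opn_scale pd_def)
qed

lemma opn_diff: "\<bar>opn p - opn q\<bar> \<le> pd p q"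
proof -
  have le: "opn p \<le> opn q + pd p q" for p q
  proof (rule opn_le)
    show "hnorm H (ev p h) \<le> (opn q + pd p q) * hnorm H h" if h: "h \<in> hcarrier H" for h
      using hnorm_le_add_minus[OF ev_in ev_in, OF h h, of p q] hnorm_ev[OF h, of q] hnorm_pd[OF h, of p q]
      by (simp add: distrib_right)
  qed (simp add: opn_nonneg pd_nonneg)
  show ?thesis using le[of p q] le[of q p] by (simp add: pd_commute)
qed

lemma inner_pd:
  assumes "h \<in> hcarrier H" "k \<in> hcarrier H"
  shows "norm (hinner H h (ev p k) - hinner H h (ev q k)) \<le> hnorm H h * (pd p q * hnorm H k)"
proof -
  have "norm (hinner H h (hminus H (ev p k) (ev q k))) \<le> hnorm H h * hnorm H (hminus H (ev p k) (ev q k))"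
    by (intro Cauchy_Schwarz minus_in ev_in assms)
  also have "\<dots> \<le> hnorm H h * (pd p q * hnorm H k)"
    by (intro mult_left_mono hnorm_pd assms hnorm_nonneg)
  finally show ?thesis using assms by (simp add: inner_simps ev_in)
qed

lemma pd_zero: "pd p (PConst 0) = opn p"
proof -
  have "pd p (PConst 0) = opn p" unfolding pd_def
  proof (rule opn_cong, rule ext)
    fix h l assume "h \<in> hcarrier H" "l \<in> hcarrier H"
    then show "hinner H l (ev (pminus p (PConst 0)) h) = hinner H l (ev p h)"
      using lact_add[of l h 0 0] by (simp add: ev_pminus inner_simps ev_in closed)
  qed (auto intro: ev_in)
  then show ?thesis .
qed

end

text \<open>An injective code of syntax trees by sequences: position 0 holds a tag for the
  constructor, odd positions carry the left branch and positive even positions the right one. The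
  tags 0, 1, 2, 3 are distinct because the reals embed in the algebra.\<close>

fun pcode :: "'b::cstar_algebra pexpr \<Rightarrow> nat \<Rightarrow> 'b" where
  "pcode (PConst b) n = (if n = 0 then 0 else b)"
| "pcode (PVar c) n = (if n = 0 then 1 else of_bool c)"
| "pcode (PPlus p q) n = (if n = 0 then 2 else if odd n then pcode p (n div 2) else pcode q (n div 2 - 1))"
| "pcode (PTimes p q) n = (if n = 0 then 3 else if odd n then pcode p (n div 2) else pcode q (n div 2 - 1))"

lemma pcode_inj: "pcode p = pcode q \<Longrightarrow> p = q"
proof (induction p arbitrary: q)
  case (PConst b)
  then show ?case using fun_cong[OF PConst, of 0] fun_cong[OF PConst, of 1] by (cases q) auto
next
  case (PVar c)
  then show ?case using fun_cong[OF PVar, of 0] fun_cong[OF PVar, of 1] by (cases q) (auto simp: of_bool_def split: if_splits)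
next
  case (PPlus p1 p2)
  have "pcode (PPlus p1 p2) 0 = pcode q 0" by (rule fun_cong[OF PPlus.prems])
  then obtain q1 q2 where q: "q = PPlus q1 q2" by (cases q) auto
  have "pcode p1 m = pcode q1 m" "pcode p2 m = pcode q2 m" for m
    using fun_cong[OF PPlus.prems, of "2 * m + 1"] fun_cong[OF PPlus.prems, of "2 * m + 2"] by (simp_all add: q)
  then show ?case using PPlus.IH q by blast
next
  case (PTimes p1 p2)
  have "pcode (PTimes p1 p2) 0 = pcode q 0" by (rule fun_cong[OF PTimes.prems])
  then obtain q1 q2 where q: "q = PTimes q1 q2" by (cases q) auto
  have "pcode p1 m = pcode q1 m" "pcode p2 m = pcode q2 m" for m
    using fun_cong[OF PTimes.prems, of "2 * m + 1"] fun_cong[OF PTimes.prems, of "2 * m + 2"] by (simp_all add: q)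
  then show ?case using PTimes.IH q by blast
qed

definition scode :: "(nat \<Rightarrow> 'b::cstar_algebra pexpr) \<Rightarrow> nat \<Rightarrow> 'b" where
  "scode u n = (case prod_decode n of (i, j) \<Rightarrow> pcode (u i) j)"

lemma scode_inj: "inj scode"
proof (rule injI, rule HOL.ext, rule pcode_inj, rule HOL.ext)
  fix u v :: "nat \<Rightarrow> 'a pexpr" and i j
  assume "scode u = scode v"
  from fun_cong[OF this, of "prod_encode (i, j)"] show "pcode (u i) j = pcode (v i) j"
    by (simp add: scode_def)
qed

section \<open>The norm completion of the polynomials\<close>

context op_pair
begin

definition "CS = {u :: nat \<Rightarrow> 'b pexpr. \<forall>e>0. \<exists>K. \<forall>i\<ge>K. \<forall>j\<ge>K. pd (u i) (u j) < e}"

definition pnull :: "(nat \<Rightarrow> 'b pexpr) \<Rightarrow> (nat \<Rightarrow> 'b pexpr) \<Rightarrow> bool" where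
  "pnull u v \<longleftrightarrow> (\<lambda>i. pd (u i) (v i)) \<longlonglongrightarrow> 0"

text \<open>\<open>cls u\<close> is the code of one representative of the class of \<open>u\<close> modulo null sequences, the same for
  the whole class, and stands for that class.\<close>

definition cls :: "(nat \<Rightarrow> 'b pexpr) \<Rightarrow> nat \<Rightarrow> 'b" where
  "cls u = scode (SOME v. v \<in> CS \<and> pnull u v)"

definition rep :: "(nat \<Rightarrow> 'b) \<Rightarrow> nat \<Rightarrow> 'b pexpr" where
  "rep = inv_into UNIV scode"

lemma CS_I: "(\<And>e. e > 0 \<Longrightarrow> \<exists>K. \<forall>i\<ge>K. \<forall>j\<ge>K. pd (u i) (u j) < e) \<Longrightarrow> u \<in> CS"
  by (simp add: CS_def)

lemma CS_D: "u \<in> CS \<Longrightarrow> e > 0 \<Longrightarrow> \<exists>K. \<forall>i\<ge>K. \<forall>j\<ge>K. pd (u i) (u j) < e"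
  by (simp add: CS_def)

lemma CS_const: "(\<lambda>_. p) \<in> CS"
  by (rule CS_I) (simp add: pd_self)

lemma pnullI: "(\<And>i. pd (u i) (v i) \<le> w i) \<Longrightarrow> w \<longlonglongrightarrow> 0 \<Longrightarrow> pnull u v"
  unfolding pnull_def by (rule tendsto_sandwich[of "\<lambda>_. 0"]) (auto simp: pd_nonneg)

lemma pnull_peq: "(\<And>i. peq (u i) (v i)) \<Longrightarrow> pnull u v"
  by (simp add: pnull_def pd_peq)

lemma pnull_refl: "pnull u u"
  by (simp add: pnull_def pd_self)

lemma pnull_sym: "pnull u v \<Longrightarrow> pnull v u"
  by (simp add: pnull_def pd_commute)

lemma pnull_trans: "pnull u v \<Longrightarrow> pnull v w \<Longrightarrow> pnull u w"
  by (rule pnullI[OF pd_triangle]) (use tendsto_add[of _ 0 sequentially _ 0] in \<open>auto simp: pnull_def\<close>)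

lemma rep_props:
  assumes "u \<in> CS"
  shows "rep (cls u) \<in> CS" "pnull u (rep (cls u))"
proof -
  have "(SOME v. v \<in> CS \<and> pnull u v) \<in> CS \<and> pnull u (SOME v. v \<in> CS \<and> pnull u v)"
    by (rule someI[of _ u]) (use assms pnull_refl in auto)
  then show "rep (cls u) \<in> CS" "pnull u (rep (cls u))"
    by (simp_all add: rep_def cls_def inv_f_f[OF scode_inj])
qed

lemma cls_eqI: "pnull u v \<Longrightarrow> cls u = cls v"
proof -
  assume "pnull u v"
  then have "(\<lambda>w. w \<in> CS \<and> pnull u w) = (\<lambda>w. w \<in> CS \<and> pnull v w)"
    using pnull_trans pnull_sym by blast
  then show ?thesis by (simp add: cls_def)
qed

lemma cls_eqD: "u \<in> CS \<Longrightarrow> v \<in> CS \<Longrightarrow> cls u = cls v \<Longrightarrow> pnull u v"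
  using rep_props(2) pnull_trans pnull_sym by metis

lemma opn_convergent:
  assumes "u \<in> CS" shows "convergent (\<lambda>i. opn (u i))"
proof (rule Cauchy_convergent, rule CauchyI)
  fix e :: real assume "e > 0"
  then obtain K where K: "\<forall>i\<ge>K. \<forall>j\<ge>K. pd (u i) (u j) < e" using CS_D[OF assms] by blast
  have "norm (opn (u i) - opn (u j)) < e" if "i \<ge> K" "j \<ge> K" for i j
    using opn_diff[of "u i" "u j"] K that by fastforce
  then show "\<exists>M. \<forall>m\<ge>M. \<forall>n\<ge>M. norm (opn (u m) - opn (u n)) < e" by blast
qed

lemma opn_bound:
  assumes "u \<in> CS" shows "\<exists>B>0. \<forall>i. opn (u i) \<le> B"
proof -
  have "Bseq (\<lambda>i. opn (u i))" using convergent_imp_Bseq[OF opn_convergent[OF assms]] .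
  then obtain B where "B > 0" "\<forall>i. norm (opn (u i)) \<le> B" by (auto simp: Bseq_def)
  then show ?thesis by (intro exI[of _ B]) (auto simp: opn_nonneg)
qed

lemma CS_plus: "u \<in> CS \<Longrightarrow> v \<in> CS \<Longrightarrow> (\<lambda>i. PPlus (u i) (v i)) \<in> CS"
proof (rule CS_I)
  fix e :: real assume "u \<in> CS" "v \<in> CS" "e > 0"
  then obtain K L where K: "\<forall>i\<ge>K. \<forall>j\<ge>K. pd (u i) (u j) < e/2" "\<forall>i\<ge>L. \<forall>j\<ge>L. pd (v i) (v j) < e/2"
    using CS_D[of u "e/2"] CS_D[of v "e/2"] by auto
  have "pd (PPlus (u i) (v i)) (PPlus (u j) (v j)) < e" if "i \<ge> max K L" "j \<ge> max K L" for i j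
  proof -
    have "pd (u i) (u j) < e/2" "pd (v i) (v j) < e/2" using K that by auto
    then show ?thesis using pd_plus[of "u i" "v i" "u j" "v j"] by simp
  qed
  then show "\<exists>K. \<forall>i\<ge>K. \<forall>j\<ge>K. pd (PPlus (u i) (v i)) (PPlus (u j) (v j)) < e" by blast
qed

lemma CS_times: "u \<in> CS \<Longrightarrow> v \<in> CS \<Longrightarrow> (\<lambda>i. PTimes (u i) (v i)) \<in> CS"
proof (rule CS_I)
  fix e :: real assume uv: "u \<in> CS" "v \<in> CS" and e: "e > 0"
  obtain B where B: "B > 0" "\<forall>i. opn (u i) \<le> B" using opn_bound[OF uv(1)] by auto
  obtain D where D: "D > 0" "\<forall>i. opn (v i) \<le> D" using opn_bound[OF uv(2)] by auto
  obtain K where K: "\<forall>i\<ge>K. \<forall>j\<ge>K. pd (u i) (u j) < e/2/D"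
    using CS_D[OF uv(1), of "e/2/D"] e D by auto
  obtain L where L: "\<forall>i\<ge>L. \<forall>j\<ge>L. pd (v i) (v j) < e/2/B"
    using CS_D[OF uv(2), of "e/2/B"] e B by auto
  have "pd (PTimes (u i) (v i)) (PTimes (u j) (v j)) < e" if "i \<ge> max K L" "j \<ge> max K L" for i j
  proof -
    have 1: "pd (u i) (u j) < e/2/D" "pd (v i) (v j) < e/2/B" using K L that by auto
    have "opn (u i) * pd (v i) (v j) \<le> B * pd (v i) (v j)" by (intro mult_right_mono B(2)[rule_format] pd_nonneg)
    also have "\<dots> < e/2" using 1 B(1) by (simp add: field_simps)
    finally have 2: "opn (u i) * pd (v i) (v j) < e/2" .
    have "pd (u i) (u j) * opn (v j) \<le> pd (u i) (u j) * D" by (intro mult_left_mono D(2)[rule_format] pd_nonneg)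
    also have "\<dots> < e/2" using 1 D(1) by (simp add: field_simps)
    finally show ?thesis using 2 pd_times[of "u i" "v i" "u j" "v j"] by simp
  qed
  then show "\<exists>K. \<forall>i\<ge>K. \<forall>j\<ge>K. pd (PTimes (u i) (v i)) (PTimes (u j) (v j)) < e" by blast
qed

lemma CS_star: "u \<in> CS \<Longrightarrow> (\<lambda>i. pstar (u i)) \<in> CS"
  by (simp add: CS_def pd_star)

lemma CS_scale: "u \<in> CS \<Longrightarrow> (\<lambda>i. pscale c (u i)) \<in> CS"
  unfolding pscale_def by (rule CS_times[OF CS_const])

lemma CS_minus: "u \<in> CS \<Longrightarrow> v \<in> CS \<Longrightarrow> (\<lambda>i. pminus (u i) (v i)) \<in> CS"
  unfolding pminus_def by (intro CS_plus CS_scale)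

lemma pnull_plus: "pnull u u' \<Longrightarrow> pnull v v' \<Longrightarrow> pnull (\<lambda>i. PPlus (u i) (v i)) (\<lambda>i. PPlus (u' i) (v' i))"
  by (rule pnullI[OF pd_plus]) (use tendsto_add[of _ 0 sequentially _ 0] in \<open>auto simp: pnull_def\<close>)

lemma pnull_times:
  assumes "u \<in> CS" "v' \<in> CS" "pnull u u'" "pnull v v'"
  shows "pnull (\<lambda>i. PTimes (u i) (v i)) (\<lambda>i. PTimes (u' i) (v' i))"
proof (rule pnullI[OF pd_times])
  show "(\<lambda>i. opn (u i) * pd (v i) (v' i) + pd (u i) (u' i) * opn (v' i)) \<longlonglongrightarrow> 0"
    using tendsto_add[OF tendsto_mult[OF convergent_LIMSEQ_iff[THEN iffD1, OF opn_convergent[OF assms(1)]] assms(4)[unfolded pnull_def]]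
        tendsto_mult[OF assms(3)[unfolded pnull_def] convergent_LIMSEQ_iff[THEN iffD1, OF opn_convergent[OF assms(2)]]]]
    by simp
qed

lemma pnull_star: "pnull u v \<Longrightarrow> pnull (\<lambda>i. pstar (u i)) (\<lambda>i. pstar (v i))"
  by (simp add: pnull_def pd_star)

lemma pnull_scale: "pnull u v \<Longrightarrow> pnull (\<lambda>i. pscale c (u i)) (\<lambda>i. pscale c (v i))"
  unfolding pnull_def pd_scale by (rule tendsto_mult_right_zero)

text \<open>Every operation is applied termwise to the chosen representatives;
  \<open>rep_props\<close> and the estimates for \<open>pd\<close> make the resulting class
  independent of the choice.\<close>

definition alg :: "(nat \<Rightarrow> 'b) cstar" where
  "alg = \<lparr> carrier = cls ` CS,
     mult = (\<lambda>a b. cls (\<lambda>i. PTimes (rep a i) (rep b i))),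
     one = cls (\<lambda>_. PConst 1), zero = cls (\<lambda>_. PConst 0),
     add = (\<lambda>a b. cls (\<lambda>i. PPlus (rep a i) (rep b i))),
     cscale = (\<lambda>c a. cls (\<lambda>i. pscale c (rep a i))),
     cstar = (\<lambda>a. cls (\<lambda>i. pstar (rep a i))),
     cnorm = (\<lambda>a. lim (\<lambda>i. opn (rep a i))) \<rparr>"

lemma alg_times: "u \<in> CS \<Longrightarrow> v \<in> CS \<Longrightarrow> cls u \<otimes>\<^bsub>alg\<^esub> cls v = cls (\<lambda>i. PTimes (u i) (v i))"
  by (simp add: alg_def) (intro cls_eqI pnull_times rep_props pnull_sym[OF rep_props(2)])

lemma alg_plus: "u \<in> CS \<Longrightarrow> v \<in> CS \<Longrightarrow> cls u \<oplus>\<^bsub>alg\<^esub> cls v = cls (\<lambda>i. PPlus (u i) (v i))"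
  by (simp add: alg_def) (intro cls_eqI pnull_plus pnull_sym[OF rep_props(2)])

lemma alg_star: "u \<in> CS \<Longrightarrow> cstar alg (cls u) = cls (\<lambda>i. pstar (u i))"
  by (simp add: alg_def) (intro cls_eqI pnull_star pnull_sym[OF rep_props(2)])

lemma alg_scale: "u \<in> CS \<Longrightarrow> cscale alg c (cls u) = cls (\<lambda>i. pscale c (u i))"
  by (simp add: alg_def) (intro cls_eqI pnull_scale pnull_sym[OF rep_props(2)])

lemma alg_norm: "u \<in> CS \<Longrightarrow> (\<lambda>i. opn (u i)) \<longlonglongrightarrow> cnorm alg (cls u)"
proof -
  assume u: "u \<in> CS"
  have lim: "(\<lambda>i. opn (rep (cls u) i)) \<longlonglongrightarrow> cnorm alg (cls u)"
    using opn_convergent[OF rep_props(1)[OF u]] by (simp add: alg_def convergent_LIMSEQ_iff)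
  have "(\<lambda>i. opn (u i) - opn (rep (cls u) i)) \<longlonglongrightarrow> 0"
    by (rule Lim_null_comparison[OF always_eventually rep_props(2)[OF u, unfolded pnull_def]]) (simp add: opn_diff)
  from tendsto_add[OF this lim] show ?thesis by simp
qed

lemma alg_normI: "u \<in> CS \<Longrightarrow> (\<lambda>i. opn (u i)) \<longlonglongrightarrow> l \<Longrightarrow> cnorm alg (cls u) = l"
  using alg_norm LIMSEQ_unique by blast

lemma alg_zero: "\<zero>\<^bsub>alg\<^esub> = cls (\<lambda>_. PConst 0)" and alg_one: "\<one>\<^bsub>alg\<^esub> = cls (\<lambda>_. PConst 1)"
  by (simp_all add: alg_def)

lemma alg_carrierI: "u \<in> CS \<Longrightarrow> cls u \<in> carrier alg"
  by (simp add: alg_def)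

lemma alg_carrierE: "a \<in> carrier alg \<Longrightarrow> (\<And>u. a = cls u \<Longrightarrow> u \<in> CS \<Longrightarrow> P) \<Longrightarrow> P"
  by (auto simp: alg_def)

lemma cls_cong: "(\<And>i h. h \<in> hcarrier H \<Longrightarrow> ev (u i) h = ev (v i) h) \<Longrightarrow> cls u = cls v"
  by (rule cls_eqI, rule pnull_peq) (simp add: peq_def)

lemma ev_eqI:
  assumes "h \<in> hcarrier H" "\<And>l. l \<in> hcarrier H \<Longrightarrow> hinner H l (ev p h) = hinner H l (ev q h)"
  shows "ev p h = ev q h"
  by (rule ext) (auto simp: assms ev_in)

lemma abelian_group_alg: "abelian_group alg"
proof (rule abelian_groupI)
  fix x y w assume xyw: "x \<in> carrier alg" "y \<in> carrier alg" "w \<in> carrier alg"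
  obtain u where u: "x = cls u" "u \<in> CS" by (rule alg_carrierE[OF xyw(1)])
  obtain v where v: "y = cls v" "v \<in> CS" by (rule alg_carrierE[OF xyw(2)])
  obtain r where r: "w = cls r" "r \<in> CS" by (rule alg_carrierE[OF xyw(3)])
  show "x \<oplus>\<^bsub>alg\<^esub> y \<in> carrier alg"
    by (simp add: u v alg_plus CS_plus alg_carrierI)
  show "x \<oplus>\<^bsub>alg\<^esub> y \<oplus>\<^bsub>alg\<^esub> w = x \<oplus>\<^bsub>alg\<^esub> (y \<oplus>\<^bsub>alg\<^esub> w)"
    unfolding u v r by (simp only: alg_plus CS_plus u(2) v(2) r(2), rule cls_cong, rule ev_eqI)
      (simp_all add: inner_simps ev_in closed)
  show "x \<oplus>\<^bsub>alg\<^esub> y = y \<oplus>\<^bsub>alg\<^esub> x"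
    unfolding u v by (simp only: alg_plus CS_plus u(2) v(2), rule cls_cong, rule ev_eqI)
      (simp_all add: inner_simps ev_in closed)
  show "\<zero>\<^bsub>alg\<^esub> \<oplus>\<^bsub>alg\<^esub> x = x"
    unfolding u by (simp only: alg_plus alg_zero CS_const u(2), rule cls_cong, rule ev_eqI)
      (simp_all add: inner_simps ev_in closed lact_zero)
  have "cls (\<lambda>i. pscale (-1) (u i)) \<oplus>\<^bsub>alg\<^esub> x = \<zero>\<^bsub>alg\<^esub>"
    unfolding u by (simp only: u(2) alg_plus alg_zero CS_scale, rule cls_cong, rule ev_eqI)
      (simp_all add: ev_scale inner_simps ev_in closed lact_zero scaleC_minus_left scaleC_one)
  then show "\<exists>y\<in>carrier alg. y \<oplus>\<^bsub>alg\<^esub> x = \<zero>\<^bsub>alg\<^esub>"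
    using u by (intro bexI[of _ "cls (\<lambda>i. pscale (-1) (u i))"]) (auto intro: alg_carrierI CS_scale)
qed (simp add: alg_zero alg_carrierI CS_const)

lemma ring_alg: "ring alg"
proof (rule ringI[OF abelian_group_alg])
  show "Group.monoid alg"
  proof (rule monoidI)
    fix x y w assume xyw: "x \<in> carrier alg" "y \<in> carrier alg" "w \<in> carrier alg"
    obtain u where u: "x = cls u" "u \<in> CS" by (rule alg_carrierE[OF xyw(1)])
    obtain v where v: "y = cls v" "v \<in> CS" by (rule alg_carrierE[OF xyw(2)])
    obtain r where r: "w = cls r" "r \<in> CS" by (rule alg_carrierE[OF xyw(3)])
    show "x \<otimes>\<^bsub>alg\<^esub> y \<in> carrier alg"
      by (simp add: u v alg_times CS_times alg_carrierI)
    show "x \<otimes>\<^bsub>alg\<^esub> y \<otimes>\<^bsub>alg\<^esub> w = x \<otimes>\<^bsub>alg\<^esub> (y \<otimes>\<^bsub>alg\<^esub> w)"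
      unfolding u v r by (simp only: alg_times CS_times u(2) v(2) r(2), rule cls_cong) simp
    show "\<one>\<^bsub>alg\<^esub> \<otimes>\<^bsub>alg\<^esub> x = x"
      unfolding u by (simp only: alg_times alg_one CS_const u(2), rule cls_cong) (simp add: lact_one_eq ev_in)
    show "x \<otimes>\<^bsub>alg\<^esub> \<one>\<^bsub>alg\<^esub> = x"
      unfolding u by (simp only: alg_times alg_one CS_const u(2), rule cls_cong) (simp add: lact_one_eq)
  qed (simp add: alg_one alg_carrierI CS_const)
  fix x y w assume xyw: "x \<in> carrier alg" "y \<in> carrier alg" "w \<in> carrier alg"
  obtain u where u: "x = cls u" "u \<in> CS" by (rule alg_carrierE[OF xyw(1)])
  obtain v where v: "y = cls v" "v \<in> CS" by (rule alg_carrierE[OF xyw(2)])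
  obtain r where r: "w = cls r" "r \<in> CS" by (rule alg_carrierE[OF xyw(3)])
  show "(x \<oplus>\<^bsub>alg\<^esub> y) \<otimes>\<^bsub>alg\<^esub> w = x \<otimes>\<^bsub>alg\<^esub> w \<oplus>\<^bsub>alg\<^esub> y \<otimes>\<^bsub>alg\<^esub> w"
    unfolding u v r by (simp only: alg_times alg_plus CS_times CS_plus u(2) v(2) r(2), rule cls_cong) simp
  show "w \<otimes>\<^bsub>alg\<^esub> (x \<oplus>\<^bsub>alg\<^esub> y) = w \<otimes>\<^bsub>alg\<^esub> x \<oplus>\<^bsub>alg\<^esub> w \<otimes>\<^bsub>alg\<^esub> y"
    unfolding u v r by (simp only: alg_times alg_plus CS_times CS_plus u(2) v(2) r(2), rule cls_cong) (simp add: ev_add ev_in)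
qed

lemma alg_minus:
  assumes u: "u \<in> CS" and v: "v \<in> CS"
  shows "cls u \<ominus>\<^bsub>alg\<^esub> cls v = cls (\<lambda>i. pminus (u i) (v i))"
proof -
  interpret ring alg by (rule ring_alg)
  have "cls v \<oplus>\<^bsub>alg\<^esub> cls (\<lambda>i. pscale (-1) (v i)) = \<zero>\<^bsub>alg\<^esub>"
    by (simp only: v alg_plus alg_zero CS_scale, rule cls_cong, rule ev_eqI)
      (simp_all add: ev_scale inner_simps ev_in closed lact_zero scaleC_minus_left scaleC_one)
  then have "\<ominus>\<^bsub>alg\<^esub> cls v = cls (\<lambda>i. pscale (-1) (v i))"
    by (metis a_comm alg_carrierI CS_scale minus_equality v)
  then show ?thesis using u v by (simp add: a_minus_def alg_plus CS_scale pminus_def)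
qed

lemma alg_dist:
  assumes u: "u \<in> CS" and v: "v \<in> CS"
  shows "(\<lambda>i. pd (u i) (v i)) \<longlonglongrightarrow> cnorm alg (cls u \<ominus>\<^bsub>alg\<^esub> cls v)"
  unfolding alg_minus[OF u v] pd_def by (rule alg_norm[OF CS_minus[OF u v]])

lemma alg_dist_const: "cnorm alg (cls (\<lambda>_. p) \<ominus>\<^bsub>alg\<^esub> cls (\<lambda>_. q)) = pd p q"
  using alg_dist[OF CS_const CS_const, of p q] LIMSEQ_unique by blast

end

context op_pair
begin

text \<open>From the n-th class a single polynomial \<open>v n\<close> at distance at most 1/(n + 1)
  is picked. The sequence \<open>v\<close> is itself Cauchy, and its class is the limit.\<close>

lemma alg_complete:
  fixes U :: "nat \<Rightarrow> nat \<Rightarrow> 'b"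
  assumes U: "\<And>n. U n \<in> carrier alg"
    and Cauchy: "\<forall>e>0. \<exists>K. \<forall>i\<ge>K. \<forall>j\<ge>K. cnorm alg (U i \<ominus>\<^bsub>alg\<^esub> U j) < e"
  shows "\<exists>x\<in>carrier alg. (\<lambda>n. cnorm alg (U n \<ominus>\<^bsub>alg\<^esub> x)) \<longlonglongrightarrow> 0"
proof -
  have "\<forall>n. \<exists>u. U n = cls u \<and> u \<in> CS" using U alg_carrierE by metis
  then obtain u where u: "\<And>n. U n = cls (u n)" "\<And>n. u n \<in> CS" by metis
  have "\<forall>n. \<exists>K. \<forall>j\<ge>K. pd (u n K) (u n j) < inverse (real (Suc n))"
  proof
    fix n
    obtain K where "\<forall>i\<ge>K. \<forall>j\<ge>K. pd (u n i) (u n j) < inverse (real (Suc n))"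
      using CS_D[OF u(2)[of n], of "inverse (real (Suc n))"] by auto
    then show "\<exists>K. \<forall>j\<ge>K. pd (u n K) (u n j) < inverse (real (Suc n))" by blast
  qed
  then obtain K where K: "\<forall>n. \<forall>j\<ge>K n. pd (u n (K n)) (u n j) < inverse (real (Suc n))" by metis
  define v where "v n = u n (K n)" for n
  have near: "cnorm alg (cls (\<lambda>_. v n) \<ominus>\<^bsub>alg\<^esub> U n) \<le> inverse (real (Suc n))" for n
    unfolding u(1)
  proof (rule LIMSEQ_le_const2[OF alg_dist[OF CS_const u(2)]])
    show "\<exists>N. \<forall>j\<ge>N. pd (v n) (u n j) \<le> inverse (real (Suc n))"
      using K unfolding v_def by (metis less_imp_le)
  qed
  have tri: "cnorm alg (a \<ominus>\<^bsub>alg\<^esub> c) \<le> cnorm alg (a \<ominus>\<^bsub>alg\<^esub> b) + cnorm alg (b \<ominus>\<^bsub>alg\<^esub> c)"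
    if abc: "a \<in> carrier alg" "b \<in> carrier alg" "c \<in> carrier alg" for a b c
  proof -
    obtain x where x: "a = cls x" "x \<in> CS" by (rule alg_carrierE[OF abc(1)])
    obtain y where y: "b = cls y" "y \<in> CS" by (rule alg_carrierE[OF abc(2)])
    obtain w where w: "c = cls w" "w \<in> CS" by (rule alg_carrierE[OF abc(3)])
    show ?thesis unfolding x y w
      by (rule LIMSEQ_le[OF alg_dist[OF x(2) w(2)] tendsto_add[OF alg_dist[OF x(2) y(2)] alg_dist[OF y(2) w(2)]]])
        (auto intro: pd_triangle)
  qed
  have comm: "cnorm alg (a \<ominus>\<^bsub>alg\<^esub> b) = cnorm alg (b \<ominus>\<^bsub>alg\<^esub> a)"
    if abc: "a \<in> carrier alg" "b \<in> carrier alg" for a b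
  proof -
    obtain x where x: "a = cls x" "x \<in> CS" by (rule alg_carrierE[OF abc(1)])
    obtain y where y: "b = cls y" "y \<in> CS" by (rule alg_carrierE[OF abc(2)])
    show ?thesis unfolding x y
      using LIMSEQ_unique[OF alg_dist[OF x(2) y(2), unfolded pd_commute[of "x _"]] alg_dist[OF y(2) x(2)]] .
  qed
  have c: "cls (\<lambda>_. v n) \<in> carrier alg" for n by (rule alg_carrierI[OF CS_const])
  have inv0: "(\<lambda>n. inverse (real (Suc n))) \<longlonglongrightarrow> 0" by (rule LIMSEQ_inverse_real_of_nat)
  have v: "v \<in> CS"
  proof (rule CS_I)
    fix e :: real assume e: "e > 0"
    obtain N where N: "\<forall>i\<ge>N. \<forall>j\<ge>N. cnorm alg (U i \<ominus>\<^bsub>alg\<^esub> U j) < e/3"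
      using Cauchy e by (meson divide_pos_pos zero_less_numeral)
    have "eventually (\<lambda>n. inverse (real (Suc n)) < e/3) sequentially"
      using order_tendstoD(2)[OF inv0, of "e/3"] e by simp
    then obtain M where M: "\<forall>n\<ge>M. inverse (real (Suc n)) < e/3" by (auto simp: eventually_sequentially)
    have "pd (v i) (v j) < e" if "i \<ge> max N M" "j \<ge> max N M" for i j
    proof -
      have "pd (v i) (v j) \<le> cnorm alg (cls (\<lambda>_. v i) \<ominus>\<^bsub>alg\<^esub> U i) + cnorm alg (U i \<ominus>\<^bsub>alg\<^esub> cls (\<lambda>_. v j))"
        using tri[OF c[of i] U[of i] c[of j]] by (simp add: alg_dist_const)
      also have "\<dots> \<le> cnorm alg (cls (\<lambda>_. v i) \<ominus>\<^bsub>alg\<^esub> U i)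
          + (cnorm alg (U i \<ominus>\<^bsub>alg\<^esub> U j) + cnorm alg (cls (\<lambda>_. v j) \<ominus>\<^bsub>alg\<^esub> U j))"
        using tri[OF U[of i] U[of j] c[of j]] comm[OF U[of j] c[of j]] by simp
      also have "\<dots> < e/3 + (e/3 + e/3)"
        using N M that by (intro add_strict_mono order.strict_trans1[OF near]) auto
      finally show ?thesis by simp
    qed
    then show "\<exists>K. \<forall>i\<ge>K. \<forall>j\<ge>K. pd (v i) (v j) < e" by blast
  qed
  show ?thesis
  proof (intro bexI[of _ "cls v"] alg_carrierI v)
    show "(\<lambda>n. cnorm alg (U n \<ominus>\<^bsub>alg\<^esub> cls v)) \<longlonglongrightarrow> 0"
    proof (rule LIMSEQ_I)
      fix e :: real assume e: "e > 0"
      obtain N where N: "\<forall>i\<ge>N. \<forall>j\<ge>N. pd (v i) (v j) < e/3"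
        using CS_D[OF v, of "e/3"] e by auto
      have "eventually (\<lambda>n. inverse (real (Suc n)) < e/3) sequentially"
        using order_tendstoD(2)[OF inv0, of "e/3"] e by simp
      then obtain M where M: "\<forall>n\<ge>M. inverse (real (Suc n)) < e/3" by (auto simp: eventually_sequentially)
      have "norm (cnorm alg (U n \<ominus>\<^bsub>alg\<^esub> cls v) - 0) < e" if n: "n \<ge> max N M" for n
      proof -
        have "cnorm alg (cls (\<lambda>_. v n) \<ominus>\<^bsub>alg\<^esub> cls v) \<le> e/3"
          by (rule LIMSEQ_le_const2[OF alg_dist[OF CS_const v]]) (use N n in \<open>auto intro!: exI[of _ N] less_imp_le\<close>)
        moreover have "cnorm alg (U n \<ominus>\<^bsub>alg\<^esub> cls (\<lambda>_. v n)) < e/3"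
          using near[of n] M n comm[OF U[of n] c[of n]] by fastforce
        moreover have "0 \<le> cnorm alg (U n \<ominus>\<^bsub>alg\<^esub> cls v)"
          unfolding u(1) by (rule LIMSEQ_le_const[OF alg_dist[OF u(2) v]]) (auto simp: pd_nonneg)
        ultimately show ?thesis using tri[OF U[of n] c[of n] alg_carrierI[OF v]] e by simp
      qed
      then show "\<exists>no. \<forall>n\<ge>no. norm (cnorm alg (U n \<ominus>\<^bsub>alg\<^esub> cls v) - 0) < e" by blast
    qed
  qed
qed

lemma cstar_algebra_alg: "cstar_algebra_on alg"
proof (intro cstar_algebra_on.intro ring_alg cstar_algebra_on_axioms.intro)
  fix x y assume xy: "x \<in> carrier alg" "y \<in> carrier alg"
  fix c d :: complex
  obtain u where u: "x = cls u" "u \<in> CS" by (rule alg_carrierE[OF xy(1)])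
  obtain v where v: "y = cls v" "v \<in> CS" by (rule alg_carrierE[OF xy(2)])
  note s = ev_scale inner_simps ev_in closed minus_in lact_zero
  show "cscale alg c x \<in> carrier alg" by (simp add: u alg_scale CS_scale alg_carrierI)
  show "cscale alg 1 x = x"
    unfolding u by (simp only: u(2) alg_scale, rule cls_cong) (simp add: ev_scale scaleC_one ract_one ev_in)
  show "cscale alg (c + d) x = cscale alg c x \<oplus>\<^bsub>alg\<^esub> cscale alg d x"
    unfolding u by (simp only: u(2) alg_scale alg_plus CS_scale, rule cls_cong) (simp add: ev_scale scaleC_add_left ract_add ev_in)
  show "cscale alg c (x \<oplus>\<^bsub>alg\<^esub> y) = cscale alg c x \<oplus>\<^bsub>alg\<^esub> cscale alg c y"
    unfolding u v by (simp only: u(2) v(2) alg_scale alg_plus CS_scale CS_plus, rule cls_cong, rule ev_eqI)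
      (simp_all add: s distrib_right)
  show "cscale alg c (cscale alg d x) = cscale alg (c * d) x"
    unfolding u by (simp only: u(2) alg_scale CS_scale, rule cls_cong)
      (simp add: ev_scale ract_mult[symmetric] ev_in scaleC_scaleC mult_scaleC_left mult.commute)
  show "cscale alg c x \<otimes>\<^bsub>alg\<^esub> y = cscale alg c (x \<otimes>\<^bsub>alg\<^esub> y)"
    unfolding u v by (simp only: u(2) v(2) alg_scale alg_times CS_scale CS_times, rule cls_cong) (simp add: ev_scale ev_in)
  show "x \<otimes>\<^bsub>alg\<^esub> cscale alg c y = cscale alg c (x \<otimes>\<^bsub>alg\<^esub> y)"
    unfolding u v by (simp only: u(2) v(2) alg_scale alg_times CS_scale CS_times, rule cls_cong) (simp add: ev_scale ev_in ev_ract)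
  show "cstar alg x \<in> carrier alg" by (simp add: u alg_star CS_star alg_carrierI)
  show "cstar alg (cstar alg x) = x" by (simp add: u alg_star CS_star pstar_pstar)
  show "cstar alg (x \<oplus>\<^bsub>alg\<^esub> y) = cstar alg x \<oplus>\<^bsub>alg\<^esub> cstar alg y"
    by (simp add: u v alg_star alg_plus CS_star CS_plus)
  show "cstar alg (x \<otimes>\<^bsub>alg\<^esub> y) = cstar alg y \<otimes>\<^bsub>alg\<^esub> cstar alg x"
    by (simp add: u v alg_star alg_times CS_star CS_times)
  show "cstar alg (cscale alg c x) = cscale alg (cnj c) (cstar alg x)"
    unfolding u by (simp only: u(2) alg_scale alg_star CS_scale CS_star, rule cls_cong)
      (simp add: pscale_def star_scaleC star_one ev_scale[unfolded pscale_def] lact_scalar_eq ev_in ev_ract)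
  show "0 \<le> cnorm alg x"
    unfolding u by (rule LIMSEQ_le_const[OF alg_norm[OF u(2)]]) (auto simp: opn_nonneg)
  show "cnorm alg x = 0 \<longleftrightarrow> x = \<zero>\<^bsub>alg\<^esub>"
  proof
    assume "cnorm alg x = 0"
    then have "(\<lambda>i. opn (u i)) \<longlonglongrightarrow> 0" using alg_norm[OF u(2)] u(1) by simp
    then show "x = \<zero>\<^bsub>alg\<^esub>" unfolding u(1) alg_zero by (intro cls_eqI) (simp add: pnull_def pd_zero)
  next
    assume "x = \<zero>\<^bsub>alg\<^esub>"
    then have "pnull u (\<lambda>_. PConst 0)" unfolding u(1) alg_zero using cls_eqD[OF u(2) CS_const] by simp
    then show "cnorm alg x = 0" unfolding u(1) using alg_normI[OF u(2)] by (simp add: pnull_def pd_zero)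
  qed
  show "cnorm alg (x \<oplus>\<^bsub>alg\<^esub> y) \<le> cnorm alg x + cnorm alg y"
    unfolding u v alg_plus[OF u(2) v(2)]
    by (rule LIMSEQ_le[OF alg_norm[OF CS_plus[OF u(2) v(2)]] tendsto_add[OF alg_norm[OF u(2)] alg_norm[OF v(2)]]])
      (auto intro: opn_plus)
  show "cnorm alg (cscale alg c x) = cmod c * cnorm alg x"
    unfolding u alg_scale[OF u(2)]
    by (rule alg_normI[OF CS_scale[OF u(2)]]) (simp only: opn_scale, intro tendsto_mult_left alg_norm u(2))
  show "cnorm alg (x \<otimes>\<^bsub>alg\<^esub> y) \<le> cnorm alg x * cnorm alg y"
    unfolding u v alg_times[OF u(2) v(2)]
    by (rule LIMSEQ_le[OF alg_norm[OF CS_times[OF u(2) v(2)]] tendsto_mult[OF alg_norm[OF u(2)] alg_norm[OF v(2)]]])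
      (auto intro: opn_times)
  show "cnorm alg (cstar alg x \<otimes>\<^bsub>alg\<^esub> x) = (cnorm alg x)\<^sup>2"
    unfolding u alg_star[OF u(2)] alg_times[OF CS_star[OF u(2)] u(2)]
    by (rule alg_normI[OF CS_times[OF CS_star[OF u(2)] u(2)]]) (simp only: opn_cstar, intro tendsto_power alg_norm u(2))
qed (rule alg_complete)

end

section \<open>The vacuum expectation on the completed algebra\<close>

fun pinst :: "bool \<Rightarrow> 'b ncexpr \<Rightarrow> 'b pexpr" where
  "pinst c (Const b) = PConst b"
| "pinst c Var = PVar c"
| "pinst c (Plus p q) = PPlus (pinst c p) (pinst c q)"
| "pinst c (Times p q) = PTimes (pinst c p) (pinst c q)"

lemma pact_pinst: "pact G z (pinst c p) h = act G (z c) p h"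
  by (induction p arbitrary: h) auto

text \<open>Cyclicity is exact: every vector is a polynomial applied to \<xi>, without closure. The
  module is accordingly not assumed to be complete.\<close>

locale gns_pair = op_pair H z for H :: "('b::cstar_algebra, 'h) corr" and z +
  fixes \<xi> :: 'h
  assumes xi_in: "\<xi> \<in> hcarrier H" and xi_unit: "hinner H \<xi> \<xi> = 1"
    and xi_central: "lact H b \<xi> = ract H \<xi> b"
    and cyclic: "h \<in> hcarrier H \<Longrightarrow> \<exists>q. h = pact H z q \<xi>"
begin

definition vev :: "(nat \<Rightarrow> 'b) \<Rightarrow> 'b" where
  "vev a = lim (\<lambda>i. hinner H \<xi> (ev (rep a i) \<xi>))"

definition vincl :: "'b \<Rightarrow> nat \<Rightarrow> 'b" where
  "vincl b = cls (\<lambda>_. PConst b)"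

lemma hnorm_xi: "hnorm H \<xi> = 1"
  by (simp add: hnorm_def xi_unit)

lemma vev_pd: "norm (hinner H \<xi> (ev p \<xi>) - hinner H \<xi> (ev q \<xi>)) \<le> pd p q"
  using inner_pd[OF xi_in xi_in] by (simp add: hnorm_xi)

lemma vev_cls: "u \<in> CS \<Longrightarrow> (\<lambda>i. hinner H \<xi> (ev (u i) \<xi>)) \<longlonglongrightarrow> vev (cls u)"
proof -
  assume u: "u \<in> CS"
  have conv: "convergent (\<lambda>i. hinner H \<xi> (ev (v i) \<xi>))" if v: "v \<in> CS" for v
  proof (rule Cauchy_convergent, rule CauchyI)
    fix e :: real assume "e > 0"
    then obtain K where "\<forall>i\<ge>K. \<forall>j\<ge>K. pd (v i) (v j) < e" using CS_D[OF v] by blast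
    then show "\<exists>K. \<forall>i\<ge>K. \<forall>j\<ge>K. norm (hinner H \<xi> (ev (v i) \<xi>) - hinner H \<xi> (ev (v j) \<xi>)) < e"
      using vev_pd order_le_less_trans by blast
  qed
  have lim: "(\<lambda>i. hinner H \<xi> (ev (rep (cls u) i) \<xi>)) \<longlonglongrightarrow> vev (cls u)"
    using conv[OF rep_props(1)[OF u]] by (simp add: vev_def convergent_LIMSEQ_iff)
  have "(\<lambda>i. hinner H \<xi> (ev (u i) \<xi>) - hinner H \<xi> (ev (rep (cls u) i) \<xi>)) \<longlonglongrightarrow> 0"
    by (rule Lim_null_comparison[OF always_eventually rep_props(2)[OF u, unfolded pnull_def]]) (simp add: vev_pd)
  from tendsto_add[OF this lim] show ?thesis by simp
qed

lemma vev_clsI: "u \<in> CS \<Longrightarrow> (\<lambda>i. hinner H \<xi> (ev (u i) \<xi>)) \<longlonglongrightarrow> l \<Longrightarrow> vev (cls u) = l"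
  using vev_cls LIMSEQ_unique by blast

lemma vev_const: "vev (cls (\<lambda>_. p)) = hinner H \<xi> (ev p \<xi>)"
  by (rule vev_clsI[OF CS_const]) simp

lemma vev_add: "x \<in> carrier alg \<Longrightarrow> y \<in> carrier alg \<Longrightarrow> vev (x \<oplus>\<^bsub>alg\<^esub> y) = vev x + vev y"
proof (elim alg_carrierE)
  fix u v assume "x = cls u" "y = cls v" and uv: "u \<in> CS" "v \<in> CS"
  then show ?thesis
    using vev_clsI[OF CS_plus[OF uv]] tendsto_add[OF vev_cls[OF uv(1)] vev_cls[OF uv(2)]]
    by (simp add: alg_plus inner_add xi_in ev_in)
qed

lemma vev_finsum:
  "(\<And>k. g k \<in> carrier alg) \<Longrightarrow> vev (\<Oplus>\<^bsub>alg\<^esub>k\<in>{..<m::nat}. g k) = (\<Sum>k<m. vev (g k))"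
proof (induction m)
  case 0
  interpret ring alg by (rule ring_alg)
  show ?case using lact_add[OF xi_in xi_in, of 0 0] by (simp add: alg_zero vev_const)
next
  case (Suc m)
  interpret ring alg by (rule ring_alg)
  show ?case using Suc by (simp add: lessThan_Suc vev_add add.commute)
qed

text \<open>Cyclicity turns the vanishing of all E[y x w] into weak convergence of the operators
  \<open>ev (u i)\<close> to 0. A sequence that is Cauchy in norm and tends weakly to 0 tends to 0
  in norm.\<close>

lemma faithful:
  assumes u: "u \<in> CS"
    and zero: "\<And>y w. y \<in> carrier alg \<Longrightarrow> w \<in> carrier alg \<Longrightarrow> vev (y \<otimes>\<^bsub>alg\<^esub> cls u \<otimes>\<^bsub>alg\<^esub> w) = 0"
  shows "cls u = \<zero>\<^bsub>alg\<^esub>"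
proof -
  have weak: "(\<lambda>i. hinner H h (ev (u i) k)) \<longlonglongrightarrow> 0" if h: "h \<in> hcarrier H" and k: "k \<in> hcarrier H" for h k
  proof -
    obtain p where p: "h = ev p \<xi>" using cyclic[OF h] by blast
    obtain q where q: "k = ev q \<xi>" using cyclic[OF k] by blast
    have cs: "(\<lambda>i. PTimes (PTimes (pstar p) (u i)) q) \<in> CS" by (intro CS_times CS_const u)
    have "vev (cls (\<lambda>_. pstar p) \<otimes>\<^bsub>alg\<^esub> cls u \<otimes>\<^bsub>alg\<^esub> cls (\<lambda>_. q)) = 0"
      by (rule zero) (intro alg_carrierI CS_const)+
    then have "vev (cls (\<lambda>i. PTimes (PTimes (pstar p) (u i)) q)) = 0"
      by (simp add: alg_times CS_times CS_const u)
    then show ?thesis using vev_cls[OF cs] by (simp add: p q ev_adj ev_in xi_in)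
  qed
  have "(\<lambda>i. opn (u i)) \<longlonglongrightarrow> 0"
  proof (rule LIMSEQ_I)
    fix e :: real assume e: "e > 0"
    obtain K where K: "\<forall>i\<ge>K. \<forall>j\<ge>K. pd (u i) (u j) < e/2" using CS_D[OF u, of "e/2"] e by auto
    have "opn (u i) \<le> e/2" if i: "i \<ge> K" for i
    proof (rule opn_le)
      fix h assume h: "h \<in> hcarrier H"
      let ?a = "ev (u i) h"
      have a: "?a \<in> hcarrier H" by (rule ev_in[OF h])
      \<comment> \<open>u_i is compared with u_j for large j: the weak limit removes the term with
        u_j and leaves the Cauchy estimate.\<close>
      have "(hnorm H ?a)\<^sup>2 \<le> hnorm H ?a * (e/2 * hnorm H h)"
      proof (rule LIMSEQ_le_const)
        show "(\<lambda>j. hnorm H ?a * (e/2 * hnorm H h) + norm (hinner H ?a (ev (u j) h))) \<longlonglongrightarrow> hnorm H ?a * (e/2 * hnorm H h)"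
          using tendsto_add[OF tendsto_const tendsto_norm_zero[OF weak[OF a h]]] by simp
        have "(hnorm H ?a)\<^sup>2 \<le> hnorm H ?a * (e/2 * hnorm H h) + norm (hinner H ?a (ev (u j) h))" if j: "j \<ge> K" for j
        proof -
          have "(hnorm H ?a)\<^sup>2 \<le> norm (hinner H ?a ?a - hinner H ?a (ev (u j) h)) + norm (hinner H ?a (ev (u j) h))"
            unfolding hnorm_sq using norm_triangle_sub[of "hinner H ?a ?a" "hinner H ?a (ev (u j) h)"] by simp
          also have "norm (hinner H ?a ?a - hinner H ?a (ev (u j) h)) \<le> hnorm H ?a * (pd (u i) (u j) * hnorm H h)"
            by (rule inner_pd[OF a h])
          also have "\<dots> \<le> hnorm H ?a * (e/2 * hnorm H h)"
            using K i j by (intro mult_left_mono mult_right_mono hnorm_nonneg less_imp_le) auto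
          finally show ?thesis by simp
        qed
        then show "\<exists>N. \<forall>j\<ge>N. (hnorm H ?a)\<^sup>2 \<le> hnorm H ?a * (e/2 * hnorm H h) + norm (hinner H ?a (ev (u j) h))" by blast
      qed
      then have "hnorm H ?a * hnorm H ?a \<le> hnorm H ?a * (e/2 * hnorm H h)" by (simp add: power2_eq_square)
      then show "hnorm H ?a \<le> e/2 * hnorm H h"
        using hnorm_nonneg[of ?a] hnorm_nonneg[of h] e by (cases "hnorm H ?a = 0") auto
    qed (use e in simp)
    then show "\<exists>no. \<forall>n\<ge>no. norm (opn (u n) - 0) < e" using e opn_nonneg by (intro exI[of _ K]) fastforce
  qed
  then show ?thesis unfolding alg_zero by (intro cls_eqI) (simp add: pnull_def pd_zero)
qed

text \<open>Along representatives the form is a sum of inner squares. Positivity passes to the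
  limit, and \<open>pos_matrix_of_form\<close> returns to the factorized matrix that the axiom
  demands.\<close>

lemma vev_cp:
  assumes Q: "\<And>i j. Q i j \<in> carrier alg"
  shows "pos_matrix m (\<lambda>i j. vev (\<Oplus>\<^bsub>alg\<^esub>k\<in>{..<m}. cstar alg (Q k i) \<otimes>\<^bsub>alg\<^esub> Q k j))"
proof -
  have "\<forall>i j. \<exists>u. Q i j = cls u \<and> u \<in> CS" using Q alg_carrierE by metis
  then obtain q where q: "\<And>i j. Q i j = cls (q i j)" "\<And>i j. q i j \<in> CS" by metis
  have cs: "(\<lambda>l. PTimes (pstar (q k i l)) (q k j l)) \<in> CS" for k i j by (intro CS_times CS_star q)
  have Qk: "cstar alg (Q k i) \<otimes>\<^bsub>alg\<^esub> Q k j = cls (\<lambda>l. PTimes (pstar (q k i l)) (q k j l))" for k i j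
    by (simp add: q alg_star alg_times CS_star)
  define M where "M i j = (\<Sum>k<m. vev (cstar alg (Q k i) \<otimes>\<^bsub>alg\<^esub> Q k j))" for i j
  define w where "w l i j = (\<Sum>k<m. hinner H (ev (q k i l) \<xi>) (ev (q k j l) \<xi>))" for l i j
  have wM: "(\<lambda>l. w l i j) \<longlonglongrightarrow> M i j" for i j
    unfolding w_def M_def Qk using vev_cls[OF cs] by (intro tendsto_sum) (simp add: ev_adj xi_in ev_in)
  have "pos_matrix m M"
  proof (rule pos_matrix_of_form)
    show "star (M i j) = M j i" for i j
    proof (rule LIMSEQ_unique[OF tendsto_star[OF wM] wM[of j i, THEN Lim_transform_eventually]])
      show "\<forall>\<^sub>F l in sequentially. w l j i = star (w l i j)"
        by (rule always_eventually) (simp add: w_def star_sum inner_sym ev_in xi_in)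
    qed
    show "cpos (\<Sum>i<m. \<Sum>j<m. star (b i) * M i j * b j)" for b
    proof (rule cpos_limit)
      show "(\<lambda>l. \<Sum>i<m. \<Sum>j<m. star (b i) * w l i j * b j) \<longlonglongrightarrow> (\<Sum>i<m. \<Sum>j<m. star (b i) * M i j * b j)"
        by (intro tendsto_intros wM)
      fix l
      have x: "ev (q k i l) \<xi> \<in> hcarrier H" for k i by (rule ev_in[OF xi_in])
      let ?L = "\<lambda>k. lin_comb (\<lambda>i. ev (q k i l) \<xi>) b m"
      have "(\<Sum>i<m. \<Sum>j<m. star (b i) * w l i j * b j)
          = (\<Sum>i<m. \<Sum>j<m. \<Sum>k<m. star (b i) * hinner H (ev (q k i l) \<xi>) (ev (q k j l) \<xi>) * b j)"
        by (simp add: w_def sum_distrib_left sum_distrib_right)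
      also have "\<dots> = (\<Sum>k<m. \<Sum>i<m. \<Sum>j<m. star (b i) * hinner H (ev (q k i l) \<xi>) (ev (q k j l) \<xi>) * b j)"
        by (subst sum.swap[of _ "{..<m}" "{..<m}"], subst sum.swap[of _ "{..<m}" "{..<m}"],
            intro sum.cong refl sum.swap)
      also have "\<dots> = (\<Sum>k<m. hinner H (?L k) (?L k))"
        by (intro sum.cong refl, subst inner_lin_comb_left)
          (simp_all add: inner_lin_comb lin_comb_in x sum_distrib_left mult.assoc)
      finally show "cpos (\<Sum>i<m. \<Sum>j<m. star (b i) * w l i j * b j)"
        by (simp add: cpos_sum inner_pos lin_comb_in x)
    qed
  qed
  moreover have "vev (\<Oplus>\<^bsub>alg\<^esub>k\<in>{..<m}. cstar alg (Q k i) \<otimes>\<^bsub>alg\<^esub> Q k j) = M i j" for i j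
    unfolding M_def by (rule vev_finsum) (simp add: Qk cs alg_carrierI)
  ultimately show ?thesis by simp
qed

lemma prob_space_alg: "bvalued_prob_space alg vincl vev"
proof (intro bvalued_prob_space.intro cstar_algebra_alg bvalued_prob_space_axioms.intro)
  note s = CS_const CS_times CS_plus
  show "vincl b \<in> carrier alg" for b by (simp add: vincl_def alg_carrierI CS_const)
  show "inj vincl"
  proof (rule injI)
    fix b c assume "vincl b = vincl c"
    then have "vev (vincl b) = vev (vincl c)" by simp
    then show "b = c" by (simp add: vincl_def vev_const xi_central inner_ract xi_in xi_unit)
  qed
  show "vincl 1 = \<one>\<^bsub>alg\<^esub>" by (simp add: vincl_def alg_one)
  show "vincl (b + c) = vincl b \<oplus>\<^bsub>alg\<^esub> vincl c" for b c
    unfolding vincl_def alg_plus[OF CS_const CS_const] by (rule cls_cong, rule ev_eqI)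
      (simp_all add: lact_add inner_add closed)
  show "vincl (b * c) = vincl b \<otimes>\<^bsub>alg\<^esub> vincl c" for b c
    unfolding vincl_def alg_times[OF CS_const CS_const] by (rule cls_cong, rule ev_eqI) (simp_all add: lact_mult)
  show "vincl (scaleC a b) = cscale alg a (vincl b)" for a b
    unfolding vincl_def alg_scale[OF CS_const] by (rule cls_cong, rule ev_eqI)
      (simp_all add: pscale_def lact_mult[symmetric] mult_scaleC_left)
  show "vincl (star b) = cstar alg (vincl b)" for b
    by (simp add: vincl_def alg_star CS_const)
  show "vev \<one>\<^bsub>alg\<^esub> = 1" by (simp add: alg_one vev_const xi_central inner_ract xi_in xi_unit)
  show "pos_matrix m (\<lambda>i j. vev (\<Oplus>\<^bsub>alg\<^esub>k\<in>{..<m}. cstar alg (Q k i) \<otimes>\<^bsub>alg\<^esub> Q k j))"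
    if "\<And>i j. Q i j \<in> carrier alg" for Q m using that by (rule vev_cp)
  fix x assume "x \<in> carrier alg"
  then obtain u where u: "x = cls u" "u \<in> CS" by (rule alg_carrierE)
  show "vev (cscale alg c x) = scaleC c (vev x)" for c
  proof -
    have "vev (cls (\<lambda>i. pscale c (u i))) = vev (cls u) * scaleC c 1"
      by (rule vev_clsI[OF CS_scale[OF u(2)]])
        (simp add: ev_scale xi_in inner_ract ev_in tendsto_mult_right vev_cls[OF u(2)])
    then show ?thesis unfolding u by (simp add: alg_scale u(2) mult_scaleC_right)
  qed
  show "vev (vincl b \<otimes>\<^bsub>alg\<^esub> x \<otimes>\<^bsub>alg\<^esub> vincl c) = b * vev x * c" for b c
  proof -
    have "hinner H \<xi> (ev (PTimes (PTimes (PConst b) p) (PConst c)) \<xi>) = b * hinner H \<xi> (ev p \<xi>) * c" for p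
      by (simp add: xi_central ev_ract xi_in inner_lact inner_ract inner_ract_left ev_in closed star_star mult.assoc)
    then have "vev (cls (\<lambda>i. PTimes (PTimes (PConst b) (u i)) (PConst c))) = b * vev (cls u) * c"
      by (intro vev_clsI[OF CS_times[OF CS_times[OF CS_const u(2)] CS_const]])
        (simp only:, intro tendsto_mult_left tendsto_mult_right vev_cls u)
    then show ?thesis unfolding u by (simp add: vincl_def alg_times s u(2))
  qed
  show "x = \<zero>\<^bsub>alg\<^esub>" if "\<forall>y\<in>carrier alg. \<forall>w\<in>carrier alg. vev (y \<otimes>\<^bsub>alg\<^esub> x \<otimes>\<^bsub>alg\<^esub> w) = 0"
    unfolding u(1) by (rule faithful[OF u(2)]) (use that u in auto)
  show "vev (x \<oplus>\<^bsub>alg\<^esub> y) = vev x + vev y" if "y \<in> carrier alg" for y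
    using \<open>x \<in> carrier alg\<close> that by (rule vev_add)
qed

lemma eval_alg: "eval_expr alg vincl (cls (\<lambda>_. PVar c)) p = cls (\<lambda>_. pinst c p)"
  by (induction p) (auto simp: vincl_def alg_plus alg_times CS_const)

lemma vev_diff:
  "vev (nc_eval alg vincl (cls (\<lambda>_. PVar True)) f \<ominus>\<^bsub>alg\<^esub> nc_eval alg vincl (cls (\<lambda>_. PVar False)) f)
    = hinner H \<xi> (act H (z True) (rep_ncpoly f) \<xi>) - hinner H \<xi> (act H (z False) (rep_ncpoly f) \<xi>)"
  unfolding nc_eval_def eval_alg alg_minus[OF CS_const CS_const] vev_const
  by (simp add: ev_pminus xi_in inner_minus ev_in pact_pinst[symmetric])

lemma norm_alg_const: "cnorm alg (cls (\<lambda>_. p)) = opn p"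
  by (rule alg_normI[OF CS_const]) simp

end

section \<open>The modulus of continuity is finite\<close>

context cstar_algebra_on
begin

lemma scale_zero: "x \<in> carrier A \<Longrightarrow> cscale A 0 x = \<zero>"
  using norm_scale[of x 0] norm_eq_zero[OF scale_closed, of x 0] by simp

lemma minus_scale: "x \<in> carrier A \<Longrightarrow> \<ominus> x = cscale A (-1) x"
proof -
  assume x: "x \<in> carrier A"
  have "x \<oplus> cscale A (-1) x = \<zero>"
    using scale_add_left[OF x, of 1 "-1"] by (simp add: scale_one x scale_zero)
  then show ?thesis using x scale_closed by (metis a_comm minus_equality)
qed

lemma norm_uminus: "x \<in> carrier A \<Longrightarrow> cnorm A (\<ominus> x) = cnorm A x"
  by (simp add: minus_scale norm_scale)

lemma star_one_on: "cstar A \<one> = \<one>"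
  by (metis one_closed r_one l_one star_closed star_invol star_times)

lemma star_uminus: "x \<in> carrier A \<Longrightarrow> cstar A (\<ominus> x) = \<ominus> cstar A x"
  by (simp add: minus_scale star_scale star_closed)

lemma norm_star_on: "x \<in> carrier A \<Longrightarrow> cnorm A (cstar A x) = cnorm A x"
proof -
  have le: "cnorm A x \<le> cnorm A (cstar A x)" if x: "x \<in> carrier A" for x
  proof (cases "cnorm A x = 0")
    case False
    have "cnorm A x * cnorm A x \<le> cnorm A (cstar A x) * cnorm A x"
      using norm_cstar[OF x] norm_times[OF star_closed[OF x] x] by (simp add: power2_eq_square)
    then show ?thesis using False norm_nonneg[OF x] by simp
  qed (simp add: norm_nonneg star_closed x)
  show "x \<in> carrier A \<Longrightarrow> ?thesis"
    using le[of x] le[of "cstar A x"] by (simp add: star_closed star_invol)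
qed

lemma norm_one_le: "cnorm A \<one> \<le> 1"
proof -
  have "cnorm A \<one> = (cnorm A \<one>)\<^sup>2" using norm_cstar[OF one_closed] by (simp add: star_one_on)
  then have "cnorm A \<one> = 0 \<or> cnorm A \<one> = 1" by (auto simp: power2_eq_square)
  then show ?thesis by auto
qed

lemma norm_minus_le: "x \<in> carrier A \<Longrightarrow> y \<in> carrier A \<Longrightarrow> cnorm A (x \<ominus> y) \<le> cnorm A x + cnorm A y"
  using norm_triangle[of x "\<ominus> y"] by (simp add: a_minus_def norm_uminus)

lemma dist_sym: "x \<in> carrier A \<Longrightarrow> y \<in> carrier A \<Longrightarrow> cnorm A (x \<ominus> y) = cnorm A (y \<ominus> x)"
  using norm_uminus[of "x \<ominus> y"] by (simp add: a_minus_def minus_add a_comm)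

lemma dist_triangle_on:
  assumes "x \<in> carrier A" "y \<in> carrier A" "w \<in> carrier A"
  shows "cnorm A (x \<ominus> w) \<le> cnorm A (x \<ominus> y) + cnorm A (y \<ominus> w)"
proof -
  have "x \<ominus> w = (x \<ominus> y) \<oplus> (y \<ominus> w)"
    using assms by (simp add: a_minus_def a_assoc r_neg1)
  then show ?thesis using norm_triangle[of "x \<ominus> y" "y \<ominus> w"] assms by simp
qed

lemma dist_sq:
  assumes x: "x \<in> carrier A" and y: "y \<in> carrier A" and q: "cnorm A x \<le> q" "cnorm A y \<le> q"
  shows "cnorm A (x \<otimes> x \<ominus> y \<otimes> y) \<le> 2 * q * cnorm A (x \<ominus> y)"
proof -
  have "x \<otimes> x \<ominus> y \<otimes> y = x \<otimes> (x \<ominus> y) \<oplus> (x \<ominus> y) \<otimes> y"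
    using x y by (simp add: a_minus_def r_distr l_distr r_minus l_minus a_assoc r_neg1)
  also have "cnorm A \<dots> \<le> cnorm A x * cnorm A (x \<ominus> y) + cnorm A (x \<ominus> y) * cnorm A y"
    using x y norm_triangle[of "x \<otimes> (x \<ominus> y)" "(x \<ominus> y) \<otimes> y"] norm_times[of x "x \<ominus> y"] norm_times[of "x \<ominus> y" y]
    by simp
  also have "\<dots> \<le> q * cnorm A (x \<ominus> y) + cnorm A (x \<ominus> y) * q"
    using x y by (intro add_mono mult_right_mono mult_left_mono q norm_nonneg) auto
  finally show ?thesis by simp
qed

text \<open>The iteration \<open>y \<mapsto> (x + y\<^sup>2)/2\<close> contracts the ball of radius \<open>\<parallel>x\<parallel>\<close>, and at its fixed
  point \<open>(1 - y)\<^sup>2 = 1 - x\<close>.\<close>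

lemma sqrt_one_minus:
  assumes x: "x \<in> carrier A" "cstar A x = x" "cnorm A x < 1"
  obtains s where "s \<in> carrier A" "cstar A s = s" "s \<otimes> s = \<one> \<ominus> x"
proof -
  define q where "q = cnorm A x"
  have q: "0 \<le> q" "q < 1" using x by (auto simp: q_def norm_nonneg)
  define F where "F y = cscale A (1/2) (x \<oplus> y \<otimes> y)" for y
  define u where "u n = (F ^^ n) \<zero>" for n
  have u_Suc: "u (Suc n) = F (u n)" and u_0: "u 0 = \<zero>" for n by (simp_all add: u_def)
  have Fc: "F y \<in> carrier A" if "y \<in> carrier A" for y unfolding F_def using that x by (simp add: scale_closed)
  have zero_norm: "cnorm A \<zero> = 0" by (simp add: norm_eq_zero)
  have star_zero_on: "cstar A \<zero> = \<zero>"
    using star_uminus[of \<zero>] norm_star_on[of \<zero>] norm_eq_zero[of "cstar A \<zero>"] by (simp add: star_closed zero_norm)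
  have uc: "u n \<in> carrier A" for n by (induction n) (auto simp: u_0 u_Suc Fc)
  have un: "cnorm A (u n) \<le> q" for n
  proof (induction n)
    case (Suc n)
    have "cnorm A (u (Suc n)) \<le> (1/2) * (cnorm A x + cnorm A (u n) * cnorm A (u n))"
      unfolding u_Suc F_def using norm_triangle[of x "u n \<otimes> u n"] norm_times[of "u n" "u n"] x uc[of n]
      by (simp add: norm_scale)
    also have "\<dots> \<le> (1/2) * (q + q * 1)"
      using Suc q by (intro mult_left_mono add_mono mult_mono norm_nonneg uc) (auto simp: q_def)
    finally show ?case by simp
  qed (simp add: u_0 zero_norm q)
  have us: "cstar A (u n) = u n" for n
    by (induction n) (simp_all add: u_0 u_Suc star_zero_on F_def star_scale x star_plus star_times uc)
  have F_dist: "cnorm A (F y \<ominus> F w) \<le> q * cnorm A (y \<ominus> w)"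
    if "y \<in> carrier A" "w \<in> carrier A" "cnorm A y \<le> q" "cnorm A w \<le> q" for y w
  proof -
    have "F y \<ominus> F w = cscale A (1/2) (y \<otimes> y \<ominus> w \<otimes> w)"
    proof -
      have "F y \<ominus> F w = cscale A (1/2) ((x \<oplus> y \<otimes> y) \<ominus> (x \<oplus> w \<otimes> w))"
        unfolding F_def a_minus_def using that x
        by (simp add: minus_scale scale_add_right scale_scale scale_closed)
      also have "(x \<oplus> y \<otimes> y) \<ominus> (x \<oplus> w \<otimes> w) = y \<otimes> y \<ominus> w \<otimes> w"
        using that x(1) by (simp add: a_minus_def minus_add a_ac r_neg1 r_neg2)
      finally show ?thesis .
    qed
    then show ?thesis using dist_sq[OF that] that by (simp add: norm_scale)
  qed
  have step: "cnorm A (u (Suc n) \<ominus> u n) \<le> q ^ n" for n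
  proof (induction n)
    case 0
    then show ?case using un[of "Suc 0"] q uc[of "Suc 0"] by (simp add: u_0 a_minus_def)
  next
    case (Suc n)
    have "cnorm A (u (Suc (Suc n)) \<ominus> u (Suc n)) \<le> q * cnorm A (u (Suc n) \<ominus> u n)"
      using F_dist[OF uc[of "Suc n"] uc[of n] un un] by (simp only: u_Suc)
    also have "\<dots> \<le> q * q ^ n" by (intro mult_left_mono Suc q)
    finally show ?case by simp
  qed
  have tail: "cnorm A (u (n + k) \<ominus> u n) \<le> q ^ n / (1 - q)" for n k
  proof -
    have "cnorm A (u (n + k) \<ominus> u n) \<le> (\<Sum>i<k. q ^ (n + i))"
    proof (induction k)
      case 0
      then show ?case using uc by (simp add: r_neg a_minus_def zero_norm)
    next
      case (Suc k)
      then show ?case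
        using dist_triangle_on[OF uc[of "n + Suc k"] uc[of "n + k"] uc[of n]] step[of "n + k"] by simp
    qed
    also have "\<dots> = q ^ n * (\<Sum>i<k. q ^ i)" by (simp add: power_add sum_distrib_left)
    also have "\<dots> \<le> q ^ n * (1 / (1 - q))"
      using q by (intro mult_left_mono) (simp_all add: sum_gp_strict divide_right_mono)
    finally show ?thesis by simp
  qed
  have tail0: "(\<lambda>n. 2 * (q ^ n / (1 - q))) \<longlonglongrightarrow> 0"
    using tendsto_mult[OF tendsto_const tendsto_divide[OF LIMSEQ_realpow_zero[OF q] tendsto_const, of "1 - q"], of 2] q by simp
  have "\<forall>e>0. \<exists>K. \<forall>i\<ge>K. \<forall>j\<ge>K. cnorm A (u i \<ominus> u j) < e"
  proof (intro allI impI)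
    fix e :: real assume "e > 0"
    then obtain K where K: "2 * (q ^ K / (1 - q)) < e"
      using order_tendstoD(2)[OF tail0, of e] by (auto simp: eventually_sequentially)
    have "cnorm A (u i \<ominus> u j) < e" if "i \<ge> K" "j \<ge> K" for i j
    proof -
      have "cnorm A (u i \<ominus> u K) \<le> q ^ K / (1 - q)" "cnorm A (u j \<ominus> u K) \<le> q ^ K / (1 - q)"
        using tail[of K "i - K"] tail[of K "j - K"] that by simp_all
      then show ?thesis
        using dist_triangle_on[OF uc[of i] uc[of K] uc[of j]] dist_sym[OF uc[of K] uc[of j]] K by simp
    qed
    then show "\<exists>K. \<forall>i\<ge>K. \<forall>j\<ge>K. cnorm A (u i \<ominus> u j) < e" by blast
  qed
  then obtain y where y: "y \<in> carrier A" "(\<lambda>n. cnorm A (u n \<ominus> y)) \<longlonglongrightarrow> 0"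
    using complete[of u] uc by blast
  have zeroI: "w = v" if "w \<in> carrier A" "v \<in> carrier A" "\<And>n. cnorm A (w \<ominus> v) \<le> g n" "g \<longlonglongrightarrow> 0" for w v and g :: "nat \<Rightarrow> real"
  proof -
    have "cnorm A (w \<ominus> v) \<le> 0" by (rule LIMSEQ_le_const[OF that(4)]) (use that(3) in auto)
    then have "cnorm A (w \<ominus> v) = 0" using norm_nonneg[of "w \<ominus> v"] that by simp
    then have "w \<ominus> v = \<zero>" using that(1,2) norm_eq_zero[of "w \<ominus> v"] by simp
    moreover have "w = (w \<ominus> v) \<oplus> v" using that(1,2) by (simp add: a_minus_def a_assoc l_neg)
    ultimately show ?thesis using that(2) by simp
  qed
  have yq: "cnorm A y \<le> q"
  proof (rule LIMSEQ_le_const)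
    show "(\<lambda>n. q + cnorm A (u n \<ominus> y)) \<longlonglongrightarrow> q" using tendsto_add[OF tendsto_const y(2), of q] by simp
    have "cnorm A y \<le> cnorm A (u n) + cnorm A (u n \<ominus> y)" for n
    proof -
      have "y = u n \<ominus> (u n \<ominus> y)"
        using y(1) uc[of n] by (simp add: a_minus_def minus_add r_neg1 r_neg2)
      then show ?thesis using norm_minus_le[of "u n" "u n \<ominus> y"] y(1) uc[of n] by simp
    qed
    then show "\<exists>N. \<forall>n\<ge>N. cnorm A y \<le> q + cnorm A (u n \<ominus> y)" using un by (meson add_right_mono order_trans)
  qed
  have ys: "cstar A y = y"
  proof (rule zeroI)
    show "(\<lambda>n. 2 * cnorm A (u n \<ominus> y)) \<longlonglongrightarrow> 0" using tendsto_mult[OF tendsto_const y(2), of 2] by simp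
    fix n
    have "cstar A (u n \<ominus> y) = u n \<ominus> cstar A y"
      using y uc[of n] by (simp add: a_minus_def star_plus star_uminus us)
    then have "cnorm A (u n \<ominus> cstar A y) = cnorm A (u n \<ominus> y)"
      using norm_star_on[of "u n \<ominus> y"] y uc[of n] by simp
    then show "cnorm A (cstar A y \<ominus> y) \<le> 2 * cnorm A (u n \<ominus> y)"
      using dist_triangle_on[of "cstar A y" "u n" y] dist_sym[of "cstar A y" "u n"] y uc[of n] star_closed[of y] by simp
  qed (use y star_closed in auto)
  have Fy: "F y = y"
  proof (rule zeroI)
    show "(\<lambda>n. q * cnorm A (u n \<ominus> y) + cnorm A (u (Suc n) \<ominus> y)) \<longlonglongrightarrow> 0"
      using tendsto_add[OF tendsto_mult[OF tendsto_const y(2), of q] LIMSEQ_Suc[OF y(2)]] by simp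
    fix n
    have "cnorm A (F y \<ominus> y) \<le> cnorm A (F y \<ominus> u (Suc n)) + cnorm A (u (Suc n) \<ominus> y)"
      by (intro dist_triangle_on Fc y uc)
    also have "cnorm A (F y \<ominus> u (Suc n)) \<le> q * cnorm A (y \<ominus> u n)"
      unfolding u_Suc by (intro F_dist y uc un yq)
    finally show "cnorm A (F y \<ominus> y) \<le> q * cnorm A (u n \<ominus> y) + cnorm A (u (Suc n) \<ominus> y)"
      using dist_sym[OF y(1) uc[of n]] by simp
  qed (use y Fc in auto)
  have "y \<oplus> y = cscale A (1/2) (x \<oplus> y \<otimes> y) \<oplus> cscale A (1/2) (x \<oplus> y \<otimes> y)"
    using Fy by (simp add: F_def)
  also have "\<dots> = x \<oplus> y \<otimes> y"
    using scale_add_left[of "x \<oplus> y \<otimes> y" "1/2" "1/2"] x(1) y(1) by (simp add: scale_one)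
  finally have yy: "y \<oplus> y = x \<oplus> y \<otimes> y" .
  have "(\<one> \<ominus> y) \<otimes> (\<one> \<ominus> y) = \<one> \<ominus> ((y \<oplus> y) \<ominus> y \<otimes> y)"
    using y(1) by (simp add: a_minus_def r_distr l_distr r_minus l_minus minus_add a_assoc)
  also have "(y \<oplus> y) \<ominus> y \<otimes> y = x"
    using x(1) y(1) unfolding yy by (simp add: a_minus_def a_assoc r_neg)
  finally have "(\<one> \<ominus> y) \<otimes> (\<one> \<ominus> y) = \<one> \<ominus> x" .
  then show thesis
    using y(1) by (intro that[of "\<one> \<ominus> y"]) (auto simp: a_minus_def star_plus star_uminus star_one_on ys)
qed

end

text \<open>A majorant of the norm of an evaluated expression that depends neither on the algebra
  nor on the element inserted, as a uniform bound in \<open>Mod\<close> requires.\<close>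

fun expr_bound :: "real \<Rightarrow> 'b::cstar_algebra ncexpr \<Rightarrow> real" where
  "expr_bound R (Const b) = norm b"
| "expr_bound R Var = R"
| "expr_bound R (Plus p q) = expr_bound R p + expr_bound R q"
| "expr_bound R (Times p q) = expr_bound R p * expr_bound R q"

section \<open>Uniform bounds in a probability space over the coefficient algebra\<close>

context bvalued_prob_space
begin

lemma E_zero: "E \<zero> = 0"
  using E_add[of \<zero> \<zero>] by simp

lemma E_uminus: "x \<in> carrier A \<Longrightarrow> E (\<ominus> x) = - E x"
  using E_add[of x "\<ominus> x"] by (simp add: r_neg E_zero eq_neg_iff_add_eq_0 add.commute)

lemma E_pos: "x \<in> carrier A \<Longrightarrow> cpos (E (cstar A x \<otimes> x))"
proof -
  assume x: "x \<in> carrier A"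
  have "pos_matrix 1 (\<lambda>i j. E (\<Oplus>k\<in>{..<1::nat}. cstar A x \<otimes> x))"
    by (rule E_cp) (rule x)
  then show ?thesis using x by (auto simp: pos_matrix_def cpos_def lessThan_Suc star_closed)
qed

text \<open>If ||y|| < 1 then 1 - y is the square of a self-adjoint element, so E y <= 1. Rescaling
  x and -x by any t > ||x|| places E x between -t and t.\<close>

lemma E_bound_sa:
  assumes x: "x \<in> carrier A" "cstar A x = x"
  shows "norm (E x) \<le> 3 * cnorm A x"
proof -
  have less: "E y \<preceq> 1" if y: "y \<in> carrier A" "cstar A y = y" "cnorm A y < 1" for y
  proof -
    obtain s where s: "s \<in> carrier A" "cstar A s = s" "s \<otimes> s = \<one> \<ominus> y"
      by (rule sqrt_one_minus[OF y])
    then show ?thesis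
      using E_pos[OF s(1)] y(1) by (simp add: a_minus_def E_add E_uminus E_one cle_def)
  qed
  have bound: "norm (E x) \<le> 3 * t" if t: "t > cnorm A x" for t
  proof (rule norm_le_of_cle)
    have t0: "t > 0" using norm_nonneg[OF x(1)] t by linarith
    have lt: "E y \<preceq> of_real t" if y: "y \<in> carrier A" "cstar A y = y" "cnorm A y = cnorm A x" for y
    proof -
      have "E (cscale A (of_real (1/t)) y) \<preceq> 1"
        by (rule less) (use y t t0 in \<open>simp_all add: scale_closed star_scale norm_scale del: of_real_divide\<close>)
      then have "t *\<^sub>R ((1/t) *\<^sub>R E y) \<preceq> t *\<^sub>R 1"
        using t0 by (intro cle_scaleR) (simp_all only: E_scale y scaleC_of_real less_imp_le)
      then show ?thesis using t0 by (simp add: of_real_def)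
    qed
    show "E x \<preceq> of_real t" by (rule lt) (use x in auto)
    show "- E x \<preceq> of_real t"
      using lt[of "\<ominus> x"] x by (simp add: E_uminus star_uminus norm_uminus)
    show "0 \<le> t" using t0 by simp
  qed
  have "norm (E x) / 3 \<le> cnorm A x"
    by (rule dense_ge) (use bound in fastforce)
  then show ?thesis by simp
qed

text \<open>2 x is x + x^* minus i times a second self-adjoint element. Both have norm at most 2
  ||x||, and each is estimated with the constant 3.\<close>

lemma E_bound: "x \<in> carrier A \<Longrightarrow> norm (E x) \<le> 6 * cnorm A x"
proof -
  assume x: "x \<in> carrier A"
  note sx = star_closed[OF x]
  define y where "y = x \<oplus> cstar A x"
  define w where "w = cscale A \<i> (x \<ominus> cstar A x)"
  have y: "y \<in> carrier A" "cstar A y = y" using x sx by (simp_all add: y_def star_plus star_invol a_comm)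
  have wc: "w \<in> carrier A" using x sx by (simp add: w_def scale_closed)
  have ws: "cstar A w = w"
  proof -
    have "cstar A w = cscale A (- \<i>) (\<ominus> (x \<ominus> cstar A x))"
      using x sx by (simp add: w_def a_minus_def star_scale star_plus star_uminus star_invol minus_add a_comm)
    then show ?thesis using x sx by (simp add: w_def minus_scale scale_scale scale_closed)
  qed
  have "E y - scaleC \<i> (E w) = 2 *\<^sub>R E x"
    using x sx by (simp add: y_def w_def E_add E_scale a_minus_def E_uminus scaleC_scaleC scaleC_minus_left scaleC_one scaleR_2)
  then have "2 * norm (E x) = norm (E y - scaleC \<i> (E w))" by simp
  also have "\<dots> \<le> norm (E y) + norm (E w)"
    using norm_triangle_ineq4[of "E y" "scaleC \<i> (E w)"] by (simp add: norm_scaleC)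
  also have "\<dots> \<le> 3 * cnorm A y + 3 * cnorm A w"
    by (intro add_mono E_bound_sa y wc ws)
  also have "cnorm A y \<le> 2 * cnorm A x"
    using norm_triangle[OF x sx] by (simp add: y_def norm_star_on x)
  also have "cnorm A w \<le> 2 * cnorm A x"
    using norm_minus_le[OF x sx] x sx by (simp add: w_def norm_scale norm_star_on)
  finally show ?thesis by simp
qed

lemma incl_one_norm: "star b * b = 1 \<Longrightarrow> cnorm A (incl b) \<le> 1"
proof -
  assume "star b * b = 1"
  then have "(cnorm A (incl b))\<^sup>2 = cnorm A \<one>"
    using norm_cstar[OF incl_closed[of b]] by (simp add: incl_star[symmetric] incl_mult[symmetric] incl_one)
  then show ?thesis using power2_le_imp_le[of "cnorm A (incl b)" 1] norm_one_le by simp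
qed

text \<open>A self-adjoint contraction is the mean of two unitaries.\<close>

lemma incl_norm_sa_le_1:
  assumes b: "star b = b" "norm b \<le> 1"
  shows "cnorm A (incl b) \<le> 1"
proof -
  have nb: "norm (b * b) \<le> 1"
    using b norm_star_mult_self[of b] by (simp add: power_le_one)
  obtain w where w: "star w = w" "w * w = 1 - b * b" "\<And>x. x * (b * b) = (b * b) * x \<Longrightarrow> x * w = w * x"
    using sqrt_series[of "b * b"] b nb by (metis star_mult)
  have bw: "b * w = w * b" by (rule w(3)) (simp add: mult.assoc)
  define u where "u = b + scaleC \<i> w"
  have su: "star u = b - scaleC \<i> w"
    by (simp add: u_def star_add star_scaleC b w scaleC_minus_left)
  let ?v = "scaleC \<i> w"
  have "b * ?v = ?v * b" "?v * ?v = b * b - 1"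
    by (simp_all add: mult_scaleC_left mult_scaleC_right scaleC_scaleC bw w(2) scaleC_minus_left scaleC_one)
  then have "star u * u = 1" "u * star u = 1"
    unfolding su unfolding u_def by (simp_all add: algebra_simps)
  then have unit: "star u * u = 1" "star (star u) * star u = 1" by (simp_all add: star_star)
  have "b = scaleC (1/2) (u + star u)"
    by (simp add: su, simp add: u_def scaleC_add_left[symmetric] scaleC_add_right scaleC_one)
  then have "incl b = cscale A (1/2) (incl u \<oplus> incl (star u))"
    by (metis incl_add incl_scale)
  then have "cnorm A (incl b) = cnorm A (incl u \<oplus> incl (star u)) / 2"
    by (simp add: norm_scale incl_closed)
  also have "\<dots> \<le> (1 + 1) / 2"
    using norm_triangle[OF incl_closed incl_closed, of u "star u"] incl_one_norm[OF unit(1)] incl_one_norm[OF unit(2)]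
    by simp
  finally show ?thesis by simp
qed

text \<open>The norm of the coefficient algebra and that of its copy are not related by assumption,
  since \<open>incl\<close> is only an injective homomorphism compatible with the involution. The
  C*-identity reduces the inequality to self-adjoint elements.\<close>

lemma incl_norm: "cnorm A (incl b) \<le> norm b"
proof -
  have sa: "cnorm A (incl c) \<le> norm c" if c: "star c = c" for c
  proof (cases "c = 0")
    case True
    then show ?thesis
      using incl_add[of 0 0] incl_closed[of 0] norm_eq_zero[OF zero_closed] by simp
  next
    case False
    have "cnorm A (incl (scaleC (of_real (1 / norm c)) c)) \<le> 1"
      by (rule incl_norm_sa_le_1) (use c False in \<open>simp_all add: star_scaleC norm_scaleC scaleC_of_real star_scaleR del: of_real_divide\<close>)
    then show ?thesis using False
      by (simp add: incl_scale norm_scale incl_closed norm_divide del: of_real_divide)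
  qed
  have "(cnorm A (incl b))\<^sup>2 = cnorm A (incl (star b * b))"
    using norm_cstar[OF incl_closed] by (simp add: incl_star incl_mult)
  also have "\<dots> \<le> (norm b)\<^sup>2"
    using sa[of "star b * b"] by (simp add: star_mult star_star norm_star_mult_self)
  finally show ?thesis by (rule power2_le_imp_le) simp
qed

lemma eval_bound:
  assumes X: "X \<in> carrier A" "cnorm A X \<le> R"
  shows "eval_expr A incl X p \<in> carrier A \<and> cnorm A (eval_expr A incl X p) \<le> expr_bound R p"
proof (induction p)
  case (Plus p q)
  then show ?case using norm_triangle[of "eval_expr A incl X p" "eval_expr A incl X q"] by simp
next
  case (Times p q)
  have "cnorm A (eval_expr A incl X p) * cnorm A (eval_expr A incl X q) \<le> expr_bound R p * expr_bound R q"
    using Times norm_nonneg by (intro mult_mono) (auto intro: order_trans[OF norm_nonneg])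
  then show ?case using Times norm_times[of "eval_expr A incl X p" "eval_expr A incl X q"] by simp
qed (use X incl_closed incl_norm in auto)

lemma E_eval_bound:
  assumes "X \<in> carrier A" "cnorm A X \<le> R" "Y \<in> carrier A" "cnorm A Y \<le> R"
  shows "norm (E (nc_eval A incl X f \<ominus> nc_eval A incl Y f)) \<le> 12 * expr_bound R (rep_ncpoly f)"
proof -
  note X = eval_bound[OF assms(1,2), of "rep_ncpoly f"] and Y = eval_bound[OF assms(3,4), of "rep_ncpoly f"]
  have "norm (E (nc_eval A incl X f \<ominus> nc_eval A incl Y f))
      \<le> 6 * (cnorm A (nc_eval A incl X f) + cnorm A (nc_eval A incl Y f))"
    using X Y E_bound norm_minus_le unfolding nc_eval_def
    by (meson minus_closed mult_left_mono order_trans zero_le_numeral)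
  also have "\<dots> \<le> 6 * (expr_bound R (rep_ncpoly f) + expr_bound R (rep_ncpoly f))"
    using X Y unfolding nc_eval_def by simp
  finally show ?thesis by simp
qed

end

text \<open>The supremum dominates its elements because the set is bounded, by 12 times
  \<open>expr_bound\<close>: two evaluations, each estimated with the constant 6.\<close>

theorem Mod_upper:
  fixes A :: "(nat \<Rightarrow> 'b::cstar_algebra) cstar" and \<iota> :: "'b \<Rightarrow> nat \<Rightarrow> 'b" and E :: "(nat \<Rightarrow> 'b) \<Rightarrow> 'b"
  assumes A: "bvalued_prob_space A \<iota> E" and X: "X \<in> carrier A" "cstar A X = X" "cnorm A X \<le> R"
    and Y: "Y \<in> carrier A" "cstar A Y = Y" "cnorm A Y \<le> R" and XY: "cnorm A (X \<ominus>\<^bsub>A\<^esub> Y) \<le> \<epsilon>"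
  shows "norm (E (nc_eval A \<iota> X f \<ominus>\<^bsub>A\<^esub> nc_eval A \<iota> Y f)) \<le> Mod f R \<epsilon>"
  unfolding Mod_def
proof (rule cSup_upper)
  show "norm (E (nc_eval A \<iota> X f \<ominus>\<^bsub>A\<^esub> nc_eval A \<iota> Y f)) \<in>
    {norm (E (nc_eval A \<iota> X f \<ominus>\<^bsub>A\<^esub> nc_eval A \<iota> Y f)) | (A :: (nat \<Rightarrow> 'b) cstar) \<iota> E X Y.
       bvalued_prob_space A \<iota> E \<and> X \<in> carrier A \<and> cstar A X = X \<and> cnorm A X \<le> R \<and>
       Y \<in> carrier A \<and> cstar A Y = Y \<and> cnorm A Y \<le> R \<and> cnorm A (X \<ominus>\<^bsub>A\<^esub> Y) \<le> \<epsilon>}"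
    by (rule CollectI, rule exI[of _ A], rule exI[of _ \<iota>], rule exI[of _ E], rule exI[of _ X], rule exI[of _ Y])
      (intro conjI refl A X Y XY)
qed (rule bdd_aboveI[of _ "12 * expr_bound R (rep_ncpoly f)"], elim CollectE exE conjE, simp only:,
    erule bvalued_prob_space.E_eval_bound; assumption)

text \<open>The vectors \<open>q(x, y)\<xi>\<close> form a submodule on which \<open>\<xi>\<close> is cyclic.\<close>

theorem inner_act_le_Mod:
  fixes G :: "('b::cstar_algebra, 'h) corr" and z :: "bool \<Rightarrow> 'h \<Rightarrow> 'h"
  assumes G: "op_pair G z" and xi: "\<xi> \<in> hcarrier G" "hinner G \<xi> \<xi> = 1"
    and central: "\<And>b. lact G b \<xi> = ract G \<xi> b"
    and bound: "\<And>c h. h \<in> hcarrier G \<Longrightarrow> hnorm G (z c h) \<le> R * hnorm G h" and R: "R \<ge> 0"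
    and close: "\<And>h. h \<in> hcarrier G \<Longrightarrow> hnorm G (hminus G (z True h) (z False h)) \<le> \<epsilon> * hnorm G h" and eps: "\<epsilon> \<ge> 0"
  shows "norm (hinner G \<xi> (act G (z True) (rep_ncpoly f) \<xi>) - hinner G \<xi> (act G (z False) (rep_ncpoly f) \<xi>))
    \<le> Mod f R \<epsilon>"
proof -
  interpret G: op_pair G z by (rule G)
  define V where "V = range (\<lambda>q. pact G z q \<xi>)"
  define H where "H = G\<lparr>hcarrier := V\<rparr>"
  have VG: "h \<in> hcarrier G" if "h \<in> V" for h using that G.ev_in[OF xi(1)] by (auto simp: V_def)
  have VI: "pact G z q \<xi> \<in> V" for q by (auto simp: V_def)
  have sel [simp]: "hcarrier H = V" "hzero H = hzero G" "hadd H = hadd G" "lact H = lact G" "ract H = ract G" "hinner H = hinner G"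
    by (simp_all add: H_def)
  have [simp]: "hminus H = hminus G" "hnorm H = hnorm G"
    by (intro HOL.ext; simp add: hminus_def hnorm_def)+
  have pact_H: "pact H z q h = pact G z q h" for q h by (induction q arbitrary: h) auto
  have act_H: "act H y q h = act G y q h" for y q h by (induction q arbitrary: h) auto
  have zero: "hzero G = pact G z (PConst 0) \<xi>"
    by (rule G.ext) (auto simp: G.closed xi G.inner_zero G.lact_zero)
  have add: "hadd G (pact G z p \<xi>) (pact G z q \<xi>) = pact G z (PPlus p q) \<xi>" for p q by simp
  have lact: "lact G a (pact G z q \<xi>) = pact G z (PTimes (PConst a) q) \<xi>" for a q by simp
  have ract: "ract G (pact G z q \<xi>) a = pact G z (PTimes q (PConst a)) \<xi>" for a q
    by (simp add: central G.ev_ract xi)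
  have zz: "z c (pact G z q \<xi>) = pact G z (PTimes (PVar c) q) \<xi>" for c q by simp
  have semi: "semi_corr H"
  proof (rule semi_corr.intro)
    show "hzero H \<in> hcarrier H" using VI[of "PConst 0"] zero by simp
    show "hadd H h k \<in> hcarrier H" if "h \<in> hcarrier H" "k \<in> hcarrier H" for h k
      using that VI add by (auto simp: V_def simp del: pact.simps)
    show "lact H a h \<in> hcarrier H" if "h \<in> hcarrier H" for h a
      using that VI lact by (auto simp: V_def simp del: pact.simps)
    show "ract H h a \<in> hcarrier H" if "h \<in> hcarrier H" for h a
      using that VI ract by (auto simp: V_def simp del: pact.simps)
  qed (auto dest!: VG simp: G.closed G.inner_simps G.inner_sym G.lact_mult G.lact_add G.lact_scalar G.inner_pos
      intro: G.inner_lact)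
  interpret H: gns_pair H z \<xi>
  proof (intro gns_pair.intro op_pair.intro nondegenerate_corr.intro semi nondegenerate_corr_axioms.intro
      op_pair_axioms.intro gns_pair_axioms.intro)
    interpret H: semi_corr H by (rule semi)
    show "h = k" if "h \<in> hcarrier H" "k \<in> hcarrier H" "\<And>l. l \<in> hcarrier H \<Longrightarrow> hinner H l h = hinner H l k" for h k
    proof (rule G.ext)
      \<comment> \<open>The difference of two vectors of \<open>V\<close> lies in \<open>V\<close>,
        so testing inside \<open>V\<close> already shows that it has length zero; Cauchy-Schwarz
        extends this to tests from all of \<open>G\<close>.\<close>
      have hk: "hminus G h k \<in> V" using H.minus_in[OF that(1,2)] by simp
      then have "hinner G (hminus G h k) (hminus G h k) = 0"
        using that VG by (simp add: G.inner_minus)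
      then have "hnorm G (hminus G h k) = 0" by (simp add: hnorm_def)
      then show "hinner G l h = hinner G l k" if "l \<in> hcarrier G" for l
        using G.Cauchy_Schwarz[OF that VG[OF hk]] that \<open>h \<in> hcarrier H\<close> \<open>k \<in> hcarrier H\<close> VG
        by (simp add: G.inner_minus)
    qed (use that VG in auto)
    show "z c h \<in> hcarrier H" if "h \<in> hcarrier H" for c h
      using that VI zz by (auto simp: V_def simp del: pact.simps)
    show "hinner H (z c h) k = hinner H h (z c k)" if "h \<in> hcarrier H" "k \<in> hcarrier H" for c h k
      using that VG G.z_sym by simp
    show "\<exists>C. \<forall>h\<in>hcarrier H. hnorm H (z c h) \<le> C * hnorm H h" for c
      using bound VG by (intro exI[of _ R]) simp
    show "\<xi> \<in> hcarrier H" using VI[of "PConst 1"] G.lact_one_eq[OF xi(1)] by simp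
    show "\<exists>q. h = pact H z q \<xi>" if "h \<in> hcarrier H" for h
      using that by (auto simp: V_def pact_H)
  qed (auto simp: xi central)
  have norm: "cnorm H.alg (H.cls (\<lambda>_. PVar c)) \<le> R" for c
    unfolding H.norm_alg_const by (rule H.opn_le) (use R bound VG in auto)
  have dist: "cnorm H.alg (H.cls (\<lambda>_. PVar True) \<ominus>\<^bsub>H.alg\<^esub> H.cls (\<lambda>_. PVar False)) \<le> \<epsilon>"
    unfolding H.alg_dist_const by (rule H.pd_le) (use eps close VG in auto)
  show ?thesis
    using Mod_upper[OF H.prob_space_alg H.alg_carrierI[OF H.CS_const] _ norm H.alg_carrierI[OF H.CS_const] _ norm dist, of f]
    by (simp add: H.alg_star H.CS_const H.vev_diff act_H)
qed

section \<open>Comparison of the laws\<close>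

lemma (in semi_corr) lact_of_real_left:
  "h \<in> hcarrier H \<Longrightarrow> k \<in> hcarrier H \<Longrightarrow> hinner H (lact H (of_real r) h) k = r *\<^sub>R hinner H h k"
  by (simp add: inner_lact_left star_of_real lact_of_real)

text \<open>The dilated creation-annihilation part is bounded by R' and lies within r R of the
  dilated sum, so both have norm at most R' + r R. \<open>Mod\<close> then controls the difference
  of their vacuum values at \<open>f\<close>.\<close>

theorem (in tree_legs) law_XX_near_YY:
  assumes r: "r \<ge> 0" and R: "R \<ge> 0" and R': "r * (2 * sqrt (real D * c)) \<le> R'"
  shows "norm (dil_law r (law_of_op S \<Omega> XX) f - word_vacuum (word_act T J \<eta> r (rep_ncpoly f) [([], [], 1)]))
    \<le> Mod f (R' + r * R) (r * R)"
proof -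
  define z where "z b h = lact S (of_real r) ((if b then XX else YY) h)" for b h
  have xy_in: "(if b then XX else YY) h \<in> hcarrier S" if "h \<in> hcarrier S" for b h
    using that XX_in YY_in by simp
  have xy_sym: "hinner S ((if b then XX else YY) h) k = hinner S h ((if b then XX else YY) k)"
    if "h \<in> hcarrier S" "k \<in> hcarrier S" for b h k
    using that XX_sym YY_sym by simp
  have c0: "0 \<le> 2 * sqrt (real D * c)" using c_nonneg by simp
  have R'0: "0 \<le> R'" using mult_nonneg_nonneg[OF r c0] R' by linarith
  have diff: "hnorm S (hminus S (z True h) (z False h)) \<le> (r * R) * hnorm S h" if h: "h \<in> hcarrier S" for h
  proof -
    have eq: "hminus S (z True h) (z False h) = lact S (of_real r) (hminus S (XX h) (YY h))"
      by (rule F.S.ext) (auto simp: z_def F.S.minus_in F.S.closed XX_in YY_in h F.S.inner_simps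
          F.S.lact_of_real scaleR_diff_right)
    have "hnorm S (hminus S (z True h) (z False h)) \<le> r * hnorm S (hminus S (XX h) (YY h))"
      unfolding eq by (intro F.S.hnorm_lact_of_real F.S.minus_in XX_in YY_in h r)
    also have "\<dots> \<le> r * (R * hnorm S h)"
      using mult_left_mono[OF XX_YY_norm[OF h] r] unfolding abs_of_nonneg[OF R] .
    finally show ?thesis by (simp add: mult.assoc)
  qed
  have Y: "hnorm S (z False h) \<le> R' * hnorm S h" if h: "h \<in> hcarrier S" for h
  proof -
    have "hnorm S (z False h) \<le> r * hnorm S (YY h)"
      unfolding z_def by (simp add: F.S.hnorm_lact_of_real YY_in h r)
    also have "\<dots> \<le> r * (2 * sqrt (real D * c) * hnorm S h)"
      by (rule mult_left_mono[OF YY_norm[OF h] r])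
    also have "\<dots> \<le> R' * hnorm S h"
      using mult_right_mono[OF R' F.S.hnorm_nonneg[of h]] by (simp add: mult.assoc)
    finally show ?thesis .
  qed
  have bound: "hnorm S (z b h) \<le> (R' + r * R) * hnorm S h" if h: "h \<in> hcarrier S" for b h
  proof -
    have z_in: "z b h \<in> hcarrier S" for b unfolding z_def by (intro F.S.closed xy_in h)
    have "0 \<le> (r * R) * hnorm S h" using r R F.S.hnorm_nonneg by simp
    then show ?thesis
      using F.S.hnorm_le_add_minus[OF z_in[of True] z_in[of False]] diff[OF h] Y[OF h]
      by (cases b) (simp_all add: distrib_right)
  qed
  have pair: "op_pair S z"
  proof (intro op_pair.intro op_pair_axioms.intro F.S.nondegenerate_corr_axioms)
    show "z b h \<in> hcarrier S" if "h \<in> hcarrier S" for b h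
      unfolding z_def by (intro F.S.closed xy_in that)
    show "hinner S (z b h) k = hinner S h (z b k)" if "h \<in> hcarrier S" "k \<in> hcarrier S" for b h k
      using that xy_sym[OF that, of b] xy_in unfolding z_def
      by (simp only: F.S.lact_of_real F.S.lact_of_real_left)
    show "\<exists>C. \<forall>h\<in>hcarrier S. hnorm S (z b h) \<le> C * hnorm S h" for b using bound by blast
  qed
  have "0 \<le> R' + r * R" "0 \<le> r * R" using r R R'0 by simp_all
  note le = inner_act_le_Mod[OF pair \<Omega>_in \<Omega>_unit \<Omega>_central bound this(1) diff this(2), of f]
  have "hinner S \<Omega> (act S (z True) (rep_ncpoly f) \<Omega>) = dil_law r (law_of_op S \<Omega> XX) f"
    using dil_law_of_op[OF symmetric_XX _ \<Omega>_in, of r f] inner_XX(1) by (simp add: adjointable_def z_def[abs_def])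
  moreover have "hinner S \<Omega> (act S (z False) (rep_ncpoly f) \<Omega>) = word_vacuum (word_act T J \<eta> r (rep_ncpoly f) [([], [], 1)])"
    using YY_law[of r "rep_ncpoly f"] by (simp add: z_def[abs_def])
  ultimately show ?thesis using le by simp
qed

theorem corollary8p14:
  fixes T :: "nat list set"
    and N n k :: nat
    and \<mu> \<nu> :: "nat \<Rightarrow> 'b::cstar_algebra ncpoly \<Rightarrow> 'b"
    and \<eta> :: "'b \<Rightarrow> 'b"
    and R R' :: real
    and f :: "'b ncpoly"
  assumes "T \<in> Tree N"
    and "n = card {j \<in> {1..N}. [j] \<in> T}"
    and "n \<ge> 2"
    and "\<And>i. i \<in> {1..N ^ k} \<Longrightarrow>
           bvalued_law (\<mu> i) \<and> mean_zero (\<mu> i) \<and> has_variance (\<mu> i) \<eta> \<and> law_radius (\<mu> i) \<le> R"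
    and "\<And>i. i \<in> {1..N ^ k} \<Longrightarrow>
           bvalued_law (\<nu> i) \<and> mean_zero (\<nu> i) \<and> has_variance (\<nu> i) \<eta> \<and> law_radius (\<nu> i) \<le> R"
    and "R' = 2 * sqrt ((real N - 1) / (real n - 1)) * norm (\<eta> 1) powr (1 / 2)"
  shows "norm (dil_law (real n powr (- real k / 2)) (boxplus (N ^ k) (tree_pow N T k) \<mu>) f
             - dil_law (real n powr (- real k / 2)) (boxplus (N ^ k) (tree_pow N T k) \<nu>) f)
         \<le> 2 * Mod f (R' + real n powr (- real k / 2) * R) (real n powr (- real k / 2) * R)"
proof -
  define r where "r = real n powr (- real k / 2)"
  define U where "U = tree_pow N T k"
  define J where "J = {1..N ^ k}"
  obtain D where bt: "bounded_tree (N ^ k) U (n ^ k) D"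
    and D: "real (max (n ^ k) D) \<le> (real N - 1) / (real n - 1) * real n ^ k" and N: "N \<ge> n"
    unfolding U_def by (rule tree_pow_children[OF assms(1-3)])
  \<comment> \<open>r^2 = n^(-k) is the reciprocal of the bound n^k for the children of the
    root.\<close>
  have r: "r \<ge> 0" "r\<^sup>2 * real n ^ k = 1"
  proof -
    have "r\<^sup>2 = real n powr (- real k)" by (simp add: r_def power2_eq_square flip: powr_add)
    then show "r\<^sup>2 * real n ^ k = 1" using assms(3) by (simp add: powr_minus powr_realpow)
  qed (simp add: r_def)
  \<comment> \<open>The comparison value depends only on \<open>U\<close>, \<open>J\<close>, \<eta>,
    \<open>r\<close> and \<open>f\<close>, so that the same number serves for both families.\<close>
  have near: "norm (dil_law r (boxplus (N ^ k) U \<rho>) f - word_vacuum (word_act U J \<eta> r (rep_ncpoly f) [([], [], 1)]))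
      \<le> Mod f (R' + r * R) (r * R)"
    if \<rho>: "\<And>i. i \<in> J \<Longrightarrow> bvalued_law (\<rho> i) \<and> mean_zero (\<rho> i) \<and> has_variance (\<rho> i) \<eta> \<and> law_radius (\<rho> i) \<le> R"
    for \<rho> :: "nat \<Rightarrow> 'b ncpoly \<Rightarrow> 'b"
  proof -
    interpret tree_legs U J "\<lambda>j. L2 (\<rho> j)" "\<lambda>j. L2_one (\<rho> j)" "\<lambda>j. L2_var (\<rho> j)" \<eta> R "max (n ^ k) D"
    proof (rule tree_legs.intro)
      \<comment> \<open>The maximum covers the root, with at most n^k children, and every other
        vertex, with at most \<open>D\<close>.\<close>
      show "card {j. j # s \<in> U} \<le> max (n ^ k) D" if "s \<in> U" for s
        using bounded_treeD(5)[OF bt] bounded_treeD(6)[OF bt that] by (cases "s = []") auto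
      show "leg (L2 (\<rho> j)) (L2_one (\<rho> j)) (L2_var (\<rho> j)) \<eta> R" if "j \<in> J" for j
        using \<rho>[OF that] by (intro leg_L2) auto
    qed (use bounded_treeD[OF bt] in \<open>auto simp: J_def\<close>)
    \<comment> \<open>\<open>N ^ k\<close> is positive, so there is at least one law, and the radius
      of a law is nonnegative.\<close>
    have "1 \<in> J" using N assms(3) by (simp add: J_def)
    with \<rho> have R: "R \<ge> 0" by (intro adj_pair_var(1)[of "\<rho> 1"]) auto
    \<comment> \<open>\<open>r\<close> is moved under the root, where r^2 cancels n^k and leaves the
      constant of R'.\<close>
    have "r * (2 * sqrt (real (max (n ^ k) D) * c)) = 2 * sqrt (r\<^sup>2 * real (max (n ^ k) D) * c)"
      using r(1) by (simp add: real_sqrt_mult)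
    also have "\<dots> \<le> 2 * sqrt (r\<^sup>2 * ((real N - 1) / (real n - 1) * real n ^ k) * c)"
      using D c_nonneg by (intro mult_left_mono real_sqrt_le_mono mult_right_mono) auto
    also have "r\<^sup>2 * ((real N - 1) / (real n - 1) * real n ^ k) = (real N - 1) / (real n - 1) * (r\<^sup>2 * real n ^ k)"
      by (simp only: mult_ac)
    also have "2 * sqrt (\<dots> * c) = R'"
      unfolding r(2) assms(6) c_def
      by (simp only: mult_1_right powr_half_sqrt[OF norm_ge_zero] real_sqrt_mult mult.assoc)
    finally have "r * (2 * sqrt (real (max (n ^ k) D) * c)) \<le> R'" .
    from law_XX_near_YY[OF r(1) R this, of f] show ?thesis
      unfolding boxplus_def Let_def XX_def \<Omega>_def J_def[symmetric] .
  qed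
  let ?w = "word_vacuum (word_act U J \<eta> r (rep_ncpoly f) [([], [], 1)])"
  have "norm (dil_law r (boxplus (N ^ k) U \<mu>) f - dil_law r (boxplus (N ^ k) U \<nu>) f)
      \<le> norm (dil_law r (boxplus (N ^ k) U \<mu>) f - ?w) + norm (dil_law r (boxplus (N ^ k) U \<nu>) f - ?w)"
    using norm_triangle_ineq4[of "dil_law r (boxplus (N ^ k) U \<mu>) f - ?w" "dil_law r (boxplus (N ^ k) U \<nu>) f - ?w"]
    by simp
  also have "\<dots> \<le> Mod f (R' + r * R) (r * R) + Mod f (R' + r * R) (r * R)"
    by (intro add_mono near) (use assms(4,5) in \<open>simp_all add: J_def\<close>)
  finally show ?thesis unfolding r_def U_def by simp
qed

end
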